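(* (Linkage.) Let $k$ be a Noetherian commutative ring and $A$ a filtered $k$-algebra with $A/F^1A=k$. Assume $A$ is $k$-Artinian with Hilbert function $\mathbf h$, and is $k$-Gorenstein. Let $I\subset A$ be an ideal with $C:=A/I\in\mathbb{AM}_A$. Form the ideal $I'\subset A$ directly linked to $I$, namely $I':=\mathrm{Hom}_A(C,A)$, and form the $A$-submodule of $A^*$ Macaulay dual to $C$, namely $C^*$. Fix an isomorphism $A\cong\mathrm{Soc}_k(A)\otimes_kA^*$ of $A$-modules (one exists). Set $C':=A/I'$. (1) Then $I$ is directly linked to $I'$; that is, $I=\mathrm{Hom}_A(C',A)$. (2) Then $I'=\mathrm{Soc}_k(A)\otimes_kC^*$ and $C'=\mathrm{Hom}_A(I,A)$; moreover, $C'\in\mathbb{AM}_A$. (3) Give $C$ the induced filtration, and assume $C\in\mathbb{AF}_A$. Then $C$ is $k$-Gorenstein if and only if there is an invertible $k$-module $L$ such that $L\otimes_kI'$ is a cyclic $A$-module. If so, then necessarily $L\cong\mathrm{Soc}_k(C)\otimes_k\mathrm{Soc}_k(A)^*$ and $L\otimes_kI'\cong C$.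
   Context: A filtered $k$-algebra $A$ has a descending chain of ideals $F^mA$, $m\in\mathbb Z$, with $F^mA=A$ for $m\le0$ and $F^mA\cdot F^nA\subset F^{m+n}A$; filtered $A$-modules $C$ have descending chains of $A$-submodules with $F^mA\cdot F^nC\subset F^{m+n}C$; $G_nC:=F^nC/F^{n+1}C$. $\mathbb{AM}_A$: the $A$-modules that are locally free of constant finite rank over $k$. $\mathbb{AF}_A$: filtered $A$-modules with $F^nC=C$ for $n\ll0$, $F^nC=0$ for $n\gg0$, and each $G_nC$ locally free of constant finite rank over $k$. "$A$ is $k$-Artinian with Hilbert function $\mathbf h$" means $A\in\mathbb{AF}_A$ with $G_nA$ of rank $\mathbf h(n)$ for all $n$. For a $k$-module $M$, $M^*:=\mathrm{Hom}_k(M,k)$; if $M$ is an $A$-module, so is $M^*$ via $(af)(\psi)=f(a\psi)$. A $k$-algebra $R$ is $k$-Gorenstein if $R^*$ is an invertible $R$-module. $\mathrm{Soc}_k(M):=\mathrm{Hom}_A(k,M)=\{x\in M:(F^1A)x=0\}$. For a quotient $A/J$, $\mathrm{Hom}_A(A/J,A)$ is viewed as the ideal $(0:_AJ)$ of $A$; similarly $C^*\subset A^*$. The first equality in (2) is a canonical isomorphism, via the fixed isomorphism $A\cong\mathrm{Soc}_k(A)\otimes_kA^*$.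
   Formalization: In (3), the isomorphism L ≅ Soc_k(C) ⊗ Soc_k(A)^* is claimed only if I ≠ A or k = 0: for I = A and k nonzero, C = 0 and I' = 0, so every invertible L makes L ⊗ I' cyclic while Soc_k(C) ⊗ Soc_k(A)^* = 0. *)

theory Defs
  imports "HOL-Algebra.Module" "HOL-Algebra.QuotRing" "HOL-Algebra.Ring_Divisibility"
begin

text \<open>
  All rings are commutative with one; the zero ring is allowed.  If \<open>A\<close> is a \<open>k\<close>-algebra, an
  \<open>A\<close>-module is a record \<open>N\<close> with \<^term>\<open>module A N\<close>, and its \<open>k\<close>-module structure is always
  \<open>restrict_scalars A N\<close> below.  The record type of modules extends that of rings; where a module
  carries no multiplication, the fields \<^const>\<open>mult\<close> and \<^const>\<open>one\<close> are irrelevant.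
\<close>

subsection \<open>Modules\<close>

definition regular_module :: "('r, 'z) ring_scheme \<Rightarrow> ('r, 'r) module" where
  "regular_module R =
    \<lparr>carrier = carrier R, mult = mult R, one = one R, zero = zero R, add = add R, smult = mult R\<rparr>"

definition restrict_scalars :: "('k, 'a) module \<Rightarrow> ('a, 'n) module \<Rightarrow> ('k, 'n) module" where
  "restrict_scalars A N =
    \<lparr>carrier = carrier N, mult = mult N, one = one N, zero = zero N, add = add N,
     smult = (\<lambda>c x. (c \<odot>\<^bsub>A\<^esub> \<one>\<^bsub>A\<^esub>) \<odot>\<^bsub>N\<^esub> x)\<rparr>"

text \<open>
  For a \<open>k\<close>-algebra \<open>A\<close> and an ideal \<open>I\<close>, \<open>quot_module A I\<close> is the \<open>k\<close>-algebra \<open>A/I\<close>, with the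
  ring structure of \<^term>\<open>A Quot I\<close>, and \<open>quot_module (regular_module A) I\<close> is the \<open>A\<close>-module \<open>A/I\<close>.
\<close>

definition quot_module :: "('r, 'm) module \<Rightarrow> 'm set \<Rightarrow> ('r, 'm set) module" where
  "quot_module M N =
    \<lparr>carrier = a_rcosets\<^bsub>M\<^esub> N, mult = rcoset_mult M N, one = N +>\<^bsub>M\<^esub> \<one>\<^bsub>M\<^esub>,
     zero = N, add = set_add M, smult = (\<lambda>r X. \<Union>x\<in>X. N +>\<^bsub>M\<^esub> (r \<odot>\<^bsub>M\<^esub> x))\<rparr>"

definition mod_hom :: "('r, 'z) ring_scheme \<Rightarrow> ('r, 'm) module \<Rightarrow> ('r, 'n) module \<Rightarrow> ('m \<Rightarrow> 'n) set"
  where "mod_hom R M N =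
    {f \<in> carrier M \<rightarrow> carrier N.
       (\<forall>x\<in>carrier M. \<forall>y\<in>carrier M. f (x \<oplus>\<^bsub>M\<^esub> y) = f x \<oplus>\<^bsub>N\<^esub> f y) \<and>
       (\<forall>r\<in>carrier R. \<forall>x\<in>carrier M. f (r \<odot>\<^bsub>M\<^esub> x) = r \<odot>\<^bsub>N\<^esub> f x)}"

definition mod_iso :: "('r, 'z) ring_scheme \<Rightarrow> ('r, 'm) module \<Rightarrow> ('r, 'n) module \<Rightarrow> ('m \<Rightarrow> 'n) set"
  where "mod_iso R M N = {f \<in> mod_hom R M N. bij_betw f (carrier M) (carrier N)}"

definition mod_isomorphic :: "('r, 'z) ring_scheme \<Rightarrow> ('r, 'm) module \<Rightarrow> ('r, 'n) module \<Rightarrow> bool"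
  where "mod_isomorphic R M N \<longleftrightarrow> mod_iso R M N \<noteq> {}"

definition hom_module ::
    "('r, 'z) ring_scheme \<Rightarrow> ('r, 'm) module \<Rightarrow> ('r, 'n) module \<Rightarrow> ('r, 'm \<Rightarrow> 'n) module" where
  "hom_module R M N =
    \<lparr>carrier = mod_hom R M N \<inter> extensional (carrier M), mult = undefined, one = undefined,
     zero = (\<lambda>x\<in>carrier M. \<zero>\<^bsub>N\<^esub>), add = (\<lambda>f g. \<lambda>x\<in>carrier M. f x \<oplus>\<^bsub>N\<^esub> g x),
     smult = (\<lambda>r f. \<lambda>x\<in>carrier M. r \<odot>\<^bsub>N\<^esub> f x)\<rparr>"

definition submod_span :: "('r, 'z) ring_scheme \<Rightarrow> ('r, 'm) module \<Rightarrow> 'm set \<Rightarrow> 'm set" where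
  "submod_span R M S = \<Inter>{H. submodule H R M \<and> S \<subseteq> H}"

definition cyclic_module :: "('r, 'z) ring_scheme \<Rightarrow> ('r, 'm) module \<Rightarrow> bool" where
  "cyclic_module R M \<longleftrightarrow>
    module R M \<and> (\<exists>x\<in>carrier M. carrier M = {a \<odot>\<^bsub>M\<^esub> x |a. a \<in> carrier R})"


subsection \<open>Free modules\<close>

definition free_module :: "('r, 'z) ring_scheme \<Rightarrow> 'x set \<Rightarrow> ('r, 'x \<Rightarrow> 'r) module" where
  "free_module R X =
    \<lparr>carrier = {f \<in> X \<rightarrow>\<^sub>E carrier R. finite {x \<in> X. f x \<noteq> \<zero>\<^bsub>R\<^esub>}},
     mult = undefined, one = undefined, zero = (\<lambda>x\<in>X. \<zero>\<^bsub>R\<^esub>),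
     add = (\<lambda>f g. \<lambda>x\<in>X. f x \<oplus>\<^bsub>R\<^esub> g x), smult = (\<lambda>r f. \<lambda>x\<in>X. r \<otimes>\<^bsub>R\<^esub> f x)\<rparr>"

definition free_gen :: "('r, 'z) ring_scheme \<Rightarrow> 'x set \<Rightarrow> 'x \<Rightarrow> 'x \<Rightarrow> 'r" where
  "free_gen R X x = (\<lambda>y\<in>X. if y = x then \<one>\<^bsub>R\<^esub> else \<zero>\<^bsub>R\<^esub>)"

text \<open>The linear map of free modules sending the generator \<open>x \<in> X\<close> to the generator \<open>g x \<in> Y\<close>.\<close>

definition free_map ::
    "('r, 'z) ring_scheme \<Rightarrow> 'x set \<Rightarrow> 'y set \<Rightarrow> ('x \<Rightarrow> 'y) \<Rightarrow> ('x \<Rightarrow> 'r) \<Rightarrow> 'y \<Rightarrow> 'r" where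
  "free_map R X Y g f = (\<lambda>y\<in>Y. finsum R f {x \<in> X. f x \<noteq> \<zero>\<^bsub>R\<^esub> \<and> g x = y})"


subsection \<open>Localization and locally free modules\<close>

definition frac_rel :: "('r, 'z) ring_scheme \<Rightarrow> ('r, 'm) module \<Rightarrow> 'r set \<Rightarrow> (('m \<times> 'r) \<times> ('m \<times> 'r)) set"
  where "frac_rel R M S =
    {((x, s), (y, t)). x \<in> carrier M \<and> y \<in> carrier M \<and> s \<in> S \<and> t \<in> S \<and>
       (\<exists>u\<in>S. u \<odot>\<^bsub>M\<^esub> (t \<odot>\<^bsub>M\<^esub> x) = u \<odot>\<^bsub>M\<^esub> (s \<odot>\<^bsub>M\<^esub> y))}"

definition frac :: "('r, 'z) ring_scheme \<Rightarrow> ('r, 'm) module \<Rightarrow> 'r set \<Rightarrow> 'm \<Rightarrow> 'r \<Rightarrow> ('m \<times> 'r) set"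
  where "frac R M S x s = frac_rel R M S `` {(x, s)}"

definition loc_ring :: "('r, 'z) ring_scheme \<Rightarrow> 'r set \<Rightarrow> ('r \<times> 'r) set ring" where
  "loc_ring R S =
    \<lparr>carrier = (carrier R \<times> S) // frac_rel R (regular_module R) S,
     mult = (\<lambda>X Y. \<Union>(x, s)\<in>X. \<Union>(y, t)\<in>Y. frac R (regular_module R) S (x \<otimes>\<^bsub>R\<^esub> y) (s \<otimes>\<^bsub>R\<^esub> t)),
     one = frac R (regular_module R) S \<one>\<^bsub>R\<^esub> \<one>\<^bsub>R\<^esub>,
     zero = frac R (regular_module R) S \<zero>\<^bsub>R\<^esub> \<one>\<^bsub>R\<^esub>,
     add = (\<lambda>X Y. \<Union>(x, s)\<in>X. \<Union>(y, t)\<in>Y.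
              frac R (regular_module R) S (t \<otimes>\<^bsub>R\<^esub> x \<oplus>\<^bsub>R\<^esub> s \<otimes>\<^bsub>R\<^esub> y) (s \<otimes>\<^bsub>R\<^esub> t))\<rparr>"

definition loc_module ::
    "('r, 'z) ring_scheme \<Rightarrow> ('r, 'm) module \<Rightarrow> 'r set \<Rightarrow> (('r \<times> 'r) set, ('m \<times> 'r) set) module" where
  "loc_module R M S =
    \<lparr>carrier = (carrier M \<times> S) // frac_rel R M S, mult = undefined, one = undefined,
     zero = frac R M S \<zero>\<^bsub>M\<^esub> \<one>\<^bsub>R\<^esub>,
     add = (\<lambda>X Y. \<Union>(x, s)\<in>X. \<Union>(y, t)\<in>Y.
              frac R M S (t \<odot>\<^bsub>M\<^esub> x \<oplus>\<^bsub>M\<^esub> s \<odot>\<^bsub>M\<^esub> y) (s \<otimes>\<^bsub>R\<^esub> t)),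
     smult = (\<lambda>X Y. \<Union>(x, s)\<in>X. \<Union>(y, t)\<in>Y. frac R M S (x \<odot>\<^bsub>M\<^esub> y) (s \<otimes>\<^bsub>R\<^esub> t))\<rparr>"

definition powers :: "('r, 'z) ring_scheme \<Rightarrow> 'r \<Rightarrow> 'r set" where
  "powers R f = {f [^]\<^bsub>R\<^esub> n |n :: nat. True}"

text \<open>
  Locally free of constant rank \<open>r\<close>: free of rank \<open>r\<close> on a Zariski-open cover of the spectrum by
  principal open sets.  (Freeness of all stalks would be weaker, as it does not force finite
  generation.)
\<close>

definition locally_free_rank :: "('r, 'z) ring_scheme \<Rightarrow> ('r, 'm) module \<Rightarrow> nat \<Rightarrow> bool" where
  "locally_free_rank R M r \<longleftrightarrow> module R M \<and>
    (\<forall>p. primeideal p R \<longrightarrow> (\<exists>f \<in> carrier R - p.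
       mod_isomorphic (loc_ring R (powers R f))
         (free_module (loc_ring R (powers R f)) {..<r}) (loc_module R M (powers R f))))"

definition invertible_module :: "('r, 'z) ring_scheme \<Rightarrow> ('r, 'm) module \<Rightarrow> bool" where
  "invertible_module R M \<longleftrightarrow> locally_free_rank R M 1"


subsection \<open>Tensor products\<close>

definition tensor_rels ::
    "('k, 'z) ring_scheme \<Rightarrow> ('k, 'm) module \<Rightarrow> ('k, 'n) module \<Rightarrow> ('m \<times> 'n \<Rightarrow> 'k) set" where
  "tensor_rels k M N =
    (let X = carrier M \<times> carrier N; E = free_module k X; e = (\<lambda>m n. free_gen k X (m, n)) in
     submod_span k E
       ({e (m \<oplus>\<^bsub>M\<^esub> m') n \<ominus>\<^bsub>E\<^esub> (e m n \<oplus>\<^bsub>E\<^esub> e m' n) |m m' n.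
           m \<in> carrier M \<and> m' \<in> carrier M \<and> n \<in> carrier N} \<union>
        {e m (n \<oplus>\<^bsub>N\<^esub> n') \<ominus>\<^bsub>E\<^esub> (e m n \<oplus>\<^bsub>E\<^esub> e m n') |m n n'.
           m \<in> carrier M \<and> n \<in> carrier N \<and> n' \<in> carrier N} \<union>
        {e (c \<odot>\<^bsub>M\<^esub> m) n \<ominus>\<^bsub>E\<^esub> c \<odot>\<^bsub>E\<^esub> e m n |c m n.
           c \<in> carrier k \<and> m \<in> carrier M \<and> n \<in> carrier N} \<union>
        {e m (c \<odot>\<^bsub>N\<^esub> n) \<ominus>\<^bsub>E\<^esub> c \<odot>\<^bsub>E\<^esub> e m n |c m n.
           c \<in> carrier k \<and> m \<in> carrier M \<and> n \<in> carrier N}))"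

definition tensor ::
    "('k, 'z) ring_scheme \<Rightarrow> ('k, 'm) module \<Rightarrow> ('k, 'n) module \<Rightarrow> ('k, ('m \<times> 'n \<Rightarrow> 'k) set) module" where
  "tensor k M N = quot_module (free_module k (carrier M \<times> carrier N)) (tensor_rels k M N)"

text \<open>For linear \<open>v : N \<rightarrow> N'\<close>, this is the map \<open>id \<otimes> v : M \<otimes> N \<rightarrow> M \<otimes> N'\<close>.\<close>

definition tensor_map ::
    "('k, 'z) ring_scheme \<Rightarrow> ('k, 'm) module \<Rightarrow> ('k, 'n) module \<Rightarrow> ('k, 'n') module \<Rightarrow> ('n \<Rightarrow> 'n')
      \<Rightarrow> ('m \<times> 'n \<Rightarrow> 'k) set \<Rightarrow> ('m \<times> 'n' \<Rightarrow> 'k) set" where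
  "tensor_map k M N N' v T =
    (\<Union>f\<in>T. tensor_rels k M N' +>\<^bsub>free_module k (carrier M \<times> carrier N')\<^esub>
       free_map k (carrier M \<times> carrier N) (carrier M \<times> carrier N') (\<lambda>(m, n). (m, v n)) f)"

text \<open>The \<open>A\<close>-module \<open>M \<otimes>\<^sub>k N\<close>, for a \<open>k\<close>-module \<open>M\<close> and an \<open>A\<close>-module \<open>N\<close>.\<close>

definition tensor_alg ::
    "('k, 'z) ring_scheme \<Rightarrow> ('k, 'a) module \<Rightarrow> ('k, 'm) module \<Rightarrow> ('a, 'n) module
      \<Rightarrow> ('a, ('m \<times> 'n \<Rightarrow> 'k) set) module" where
  "tensor_alg k A M N =
    (let N\<^sub>k = restrict_scalars A N; T = tensor k M N\<^sub>k in
     \<lparr>carrier = carrier T, mult = mult T, one = one T, zero = zero T, add = add T,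
      smult = (\<lambda>a. tensor_map k M N\<^sub>k N\<^sub>k (\<lambda>n. a \<odot>\<^bsub>N\<^esub> n))\<rparr>)"


subsection \<open>Duals and Gorenstein algebras\<close>

definition dual :: "('k, 'z) ring_scheme \<Rightarrow> ('k, 'm) module \<Rightarrow> ('k, 'm \<Rightarrow> 'k) module" where
  "dual k M = hom_module k M (regular_module k)"

text \<open>The dual over \<open>k\<close> of an \<open>A\<close>-module, as an \<open>A\<close>-module.\<close>

definition dual_alg ::
    "('k, 'z) ring_scheme \<Rightarrow> ('k, 'a) module \<Rightarrow> ('a, 'm) module \<Rightarrow> ('a, 'm \<Rightarrow> 'k) module" where
  "dual_alg k A M =
    (let D = dual k (restrict_scalars A M) in
     \<lparr>carrier = carrier D, mult = mult D, one = one D, zero = zero D, add = add D,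
      smult = (\<lambda>a f. \<lambda>x\<in>carrier M. f (a \<odot>\<^bsub>M\<^esub> x))\<rparr>)"

definition gorenstein :: "('k, 'z) ring_scheme \<Rightarrow> ('k, 'a) module \<Rightarrow> bool" where
  "gorenstein k R \<longleftrightarrow> algebra k R \<and> invertible_module R (dual_alg k R (regular_module R))"

text \<open>The inclusion \<open>(A/I)\<^sup>* \<subseteq> A\<^sup>*\<close>: composition with the quotient map.\<close>

definition quot_dual_incl :: "('k, 'a) module \<Rightarrow> 'a set \<Rightarrow> ('a set \<Rightarrow> 'k) \<Rightarrow> 'a \<Rightarrow> 'k" where
  "quot_dual_incl A I g = (\<lambda>a\<in>carrier A. g (I +>\<^bsub>A\<^esub> a))"


subsection \<open>Filtrations\<close>

definition filtered_algebra :: "('k, 'z) ring_scheme \<Rightarrow> ('k, 'a) module \<Rightarrow> (int \<Rightarrow> 'a set) \<Rightarrow> bool" where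
  "filtered_algebra k A F \<longleftrightarrow> algebra k A \<and>
    (\<forall>m. ideal (F m) A) \<and> (\<forall>m. F (m + 1) \<subseteq> F m) \<and> (\<forall>m\<le>0. F m = carrier A) \<and>
    (\<forall>m n. \<forall>a\<in>F m. \<forall>b\<in>F n. a \<otimes>\<^bsub>A\<^esub> b \<in> F (m + n))"

definition filtered_module ::
    "('k, 'a) module \<Rightarrow> (int \<Rightarrow> 'a set) \<Rightarrow> ('a, 'c) module \<Rightarrow> (int \<Rightarrow> 'c set) \<Rightarrow> bool" where
  "filtered_module A F C FC \<longleftrightarrow> module A C \<and>
    (\<forall>n. submodule (FC n) A C) \<and> (\<forall>n. FC (n + 1) \<subseteq> FC n) \<and>
    (\<forall>m n. \<forall>a\<in>F m. \<forall>x\<in>FC n. a \<odot>\<^bsub>C\<^esub> x \<in> FC (m + n))"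

definition graded_piece :: "('a, 'c) module \<Rightarrow> (int \<Rightarrow> 'c set) \<Rightarrow> int \<Rightarrow> ('a, 'c set) module" where
  "graded_piece C FC n = quot_module (C\<lparr>carrier := FC n\<rparr>) (FC (n + 1))"

definition in_AM :: "('k, 'z) ring_scheme \<Rightarrow> ('k, 'a) module \<Rightarrow> ('a, 'c) module \<Rightarrow> bool" where
  "in_AM k A C \<longleftrightarrow> module A C \<and> (\<exists>r. locally_free_rank k (restrict_scalars A C) r)"

definition in_AF ::
    "('k, 'z) ring_scheme \<Rightarrow> ('k, 'a) module \<Rightarrow> (int \<Rightarrow> 'a set) \<Rightarrow> ('a, 'c) module \<Rightarrow> (int \<Rightarrow> 'c set)
      \<Rightarrow> bool" where
  "in_AF k A F C FC \<longleftrightarrow> filtered_module A F C FC \<and>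
    (\<exists>n\<^sub>0. \<forall>n\<le>n\<^sub>0. FC n = carrier C) \<and> (\<exists>n\<^sub>1. \<forall>n\<ge>n\<^sub>1. FC n = {\<zero>\<^bsub>C\<^esub>}) \<and>
    (\<forall>n. \<exists>r. locally_free_rank k (restrict_scalars A (graded_piece C FC n)) r)"

definition artinian_with_hilbert_function ::
    "('k, 'z) ring_scheme \<Rightarrow> ('k, 'a) module \<Rightarrow> (int \<Rightarrow> 'a set) \<Rightarrow> (int \<Rightarrow> nat) \<Rightarrow> bool" where
  "artinian_with_hilbert_function k A F h \<longleftrightarrow> in_AF k A F (regular_module A) F \<and>
    (\<forall>n. locally_free_rank k (restrict_scalars A (graded_piece (regular_module A) F n)) (h n))"

text \<open>
  \<open>A/F\<^sup>1A = k\<close>: the structure map of the \<open>k\<close>-algebra \<open>A/F\<^sup>1A\<close> is an isomorphism.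
\<close>

definition augmented :: "('k, 'z) ring_scheme \<Rightarrow> ('k, 'a) module \<Rightarrow> (int \<Rightarrow> 'a set) \<Rightarrow> bool" where
  "augmented k A F \<longleftrightarrow> (\<lambda>c. F 1 +>\<^bsub>A\<^esub> (c \<odot>\<^bsub>A\<^esub> \<one>\<^bsub>A\<^esub>)) \<in> ring_iso k (A Quot F 1)"

definition soc :: "('k, 'a) module \<Rightarrow> (int \<Rightarrow> 'a set) \<Rightarrow> ('a, 'm) module \<Rightarrow> ('k, 'm) module" where
  "soc A F M =
    (restrict_scalars A M)\<lparr>carrier := {x \<in> carrier M. \<forall>a\<in>F 1. a \<odot>\<^bsub>M\<^esub> x = \<zero>\<^bsub>M\<^esub>}\<rparr>"


subsection \<open>Linkage\<close>

text \<open>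
  \<open>linked A J\<close> is \<open>Hom\<^sub>A(A/J, A)\<close> viewed as an ideal of \<open>A\<close>, by evaluating at the class of one.
\<close>

definition linked :: "('k, 'a) module \<Rightarrow> 'a set \<Rightarrow> 'a set" where
  "linked A J = (\<lambda>u. u (J +>\<^bsub>A\<^esub> \<one>\<^bsub>A\<^esub>)) `
     carrier (hom_module A (quot_module (regular_module A) J) (regular_module A))"

lemma regular_module_simps [simp]:
  "carrier (regular_module R) = carrier R" "mult (regular_module R) = mult R"
  "one (regular_module R) = one R" "zero (regular_module R) = zero R"
  "add (regular_module R) = add R" "smult (regular_module R) = mult R"
  by (simp_all add: regular_module_def)

lemma linked_eq_annihilator:
  assumes "cring A" and "ideal J A"
  shows "linked A J = {a \<in> carrier A. \<forall>x\<in>J. a \<otimes>\<^bsub>A\<^esub> x = \<zero>\<^bsub>A\<^esub>}"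
proof -
  interpret cring A by fact
  interpret J: ideal J A by fact
  have same: "J +>\<^bsub>regular_module A\<^esub> x = J +>\<^bsub>A\<^esub> x" for x
    by (simp add: a_r_coset_defs)
  have car: "carrier (quot_module (regular_module A) J) = a_rcosets\<^bsub>A\<^esub> J"
    by (simp add: quot_module_def A_RCOSETS_def' same)
  have ad: "add (quot_module (regular_module A) J) = set_add A"
    by (simp add: quot_module_def set_add_def set_mult_def fun_eq_iff)
  have sm: "a \<odot>\<^bsub>quot_module (regular_module A) J\<^esub> (J +>\<^bsub>A\<^esub> x) = J +>\<^bsub>A\<^esub> (a \<otimes>\<^bsub>A\<^esub> x)"
    if "a \<in> carrier A" "x \<in> carrier A" for a x
  proof -
    have "J +>\<^bsub>A\<^esub> (a \<otimes>\<^bsub>A\<^esub> y) = J +>\<^bsub>A\<^esub> (a \<otimes>\<^bsub>A\<^esub> x)" if y: "y \<in> J +>\<^bsub>A\<^esub> x" for y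
    proof -
      obtain j where j: "j \<in> J" "y = j \<oplus>\<^bsub>A\<^esub> x"
        using y by (auto simp: a_r_coset_defs)
      have "a \<otimes>\<^bsub>A\<^esub> y = a \<otimes>\<^bsub>A\<^esub> j \<oplus>\<^bsub>A\<^esub> a \<otimes>\<^bsub>A\<^esub> x"
        using j \<open>a \<in> carrier A\<close> \<open>x \<in> carrier A\<close> by (simp add: r_distr J.a_Hcarr)
      moreover have "a \<otimes>\<^bsub>A\<^esub> j \<in> J"
        using j \<open>a \<in> carrier A\<close> by (simp add: J.I_l_closed)
      ultimately have "a \<otimes>\<^bsub>A\<^esub> y \<in> J +>\<^bsub>A\<^esub> (a \<otimes>\<^bsub>A\<^esub> x)"
        by (auto simp: a_r_coset_defs)
      then show ?thesis
        using a_repr_independence[OF _ _ J.a_subgroup] that \<open>a \<in> carrier A\<close> \<open>x \<in> carrier A\<close> m_closed by metis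
    qed
    moreover have "x \<in> J +>\<^bsub>A\<^esub> x"
      using that J.a_rcos_self by blast
    ultimately have "(\<Union>y\<in>J +>\<^bsub>A\<^esub> x. J +>\<^bsub>A\<^esub> (a \<otimes>\<^bsub>A\<^esub> y)) = J +>\<^bsub>A\<^esub> (a \<otimes>\<^bsub>A\<^esub> x)"
      by (intro UN_constant_eq[of x]) blast+
    then show ?thesis
      by (simp only: quot_module_def module.simps regular_module_simps same)
  qed
  show ?thesis
  proof (intro equalityI subsetI)
    fix b assume "b \<in> linked A J"
    then obtain u where u: "u \<in> mod_hom A (quot_module (regular_module A) J) (regular_module A)"
      and b: "b = u (J +>\<^bsub>A\<^esub> \<one>\<^bsub>A\<^esub>)"
      by (auto simp: linked_def hom_module_def)
    have in_car: "J +>\<^bsub>A\<^esub> x \<in> a_rcosets\<^bsub>A\<^esub> J" if "x \<in> carrier A" for x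
      using that J.a_subset a_rcosetsI by blast
    have bA: "b \<in> carrier A"
      using u in_car b by (auto simp: mod_hom_def car)
    have lin: "u (J +>\<^bsub>A\<^esub> x) = x \<otimes>\<^bsub>A\<^esub> b" if "x \<in> carrier A" for x
    proof -
      have "u (x \<odot>\<^bsub>quot_module (regular_module A) J\<^esub> (J +>\<^bsub>A\<^esub> \<one>\<^bsub>A\<^esub>)) = x \<otimes>\<^bsub>A\<^esub> u (J +>\<^bsub>A\<^esub> \<one>\<^bsub>A\<^esub>)"
        using u in_car that by (auto simp: mod_hom_def car)
      then show ?thesis using that by (simp add: sm b)
    qed
    have "b \<otimes>\<^bsub>A\<^esub> x = \<zero>\<^bsub>A\<^esub>" if x: "x \<in> J" for x
    proof -
      have "J +>\<^bsub>A\<^esub> x = J +>\<^bsub>A\<^esub> \<zero>\<^bsub>A\<^esub>"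
        using x J.a_rcos_const[OF x] J.a_rcos_const[OF J.zero_closed] by simp
      then have "x \<otimes>\<^bsub>A\<^esub> b = \<zero>\<^bsub>A\<^esub> \<otimes>\<^bsub>A\<^esub> b"
        using lin x J.a_Hcarr by (metis zero_closed)
      then show ?thesis using bA x J.a_Hcarr m_comm l_null by metis
    qed
    with bA show "b \<in> {a \<in> carrier A. \<forall>x\<in>J. a \<otimes>\<^bsub>A\<^esub> x = \<zero>\<^bsub>A\<^esub>}" by blast
  next
    fix b assume "b \<in> {a \<in> carrier A. \<forall>x\<in>J. a \<otimes>\<^bsub>A\<^esub> x = \<zero>\<^bsub>A\<^esub>}"
    then have bA: "b \<in> carrier A" and b0: "\<And>x. x \<in> J \<Longrightarrow> b \<otimes>\<^bsub>A\<^esub> x = \<zero>\<^bsub>A\<^esub>" by auto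
    define u where "u = (\<lambda>X \<in> a_rcosets\<^bsub>A\<^esub> J. b \<otimes>\<^bsub>A\<^esub> (SOME x. x \<in> X))"
    have u: "u (J +>\<^bsub>A\<^esub> x) = b \<otimes>\<^bsub>A\<^esub> x" if x: "x \<in> carrier A" for x
    proof -
      have "(SOME y. y \<in> J +>\<^bsub>A\<^esub> x) \<in> J +>\<^bsub>A\<^esub> x"
        using J.a_rcos_self[OF x] by (rule someI)
      then obtain j where j: "j \<in> J" "(SOME y. y \<in> J +>\<^bsub>A\<^esub> x) = j \<oplus>\<^bsub>A\<^esub> x"
        by (auto simp: a_r_coset_defs)
      have "J +>\<^bsub>A\<^esub> x \<in> a_rcosets\<^bsub>A\<^esub> J" using x J.a_subset a_rcosetsI by blast
      then show ?thesis
        using j x bA b0[OF j(1)] J.a_Hcarr[OF j(1)] by (simp add: u_def r_distr)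
    qed
    have rep: "\<exists>x\<in>carrier A. X = J +>\<^bsub>A\<^esub> x" if "X \<in> a_rcosets\<^bsub>A\<^esub> J" for X
      using that by (auto simp: A_RCOSETS_def')
    have "u \<in> mod_hom A (quot_module (regular_module A) J) (regular_module A)"
      unfolding mod_hom_def
    proof (intro CollectI conjI ballI)
      show "u \<in> carrier (quot_module (regular_module A) J) \<rightarrow> carrier (regular_module A)"
        using rep u bA by (fastforce simp: car)
    next
      fix X Y
      assume "X \<in> carrier (quot_module (regular_module A) J)"
        and "Y \<in> carrier (quot_module (regular_module A) J)"
      then obtain x y where "x \<in> carrier A" "y \<in> carrier A" "X = J +>\<^bsub>A\<^esub> x" "Y = J +>\<^bsub>A\<^esub> y"
        using rep by (metis car)
      then show "u (X \<oplus>\<^bsub>quot_module (regular_module A) J\<^esub> Y) = u X \<oplus>\<^bsub>regular_module A\<^esub> u Y"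
        using bA by (simp add: ad J.a_rcos_sum u r_distr)
    next
      fix r X
      assume "r \<in> carrier A" and "X \<in> carrier (quot_module (regular_module A) J)"
      then obtain x where "x \<in> carrier A" "X = J +>\<^bsub>A\<^esub> x" "r \<in> carrier A"
        using rep by (metis car)
      then show "u (r \<odot>\<^bsub>quot_module (regular_module A) J\<^esub> X) = r \<odot>\<^bsub>regular_module A\<^esub> u X"
        using bA by (simp add: sm u m_lcomm)
    qed
    moreover have "u \<in> extensional (carrier (quot_module (regular_module A) J))"
      by (simp add: u_def car)
    moreover have "b = u (J +>\<^bsub>A\<^esub> \<one>\<^bsub>A\<^esub>)" using bA by (simp add: u)
    ultimately show "b \<in> linked A J"
      unfolding linked_def by (auto simp: hom_module_def)
  qed
qed

end

theory Submission
 imports Defs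
begin

text \<open>
 Since \<open>A\<^sup>*\<close> is invertible and the augmentation ideal of \<open>A\<close> is nilpotent, there is a frame: elements
 \<open>s\<^sub>i\<close> of the socle and functionals \<open>\<phi>\<^sub>i\<close> with \<open>\<Sum> \<phi>\<^sub>i(s\<^sub>i) = 1\<close> and \<open>\<phi>\<^sub>i(t) \<phi>\<^sub>j = \<phi>\<^sub>j(t) \<phi>\<^sub>i\<close> for \<open>t\<close> in the socle, such
 that \<open>A\<close> is isomorphic to \<open>Soc(A) \<otimes> A\<^sup>*\<close> by \<open>a \<mapsto> \<Sum> s\<^sub>i \<otimes> a \<phi>\<^sub>i\<close>, with inverse \<open>\<theta>\<close>.  As \<open>I\<close> is a direct summand of the
 projective \<open>k\<close>-module \<open>A\<close>, functionals separate \<open>A/I\<close>; so \<open>I\<close> is its own double annihilator, and every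
 isomorphism \<open>A \<cong> Soc(A) \<otimes> A\<^sup>*\<close> carries \<open>I' = Ann(I)\<close> to the part of the right side that \<open>I\<close> kills, which
 is \<open>Soc(A) \<otimes> (A/I)\<^sup>*\<close>.  A generator of \<open>L \<otimes> I'\<close> therefore yields, locally on the spectrum of \<open>k\<close>, a generator of
 \<open>(A/I)\<^sup>*\<close>; it has annihilator \<open>I\<close>, whence \<open>A/I \<cong> L \<otimes> I'\<close>, and comparing socles determines \<open>L\<close>.
 Conversely, if \<open>A/I\<close> is Gorenstein, frames of \<open>A\<close> and of \<open>A/I\<close> show that \<open>L = Hom(Soc(A), Soc(A/I))\<close> works.
\<close>

text \<open>The existence of a frame is a lifting argument. Restriction to the socle maps the dual
  of \<open>A\<close> to the dual of \<open>Soc(A)\<close>; a \<open>k\<close>-linear section of it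
  induces an \<open>A\<close>-linear map from \<open>A\<close> tensor the dual of
  \<open>Soc(A)\<close> to the dual of \<open>A\<close>. This is bijective modulo the augmentation
  ideal, and nilpotency takes the place of Nakayama's lemma. \<open>Soc(A)\<close> is invertible but
  need not be free, so a single generator may not exist; a frame is a finite system of trace one,
  and identities stated with it are global. Invertibility is defined by localizations but used in a
  denominator-free form: \<open>f\<close> times the identity factors through a free module. This
  form requires one exponent for all elements, which comes from finite generation and from bounded
  torsion over a Noetherian ring. The filtration acts at three points: it makes the augmentation
  ideal nil, its graded pieces make \<open>A\<close> locally free over \<open>k\<close>, and the
  constant rank of the degree-zero piece of \<open>A/I\<close> forces \<open>I = A\<close> or
  \<open>I\<close> inside the augmentation ideal. Elsewhere only the augmentation
  \<open>\<epsilon>\<close> is kept.\<close>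

abbreviation (input) add_sub ("(_ \<oplus>\<^sub>_ _)" [65, 1000, 66] 65) where "x \<oplus>\<^sub>R y \<equiv> x \<oplus>\<^bsub>R\<^esub> y"
abbreviation (input) minus_sub ("(_ \<ominus>\<^sub>_ _)" [65, 1000, 66] 65) where "x \<ominus>\<^sub>R y \<equiv> x \<ominus>\<^bsub>R\<^esub> y"
abbreviation (input) uminus_sub ("(\<ominus>\<^sub>_ _)" [1000, 81] 80) where "\<ominus>\<^sub>R x \<equiv> \<ominus>\<^bsub>R\<^esub> x"
abbreviation (input) mult_sub ("(_ \<otimes>\<^sub>_ _)" [70, 1000, 71] 70) where "x \<otimes>\<^sub>R y \<equiv> x \<otimes>\<^bsub>R\<^esub> y"
abbreviation (input) smult_sub ("(_ \<odot>\<^sub>_ _)" [70, 1000, 71] 70) where "c \<odot>\<^sub>M x \<equiv> c \<odot>\<^bsub>M\<^esub> x"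
abbreviation (input) zero_sub ("\<zero>\<^sub>_" [1000] 1000) where "\<zero>\<^sub>R \<equiv> \<zero>\<^bsub>R\<^esub>"
abbreviation (input) one_sub ("\<one>\<^sub>_" [1000] 1000) where "\<one>\<^sub>R \<equiv> \<one>\<^bsub>R\<^esub>"
syntax "_finsum_sub" :: "any \<Rightarrow> idt \<Rightarrow> 'a set \<Rightarrow> 'b \<Rightarrow> 'b" ("(3\<Oplus>\<^sub>_ _\<in>_./ _)" [1000, 0, 51, 10] 10)
translations "_finsum_sub G i A b" \<rightharpoonup> "CONST finsum G (\<lambda>i. b) A"
abbreviation (input) car where "car R \<equiv> carrier R"
abbreviation (input) lin where "lin R M \<equiv> mod_hom R M (regular_module R)"

section \<open>Linear maps and sums\<close>

lemma mod_homI: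
 assumes "\<And>x. x \<in> car M ==> f x \<in> car N"
  and "\<And>x y. x \<in> car M ==> y \<in> car M ==> f (x \<oplus>\<^sub>M y) = f x \<oplus>\<^sub>N f y"
  and "\<And>r x. r \<in> car R ==> x \<in> car M ==> f (r \<odot>\<^sub>M x) = r \<odot>\<^sub>N f x"
 shows "f \<in> mod_hom R M N"
 using assms by (auto simp: mod_hom_def)

lemma mod_homD:
 assumes "f \<in> mod_hom R M N"
 shows mod_hom_closed: "x \<in> car M ==> f x \<in> car N"
  and mod_hom_add: "x \<in> car M ==> y \<in> car M ==> f (x \<oplus>\<^sub>M y) = f x \<oplus>\<^sub>N f y"
  and mod_hom_smult: "r \<in> car R ==> x \<in> car M ==> f (r \<odot>\<^sub>M x) = r \<odot>\<^sub>N f x"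
 using assms by (auto simp: mod_hom_def)

lemma module_regular: "cring R ==> module R (regular_module R)"
proof -
 assume "cring R"
 then interpret cring R .
 have "abelian_group (regular_module R)"
  by (rule abelian_groupI) (auto simp: a_ac intro!: bexI[of _ "\<ominus>\<^sub>R x" for x] l_neg)
 then show ?thesis
  by (intro moduleI) (auto simp: l_distr r_distr m_assoc is_cring)
qed

lemma mod_hom_zero:
 assumes "module R M" "module R N" "f \<in> mod_hom R M N"
 shows "f \<zero>\<^sub>M = \<zero>\<^sub>N"
proof -
 interpret M: module R M by fact
 interpret N: module R N by fact
 have "f (\<zero>\<^sub>R \<odot>\<^sub>M \<zero>\<^sub>M) = \<zero>\<^sub>R \<odot>\<^sub>N f \<zero>\<^sub>M"
  by (rule mod_hom_smult[OF assms(3)]) auto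
 then show ?thesis using mod_hom_closed[OF assms(3)] by simp
qed

lemma mod_hom_uminus:
 assumes "module R M" "module R N" "f \<in> mod_hom R M N" "x \<in> car M"
 shows "f (\<ominus>\<^sub>M x) = \<ominus>\<^sub>N f x"
proof -
 interpret M: module R M by fact
 interpret N: module R N by fact
 have "f (\<ominus>\<^sub>M x) \<oplus>\<^sub>N f x = \<zero>\<^sub>N"
  using mod_hom_add[OF assms(3), of "\<ominus>\<^sub>M x" x] mod_hom_zero[OF assms(1-3)] assms(4)
  by (simp add: M.M.l_neg)
 then show ?thesis using mod_hom_closed[OF assms(3)] assms(4) by (simp add: N.M.minus_equality)
qed

lemma mod_hom_minus:
 assumes "module R M" "module R N" "f \<in> mod_hom R M N" "x \<in> car M" "y \<in> car M"
 shows "f (x \<ominus>\<^sub>M y) = f x \<ominus>\<^sub>N f y"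
proof -
 interpret M: module R M by fact
 interpret N: module R N by fact
 show ?thesis
  using assms by (simp add: a_minus_def mod_hom_add mod_hom_uminus[OF assms(1-3)])
qed

lemma mod_hom_finsum:
 assumes "module R M" "module R N" "f \<in> mod_hom R M N" "finite I" "g \<in> I \<rightarrow> car M"
 shows "f (finsum M g I) = (\<Oplus>\<^sub>N i\<in>I. f (g i))"
proof -
 interpret M: module R M by fact
 interpret N: module R N by fact
 show ?thesis using assms(4,5)
 proof (induction I)
  case empty
  then show ?case by (simp add: mod_hom_zero[OF assms(1-3)] M.finsum_empty N.finsum_empty)
 next
  case (insert i I)
  then have "(\<lambda>i. f (g i)) \<in> I \<rightarrow> car N" "f (g i) \<in> car N"
   using mod_hom_closed[OF assms(3)] by auto
  with insert show ?case
   by (simp add: M.finsum_insert N.finsum_insert mod_hom_add[OF assms(3)] M.finsum_closed)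
 qed
qed

lemma mod_hom_comp:
 assumes "f \<in> mod_hom R M N" "g \<in> mod_hom R N P"
 shows "(\<lambda>x. g (f x)) \<in> mod_hom R M P"
 using assms by (auto simp: mod_hom_def Pi_def)

lemma mod_hom_cong:
 assumes "module R M" "f \<in> mod_hom R M N" "\<And>x. x \<in> car M ==> f x = g x"
 shows "g \<in> mod_hom R M N"
proof -
 interpret M: module R M by fact
 show ?thesis using assms by (auto simp: mod_hom_def Pi_def)
qed

section \<open>Sums and differences in abelian groups and monoids\<close>

context abelian_group
begin

lemma minus_zero_right: "x \<in> car G ==> x \<ominus> \<zero> = x"
 using add.inv_one by (simp add: a_minus_def)

lemma right_minus_eq: "x \<in> car G ==> y \<in> car G ==> x \<ominus> y = \<zero> \<longleftrightarrow> x = y"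
 using minus_equality[of x "\<ominus> y"] by (auto simp: a_minus_def r_neg minus_minus)

lemma minus_add_cancel: "x \<in> car G ==> y \<in> car G ==> x \<ominus> y \<oplus> y = x"
 by (simp add: a_minus_def a_assoc l_neg)

end

context abelian_monoid
begin

lemma finsum_delta:
 assumes "finite I" "i \<in> I" "x \<in> car G"
 shows "(\<Oplus>j\<in>I. if j = i then x else \<zero>) = x"
proof -
 have "(\<Oplus>j\<in>I. if j = i then x else \<zero>) = (\<Oplus>j\<in>I. if i = j then x else \<zero>)"
  by (simp only: eq_commute[of i])
 also have "... = x"
  by (rule finsum_singleton[OF assms(2,1), of "\<lambda>_. x"]) (use assms(3) in blast)
 finally show ?thesis .
qed

lemma finsum_add_index:
 fixes m n :: nat
 assumes "\<And>i. i < m + n ==> f i \<in> car G"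
 shows "(\<Oplus>i\<in>{..<m + n}. f i) = (\<Oplus>i\<in>{..<m}. f i) \<oplus> (\<Oplus>i\<in>{..<n}. f (m + i))"
proof -
 have *: "{..<m + n} = {..<m} \<union> (\<lambda>i. m + i) ` {..<n}"
  unfolding lessThan_atLeast0 image_add_atLeastLessThan by auto
 have "(\<Oplus>i\<in>(\<lambda>i. m + i) ` {..<n}. f i) = (\<Oplus>i\<in>{..<n}. f (m + i))"
  using assms by (intro finsum_reindex) auto
 moreover have "(\<Oplus>i\<in>{..<m + n}. f i) = (\<Oplus>i\<in>{..<m}. f i) \<oplus> (\<Oplus>i\<in>(\<lambda>i. m + i) ` {..<n}. f i)"
  unfolding * by (rule finsum_Un_disjoint) (use assms in auto)
 ultimately show ?thesis by simp
qed

lemma finsum_all_zero: "(\<And>i. i \<in> I ==> f i = \<zero>) ==> finsum G f I = \<zero>"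
 using finsum_cong'[of I I "\<lambda>_. \<zero>" f] by (simp add: finsum_zero)

end

lemma (in module) smult_lcomm:
 assumes "a \<in> car R" "b \<in> car R" "x \<in> car M"
 shows "a \<odot>\<^sub>M (b \<odot>\<^sub>M x) = b \<odot>\<^sub>M (a \<odot>\<^sub>M x)"
 using assms by (metis R.m_comm smult_assoc1)

text \<open>The axioms are equations, and equations pass along any surjection that respects the
  operations. Injectivity is not asked, so that the lemma covers quotients as well as copies on
  another type.\<close>

lemma module_surj_image:
 assumes "module R M" and surj: "car N = q ` car M"
  and add: "\<And>x y. x \<in> car M ==> y \<in> car M ==> q x \<oplus>\<^sub>N q y = q (x \<oplus>\<^sub>M y)"
  and smult: "\<And>r x. r \<in> car R ==> x \<in> car M ==> r \<odot>\<^sub>N q x = q (r \<odot>\<^sub>M x)"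
  and zero: "\<zero>\<^sub>N = q \<zero>\<^sub>M"
 shows "module R N"
proof -
 interpret M: module R M by fact
 have "abelian_group N"
 proof (rule abelian_groupI)
  fix X assume "X \<in> car N"
  then obtain x where "x \<in> car M" "X = q x" by (auto simp: surj)
  then show "\<exists>Y\<in>car N. Y \<oplus>\<^sub>N X = \<zero>\<^sub>N"
   by (intro bexI[of _ "q (\<ominus>\<^sub>M x)"]) (auto simp: surj add zero M.M.l_neg)
 qed (auto simp: surj add zero M.M.a_ac)
 then show ?thesis
  by (rule moduleI[OF M.R.is_cring])
   (auto simp: surj add smult M.smult_l_distr M.smult_r_distr M.smult_assoc1)
qed

lemma algebra_surj_image:
 assumes "algebra R M" and surj: "car N = q ` car M"
  and add: "\<And>x y. x \<in> car M ==> y \<in> car M ==> q x \<oplus>\<^sub>N q y = q (x \<oplus>\<^sub>M y)"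
  and mult: "\<And>x y. x \<in> car M ==> y \<in> car M ==> q x \<otimes>\<^sub>N q y = q (x \<otimes>\<^sub>M y)"
  and smult: "\<And>r x. r \<in> car R ==> x \<in> car M ==> r \<odot>\<^sub>N q x = q (r \<odot>\<^sub>M x)"
  and zero: "\<zero>\<^sub>N = q \<zero>\<^sub>M" and one: "\<one>\<^sub>N = q \<one>\<^sub>M"
 shows "algebra R N"
proof -
 interpret M: algebra R M by fact
 have N: "module R N"
  by (rule module_surj_image[OF M.module surj]) (auto simp: add smult zero)
 interpret N: module R N by fact
 have "comm_monoid N"
  by (rule comm_monoidI) (auto simp: surj mult one M.m_ac)
 then have "cring N"
  by (intro cringI N.M.abelian_group_axioms) (auto simp: surj mult add M.l_distr)
 then show ?thesis
  by (rule algebraI[OF M.R_cring])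
   (auto simp: surj add smult mult M.smult_l_distr M.smult_r_distr M.smult_assoc1 M.smult_assoc2)
qed

section \<open>Submodules and quotient modules\<close>

lemma submodule_of_ideal:
 assumes "cring R" "ideal I R"
 shows "submodule I R (regular_module R)"
proof -
 interpret M: module R "regular_module R" by (rule module_regular[OF assms(1)])
 interpret I: ideal I R by fact
 have "\<ominus>\<^bsub>regular_module R\<^esub> a = \<ominus>\<^sub>R a" for a
  by (simp add: a_inv_def m_inv_def)
 then show ?thesis
  by (intro M.submoduleI) (auto simp: I.I_l_closed)
qed

context module
begin

lemma submodule_abelian_subgroup:
 assumes "submodule H R M"
 shows "abelian_subgroup H M"
 using assms by (intro abelian_subgroupI3 additive_subgroup.intro submodule.axioms(1) M.abelian_group_axioms)

lemma submodule_closed: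
 assumes "submodule H R M"
 shows "x \<in> H ==> x \<in> car M" "\<zero>\<^sub>M \<in> H" "x \<in> H ==> y \<in> H ==> x \<oplus>\<^sub>M y \<in> H"
  "x \<in> H ==> \<ominus>\<^sub>M x \<in> H" "x \<in> H ==> y \<in> H ==> x \<ominus>\<^sub>M y \<in> H"
  "r \<in> car R ==> x \<in> H ==> r \<odot>\<^sub>M x \<in> H"
 using submoduleE[OF assms] submodule_abelian_subgroup[OF assms]
 by (auto simp: a_minus_def abelian_subgroup_def additive_subgroup.zero_closed)

lemma submodule_finsum:
 assumes "submodule H R M" "f \<in> I \<rightarrow> H"
 shows "finsum M f I \<in> H"
proof (cases "finite I")
 case True
 then show ?thesis using assms(2)
 proof (induction I)
  case (insert i I)
  then have "f \<in> I \<rightarrow> car M" "f i \<in> car M" using submodule_closed(1)[OF assms(1)] by auto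
  with insert show ?case using submodule_closed(3)[OF assms(1)] by (simp add: M.finsum_insert Pi_def)
 qed (use submodule_closed[OF assms(1)] in \<open>simp add: M.finsum_empty\<close>)
qed (use submodule_closed[OF assms(1)] in \<open>simp add: M.finsum_infinite\<close>)

end

lemma carrier_quot_module: "car (quot_module M H) = (\<lambda>x. H +>\<^bsub>M\<^esub> x) ` car M"
 by (auto simp: quot_module_def A_RCOSETS_def')

context
 fixes R :: "('r, 'z) ring_scheme" and M :: "('r, 'm) module" and H
 assumes M: "module R M" and H: "submodule H R M"
begin

interpretation module R M by (rule M)

interpretation H: abelian_subgroup H M by (rule submodule_abelian_subgroup[OF H])

lemma zero_quot_module: "\<zero>\<^bsub>quot_module M H\<^esub> = H +>\<^bsub>M\<^esub> \<zero>\<^sub>M"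
 using submodule_closed[OF H] by (auto simp: quot_module_def a_r_coset_defs)

lemma add_quot_module:
 "x \<in> car M ==> y \<in> car M ==>
  (H +>\<^bsub>M\<^esub> x) \<oplus>\<^bsub>quot_module M H\<^esub> (H +>\<^bsub>M\<^esub> y) = H +>\<^bsub>M\<^esub> (x \<oplus>\<^sub>M y)"
 using H.a_rcos_sum by (simp add: quot_module_def)

lemma coset_eq_iff:
 assumes "x \<in> car M" "y \<in> car M"
 shows "H +>\<^bsub>M\<^esub> x = H +>\<^bsub>M\<^esub> y \<longleftrightarrow> x \<ominus>\<^sub>M y \<in> H"
 using H.a_rcos_module[OF assms(2,1), folded a_minus_def] assms H.a_rcos_self
 by (metis H.a_repr_independence')

text \<open>The scalar action on cosets is defined as a union over all representatives. Since
  \<open>H\<close> is stable under scalars, all cosets in that union coincide, and a nonempty union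
  of equal sets is that set.\<close>

lemma smult_quot_module:
 assumes "r \<in> car R" "x \<in> car M"
 shows "r \<odot>\<^bsub>quot_module M H\<^esub> (H +>\<^bsub>M\<^esub> x) = H +>\<^bsub>M\<^esub> (r \<odot>\<^sub>M x)"
proof -
 have *: "H +>\<^bsub>M\<^esub> (r \<odot>\<^sub>M y) = H +>\<^bsub>M\<^esub> (r \<odot>\<^sub>M x)" if "y \<in> H +>\<^bsub>M\<^esub> x" for y
 proof -
  have y: "y \<in> car M" using that assms(2) H.a_elemrcos_carrier by blast
  then have "y \<ominus>\<^sub>M x \<in> H"
   using that H.a_rcos_module[OF assms(2), folded a_minus_def] by blast
  then have "r \<odot>\<^sub>M (y \<ominus>\<^sub>M x) \<in> H" by (rule submodule_closed(6)[OF H assms(1)])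
  then show ?thesis
   using assms y by (simp add: coset_eq_iff a_minus_def smult_r_distr smult_r_minus)
 qed
 have "x \<in> H +>\<^bsub>M\<^esub> x" using assms(2) H.a_rcos_self by blast
 then have "(\<Union>y\<in>H +>\<^bsub>M\<^esub> x. H +>\<^bsub>M\<^esub> (r \<odot>\<^sub>M y)) = H +>\<^bsub>M\<^esub> (r \<odot>\<^sub>M x)"
  using * by (intro UN_constant_eq[of x]) blast+
 then show ?thesis by (simp add: quot_module_def)
qed

lemma module_quot_module: "module R (quot_module M H)"
 by (rule module_surj_image[OF module_axioms carrier_quot_module])
  (auto simp: zero_quot_module add_quot_module smult_quot_module)

lemma quot_module_hom: "(\<lambda>x. H +>\<^bsub>M\<^esub> x) \<in> mod_hom R M (quot_module M H)"
 by (rule mod_homI) (auto simp: carrier_quot_module add_quot_module smult_quot_module)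

lemma coset_zero_iff:
 "x \<in> car M ==> H +>\<^bsub>M\<^esub> x = \<zero>\<^bsub>quot_module M H\<^esub> \<longleftrightarrow> x \<in> H"
 by (simp add: zero_quot_module coset_eq_iff M.minus_zero_right)

end

text \<open>The lift picks a representative by choice; as \<open>H\<close> is sent to zero, the
  value does not depend on it. Outside the cosets the values are arbitrary, so the lift is
  restricted wherever extensionality matters.\<close>

lemma quot_module_lift:
 fixes M :: "('r, 'm) module"
 assumes "module R M" "module R N" "submodule H R M" "f \<in> mod_hom R M N"
  and "\<And>x. x \<in> H ==> f x = \<zero>\<^sub>N"
 obtains g where "g \<in> mod_hom R (quot_module M H) N"
  "\<And>x. x \<in> car M ==> g (H +>\<^bsub>M\<^esub> x) = f x"
proof -
 interpret M: module R M by fact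
 interpret N: module R N by fact
 define g where "g X = f (SOME x. x \<in> car M \<and> X = H +>\<^bsub>M\<^esub> x)" for X
 have g: "g (H +>\<^bsub>M\<^esub> x) = f x" if x: "x \<in> car M" for x
 proof -
  define y where "y = (SOME y. y \<in> car M \<and> H +>\<^bsub>M\<^esub> x = H +>\<^bsub>M\<^esub> y)"
  have "y \<in> car M \<and> H +>\<^bsub>M\<^esub> x = H +>\<^bsub>M\<^esub> y"
   unfolding y_def by (rule someI[of _ x]) (use x in auto)
  then have y: "y \<in> car M" "x \<ominus>\<^sub>M y \<in> H" using x by (auto simp: coset_eq_iff[OF assms(1,3)])
  then have "f x \<ominus>\<^sub>N f y = \<zero>\<^sub>N"
   using assms(5) mod_hom_minus[OF assms(1,2,4) x y(1)] by metis
  then show ?thesis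
   unfolding g_def y_def[symmetric] using x y mod_hom_closed[OF assms(4)] N.M.right_minus_eq by metis
 qed
 show ?thesis
 proof (rule that[of g])
  show "g \<in> mod_hom R (quot_module M H) N"
   by (rule mod_homI)
    (auto simp: carrier_quot_module add_quot_module[OF assms(1,3)] smult_quot_module[OF assms(1,3)] g
     mod_hom_add[OF assms(4)] mod_hom_smult[OF assms(4)] mod_hom_closed[OF assms(4)])
 qed (use g in blast)
qed

section \<open>Restriction of scalars, homomorphism modules and duals\<close>

lemma restrict_scalars_simps [simp]:
 "car (restrict_scalars A N) = car N" "zero (restrict_scalars A N) = zero N"
 "add (restrict_scalars A N) = add N"
 "c \<odot>\<^bsub>restrict_scalars A N\<^esub> x = (c \<odot>\<^sub>A \<one>\<^sub>A) \<odot>\<^sub>N x"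
 by (simp_all add: restrict_scalars_def)

text \<open>Restriction of scalars, duals over \<open>A\<close> and tensor products with an
  \<open>A\<close>-module differ from their \<open>k\<close>-versions only in the scalar action, so
  the additive group is carried over.\<close>

lemma abelian_group_cong:
 assumes "abelian_group M" "car N = car M" "zero N = zero M" "add N = add M"
 shows "abelian_group N"
proof -
 interpret abelian_group M by fact
 show ?thesis
  by (rule abelian_groupI) (use assms l_neg in \<open>auto simp: a_ac\<close>)
qed

lemma module_restrict_scalars:
 assumes "algebra k A" "module A N"
 shows "module k (restrict_scalars A N)"
proof -
 interpret A: algebra k A by fact
 interpret N: module A N by fact
 show ?thesis
  by (rule moduleI[OF A.R_cring abelian_group_cong[OF N.M.abelian_group_axioms]])
   (auto simp: A.smult_l_distr N.smult_l_distr N.smult_r_distr A.smult_assoc1 A.smult_assoc2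
    simp flip: N.smult_assoc1)
qed

lemma mod_hom_restrict_scalars:
 assumes "algebra k A" "f \<in> mod_hom A M N"
 shows "f \<in> mod_hom k (restrict_scalars A M) (restrict_scalars A N)"
proof -
 interpret A: algebra k A by fact
 show ?thesis using assms(2) by (auto simp: mod_hom_def)
qed

lemma hom_module_simps [simp]:
 "car (hom_module R M N) = mod_hom R M N \<inter> extensional (car M)"
 "zero (hom_module R M N) = (\<lambda>x\<in>car M. \<zero>\<^sub>N)"
 "f \<oplus>\<^bsub>hom_module R M N\<^esub> g = (\<lambda>x\<in>car M. f x \<oplus>\<^sub>N g x)"
 "r \<odot>\<^bsub>hom_module R M N\<^esub> f = (\<lambda>x\<in>car M. r \<odot>\<^sub>N f x)"
 by (simp_all add: hom_module_def)

lemma module_hom_module: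
 assumes "module R M" "module R N"
 shows "module R (hom_module R M N)"
proof -
 interpret M: module R M by fact
 interpret N: module R N by fact
 have "abelian_group (hom_module R M N)"
 proof (rule abelian_groupI)
  fix f assume f: "f \<in> car (hom_module R M N)"
  then show "\<exists>g\<in>car (hom_module R M N). g \<oplus>\<^bsub>hom_module R M N\<^esub> f = \<zero>\<^bsub>hom_module R M N\<^esub>"
   by (intro bexI[of _ "\<lambda>x\<in>car M. \<ominus>\<^sub>N f x"])
    (auto simp: mod_hom_def Pi_def N.M.l_neg N.M.r_neg N.M.minus_add N.smult_r_minus N.M.a_ac intro!: restrict_ext)
 qed (auto simp: mod_hom_def Pi_def N.M.a_ac N.smult_r_distr intro!: restrict_ext extensionalityI[of _ "car M"])
 then show ?thesis
  by (rule moduleI[OF M.R.is_cring])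
   (auto simp: mod_hom_def Pi_def N.M.a_ac N.smult_r_distr N.smult_l_distr M.R.m_comm
    simp flip: N.smult_assoc1 intro!: restrict_ext extensionalityI[of _ "car M"])
qed

lemma dual_simps [simp]:
 "car (dual k M) = lin k M \<inter> extensional (car M)"
 "zero (dual k M) = (\<lambda>x\<in>car M. \<zero>\<^sub>k)"
 "f \<oplus>\<^bsub>dual k M\<^esub> g = (\<lambda>x\<in>car M. f x \<oplus>\<^sub>k g x)"
 "r \<odot>\<^bsub>dual k M\<^esub> f = (\<lambda>x\<in>car M. r \<otimes>\<^sub>k f x)"
 by (simp_all add: dual_def)

lemma module_dual: "module k M ==> module k (dual k M)"
 unfolding dual_def by (intro module_hom_module module_regular) (auto simp: module_def)

lemma dual_alg_simps [simp]:
 "car (dual_alg k A M) = lin k (restrict_scalars A M) \<inter> extensional (car M)"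
 "zero (dual_alg k A M) = (\<lambda>x\<in>car M. \<zero>\<^sub>k)"
 "add (dual_alg k A M) = (\<lambda>f g. \<lambda>x\<in>car M. f x \<oplus>\<^sub>k g x)"
 "smult (dual_alg k A M) = (\<lambda>a f. \<lambda>x\<in>car M. f (a \<odot>\<^sub>M x))"
 by (simp_all add: dual_alg_def dual_def hom_module_def Let_def)

lemma module_dual_alg:
 assumes "algebra k A" "module A M"
 shows "module A (dual_alg k A M)"
proof -
 interpret A: algebra k A by fact
 interpret M: module A M by fact
 have "abelian_group (dual k (restrict_scalars A M))"
  by (rule module.axioms(2)[OF module_dual[OF module_restrict_scalars[OF assms]]])
 then have "abelian_group (dual_alg k A M)"
  by (rule abelian_group_cong) (auto simp: fun_eq_iff)
 then show ?thesis
 proof (rule moduleI[OF A.M_cring])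
  fix a x assume "a \<in> car A" "x \<in> car (dual_alg k A M)"
  then show "a \<odot>\<^bsub>dual_alg k A M\<^esub> x \<in> car (dual_alg k A M)"
   by (auto simp: mod_hom_def Pi_def M.smult_r_distr M.smult_lcomm[of a])
 qed (auto simp: mod_hom_def Pi_def M.smult_r_distr M.smult_l_distr A.m_comm
   simp flip: M.smult_assoc1 intro!: restrict_ext extensionalityI[of _ "car M"])
qed

section \<open>Gluing over the spectrum\<close>

text \<open>Zorn's lemma among the ideals that contain \<open>J\<close> and miss one: a maximal
  member is a maximal ideal, hence prime.\<close>

lemma (in cring) proper_ideal_below_prime:
 assumes "ideal J R" "\<one> \<notin> J"
 obtains p where "primeideal p R" "J \<subseteq> p"
proof -
 define \<A> where "\<A> = {I. ideal I R \<and> J \<subseteq> I \<and> \<one> \<notin> I}"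
 have "\<exists>M\<in>\<A>. \<forall>X\<in>\<A>. M \<subseteq> X --> X = M"
 proof (rule subset_Zorn_nonempty)
  show "\<A> \<noteq> {}" using assms by (auto simp: \<A>_def)
  fix \<C> assume C: "\<C> \<noteq> {}" "subset.chain \<A> \<C>"
  then have "subset.chain {I. ideal I R} \<C>"
   by (auto simp: \<A>_def pred_on.chain_def)
  then have "ideal (if \<C> = {} then {\<zero>} else \<Union>\<C>) R" by (rule chain_Union_is_ideal)
  with C show "\<Union>\<C> \<in> \<A>"
   by (auto simp: \<A>_def pred_on.chain_def)
 qed
 then obtain M where M: "M \<in> \<A>" "\<And>X. X \<in> \<A> ==> M \<subseteq> X ==> X = M" by blast
 have "maximalideal M R"
 proof (rule maximalidealI)
  show "ideal M R" "car R \<noteq> M" using M by (auto simp: \<A>_def)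
  fix K assume K: "ideal K R" "M \<subseteq> K" "K \<subseteq> car R"
  show "K = M \<or> K = car R"
  proof (cases "\<one> \<in> K")
   case True
   then show ?thesis using K(1) ideal.one_imp_carrier by blast
  next
   case False
   then show ?thesis using K M(1) M(2)[of K] by (auto simp: \<A>_def)
  qed
 qed
 then show ?thesis using that[of M] M by (auto simp: \<A>_def dest: maximalideal_prime)
qed

text \<open>The local-to-global principle behind all gluing below. It is applied to the scalars for
  which an assertion holds, once these are known to form an ideal.\<close>

lemma (in cring) one_in_ideal_if_local:
 assumes "ideal J R" "\<And>p. primeideal p R ==> \<exists>f\<in>J. f \<notin> p"
 shows "\<one> \<in> J"
 using proper_ideal_below_prime[OF assms(1)] assms(2) by (metis subsetD)

text \<open>Quasi-compactness of the spectrum: the finite sums of multiples of elements with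
  \<open>P\<close> form an ideal that no prime contains. \<open>P\<close> itself need not be stable
  under any operation.\<close>

lemma (in cring) partition_of_unity:
 assumes "\<forall>p. primeideal p R --> (\<exists>f \<in> car R - p. P f)"
 shows "\<exists>(n::nat) b c. (\<forall>i<n. b i \<in> car R \<and> c i \<in> car R \<and> P (c i)) \<and>
  (\<Oplus>i\<in>{..<n}. b i \<otimes> c i) = \<one>"
proof -
 define good where "good x n b c \<longleftrightarrow> (\<forall>i<n. b i \<in> car R \<and> c i \<in> car R \<and> P (c i)) \<and>
  (\<Oplus>i\<in>{..<n}. b i \<otimes> c i) = x" for x and n :: nat and b c
 define J where "J = {x. \<exists>n b c. good x n b c}"
 have JI: "x \<in> J" if "good x n b c" for x n b c using that by (auto simp: J_def)
 have sum: "x \<oplus> y \<in> J" if "x \<in> J" "y \<in> J" for x y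
 proof -
  from that obtain n b c n' b' c' where *: "good x n b c" "good y n' b' c'" by (auto simp: J_def)
  have "(\<Oplus>i\<in>{..<n + n'}. (if i < n then b i else b' (i - n)) \<otimes> (if i < n then c i else c' (i - n)))
   = (\<Oplus>i\<in>{..<n}. b i \<otimes> c i) \<oplus> (\<Oplus>i\<in>{..<n'}. b' i \<otimes> c' i)"
   using * by (subst finsum_add_index) (auto simp: good_def intro!: arg_cong2[where f="(\<oplus>)"] finsum_cong')
  with * show ?thesis
   by (intro JI[of _ "n + n'" "\<lambda>i. if i < n then b i else b' (i - n)" "\<lambda>i. if i < n then c i else c' (i - n)"])
    (auto simp: good_def)
 qed
 have scale: "a \<otimes> x \<in> J" if "x \<in> J" "a \<in> car R" for x a
 proof -
  from that obtain n b c where *: "good x n b c" by (auto simp: J_def)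
  then have "(\<Oplus>i\<in>{..<n}. (a \<otimes> b i) \<otimes> c i) = a \<otimes> x"
   using that by (auto simp: good_def finsum_rdistr m_assoc intro!: finsum_cong')
  with * that show ?thesis
   by (intro JI[of _ n "\<lambda>i. a \<otimes> b i" c]) (auto simp: good_def)
 qed
 have Jc: "x \<in> car R" if "x \<in> J" for x
  using that by (auto simp: J_def good_def intro!: finsum_closed)
 have zero: "\<zero> \<in> J" by (rule JI[of _ 0]) (auto simp: good_def finsum_empty)
 have "ideal J R"
 proof (rule idealI)
  show "subgroup J (add_monoid R)"
  proof (rule add.subgroupI)
   fix x assume x: "x \<in> J"
   have "\<ominus> \<one> \<otimes> x = \<ominus> x" using Jc[OF x] by (simp add: l_minus)
   then show "\<ominus> x \<in> J" using scale[OF x, of "\<ominus> \<one>"] by simp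
  qed (use Jc zero sum in auto)
 qed (use scale Jc in \<open>auto simp: ring_axioms m_comm\<close>)
 moreover have "\<exists>f\<in>J. f \<notin> p" if p: "primeideal p R" for p
 proof -
  obtain f where f: "f \<in> car R - p" "P f" using assms p by blast
  then have "good f 1 (\<lambda>_. \<one>) (\<lambda>_. f)" by (auto simp: good_def finsum_insert lessThan_Suc finsum_empty)
  then show ?thesis using f JI by blast
 qed
 ultimately have "\<one> \<in> J" by (rule one_in_ideal_if_local)
 then show ?thesis by (auto simp: J_def good_def)
qed

text \<open>The annihilator of \<open>z\<close> is an ideal that no prime contains.\<close>

lemma (in module) zero_if_locally_zero:
 assumes "z \<in> car M" "\<And>p. primeideal p R ==> \<exists>f \<in> car R - p. f \<odot>\<^sub>M z = \<zero>\<^sub>M"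
 shows "z = \<zero>\<^sub>M"
proof -
 define J where "J = {f \<in> car R. f \<odot>\<^sub>M z = \<zero>\<^sub>M}"
 have "ideal J R"
 proof (rule idealI)
  show "subgroup J (add_monoid R)"
   by (rule R.add.subgroupI) (use assms(1) in \<open>auto simp: J_def smult_l_distr smult_l_minus\<close>)
  fix a x assume "a \<in> J" "x \<in> car R"
  then show "x \<otimes> a \<in> J" "a \<otimes> x \<in> J"
   using assms(1) smult_lcomm[of a x z] by (auto simp: J_def smult_assoc1)
 qed (rule R.ring_axioms)
 then have "\<one>\<^sub>R \<in> J"
  by (rule R.one_in_ideal_if_local) (use assms(2) in \<open>auto simp: J_def\<close>)
 then show ?thesis using assms(1) by (simp add: J_def)
qed

section \<open>Localization in elementary terms\<close>

lemma (in module) finsum_smult_rdistr: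
 assumes "finite I" "g \<in> I \<rightarrow> car R" "x \<in> car M"
 shows "(\<Oplus>\<^sub>R i\<in>I. g i) \<odot>\<^sub>M x = (\<Oplus>\<^sub>M i\<in>I. g i \<odot>\<^sub>M x)"
 using assms(1,2)
 by (induction I)
  (auto simp: Pi_def assms(3) smult_l_distr R.finsum_closed M.finsum_insert R.finsum_insert
   R.finsum_empty M.finsum_empty)

text \<open>The operations on fractions are unions over all pairs of representatives; this removes
  the union once independence of the pair is known.\<close>

lemma UN_pairs_constant:
 assumes "X \<noteq> {}" "Y \<noteq> {}" "\<And>x s y t. (x, s) \<in> X ==> (y, t) \<in> Y ==> f x s y t = c"
 shows "(\<Union>(x, s)\<in>X. \<Union>(y, t)\<in>Y. f x s y t) = c"
proof -
 have "(\<Union>(y, t)\<in>Y. f x s y t) = c" if "(x, s) \<in> X" for x s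
  using assms(2) assms(3)[OF that] by (simp add: split_beta)
 then show ?thesis using assms(1) by (simp add: split_beta)
qed

locale localization = module R M for R :: "('r, 'z) ring_scheme" (structure) and M :: "('r, 'm) module" +
 fixes S :: "'r set"
 assumes S_sub: "S \<subseteq> car R" and S_one: "\<one> \<in> S"
  and S_mult: "s \<in> S ==> t \<in> S ==> s \<otimes> t \<in> S"
begin

abbreviation fr :: "'m => 'r => ('m \<times> 'r) set" where "fr \<equiv> frac R M S"

lemma S_carrier: "s \<in> S ==> s \<in> car R"
 using S_sub by blast

lemma equiv_frac_rel: "equiv (car M \<times> S) (frac_rel R M S)"
proof (rule equivI)
 show "frac_rel R M S \<subseteq> (car M \<times> S) \<times> (car M \<times> S)" by (auto simp: frac_rel_def)
 show "refl_on (car M \<times> S) (frac_rel R M S)"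
  using S_one by (auto simp: refl_on_def frac_rel_def)
 show "sym (frac_rel R M S)" by (rule symI, clarsimp simp: frac_rel_def, metis)
 have "((x, s), (z, w)) \<in> frac_rel R M S"
  if xy: "((x, s), (y, t)) \<in> frac_rel R M S" and yz: "((y, t), (z, w)) \<in> frac_rel R M S" for x s y t z w
 proof -
  from xy obtain u where u: "u \<in> S" "u \<odot>\<^sub>M (t \<odot>\<^sub>M x) = u \<odot>\<^sub>M (s \<odot>\<^sub>M y)"
   and c: "x \<in> car M" "y \<in> car M" "s \<in> S" "t \<in> S" by (auto simp: frac_rel_def)
  from yz obtain v where v: "v \<in> S" "v \<odot>\<^sub>M (w \<odot>\<^sub>M y) = v \<odot>\<^sub>M (t \<odot>\<^sub>M z)"
   and d: "z \<in> car M" "w \<in> S" by (auto simp: frac_rel_def)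
  note R = u(1) v(1) c d S_carrier[OF u(1)] S_carrier[OF v(1)] S_carrier[OF c(3)] S_carrier[OF c(4)]
   S_carrier[OF d(2)]
  \<comment> \<open>Transitivity: if \<open>u\<close> and \<open>v\<close> are the witnesses of the
    two relations, then \<open>u v t\<close> is a witness of the third, because both sides pass
    through \<open>u s v w y\<close>.\<close>
  have "(u \<otimes> v \<otimes> t) \<odot>\<^sub>M (w \<odot>\<^sub>M x) = (v \<otimes> w) \<odot>\<^sub>M (u \<odot>\<^sub>M (t \<odot>\<^sub>M x))"
   using R by (simp add: R.m_ac flip: smult_assoc1)
  also have "... = (u \<otimes> s) \<odot>\<^sub>M (v \<odot>\<^sub>M (w \<odot>\<^sub>M y))"
   unfolding u(2) using R by (simp add: R.m_ac flip: smult_assoc1)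
  also have "... = (u \<otimes> v \<otimes> t) \<odot>\<^sub>M (s \<odot>\<^sub>M z)"
   unfolding v(2) using R by (simp add: R.m_ac flip: smult_assoc1)
  finally show ?thesis using R S_mult by (auto simp: frac_rel_def)
 qed
 then show "trans (frac_rel R M S)" unfolding trans_def by auto
qed

lemma frac_eq_iff:
 assumes "x \<in> car M" "y \<in> car M" "s \<in> S" "t \<in> S"
 shows "fr x s = fr y t \<longleftrightarrow> (\<exists>u\<in>S. u \<odot>\<^sub>M (t \<odot>\<^sub>M x) = u \<odot>\<^sub>M (s \<odot>\<^sub>M y))"
proof -
 have "fr x s = fr y t \<longleftrightarrow> ((x, s), (y, t)) \<in> frac_rel R M S"
  unfolding frac_def by (rule eq_equiv_class_iff[OF equiv_frac_rel]) (use assms in auto)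
 then show ?thesis using assms by (simp add: frac_rel_def)
qed

lemma frac_eqI:
 assumes "x \<in> car M" "y \<in> car M" "s \<in> S" "t \<in> S" "t \<odot>\<^sub>M x = s \<odot>\<^sub>M y"
 shows "fr x s = fr y t"
 using assms S_one by (auto simp: frac_eq_iff)

lemma mem_frac:
 assumes "x \<in> car M" "s \<in> S"
 shows "(y, t) \<in> fr x s \<longleftrightarrow> y \<in> car M \<and> t \<in> S \<and> fr y t = fr x s"
 using assms frac_eq_iff[of x y s t] by (auto simp: frac_def frac_rel_def)

lemma frac_self: "x \<in> car M ==> s \<in> S ==> (x, s) \<in> fr x s"
 by (simp add: mem_frac)

lemma carrier_loc_module: "car (loc_module R M S) = {fr x s |x s. x \<in> car M \<and> s \<in> S}"
 by (auto simp: loc_module_def quotient_def frac_def)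

lemma zero_loc_module: "zero (loc_module R M S) = fr \<zero>\<^sub>M \<one>"
 by (simp add: loc_module_def)

lemma add_loc_module:
 assumes c: "x \<in> car M" "y \<in> car M" "s \<in> S" "t \<in> S"
 shows "fr x s \<oplus>\<^bsub>loc_module R M S\<^esub> fr y t = fr (t \<odot>\<^sub>M x \<oplus>\<^sub>M s \<odot>\<^sub>M y) (s \<otimes> t)"
proof -
 have *: "fr (t' \<odot>\<^sub>M x' \<oplus>\<^sub>M s' \<odot>\<^sub>M y') (s' \<otimes> t') = fr (t \<odot>\<^sub>M x \<oplus>\<^sub>M s \<odot>\<^sub>M y) (s \<otimes> t)"
  if "(x', s') \<in> fr x s" "(y', t') \<in> fr y t" for x' s' y' t'
 proof -
  from that c have d: "x' \<in> car M" "y' \<in> car M" "s' \<in> S" "t' \<in> S"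
   "fr x' s' = fr x s" "fr y' t' = fr y t" by (auto simp: mem_frac)
  then obtain u v where u: "u \<in> S" "u \<odot>\<^sub>M (s \<odot>\<^sub>M x') = u \<odot>\<^sub>M (s' \<odot>\<^sub>M x)"
   and v: "v \<in> S" "v \<odot>\<^sub>M (t \<odot>\<^sub>M y') = v \<odot>\<^sub>M (t' \<odot>\<^sub>M y)"
   using c by (auto simp: frac_eq_iff)
  note R = u(1) v(1) c d(1-4) S_carrier[OF u(1)] S_carrier[OF v(1)] S_carrier[OF c(3)] S_carrier[OF c(4)]
   S_carrier[OF d(3)] S_carrier[OF d(4)] S_mult
  have "(u \<otimes> v) \<odot>\<^sub>M ((s \<otimes> t) \<odot>\<^sub>M (t' \<odot>\<^sub>M x' \<oplus>\<^sub>M s' \<odot>\<^sub>M y'))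
   = (v \<otimes> t \<otimes> t') \<odot>\<^sub>M (u \<odot>\<^sub>M (s \<odot>\<^sub>M x')) \<oplus>\<^sub>M (u \<otimes> s \<otimes> s') \<odot>\<^sub>M (v \<odot>\<^sub>M (t \<odot>\<^sub>M y'))"
   using R by (simp add: R.m_ac smult_r_distr flip: smult_assoc1)
  also have "... = (u \<otimes> v) \<odot>\<^sub>M ((s' \<otimes> t') \<odot>\<^sub>M (t \<odot>\<^sub>M x \<oplus>\<^sub>M s \<odot>\<^sub>M y))"
   unfolding u(2) v(2) using R by (simp add: R.m_ac smult_r_distr flip: smult_assoc1)
  finally show ?thesis
   using R by (subst frac_eq_iff) (auto intro!: bexI[of _ "u \<otimes> v"])
 qed
 have "fr x s \<oplus>\<^bsub>loc_module R M S\<^esub> fr y t =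
  (\<Union>(x', s')\<in>fr x s. \<Union>(y', t')\<in>fr y t. fr (t' \<odot>\<^sub>M x' \<oplus>\<^sub>M s' \<odot>\<^sub>M y') (s' \<otimes> t'))"
  by (simp add: loc_module_def)
 also have "... = fr (t \<odot>\<^sub>M x \<oplus>\<^sub>M s \<odot>\<^sub>M y) (s \<otimes> t)"
  by (rule UN_pairs_constant[OF _ _ *]) (use frac_self[OF c(1,3)] frac_self[OF c(2,4)] in blast)+
 finally show ?thesis .
qed

end

text \<open>The localized ring has the carrier and the operations of the localized regular module,
  so one set of lemmas about fractions serves both.\<close>

lemma localization_regular:
 assumes "localization R M S"
 shows "localization R (regular_module R) S"
proof -
 interpret localization R M S by fact
 interpret reg: module R "regular_module R" by (rule module_regular) (rule R.is_cring)
 show ?thesis by unfold_locales (auto intro: S_carrier S_one S_mult)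
qed

context localization
begin

interpretation reg: localization R "regular_module R" S
 by (rule localization_regular[OF localization_axioms])

abbreviation frr :: "'r => 'r => ('r \<times> 'r) set" where "frr \<equiv> frac R (regular_module R) S"

lemma carrier_loc_ring: "car (loc_ring R S) = {frr x s |x s. x \<in> car R \<and> s \<in> S}"
 using reg.carrier_loc_module by (simp add: loc_ring_def loc_module_def)

lemma zero_loc_ring: "zero (loc_ring R S) = frr \<zero> \<one>"
 by (simp add: loc_ring_def)

lemma one_loc_ring: "one (loc_ring R S) = frr \<one> \<one>"
 by (simp add: loc_ring_def)

lemma add_loc_ring:
 "x \<in> car R ==> y \<in> car R ==> s \<in> S ==> t \<in> S ==>
  frr x s \<oplus>\<^bsub>loc_ring R S\<^esub> frr y t = frr (t \<otimes> x \<oplus> s \<otimes> y) (s \<otimes> t)"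
 using reg.add_loc_module[of x y s t] by (simp add: loc_ring_def loc_module_def)

lemma smult_loc_module:
 assumes c: "a \<in> car R" "y \<in> car M" "s \<in> S" "t \<in> S"
 shows "frr a s \<odot>\<^bsub>loc_module R M S\<^esub> fr y t = fr (a \<odot>\<^sub>M y) (s \<otimes> t)"
proof -
 have *: "fr (a' \<odot>\<^sub>M y') (s' \<otimes> t') = fr (a \<odot>\<^sub>M y) (s \<otimes> t)"
  if "(a', s') \<in> frr a s" "(y', t') \<in> fr y t" for a' s' y' t'
 proof -
  from that c have d: "a' \<in> car R" "y' \<in> car M" "s' \<in> S" "t' \<in> S"
   "frr a' s' = frr a s" "fr y' t' = fr y t" by (auto simp: mem_frac reg.mem_frac)
  then obtain u v where u: "u \<in> S" "u \<otimes> (s \<otimes> a') = u \<otimes> (s' \<otimes> a)"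
   and v: "v \<in> S" "v \<odot>\<^sub>M (t \<odot>\<^sub>M y') = v \<odot>\<^sub>M (t' \<odot>\<^sub>M y)"
   using c by (auto simp: frac_eq_iff reg.frac_eq_iff)
  note R = u(1) v(1) c d(1-4) S_carrier[OF u(1)] S_carrier[OF v(1)] S_carrier[OF c(3)] S_carrier[OF c(4)]
   S_carrier[OF d(3)] S_carrier[OF d(4)] S_mult
  have "(u \<otimes> v) \<odot>\<^sub>M ((s \<otimes> t) \<odot>\<^sub>M (a' \<odot>\<^sub>M y'))
   = (u \<otimes> (s \<otimes> a')) \<odot>\<^sub>M (v \<odot>\<^sub>M (t \<odot>\<^sub>M y'))"
   using R by (simp add: R.m_ac flip: smult_assoc1)
  also have "... = (u \<otimes> v) \<odot>\<^sub>M ((s' \<otimes> t') \<odot>\<^sub>M (a \<odot>\<^sub>M y))"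
   unfolding u(2) v(2) using R by (simp add: R.m_ac flip: smult_assoc1)
  finally show ?thesis
   using R by (subst frac_eq_iff) (auto intro!: bexI[of _ "u \<otimes> v"])
 qed
 have "frr a s \<odot>\<^bsub>loc_module R M S\<^esub> fr y t =
  (\<Union>(a', s')\<in>frr a s. \<Union>(y', t')\<in>fr y t. fr (a' \<odot>\<^sub>M y') (s' \<otimes> t'))"
  by (simp add: loc_module_def)
 also have "... = fr (a \<odot>\<^sub>M y) (s \<otimes> t)"
  by (rule UN_pairs_constant[OF _ _ *]) (use reg.frac_self[of a s] frac_self[OF c(2,4)] c in auto)
 finally show ?thesis .
qed

lemma mult_loc_ring:
 "x \<in> car R ==> y \<in> car R ==> s \<in> S ==> t \<in> S ==>
  frr x s \<otimes>\<^bsub>loc_ring R S\<^esub> frr y t = frr (x \<otimes> y) (s \<otimes> t)"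
 using localization.smult_loc_module[OF reg.localization_axioms, of x y s t]
 by (simp add: loc_ring_def loc_module_def)

lemmas frr_eq_iff = reg.frac_eq_iff[simplified]
lemmas frr_eqI = reg.frac_eqI[simplified]

end

lemma free_module_simps:
 "finite X ==> car (free_module R X) = X \<rightarrow>\<^sub>E car R"
 "zero (free_module R X) = (\<lambda>x\<in>X. \<zero>\<^sub>R)"
 "f \<oplus>\<^bsub>free_module R X\<^esub> g = (\<lambda>x\<in>X. f x \<oplus>\<^sub>R g x)"
 "c \<odot>\<^bsub>free_module R X\<^esub> f = (\<lambda>x\<in>X. c \<otimes>\<^sub>R f x)"
 by (auto simp: free_module_def)

lemma localization_powers:
 assumes "module R M" "f \<in> car R"
 shows "localization R M (powers R f)"
proof -
 interpret module R M by fact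
 show ?thesis
 proof
  show "powers R f \<subseteq> car R" using assms(2) by (auto simp: powers_def)
  show "\<one>\<^sub>R \<in> powers R f" unfolding powers_def by (auto intro!: exI[of _ "0 :: nat"])
  show "s \<otimes>\<^sub>R t \<in> powers R f" if st: "s \<in> powers R f" "t \<in> powers R f" for s t
  proof -
   from st obtain i j :: nat where "s = f [^]\<^bsub>R\<^esub> i" "t = f [^]\<^bsub>R\<^esub> j" by (auto simp: powers_def)
   then have "s \<otimes>\<^sub>R t = f [^]\<^bsub>R\<^esub> (i + j)" using assms(2) by (simp add: R.nat_pow_mult)
   then show ?thesis unfolding powers_def by blast
  qed
 qed
qed

text \<open>The images of \<open>m 0, ..., m (r - 1)\<close> form a basis of the localization of \<open>M\<close> at the powers of \<open>f\<close>.\<close>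

definition frac_basis :: "('r, 'z) ring_scheme => ('r, 'm) module => 'r => nat => (nat => 'm) => bool" where
 "frac_basis R M f r m \<longleftrightarrow> (\<forall>i<r. m i \<in> car M) \<and>
  (\<forall>x\<in>car M. \<exists>(N::nat) c. (\<forall>i<r. c i \<in> car R) \<and>
   f [^]\<^bsub>R\<^esub> N \<odot>\<^sub>M x = (\<Oplus>\<^sub>M i\<in>{..<r}. c i \<odot>\<^sub>M m i)) \<and>
  (\<forall>c. (\<forall>i<r. c i \<in> car R) \<and> (\<Oplus>\<^sub>M i\<in>{..<r}. c i \<odot>\<^sub>M m i) = \<zero>\<^sub>M -->
   (\<exists>N::nat. \<forall>i<r. f [^]\<^bsub>R\<^esub> N \<otimes>\<^sub>R c i = \<zero>\<^sub>R))"

context module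
begin

lemma powers_common_multiple:
 assumes "f \<in> car R" "\<forall>i<r::nat. u i \<in> powers R f"
 shows "\<exists>q. \<exists>N::nat. \<forall>i<r. q i \<in> car R \<and> f [^] N = q i \<otimes> u i"
proof -
 from assms(2) obtain n :: "nat => nat" where n: "\<And>i. i < r ==> u i = f [^] n i"
  unfolding powers_def by (auto, metis)
 \<comment> \<open>Zero is inserted so that the maximum also makes sense for
   \<open>r = 0\<close>.\<close>
 define N where "N = Max (insert 0 (n ` {..<r}))"
 have "f [^] N = f [^] (N - n i) \<otimes> u i" if "i < r" for i
 proof -
  have "n i \<le> N" using that by (auto simp: N_def)
  then show ?thesis using that assms(1) n by (simp add: R.nat_pow_mult)
 qed
 then show ?thesis using assms(1) by (intro exI[of _ "\<lambda>i. f [^] (N - n i)"] exI[of _ N]) simp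
qed

end

text \<open>The basis consists of the numerators of the images of the unit vectors. Dropping the
  denominators is harmless, since they are units in the localization.\<close>

lemma frac_basis_if_iso:
 fixes R :: "('r, 'z) ring_scheme" (structure) and M :: "('r, 'm) module"
 assumes M: "module R M" and f: "f \<in> car R"
  and iso: "mod_isomorphic (loc_ring R (powers R f))
    (free_module (loc_ring R (powers R f)) {..<r}) (loc_module R M (powers R f))"
 shows "\<exists>m. frac_basis R M f r m"
proof -
 define S where "S = powers R f"
 interpret localization R M S unfolding S_def by (rule localization_powers[OF M f])
 define Rf where "Rf = loc_ring R S"
 define F where "F = free_module Rf {..<r}"
 define L where "L = loc_module R M S"
 note Lrules = add_loc_module[folded L_def] smult_loc_module[folded L_def] zero_loc_module[folded L_def]
  carrier_loc_module[folded L_def]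
 note Rrules = add_loc_ring[folded Rf_def] mult_loc_ring[folded Rf_def] zero_loc_ring[folded Rf_def]
  carrier_loc_ring[folded Rf_def] one_loc_ring[folded Rf_def]
 have frrc: "frr a s \<in> car Rf" if "a \<in> car R" "s \<in> S" for a s using that by (auto simp: Rrules)
 have Fc: "car F = {..<r} \<rightarrow>\<^sub>E car Rf" by (simp add: F_def free_module_simps)
 obtain \<Phi> where "\<Phi> \<in> mod_iso Rf F L" using iso by (auto simp: mod_isomorphic_def Rf_def F_def L_def S_def)
 then have \<Phi>: "\<Phi> \<in> mod_hom Rf F L" "bij_betw \<Phi> (car F) (car L)" by (auto simp: mod_iso_def)
 define e where "e i = (\<lambda>j\<in>{..<r}. if j = i then frr \<one> \<one> else frr \<zero> \<one>)" for i
 have e: "e i \<in> car F" for i by (auto simp: Fc e_def S_one intro!: frrc)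
 have "\<exists>x s. x \<in> car M \<and> s \<in> S \<and> \<Phi> (e i) = fr x s" for i
  using mod_hom_closed[OF \<Phi>(1) e[of i]] by (auto simp: Lrules)
 then obtain x s where xs: "\<And>i. x i \<in> car M" "\<And>i. s i \<in> S" "\<And>i. \<Phi> (e i) = fr (x i) (s i)" by metis
 have sR: "s i \<in> car R" for i using xs S_carrier by blast
 \<comment> \<open>The coordinates are multiplied by \<open>s i\<close> to cancel the denominators
   of the images of the unit vectors; the cut at \<open>j\<close> permits an induction that adds one
   coordinate at a time.\<close>
 define v where "v c j = (\<lambda>i\<in>{..<r}. if i < j then frr (c i \<otimes> s i) \<one> else frr \<zero> \<one>)" for c j
 have v: "v c j \<in> car F" if "\<And>i. i < r ==> c i \<in> car R" for c j
  using that sR by (auto simp: Fc v_def S_one intro!: frrc)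
 have \<Phi>v: "\<Phi> (v c j) = fr (\<Oplus>\<^sub>M i\<in>{..<j}. c i \<odot>\<^sub>M x i) \<one>"
  if "j \<le> r" and c: "\<And>i. i < r ==> c i \<in> car R" for c j
  using that(1)
 proof (induction j)
  case 0
  \<comment> \<open>\<open>v c 0\<close> is the zero vector. That its image is zero is read off from
    the scalar action, by writing it as zero times itself; the module axioms over the localized ring
    are not invoked.\<close>
  have v0: "frr \<zero> \<one> \<odot>\<^sub>F v c 0 = v c 0"
   by (auto simp: v_def F_def free_module_simps Rrules S_one intro!: restrict_ext)
  have eq: "\<Phi> (v c 0) = frr \<zero> \<one> \<odot>\<^sub>L \<Phi> (v c 0)"
   by (rule mod_hom_smult[OF \<Phi>(1) frrc[OF R.zero_closed S_one] v[of c 0], unfolded v0]) (rule c)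
  have "\<Phi> (v c 0) \<in> car L" by (rule mod_hom_closed[OF \<Phi>(1) v[of c 0]]) (rule c)
  then obtain y t where yt: "y \<in> car M" "t \<in> S" "\<Phi> (v c 0) = fr y t"
   unfolding carrier_loc_module[folded L_def] by blast
  have "\<Phi> (v c 0) = fr \<zero>\<^sub>M t"
   by (rule trans[OF eq]) (use S_one yt in \<open>simp add: Lrules S_carrier\<close>)
  also have "... = fr \<zero>\<^sub>M \<one>"
   by (rule frac_eqI) (use S_one yt(2) S_carrier in simp_all)
  finally show ?case by (simp add: M.finsum_empty)
 next
  case (Suc j)
  then have j: "j < r" by simp
  have "v c (Suc j) = v c j \<oplus>\<^sub>F (frr (c j \<otimes> s j) \<one> \<odot>\<^sub>F e j)"
   using j c sR
   by (auto simp: v_def e_def F_def free_module_simps Rrules S_one less_Suc_eq intro!: restrict_ext)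
  moreover have ej: "frr (c j \<otimes> s j) \<one> \<odot>\<^sub>F e j \<in> car F"
   using c[OF j] sR[of j] S_one S_mult
   by (auto simp: Fc F_def free_module_simps e_def Rrules(2) intro!: frrc)
  ultimately have "\<Phi> (v c (Suc j)) = \<Phi> (v c j) \<oplus>\<^sub>L \<Phi> (frr (c j \<otimes> s j) \<one> \<odot>\<^sub>F e j)"
   using mod_hom_add[OF \<Phi>(1) v[of c j, OF c] ej] by simp
  also have "\<Phi> (frr (c j \<otimes> s j) \<one> \<odot>\<^sub>F e j) = frr (c j \<otimes> s j) \<one> \<odot>\<^sub>L \<Phi> (e j)"
   by (rule mod_hom_smult[OF \<Phi>(1) frrc e]) (use c[OF j] sR[of j] S_one in auto)
  also have "frr (c j \<otimes> s j) \<one> \<odot>\<^sub>L \<Phi> (e j) = fr (c j \<odot>\<^sub>M x j) \<one>"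
   using xs[of j] sR[of j] c[OF j] S_one
   by (simp add: Lrules, intro frac_eqI) (simp_all add: R.m_comm flip: smult_assoc1)
  also have "\<Phi> (v c j) = fr (\<Oplus>\<^sub>M i\<in>{..<j}. c i \<odot>\<^sub>M x i) \<one>" using Suc by simp
  also have "fr (\<Oplus>\<^sub>M i\<in>{..<j}. c i \<odot>\<^sub>M x i) \<one> \<oplus>\<^sub>L fr (c j \<odot>\<^sub>M x j) \<one>
   = fr (\<Oplus>\<^sub>M i\<in>{..<Suc j}. c i \<odot>\<^sub>M x i) \<one>"
   using j c xs S_one
   by (simp add: Lrules M.finsum_closed Pi_def lessThan_Suc M.finsum_insert M.a_comm)
  finally show ?case .
 qed
 have "frac_basis R M f r x"
  unfolding frac_basis_def
 proof (intro conjI allI ballI impI)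
  show "x i \<in> car M" for i by (rule xs)
 next
  fix y assume y: "y \<in> car M"
  then have "fr y \<one> \<in> car L" using S_one unfolding carrier_loc_module[folded L_def] by blast
  then have "fr y \<one> \<in> \<Phi> ` car F" by (simp only: bij_betw_imp_surj_on[OF \<Phi>(2)])
  then obtain g where g: "fr y \<one> = \<Phi> g" "g \<in> car F" by (rule imageE)
  have "\<exists>a u. a \<in> car R \<and> u \<in> S \<and> g i = frr a u" if "i < r" for i
  proof -
   have "g i \<in> car Rf" using g(2) that by (auto simp: Fc)
   then show ?thesis unfolding Rrules(4) by blast
  qed
  then obtain a u where au: "\<And>i. i < r ==> a i \<in> car R" "\<And>i. i < r ==> u i \<in> S"
   "\<And>i. i < r ==> g i = frr (a i) (u i)" by metis
  have "\<forall>i<r. s i \<otimes> u i \<in> powers R f"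
   using au xs S_mult by (simp add: S_def)
  from powers_common_multiple[OF f this]
  obtain q and N :: nat where qN: "\<forall>i<r. q i \<in> car R \<and> f [^] N = q i \<otimes> (s i \<otimes> u i)"
   by (elim exE)
  note q = qN[rule_format, THEN conjunct1] qN[rule_format, THEN conjunct2]
  have fN: "f [^] N \<in> car R" "f [^] N \<in> S" using f by (auto simp: S_def powers_def)
  \<comment> \<open>As \<open>f^N = q i s i u i\<close>, the coordinate \<open>a i / u i\<close>
    times \<open>f^N\<close> equals \<open>q i a i s i\<close>, which is the shape that
    \<open>v\<close> expects.\<close>
  define c where "c i = q i \<otimes> a i" for i
  have c: "c i \<in> car R" if "i < r" for i using that q au by (simp add: c_def)
  have "v c r = frr (f [^] N) \<one> \<odot>\<^sub>F g"
  proof -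
   have "frr (c i \<otimes> s i) \<one> = frr (f [^] N) \<one> \<otimes>\<^bsub>Rf\<^esub> g i" if i: "i < r" for i
    using i au[OF i] q[OF i] sR[of i] S_carrier[OF au(2)[OF i]] S_one fN
    by (simp only: Rrules, intro frr_eqI) (simp_all add: c_def R.m_ac)
   then show ?thesis by (auto simp: v_def F_def free_module_simps intro!: restrict_ext)
  qed
  then have "\<Phi> (v c r) = frr (f [^] N) \<one> \<odot>\<^sub>L fr y \<one>"
   using mod_hom_smult[OF \<Phi>(1) frrc[OF fN(1) S_one] g(2)] by (simp only: g(1))
  also have "... = fr (f [^] N \<odot>\<^sub>M y) \<one>" using fN S_one y by (simp add: Lrules)
  finally have "fr (f [^] N \<odot>\<^sub>M y) \<one> = fr (\<Oplus>\<^sub>M i\<in>{..<r}. c i \<odot>\<^sub>M x i) \<one>"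
   using \<Phi>v[OF order_refl c] by simp
  then obtain w where w: "w \<in> S" "w \<odot>\<^sub>M (f [^] N \<odot>\<^sub>M y) = w \<odot>\<^sub>M (\<Oplus>\<^sub>M i\<in>{..<r}. c i \<odot>\<^sub>M x i)"
   using fN y c xs S_one
   by (subst (asm) frac_eq_iff) (auto simp: M.finsum_closed Pi_def)
  then obtain K :: nat where K: "w = f [^] K" by (auto simp: S_def powers_def)
  have "f [^] (K + N) \<odot>\<^sub>M y = (\<Oplus>\<^sub>M i\<in>{..<r}. (w \<otimes> c i) \<odot>\<^sub>M x i)"
  proof -
   have "f [^] (K + N) \<odot>\<^sub>M y = w \<odot>\<^sub>M (f [^] N \<odot>\<^sub>M y)"
    using f y by (simp add: K smult_assoc1 flip: R.nat_pow_mult)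
   also have "... = (\<Oplus>\<^sub>M i\<in>{..<r}. w \<odot>\<^sub>M (c i \<odot>\<^sub>M x i))"
    unfolding w(2) using c xs S_carrier[OF w(1)] by (intro finsum_smult_ldistr) auto
   also have "... = (\<Oplus>\<^sub>M i\<in>{..<r}. (w \<otimes> c i) \<odot>\<^sub>M x i)"
    using c xs S_carrier[OF w(1)] by (intro M.finsum_cong') (auto simp: smult_assoc1)
   finally show ?thesis .
  qed
  then show "\<exists>(N::nat) c. (\<forall>i<r. c i \<in> car R) \<and>
   f [^] N \<odot>\<^sub>M y = (\<Oplus>\<^sub>M i\<in>{..<r}. c i \<odot>\<^sub>M x i)"
   using c S_carrier[OF w(1)] by (intro exI[of _ "K + N"] exI[of _ "\<lambda>i. w \<otimes> c i"]) auto
 next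
  fix c assume "(\<forall>i<r. c i \<in> car R) \<and> (\<Oplus>\<^sub>M i\<in>{..<r}. c i \<odot>\<^sub>M x i) = \<zero>\<^sub>M"
  then have c: "\<And>i. i < r ==> c i \<in> car R" and c0: "(\<Oplus>\<^sub>M i\<in>{..<r}. c i \<odot>\<^sub>M x i) = \<zero>\<^sub>M" by auto
  have "\<Phi> (v c r) = \<Phi> (v c 0)"
   using \<Phi>v[OF order_refl, of c] \<Phi>v[of 0 c] c c0 by (simp add: M.finsum_empty)
  then have "v c r = v c 0" using \<Phi>(2) v[OF c] by (auto simp: bij_betw_def inj_on_def)
  have "\<exists>u\<in>S. u \<otimes> c i = \<zero>" if i: "i < r" for i
  proof -
   have "frr (c i \<otimes> s i) \<one> = frr \<zero> \<one>" using fun_cong[OF \<open>v c r = v c 0\<close>, of i] i by (simp add: v_def)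
   then obtain u where u: "u \<in> S" "u \<otimes> (c i \<otimes> s i) = \<zero>"
    using c[OF i] sR[of i] S_one by (auto simp: frr_eq_iff S_carrier)
   then have "(u \<otimes> s i) \<otimes> c i = \<zero>" using S_carrier[OF u(1)] sR[of i] c[OF i] by (simp add: R.m_ac)
   then show ?thesis using S_mult[OF u(1) xs(2)[of i]] by blast
  qed
  then obtain u where u: "\<And>i. i < r ==> u i \<in> S" "\<And>i. i < r ==> u i \<otimes> c i = \<zero>" by metis
  have "\<forall>i<r. u i \<in> powers R f" using u(1) by (simp add: S_def)
  from powers_common_multiple[OF f this]
  obtain q and N :: nat where qN: "\<forall>i<r. q i \<in> car R \<and> f [^] N = q i \<otimes> u i"
   by (elim exE)
  note q = qN[rule_format, THEN conjunct1] qN[rule_format, THEN conjunct2]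
  have "f [^] N \<otimes> c i = \<zero>" if i: "i < r" for i
   using q[OF i] u[OF i] c[OF i] S_carrier[OF u(1)[OF i]] by (simp add: R.m_assoc)
  then show "\<exists>N::nat. \<forall>i<r. f [^] N \<otimes> c i = \<zero>" by blast
 qed
 then show ?thesis by blast
qed

text \<open>The isomorphism writes a vector of fractions over a common denominator and sends it to
  the combination of the \<open>m i\<close> with the numerators, over the same denominator. That
  this is well defined and that it is injective are the two directions of the single equivalence
  \<open>eq_iff\<close>.\<close>

lemma iso_if_frac_basis:
 fixes R :: "('r, 'z) ring_scheme" (structure) and M :: "('r, 'm) module"
 assumes M: "module R M" and f: "f \<in> car R" and m: "frac_basis R M f r m"
 shows "mod_isomorphic (loc_ring R (powers R f))
    (free_module (loc_ring R (powers R f)) {..<r}) (loc_module R M (powers R f))"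
proof -
 define S where "S = powers R f"
 interpret localization R M S unfolding S_def by (rule localization_powers[OF M f])
 define Rf where "Rf = loc_ring R S"
 define F where "F = free_module Rf {..<r}"
 define L where "L = loc_module R M S"
 note Lrules = add_loc_module[folded L_def] smult_loc_module[folded L_def] zero_loc_module[folded L_def]
  carrier_loc_module[folded L_def]
 note Rrules = add_loc_ring[folded Rf_def] mult_loc_ring[folded Rf_def] zero_loc_ring[folded Rf_def]
  carrier_loc_ring[folded Rf_def] one_loc_ring[folded Rf_def]
 have mc: "\<And>i. i < r ==> m i \<in> car M" using m by (simp add: frac_basis_def)
 have frrc: "frr a s \<in> car Rf" if "a \<in> car R" "s \<in> S" for a s using that by (auto simp: Rrules)
 have Fc: "car F = {..<r} \<rightarrow>\<^sub>E car Rf" by (simp add: F_def free_module_simps)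
 define lc where "lc c = (\<Oplus>\<^sub>M i\<in>{..<r}. c i \<odot>\<^sub>M m i)" for c
 have lc_closed: "lc c \<in> car M" if "\<forall>i<r. c i \<in> car R" for c
  using that mc by (auto simp: lc_def intro!: M.finsum_closed)
 have lc_add: "lc (\<lambda>i. c i \<oplus> d i) = lc c \<oplus>\<^sub>M lc d"
  if "\<forall>i<r. c i \<in> car R" "\<forall>i<r. d i \<in> car R" for c d
 proof -
  have "lc (\<lambda>i. c i \<oplus> d i) = (\<Oplus>\<^sub>M i\<in>{..<r}. c i \<odot>\<^sub>M m i \<oplus>\<^sub>M d i \<odot>\<^sub>M m i)"
   unfolding lc_def using that mc by (intro M.finsum_cong') (auto simp: smult_l_distr)
  also have "... = lc c \<oplus>\<^sub>M lc d"
   unfolding lc_def using that mc by (intro M.finsum_addf) auto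
  finally show ?thesis .
 qed
 have lc_smult: "lc (\<lambda>i. a \<otimes> c i) = a \<odot>\<^sub>M lc c" if "\<forall>i<r. c i \<in> car R" "a \<in> car R" for a c
  unfolding lc_def using that mc
  by (subst finsum_smult_ldistr) (auto simp: smult_assoc1 intro!: M.finsum_cong')
 define rep where "rep g c q \<longleftrightarrow> (\<forall>i<r. c i \<in> car R) \<and> q \<in> S \<and> (\<forall>i<r. g i = frr (c i) q)" for g c q
 have rep_ex: "\<exists>c q. rep g c q" if g: "g \<in> car F" for g
 proof -
  have "\<exists>a u. a \<in> car R \<and> u \<in> S \<and> g i = frr a u" if "i < r" for i
  proof -
   have "g i \<in> car Rf" using g that by (auto simp: Fc)
   then show ?thesis unfolding Rrules(4) by blast
  qed
  then obtain a u where au: "\<And>i. i < r ==> a i \<in> car R" "\<And>i. i < r ==> u i \<in> S"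
   "\<And>i. i < r ==> g i = frr (a i) (u i)" by metis
  have "\<forall>i<r. u i \<in> powers R f" using au(2) by (simp add: S_def)
  from powers_common_multiple[OF f this]
  obtain q and N :: nat where qN: "\<forall>i<r. q i \<in> car R \<and> f [^] N = q i \<otimes> u i"
   by (elim exE)
  note q = qN[rule_format, THEN conjunct1] qN[rule_format, THEN conjunct2]
  have fN: "f [^] N \<in> car R" "f [^] N \<in> S" using f by (auto simp: S_def powers_def)
  have "frr (a i) (u i) = frr (q i \<otimes> a i) (f [^] N)" if i: "i < r" for i
   using i au[OF i] q[OF i] S_carrier[OF au(2)[OF i]] fN by (intro frr_eqI) (auto simp: R.m_ac)
  then show ?thesis
   using au q fN by (intro exI[of _ "\<lambda>i. q i \<otimes> a i"] exI[of _ "f [^] N"]) (auto simp: rep_def)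
 qed
 have eq_iff: "fr (lc c) q = fr (lc d) w \<longleftrightarrow> (\<forall>i<r. frr (c i) q = frr (d i) w)"
  if c: "\<forall>i<r. c i \<in> car R" "q \<in> S" and d: "\<forall>i<r. d i \<in> car R" "w \<in> S" for c d q w
 proof
  note qw = S_carrier[OF c(2)] S_carrier[OF d(2)]
  assume "\<forall>i<r. frr (c i) q = frr (d i) w"
  then have "\<exists>u\<in>S. u \<otimes> (w \<otimes> c i) = u \<otimes> (q \<otimes> d i)" if "i < r" for i
   using that c d by (auto simp: frr_eq_iff)
  then obtain u where u: "\<And>i. i < r ==> u i \<in> S" "\<And>i. i < r ==> u i \<otimes> (w \<otimes> c i) = u i \<otimes> (q \<otimes> d i)" by metis
  have "\<forall>i<r. u i \<in> powers R f" using u(1) by (simp add: S_def)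
  from powers_common_multiple[OF f this]
  obtain p and N :: nat where qN: "\<forall>i<r. p i \<in> car R \<and> f [^] N = p i \<otimes> u i"
   by (elim exE)
  note p = qN[rule_format, THEN conjunct1] qN[rule_format, THEN conjunct2]
  have fN: "f [^] N \<in> car R" "f [^] N \<in> S" using f by (auto simp: S_def powers_def)
  have "f [^] N \<otimes> (w \<otimes> c i) = f [^] N \<otimes> (q \<otimes> d i)" if i: "i < r" for i
   using p[OF i] u[OF i] i c d qw S_carrier[OF u(1)[OF i]] by (simp add: R.m_assoc)
  then have "lc (\<lambda>i. f [^] N \<otimes> (w \<otimes> c i)) = lc (\<lambda>i. f [^] N \<otimes> (q \<otimes> d i))"
   unfolding lc_def using c d qw fN mc by (intro M.finsum_cong') auto
  then have "f [^] N \<odot>\<^sub>M (w \<odot>\<^sub>M lc c) = f [^] N \<odot>\<^sub>M (q \<odot>\<^sub>M lc d)"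
   using c d qw fN by (simp add: lc_smult)
  then show "fr (lc c) q = fr (lc d) w"
   using c d fN lc_closed by (auto simp: frac_eq_iff)
 next
  note qw = S_carrier[OF c(2)] S_carrier[OF d(2)]
  assume "fr (lc c) q = fr (lc d) w"
  then obtain u where u: "u \<in> S" "u \<odot>\<^sub>M (w \<odot>\<^sub>M lc c) = u \<odot>\<^sub>M (q \<odot>\<^sub>M lc d)"
   using c d lc_closed by (auto simp: frac_eq_iff)
  note uR = S_carrier[OF u(1)]
  \<comment> \<open>The coefficients of the difference of both sides. Subtraction is written as a
    sum with the scalar minus one, so that \<open>lc_add\<close> and \<open>lc_smult\<close>
    suffice.\<close>
  define z where "z i = u \<otimes> (w \<otimes> c i) \<oplus> (\<ominus> \<one>) \<otimes> (u \<otimes> (q \<otimes> d i))" for i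
  have z: "\<forall>i<r. z i \<in> car R" using c d qw uR by (simp add: z_def)
  have "lc z = u \<odot>\<^sub>M (w \<odot>\<^sub>M lc c) \<oplus>\<^sub>M (\<ominus> \<one>) \<odot>\<^sub>M (u \<odot>\<^sub>M (q \<odot>\<^sub>M lc d))"
   unfolding z_def using c d qw uR by (simp add: lc_add lc_smult)
  also have "... = \<zero>\<^sub>M" unfolding u(2) using c d qw uR lc_closed by (simp add: smult_l_minus M.r_neg)
  finally obtain N :: nat where N: "\<forall>i<r. f [^] N \<otimes> z i = \<zero>"
   using m z unfolding frac_basis_def lc_def by blast
  have fN: "f [^] N \<in> car R" "f [^] N \<in> S" using f by (auto simp: S_def powers_def)
  show "\<forall>i<r. frr (c i) q = frr (d i) w"
  proof (intro allI impI)
   fix i assume i: "i < r"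
   then have "f [^] N \<otimes> (u \<otimes> (w \<otimes> c i)) \<ominus> f [^] N \<otimes> (u \<otimes> (q \<otimes> d i)) = \<zero>"
    using N c d qw uR fN by (simp add: z_def R.r_distr R.l_minus R.r_minus a_minus_def)
   then have "(f [^] N \<otimes> u) \<otimes> (w \<otimes> c i) = (f [^] N \<otimes> u) \<otimes> (q \<otimes> d i)"
    using i c d qw uR fN by (subst (asm) R.right_minus_eq) (auto simp: R.m_assoc)
   then show "frr (c i) q = frr (d i) w"
    using i c d S_mult[OF fN(2) u(1)] by (auto simp: frr_eq_iff)
  qed
 qed
 define \<Phi> where "\<Phi> g = (let (c, q) = (SOME (c, q). rep g c q) in fr (lc c) q)" for g
 have \<Phi>: "\<Phi> g = fr (lc c) q" if g: "rep g c q" for g c q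
 proof -
  obtain d w where dw: "(SOME (c, q). rep g c q) = (d, w)" by fastforce
  have "rep g d w" using someI[of "\<lambda>(c, q). rep g c q" "(c, q)"] g dw by simp
  then have "fr (lc d) w = fr (lc c) q" using g eq_iff[of d w c q] by (simp add: rep_def)
  moreover have "\<Phi> g = fr (lc d) w" unfolding \<Phi>_def dw by simp
  ultimately show ?thesis by simp
 qed
 have \<Phi>_closed: "\<Phi> g \<in> car L" if g: "rep g c q" for g c q
  unfolding \<Phi>[OF g] using g lc_closed by (auto simp: Lrules rep_def)
 have "\<Phi> \<in> mod_hom Rf F L"
 proof (rule mod_homI)
  fix g assume "g \<in> car F"
  then obtain c q where "rep g c q" using rep_ex by blast
  then show "\<Phi> g \<in> car L" by (rule \<Phi>_closed)
 next
  fix g h assume gh: "g \<in> car F" "h \<in> car F"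
  then obtain c q d w where r: "rep g c q" "rep h d w" using rep_ex by metis
  then have qw: "q \<in> car R" "w \<in> car R" using S_carrier by (auto simp: rep_def)
  have r': "rep (g \<oplus>\<^sub>F h) (\<lambda>i. w \<otimes> c i \<oplus> q \<otimes> d i) (q \<otimes> w)"
   using r qw S_mult by (auto simp: rep_def F_def free_module_simps Rrules)
  then show "\<Phi> (g \<oplus>\<^sub>F h) = \<Phi> g \<oplus>\<^sub>L \<Phi> h"
   unfolding \<Phi>[OF r(1)] \<Phi>[OF r(2)] \<Phi>[OF r']
   using r qw lc_closed by (simp add: rep_def Lrules lc_add lc_smult)
 next
  fix a g assume "a \<in> car Rf" "g \<in> car F"
  then obtain b s c q where r: "b \<in> car R" "s \<in> S" "a = frr b s" "rep g c q"
   using rep_ex by (force simp: Rrules)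
  then have r': "rep (a \<odot>\<^sub>F g) (\<lambda>i. b \<otimes> c i) (s \<otimes> q)"
   using S_mult by (auto simp: rep_def F_def free_module_simps Rrules)
  then show "\<Phi> (a \<odot>\<^sub>F g) = a \<odot>\<^sub>L \<Phi> g"
   unfolding \<Phi>[OF r(4)] \<Phi>[OF r']
   using r lc_closed by (simp add: rep_def Lrules lc_smult)
 qed
 moreover have "bij_betw \<Phi> (car F) (car L)"
 proof (rule bij_betw_imageI)
  show "inj_on \<Phi> (car F)"
  proof (rule inj_onI)
   fix g h assume gh: "g \<in> car F" "h \<in> car F" "\<Phi> g = \<Phi> h"
   then obtain c q d w where r: "rep g c q" "rep h d w" using rep_ex by metis
   then have "\<forall>i<r. g i = h i" using gh(3)[unfolded \<Phi>[OF r(1)] \<Phi>[OF r(2)]] eq_iff[of c q d w] by (simp add: rep_def)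
   then show "g = h" using gh(1,2) by (auto simp: Fc intro: PiE_ext)
  qed
  show "\<Phi> ` car F = car L"
  proof (intro equalityI subsetI)
   fix X assume "X \<in> \<Phi> ` car F"
   then obtain c q g where "rep g c q" "X = \<Phi> g" using rep_ex by blast
   then show "X \<in> car L" using \<Phi>_closed by blast
  next
   fix X assume "X \<in> car L"
   then obtain x s where x: "x \<in> car M" "s \<in> S" "X = fr x s" by (auto simp: Lrules)
   then obtain N :: nat and c where c: "\<forall>i<r. c i \<in> car R" "f [^] N \<odot>\<^sub>M x = lc c"
    using m unfolding frac_basis_def lc_def by blast
   have fN: "f [^] N \<in> car R" "f [^] N \<in> S" using f by (auto simp: S_def powers_def)
   define g where "g = (\<lambda>i\<in>{..<r}. frr (c i) (f [^] N \<otimes> s))"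
   have r: "rep g c (f [^] N \<otimes> s)" using c fN x S_mult by (auto simp: rep_def g_def)
   have "X = fr (lc c) (f [^] N \<otimes> s)"
    unfolding x(3) using x fN S_carrier[OF x(2)] lc_closed[OF c(1)] S_mult
    by (intro frac_eqI) (simp_all add: R.m_comm flip: c(2) smult_assoc1)
   moreover have "g \<in> car F" using c fN x S_mult by (auto simp: Fc g_def intro!: frrc)
   ultimately show "X \<in> \<Phi> ` car F" using \<Phi>[OF r] by blast
  qed
 qed
 ultimately show ?thesis
  unfolding mod_isomorphic_def mod_iso_def Rf_def F_def L_def S_def by blast
qed

text \<open>All later arguments use local freeness through this form, in which elements of the
  module and powers of \<open>f\<close> replace fractions.\<close>

lemma locally_free_rank_iff:
 fixes M :: "('r, 'm) module"
 shows "locally_free_rank R M r \<longleftrightarrow> module R M \<and>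
  (\<forall>p. primeideal p R --> (\<exists>f \<in> car R - p. \<exists>m. frac_basis R M f r m))"
 unfolding locally_free_rank_def using frac_basis_if_iso iso_if_frac_basis by (metis DiffD1)

section \<open>Local bases\<close>

text \<open>\<open>finsum\<close> reads only carrier, zero and addition, so a sum may be moved
  between structures that share these.\<close>

lemma finsum_cong_structure:
 assumes "car M = car N" "zero M = zero N" "add M = add N"
 shows "finsum M = finsum N"
 using assms by (auto simp: finsum_def finprod_def intro!: ext)

lemma finsum_regular [simp]: "finsum (regular_module R) = finsum R"
 by (rule finsum_cong_structure) simp_all

lemma finsum_restrict_scalars [simp]: "finsum (restrict_scalars A N) = finsum N"
 by (rule finsum_cong_structure) simp_all

lemma (in primeideal) nat_pow_notin:
 assumes "f \<in> car R" "f \<notin> I"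
 shows "f [^] (N::nat) \<notin> I"
proof (induction N)
 case 0
 then show ?case using I_notcarr one_imp_carrier by auto
next
 case (Suc N)
 then show ?case using I_prime[of "f [^] N" f] assms by auto
qed

text \<open>
 \<open>f\<close> times the identity factors through the free module of rank \<open>r\<close>, as does \<open>f\<close> times the identity
 of the free module through \<open>M\<close>: a denominator-free form of a basis of the localization at \<open>f\<close>.
\<close>

definition local_basis :: "('r, 'z) ring_scheme => ('r, 'm) module => 'r => nat => (nat => 'm) => (nat => 'm => 'r) => bool"
 where "local_basis R M f r m \<mu> \<longleftrightarrow> f \<in> car R \<and>
  (\<forall>i<r. m i \<in> car M) \<and> (\<forall>i<r. \<mu> i \<in> lin R M) \<and>
  (\<forall>x\<in>car M. f \<odot>\<^sub>M x = (\<Oplus>\<^sub>M i\<in>{..<r}. \<mu> i x \<odot>\<^sub>M m i)) \<and>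
  (\<forall>i<r. \<forall>j<r. \<mu> i (m j) = (if i = j then f else \<zero>\<^sub>R))"

lemma local_basisD:
 assumes "local_basis R M f r m \<mu>"
 shows "f \<in> car R" "i < r ==> m i \<in> car M" "i < r ==> \<mu> i \<in> lin R M"
  "x \<in> car M ==> f \<odot>\<^sub>M x = (\<Oplus>\<^sub>M i\<in>{..<r}. \<mu> i x \<odot>\<^sub>M m i)"
  "i < r ==> j < r ==> \<mu> i (m j) = (if i = j then f else \<zero>\<^sub>R)"
  "i < r ==> x \<in> car M ==> \<mu> i x \<in> car R"
 using assms mod_hom_closed[of "\<mu> i" R M "regular_module R" x] by (auto simp: local_basis_def)

lemma functional_finsum:
 assumes "module R M" "\<mu> \<in> lin R M" "finite I" "g \<in> I \<rightarrow> car M"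
 shows "\<mu> (finsum M g I) = (\<Oplus>\<^sub>R i\<in>I. \<mu> (g i))"
 using mod_hom_finsum[OF assms(1) module_regular assms(2-4)] assms(1) by (simp add: module_def)

lemma functional_lincomb:
 assumes "module R M" "\<mu> \<in> lin R M" "finite I"
  "m \<in> I \<rightarrow> car M" "c \<in> I \<rightarrow> car R"
 shows "\<mu> (\<Oplus>\<^sub>M i\<in>I. c i \<odot>\<^sub>M m i) = (\<Oplus>\<^sub>R i\<in>I. c i \<otimes>\<^sub>R \<mu> (m i))"
proof -
 interpret M: module R M by fact
 have "\<mu> (\<Oplus>\<^sub>M i\<in>I. c i \<odot>\<^sub>M m i) = (\<Oplus>\<^sub>R i\<in>I. \<mu> (c i \<odot>\<^sub>M m i))"
  by (rule functional_finsum[OF assms(1-3)]) (use assms in auto)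
 also have "... = (\<Oplus>\<^sub>R i\<in>I. c i \<otimes>\<^sub>R \<mu> (m i))"
  using assms mod_hom_smult[OF assms(2)] mod_hom_closed[OF assms(2)] by (intro M.R.finsum_cong') (auto simp: Pi_def)
 finally show ?thesis .
qed

lemma (in cring) finsum_delta_mult:
 assumes "finite I" "j \<in> I" "c \<in> I \<rightarrow> car R" "f \<in> car R"
 shows "(\<Oplus>i\<in>I. c i \<otimes> (if j = i then f else \<zero>)) = c j \<otimes> f"
proof -
 have "(\<Oplus>i\<in>I. c i \<otimes> (if j = i then f else \<zero>)) = (\<Oplus>i\<in>I. if i = j then c j \<otimes> f else \<zero>)"
  using assms by (intro finsum_cong') (auto simp: Pi_def)
 then show ?thesis using assms by (simp add: finsum_delta Pi_def)
qed

text \<open>The exponent one suffices in both clauses; in the second, applying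
  \<open>\<mu> j\<close> to the vanishing combination gives \<open>c j f = 0\<close>.\<close>

lemma frac_basis_if_local_basis:
 assumes M: "module R M" and lb: "local_basis R M f r m \<mu>"
 shows "frac_basis R M f r m"
proof -
 interpret M: module R M by fact
 note b = local_basisD[OF lb]
 show ?thesis
  unfolding frac_basis_def
 proof (intro conjI ballI allI impI)
  fix x assume x: "x \<in> car M"
  have "f [^]\<^bsub>R\<^esub> (1::nat) \<odot>\<^sub>M x = (\<Oplus>\<^sub>M i\<in>{..<r}. \<mu> i x \<odot>\<^sub>M m i)" using b x by simp
  with b(6)[OF _ x] show "\<exists>(N::nat) c. (\<forall>i<r. c i \<in> car R) \<and>
   f [^]\<^bsub>R\<^esub> N \<odot>\<^sub>M x = (\<Oplus>\<^sub>M i\<in>{..<r}. c i \<odot>\<^sub>M m i)"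
   by (intro exI[of _ 1] exI[of _ "\<lambda>i. \<mu> i x"]) auto
 next
  fix c assume c: "(\<forall>i<r. c i \<in> car R) \<and> (\<Oplus>\<^sub>M i\<in>{..<r}. c i \<odot>\<^sub>M m i) = \<zero>\<^sub>M"
  have "f [^]\<^bsub>R\<^esub> (1::nat) \<otimes>\<^sub>R c j = \<zero>\<^sub>R" if j: "j < r" for j
  proof -
   have "\<zero>\<^sub>R = \<mu> j (\<Oplus>\<^sub>M i\<in>{..<r}. c i \<odot>\<^sub>M m i)"
    using c mod_hom_zero[OF M module_regular[OF M.R.is_cring] b(3)[OF j]] by simp
   also have "... = (\<Oplus>\<^sub>R i\<in>{..<r}. c i \<otimes>\<^sub>R \<mu> j (m i))"
    by (rule functional_lincomb[OF M b(3)[OF j]]) (use b c in auto)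
   also have "... = (\<Oplus>\<^sub>R i\<in>{..<r}. c i \<otimes>\<^sub>R (if j = i then f else \<zero>\<^sub>R))"
    using b c j by (intro M.R.finsum_cong') auto
   also have "... = c j \<otimes>\<^sub>R f"
    by (rule M.R.finsum_delta_mult) (use b c j in auto)
   finally show ?thesis using b(1) c j by (simp add: M.R.m_comm)
  qed
  then show "\<exists>N::nat. \<forall>i<r. f [^]\<^bsub>R\<^esub> N \<otimes>\<^sub>R c i = \<zero>\<^sub>R" by blast
 qed (use b in auto)
qed

text \<open>Take the union of the local bases over a finite cover. Expressing generation by
  submodules avoids computing coefficients: for a submodule \<open>H\<close> that contains the
  union, the scalars that send \<open>x\<close> into \<open>H\<close> form an ideal that no prime
  contains.\<close>

lemma finitely_generated_if_locally_free:
 fixes R :: "('r, 'z) ring_scheme" (structure) and M :: "('r, 'm) module"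
 assumes "locally_free_rank R M r"
 shows "\<exists>G. finite G \<and> G \<subseteq> car M \<and> (\<forall>H. submodule H R M --> G \<subseteq> H --> car M \<subseteq> H)"
proof -
 have M: "module R M" and loc: "\<forall>p. primeideal p R --> (\<exists>f \<in> car R - p. \<exists>m. frac_basis R M f r m)"
  using assms by (auto simp: locally_free_rank_iff)
 interpret module R M by (rule M)
 from R.partition_of_unity[OF loc] obtain n :: nat and b c where
  *: "\<forall>i<n. b i \<in> car R \<and> c i \<in> car R \<and> (\<exists>m. frac_basis R M (c i) r m)"
  and one: "(\<Oplus>i\<in>{..<n}. b i \<otimes> c i) = \<one>" by (elim exE conjE)
 then have bc: "\<And>i. i < n ==> b i \<in> car R" "\<And>i. i < n ==> c i \<in> car R"
  "\<And>i. i < n ==> \<exists>m. frac_basis R M (c i) r m" "(\<Oplus>i\<in>{..<n}. b i \<otimes> c i) = \<one>" by auto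
 obtain m where m: "\<And>j. j < n ==> frac_basis R M (c j) r (m j)" using bc(3) by metis
 define G where "G = (\<Union>j<n. m j ` {..<r})"
 have "car M \<subseteq> H" if H: "submodule H R M" "G \<subseteq> H" for H
 proof
  fix x assume x: "x \<in> car M"
  define J where "J = {a \<in> car R. a \<odot>\<^sub>M x \<in> H}"
  note Hc = submodule_closed[OF H(1)]
  have "ideal J R"
  proof (rule idealI)
   show "subgroup J (add_monoid R)"
    by (rule R.add.subgroupI) (use x Hc in \<open>auto simp: J_def smult_l_distr smult_l_minus\<close>)
   fix a y assume "a \<in> J" "y \<in> car R"
   then show "y \<otimes> a \<in> J" "a \<otimes> y \<in> J"
    using x Hc(6)[of y "a \<odot>\<^sub>M x"] smult_lcomm[of a y x] by (auto simp: J_def smult_assoc1)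
  qed (rule R.ring_axioms)
  moreover have "\<exists>f\<in>J. f \<notin> p" if p: "primeideal p R" for p
  proof -
   interpret p: primeideal p R by fact
   have "\<exists>j<n. c j \<notin> p"
   proof (rule ccontr)
    assume "\<not> ?thesis"
    then have "(\<lambda>i. b i \<otimes> c i) \<in> {..<n} \<rightarrow> p" using bc by (auto intro: p.I_l_closed)
    then have "finsum (regular_module R) (\<lambda>i. b i \<otimes> c i) {..<n} \<in> p"
     by (rule module.submodule_finsum[OF module_regular[OF R.is_cring]
      submodule_of_ideal[OF R.is_cring p.is_ideal]])
    then have "\<one> \<in> p" using bc(4) by simp
    then show False using p.one_imp_carrier p.I_notcarr by auto
   qed
   then obtain j where j: "j < n" "c j \<notin> p" by blast
   obtain N :: nat and d where d: "\<forall>i<r. d i \<in> car R"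
    "c j [^] N \<odot>\<^sub>M x = (\<Oplus>\<^sub>M i\<in>{..<r}. d i \<odot>\<^sub>M m j i)"
    using m[OF j(1)] x unfolding frac_basis_def by blast
   have "m j i \<in> H" if "i < r" for i using that j H(2) by (auto simp: G_def)
   then have "(\<lambda>i. d i \<odot>\<^sub>M m j i) \<in> {..<r} \<rightarrow> H" using d(1) Hc(6) by auto
   then have "c j [^] N \<odot>\<^sub>M x \<in> H" unfolding d(2) by (rule submodule_finsum[OF H(1)])
   then have "c j [^] N \<in> J" using bc(2)[OF j(1)] by (simp add: J_def)
   then show ?thesis using p.nat_pow_notin[OF bc(2)[OF j(1)] j(2)] by blast
  qed
  ultimately have "\<one> \<in> J" by (rule R.one_in_ideal_if_local)
  then show "x \<in> H" using x by (simp add: J_def)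
 qed
 moreover have "G \<subseteq> car M" using m by (auto simp: G_def frac_basis_def)
 moreover have "finite G" by (simp add: G_def)
 ultimately show ?thesis by blast
qed

text \<open>The annihilators of the powers of \<open>f\<close> form an ascending chain of ideals,
  which becomes stationary. Here the Noetherian hypothesis enters.\<close>

lemma torsion_bounded:
 fixes R (structure)
 assumes "cring R" "noetherian_ring R" "f \<in> car R"
 shows "\<exists>T::nat. \<forall>a\<in>car R. \<forall>N::nat. f [^] N \<otimes> a = \<zero> --> f [^] T \<otimes> a = \<zero>"
proof -
 interpret cring R by fact
 interpret N: noetherian_ring R by fact
 define I where "I N = {a \<in> car R. f [^] (N::nat) \<otimes> a = \<zero>}" for N
 have mono: "I N \<subseteq> I K" if "N \<le> K" for N K
 proof
  fix a assume a: "a \<in> I N"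
  have "f [^] K = f [^] (K - N) \<otimes> f [^] N" using that assms(3) by (simp add: nat_pow_mult)
  then show "a \<in> I K" using a assms(3) by (simp add: I_def m_assoc)
 qed
 have ideal: "ideal (I N) R" for N
 proof (rule idealI)
  show "subgroup (I N) (add_monoid R)"
   by (rule add.subgroupI) (use assms(3) in \<open>auto simp: I_def r_distr r_minus intro!: exI[of _ \<zero>]\<close>)
  fix a x assume "a \<in> I N" "x \<in> car R"
  then show "x \<otimes> a \<in> I N" "a \<otimes> x \<in> I N"
   using assms(3) m_lcomm[of "f [^] N" x a] m_comm[of a x] by (auto simp: I_def)
 qed (rule ring_axioms)
 have "subset.chain {I. ideal I R} (range I)"
 proof -
  have "I N \<subseteq> I K \<or> I K \<subseteq> I N" for N K using mono nat_le_linear by blast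
  then show ?thesis unfolding pred_on.chain_def using ideal by blast
 qed
 then have "\<Union>(range I) \<in> range I" by (intro N.ideal_chain_is_trivial) auto
 then obtain T where T: "\<Union>(range I) = I T" by blast
 have "f [^] T \<otimes> a = \<zero>" if "a \<in> car R" "f [^] N \<otimes> a = \<zero>" for a and N :: nat
 proof -
  have "a \<in> I N" using that by (simp add: I_def)
  then have "a \<in> I T" using T by blast
  then show ?thesis by (simp add: I_def)
 qed
 then show ?thesis by blast
qed

text \<open>Finite generation gives one \<open>N\<close> such that every \<open>f^N x\<close> has
  coordinates. They are unique up to \<open>f\<close>-torsion, and a fixed power \<open>f^T\<close>
  kills that torsion. Multiplied by \<open>f^T\<close>, the coordinates become well-defined
  functions of \<open>x\<close>, and uniqueness makes them linear.\<close>

lemma local_basis_if_frac_basis: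
 fixes R :: "('r, 'z) ring_scheme" (structure) and M :: "('r, 'm) module"
 assumes M: "module R M" and noeth: "noetherian_ring R" and f: "f \<in> car R"
  and m: "frac_basis R M f r m"
  and fg: "\<exists>G. finite G \<and> G \<subseteq> car M \<and> (\<forall>H. submodule H R M --> G \<subseteq> H --> car M \<subseteq> H)"
 shows "\<exists>(N::nat) \<mu>. local_basis R M (f [^] N) r m \<mu>"
proof -
 interpret module R M by (rule M)
 have mc: "\<And>i. i < r ==> m i \<in> car M" using m by (simp add: frac_basis_def)
 define lc where "lc c = (\<Oplus>\<^sub>M i\<in>{..<r}. c i \<odot>\<^sub>M m i)" for c
 have lc_closed: "lc c \<in> car M" if "\<forall>i<r. c i \<in> car R" for c
  using that mc by (auto simp: lc_def intro!: M.finsum_closed)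
 have lc_add: "lc (\<lambda>i. c i \<oplus> d i) = lc c \<oplus>\<^sub>M lc d"
  if "\<forall>i<r. c i \<in> car R" "\<forall>i<r. d i \<in> car R" for c d
 proof -
  have "lc (\<lambda>i. c i \<oplus> d i) = (\<Oplus>\<^sub>M i\<in>{..<r}. c i \<odot>\<^sub>M m i \<oplus>\<^sub>M d i \<odot>\<^sub>M m i)"
   unfolding lc_def using that mc by (intro M.finsum_cong') (auto simp: smult_l_distr)
  also have "... = lc c \<oplus>\<^sub>M lc d"
   unfolding lc_def using that mc by (intro M.finsum_addf) auto
  finally show ?thesis .
 qed
 have lc_smult: "lc (\<lambda>i. a \<otimes> c i) = a \<odot>\<^sub>M lc c" if "\<forall>i<r. c i \<in> car R" "a \<in> car R" for a c
  unfolding lc_def using that mc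
  by (subst finsum_smult_ldistr) (auto simp: smult_assoc1 intro!: M.finsum_cong')
 have fp: "f [^] (N::nat) \<in> car R" for N using f by simp
 \<comment> \<open>An ascending family of submodules; a finite generating set is contained in one of
   them.\<close>
 define H where "H N = {x \<in> car M. \<exists>c. (\<forall>i<r. c i \<in> car R) \<and> f [^] (N::nat) \<odot>\<^sub>M x = lc c}" for N
 have HI: "x \<in> H N" if "x \<in> car M" "\<forall>i<r. c i \<in> car R" "f [^] N \<odot>\<^sub>M x = lc c" for x N c
  using that unfolding H_def by blast
 have mono: "H N \<subseteq> H K" if "N \<le> K" for N K
 proof
  fix x assume "x \<in> H N"
  then obtain c where x: "x \<in> car M" and c: "\<forall>i<r. c i \<in> car R" "f [^] N \<odot>\<^sub>M x = lc c"
   by (auto simp: H_def)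
  have "f [^] K = f [^] (K - N) \<otimes> f [^] N" using that f by (simp add: R.nat_pow_mult)
  then have "f [^] K \<odot>\<^sub>M x = lc (\<lambda>i. f [^] (K - N) \<otimes> c i)"
   using x c fp by (simp add: smult_assoc1 lc_smult)
  then show "x \<in> H K" by (rule HI[OF x, rotated]) (use c fp in auto)
 qed
 have sub: "submodule (H N) R M" for N
 proof (rule submoduleI)
  show "H N \<subseteq> car M" by (auto simp: H_def)
  show "\<zero>\<^sub>M \<in> H N"
   using fp mc
   by (intro HI[of _ "\<lambda>_. \<zero>"]) (auto simp: lc_def intro!: M.finsum_all_zero[symmetric])
  fix x assume "x \<in> H N"
  then obtain c where x: "x \<in> car M" and c: "\<forall>i<r. c i \<in> car R" "f [^] N \<odot>\<^sub>M x = lc c"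
   by (auto simp: H_def)
  show smult: "a \<odot>\<^sub>M x \<in> H N" if a: "a \<in> car R" for a
   using x c fp a smult_lcomm[OF fp a x, of N]
   by (intro HI[of _ "\<lambda>i. a \<otimes> c i"]) (auto simp: lc_smult)
  show "\<ominus>\<^sub>M x \<in> H N" using smult[of "\<ominus> \<one>"] x by (simp add: smult_l_minus)
  fix y assume "y \<in> H N"
  then obtain d where y: "y \<in> car M" and d: "\<forall>i<r. d i \<in> car R" "f [^] N \<odot>\<^sub>M y = lc d"
   by (auto simp: H_def)
  show "x \<oplus>\<^sub>M y \<in> H N"
   using x c y d fp by (intro HI[of _ "\<lambda>i. c i \<oplus> d i"]) (auto simp: lc_add smult_r_distr)
 qed
 obtain G where G: "finite G" "G \<subseteq> car M" "\<And>H. submodule H R M ==> G \<subseteq> H ==> car M \<subseteq> H"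
  using fg by blast
 have "\<exists>N. G \<subseteq> H N"
  using G(1,2)
 proof (induction G)
  case (insert x G)
  then obtain N where N: "G \<subseteq> H N" by blast
  from insert obtain K :: nat and c where "\<forall>i<r. c i \<in> car R" "f [^] K \<odot>\<^sub>M x = lc c"
   using m unfolding frac_basis_def lc_def by blast
  then have "x \<in> H K" using insert HI by blast
  then have "insert x G \<subseteq> H (max N K)"
   using N mono[of N "max N K"] mono[of K "max N K"] by auto
  then show ?case by blast
 qed auto
 then obtain N where N: "car M \<subseteq> H N" using G(3)[OF sub] by blast
 then have "\<forall>x\<in>car M. \<exists>c. (\<forall>i<r. c i \<in> car R) \<and> f [^] N \<odot>\<^sub>M x = lc c" by (auto simp: H_def)
 from bchoice[OF this] obtain c where
  "\<forall>x\<in>car M. (\<forall>i<r. c x i \<in> car R) \<and> f [^] N \<odot>\<^sub>M x = lc (c x)" by (elim exE)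
 then have c: "\<And>x i. x \<in> car M ==> i < r ==> c x i \<in> car R"
  "\<And>x. x \<in> car M ==> f [^] N \<odot>\<^sub>M x = lc (c x)" by auto
 obtain T :: nat where T: "\<And>a K. a \<in> car R ==> f [^] (K::nat) \<otimes> a = \<zero> ==> f [^] T \<otimes> a = \<zero>"
  using torsion_bounded[OF R.is_cring noeth f] by blast
 define \<mu> where "\<mu> i x = f [^] T \<otimes> c x i" for i x
 have unique: "\<mu> i x = f [^] T \<otimes> d i"
  if x: "x \<in> car M" and d: "\<forall>i<r. d i \<in> car R" "f [^] N \<odot>\<^sub>M x = lc d" and i: "i < r" for x d i
 proof -
  define z where "z i = c x i \<oplus> (\<ominus> \<one>) \<otimes> d i" for i
  have z: "\<forall>i<r. z i \<in> car R" using c(1)[OF x] d by (simp add: z_def)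
  have "lc z = lc (c x) \<oplus>\<^sub>M (\<ominus> \<one>) \<odot>\<^sub>M lc d"
   unfolding z_def using c(1)[OF x] d by (simp add: lc_add lc_smult)
  also have "... = \<zero>\<^sub>M"
   unfolding c(2)[OF x, symmetric] d(2)[symmetric] using x fp by (simp add: smult_l_minus M.r_neg)
  finally obtain K :: nat where "\<forall>i<r. f [^] K \<otimes> z i = \<zero>"
   using m z unfolding frac_basis_def lc_def by blast
  then have "f [^] T \<otimes> z i = \<zero>" using T z i by blast
  then have "f [^] T \<otimes> c x i \<ominus> f [^] T \<otimes> d i = \<zero>"
   using c(1)[OF x i] d(1) i fp by (simp add: z_def R.r_distr R.l_minus R.r_minus a_minus_def)
  then show ?thesis
   using c(1)[OF x i] d(1) i fp by (simp add: \<mu>_def R.right_minus_eq)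
 qed
 have "local_basis R M (f [^] (N + T)) r m \<mu>"
  unfolding local_basis_def
 proof (intro conjI allI impI ballI)
  fix i assume i: "i < r"
  show "\<mu> i \<in> lin R M"
  proof (rule mod_homI)
   fix x y assume x: "x \<in> car M" and y: "y \<in> car M"
   show "\<mu> i x \<in> car (regular_module R)" using c(1)[OF x i] fp by (simp add: \<mu>_def)
   have "\<mu> i (x \<oplus>\<^sub>M y) = f [^] T \<otimes> (c x i \<oplus> c y i)"
    using c x y fp i by (intro unique) (auto simp: smult_r_distr lc_add)
   then show "\<mu> i (x \<oplus>\<^sub>M y) = \<mu> i x \<oplus>\<^bsub>regular_module R\<^esub> \<mu> i y"
    using c(1)[OF x i] c(1)[OF y i] fp by (simp add: \<mu>_def R.r_distr)
  next
   fix a x assume a: "a \<in> car R" and x: "x \<in> car M"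
   have "\<mu> i (a \<odot>\<^sub>M x) = f [^] T \<otimes> (a \<otimes> c x i)"
    using c x a fp i smult_lcomm[OF fp a x, of N] by (intro unique) (auto simp: lc_smult)
   then show "\<mu> i (a \<odot>\<^sub>M x) = a \<odot>\<^bsub>regular_module R\<^esub> \<mu> i x"
    using c(1)[OF x i] a fp by (simp add: \<mu>_def R.m_lcomm)
  qed
 next
  fix x assume x: "x \<in> car M"
  have "f [^] (N + T) \<odot>\<^sub>M x = f [^] T \<odot>\<^sub>M (f [^] N \<odot>\<^sub>M x)"
   using x fp f by (simp add: R.m_comm flip: R.nat_pow_mult smult_assoc1)
  also have "... = lc (\<lambda>i. f [^] T \<otimes> c x i)" using c x fp by (simp add: lc_smult)
  finally show "f [^] (N + T) \<odot>\<^sub>M x = (\<Oplus>\<^sub>M i\<in>{..<r}. \<mu> i x \<odot>\<^sub>M m i)"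
   by (simp add: lc_def \<mu>_def)
 next
  fix i j assume ij: "i < r" "j < r"
  have "(\<Oplus>\<^sub>M l\<in>{..<r}. (if l = j then f [^] N else \<zero>) \<odot>\<^sub>M m l)
   = (\<Oplus>\<^sub>M l\<in>{..<r}. if l = j then f [^] N \<odot>\<^sub>M m j else \<zero>\<^sub>M)"
   using mc fp by (intro M.finsum_cong') auto
  also have "... = f [^] N \<odot>\<^sub>M m j" using ij mc fp by (intro M.finsum_delta) auto
  finally have "\<mu> i (m j) = f [^] T \<otimes> (if i = j then f [^] N else \<zero>)"
   using ij fp mc by (intro unique) (auto simp: lc_def)
  then show "\<mu> i (m j) = (if i = j then f [^] (N + T) else \<zero>)"
   using f by (simp add: R.nat_pow_mult add.commute)
 qed (use mc f in auto)
 then show ?thesis by blast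
qed

lemma local_basis_if_locally_free:
 fixes R :: "('r, 'z) ring_scheme" (structure) and M :: "('r, 'm) module"
 assumes "noetherian_ring R" "locally_free_rank R M r" "primeideal p R"
 obtains f m \<mu> where "f \<notin> p" "local_basis R M f r m \<mu>"
proof -
 have M: "module R M" using assms by (simp add: locally_free_rank_iff)
 obtain f m where f: "f \<in> car R" "f \<notin> p" "frac_basis R M f r m"
  using assms by (auto simp: locally_free_rank_iff)
 then obtain N :: nat and \<mu> where "local_basis R M (f [^] N) r m \<mu>"
  using local_basis_if_frac_basis[OF M assms(1) f(1,3) finitely_generated_if_locally_free[OF assms(2)]] by blast
 then show ?thesis using that primeideal.nat_pow_notin[OF assms(3) f(1,2)] by blast
qed

lemma locally_free_if_local_basis:
 fixes R :: "('r, 'z) ring_scheme" (structure) and M :: "('r, 'm) module"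
 assumes "module R M" "\<And>p. primeideal p R ==> \<exists>f m \<mu>. f \<notin> p \<and> local_basis R M f r m \<mu>"
 shows "locally_free_rank R M r"
 unfolding locally_free_rank_iff
proof (intro conjI allI impI assms(1))
 fix p assume "primeideal p R"
 then obtain f m \<mu> where f: "f \<notin> p" "local_basis R M f r m \<mu>" using assms(2) by blast
 show "\<exists>f\<in>car R - p. \<exists>m. frac_basis R M f r m"
  using f(1) local_basisD(1)[OF f(2)] frac_basis_if_local_basis[OF assms(1) f(2)] by auto
qed

section \<open>Arithmetic of homomorphisms, splittings and extensions\<close>

lemma mod_hom_scale:
 assumes "module R M" "module R N" "f \<in> mod_hom R M N" "a \<in> car R"
 shows "(\<lambda>x. a \<odot>\<^sub>N f x) \<in> mod_hom R M N"
proof -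
 interpret N: module R N by fact
 show ?thesis
  by (rule mod_homI)
   (use assms N.smult_lcomm[of a] in
    \<open>auto simp: mod_hom_closed mod_hom_add mod_hom_smult N.smult_r_distr\<close>)
qed

lemma mod_hom_sum2:
 assumes "module R M" "module R N" "f \<in> mod_hom R M N" "g \<in> mod_hom R M N"
 shows "(\<lambda>x. f x \<oplus>\<^sub>N g x) \<in> mod_hom R M N"
proof -
 interpret N: module R N by fact
 show ?thesis
  by (rule mod_homI)
   (use assms in \<open>auto simp: mod_hom_closed mod_hom_add mod_hom_smult N.smult_r_distr N.M.a_ac\<close>)
qed

lemma mod_hom_diff:
 assumes "module R M" "module R N" "f \<in> mod_hom R M N" "g \<in> mod_hom R M N"
 shows "(\<lambda>x. f x \<ominus>\<^sub>N g x) \<in> mod_hom R M N"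
proof -
 interpret N: module R N by fact
 show ?thesis
  by (rule mod_homI)
   (use assms in \<open>auto simp: mod_hom_closed mod_hom_add mod_hom_smult N.smult_r_distr N.M.a_ac
    a_minus_def N.smult_r_minus N.M.minus_add\<close>)
qed

lemma mod_hom_lincomb:
 assumes "module R M" "module R N" "finite I" "\<And>i. i \<in> I ==> \<gamma> i \<in> lin R M"
  "\<And>i. i \<in> I ==> l i \<in> car N"
 shows "(\<lambda>x. \<Oplus>\<^sub>N i\<in>I. \<gamma> i x \<odot>\<^sub>N l i) \<in> mod_hom R M N"
proof -
 interpret M: module R M by fact
 interpret N: module R N by fact
 have c: "\<gamma> i x \<in> car R" if "i \<in> I" "x \<in> car M" for i x
  using mod_hom_closed[OF assms(4)[OF that(1)] that(2)] by simp
 have term_closed: "(\<lambda>i. \<gamma> i x \<odot>\<^sub>N l i) \<in> I \<rightarrow> car N" if "x \<in> car M" for x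
  using c[OF _ that] assms(5) by auto
 show ?thesis
 proof (rule mod_homI)
  fix x y assume x: "x \<in> car M" and y: "y \<in> car M"
  show "(\<Oplus>\<^sub>N i\<in>I. \<gamma> i x \<odot>\<^sub>N l i) \<in> car N" using term_closed[OF x] by (rule N.M.finsum_closed)
  have "(\<Oplus>\<^sub>N i\<in>I. \<gamma> i (x \<oplus>\<^sub>M y) \<odot>\<^sub>N l i) = (\<Oplus>\<^sub>N i\<in>I. \<gamma> i x \<odot>\<^sub>N l i \<oplus>\<^sub>N \<gamma> i y \<odot>\<^sub>N l i)"
   using x y c assms(5) by (intro N.M.finsum_cong') (auto simp: mod_hom_add[OF assms(4)] N.smult_l_distr)
  then show "(\<Oplus>\<^sub>N i\<in>I. \<gamma> i (x \<oplus>\<^sub>M y) \<odot>\<^sub>N l i) =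
    (\<Oplus>\<^sub>N i\<in>I. \<gamma> i x \<odot>\<^sub>N l i) \<oplus>\<^sub>N (\<Oplus>\<^sub>N i\<in>I. \<gamma> i y \<odot>\<^sub>N l i)"
   using N.M.finsum_addf[OF term_closed[OF x] term_closed[OF y]] by simp
 next
  fix a x assume a: "a \<in> car R" and x: "x \<in> car M"
  have "(\<Oplus>\<^sub>N i\<in>I. \<gamma> i (a \<odot>\<^sub>M x) \<odot>\<^sub>N l i) = (\<Oplus>\<^sub>N i\<in>I. a \<odot>\<^sub>N (\<gamma> i x \<odot>\<^sub>N l i))"
   using x a c assms(5) by (intro N.M.finsum_cong') (auto simp: mod_hom_smult[OF assms(4)] N.smult_assoc1)
  then show "(\<Oplus>\<^sub>N i\<in>I. \<gamma> i (a \<odot>\<^sub>M x) \<odot>\<^sub>N l i) = a \<odot>\<^sub>N (\<Oplus>\<^sub>N i\<in>I. \<gamma> i x \<odot>\<^sub>N l i)"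
   using N.finsum_smult_ldistr[OF assms(3) a term_closed[OF x]] by simp
 qed
qed

lemma finsum_submodule:
 fixes M :: "('r, 'm) module"
 assumes "module R M" "submodule N R M" "finite I" "f \<in> I \<rightarrow> N"
 shows "finsum (M\<lparr>carrier := N\<rparr>) f I = finsum M f I"
proof -
 interpret module R M by fact
 have N: "module R (M\<lparr>carrier := N\<rparr>)" by (rule submodule.submodule_is_module[OF assms(2,1)])
 have "(\<lambda>x. x) \<in> mod_hom R (M\<lparr>carrier := N\<rparr>) M"
  by (rule mod_homI) (use submodule_closed(1)[OF assms(2)] in auto)
 from mod_hom_finsum[OF N assms(1) this assms(3)] assms(4) show ?thesis by simp
qed

lemma (in cring) functional_scale:
 "\<mu> \<in> lin R M ==> module R M ==> a \<in> car R ==>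
  (\<lambda>x. a \<otimes> \<mu> x) \<in> lin R M"
 using mod_hom_scale[of R M "regular_module R" \<mu> a] module_regular[OF is_cring] by simp

lemma (in cring) minus_regular_module: "x \<ominus>\<^bsub>regular_module R\<^esub> y = x \<ominus> y"
 by (simp add: a_minus_def a_inv_def m_inv_def)

lemma (in cring) functional_diff:
 "\<mu> \<in> lin R M ==> \<nu> \<in> lin R M ==> module R M ==>
  (\<lambda>x. \<mu> x \<ominus> \<nu> x) \<in> lin R M"
 using mod_hom_diff[of R M "regular_module R" \<mu> \<nu>] module_regular[OF is_cring]
 by (simp add: minus_regular_module)

text \<open>A splitting of \<open>M \<rightarrow> M/N\<close> up to the factor \<open>g\<close>, with projection \<open>\<pi>\<close> to \<open>N\<close>.\<close>

definition local_splitting ::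
  "('r, 'z) ring_scheme => ('r, 'm) module => 'm set => 'r => nat => (nat => 'm) => (nat => 'm => 'r)
   => ('m => 'm) => bool"
 where "local_splitting R M N g b l \<delta> \<pi> \<longleftrightarrow>
  (\<forall>i<b. l i \<in> car M) \<and> (\<forall>i<b. \<delta> i \<in> lin R M) \<and>
  (\<forall>i<b. \<forall>j<b. \<delta> i (l j) = (if i = j then g else \<zero>\<^sub>R)) \<and>
  (\<forall>i<b. \<forall>x\<in>N. \<delta> i x = \<zero>\<^sub>R) \<and>
  \<pi> \<in> mod_hom R M (M\<lparr>carrier := N\<rparr>) \<and>
  (\<forall>x\<in>car M. g \<odot>\<^sub>M x = \<pi> x \<oplus>\<^sub>M (\<Oplus>\<^sub>M i\<in>{..<b}. \<delta> i x \<odot>\<^sub>M l i)) \<and>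
  (\<forall>x\<in>N. \<pi> x = g \<odot>\<^sub>M x) \<and> (\<forall>i<b. \<pi> (l i) = \<zero>\<^sub>M)"

lemma local_splittingD:
 assumes "local_splitting R M N g b l \<delta> \<pi>"
 shows "i < b ==> l i \<in> car M" "i < b ==> \<delta> i \<in> lin R M"
  "i < b ==> j < b ==> \<delta> i (l j) = (if i = j then g else \<zero>\<^sub>R)"
  "i < b ==> x \<in> N ==> \<delta> i x = \<zero>\<^sub>R"
  "\<pi> \<in> mod_hom R M (M\<lparr>carrier := N\<rparr>)"
  "x \<in> car M ==> g \<odot>\<^sub>M x = \<pi> x \<oplus>\<^sub>M (\<Oplus>\<^sub>M i\<in>{..<b}. \<delta> i x \<odot>\<^sub>M l i)"
  "x \<in> N ==> \<pi> x = g \<odot>\<^sub>M x" "i < b ==> \<pi> (l i) = \<zero>\<^sub>M"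
 using assms by (simp_all add: local_splitting_def)

text \<open>Lifts of the basis vectors of \<open>M/N\<close> define \<open>g\<close> times a
  section. What is left of \<open>g x\<close> after the lifted part is subtracted vanishes in the
  quotient and so lies in \<open>N\<close>.\<close>

lemma local_basis_quotient_splits:
 fixes R :: "('r, 'z) ring_scheme" (structure) and M :: "('r, 'm) module"
 assumes M: "module R M" and N: "submodule N R M" and lb: "local_basis R (quot_module M N) g b c \<gamma>"
 shows "\<exists>l \<delta> \<pi>. local_splitting R M N g b l \<delta> \<pi>"
proof -
 interpret module R M by (rule M)
 let ?Q = "quot_module M N"
 interpret Q: module R ?Q by (rule module_quot_module[OF M N])
 note lbD = local_basisD[OF lb] and Nc = submodule_closed[OF N]
 have q: "(\<lambda>x. N +>\<^bsub>M\<^esub> x) \<in> mod_hom R M ?Q" by (rule quot_module_hom[OF M N])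
 have "\<forall>i\<in>{..<b}. \<exists>x. x \<in> car M \<and> c i = N +>\<^bsub>M\<^esub> x"
  using lbD(2) by (auto simp: carrier_quot_module)
 from bchoice[OF this] obtain l where "\<forall>i\<in>{..<b}. l i \<in> car M \<and> c i = N +>\<^bsub>M\<^esub> l i" by (elim exE)
 then have l: "\<And>i. i < b ==> l i \<in> car M" "\<And>i. i < b ==> c i = N +>\<^bsub>M\<^esub> l i" by auto
 define \<delta> where "\<delta> i = (\<lambda>x. \<gamma> i (N +>\<^bsub>M\<^esub> x))" for i
 have \<delta>: "\<delta> i \<in> lin R M" if "i < b" for i
  unfolding \<delta>_def by (rule mod_hom_comp[OF q lbD(3)[OF that]])
 have \<delta>c: "\<delta> i x \<in> car R" if "i < b" "x \<in> car M" for i x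
  using mod_hom_closed[OF \<delta>] that by auto
 have \<delta>l: "\<delta> i (l j) = (if i = j then g else \<zero>)" if "i < b" "j < b" for i j
  using lbD(5)[OF that] l(2)[OF that(2)] by (simp add: \<delta>_def)
 have \<delta>N: "\<delta> i x = \<zero>" if "i < b" "x \<in> N" for i x
 proof -
  have "N +>\<^bsub>M\<^esub> x = \<zero>\<^sub>?Q" using coset_zero_iff[OF M N] Nc(1)[OF that(2)] that(2) by simp
  then show ?thesis
   using mod_hom_zero[OF Q.module_axioms module_regular[OF R.is_cring] lbD(3)[OF that(1)]]
   by (simp add: \<delta>_def)
 qed
 define s where "s x = (\<Oplus>\<^sub>M i\<in>{..<b}. \<delta> i x \<odot>\<^sub>M l i)" for x
 have s: "s \<in> mod_hom R M M"
  unfolding s_def by (rule mod_hom_lincomb[OF M M]) (use \<delta> l in auto)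
 define \<pi> where "\<pi> x = g \<odot>\<^sub>M x \<ominus>\<^sub>M s x" for x
 have id: "(\<lambda>x. x) \<in> mod_hom R M M" by (rule mod_homI) auto
 have \<pi>M: "\<pi> \<in> mod_hom R M M"
  unfolding \<pi>_def by (rule mod_hom_diff[OF M M mod_hom_scale[OF M M id lbD(1)] s])
 have sc: "s x \<in> car M" if "x \<in> car M" for x using mod_hom_closed[OF s that] .
 have \<pi>N: "\<pi> x \<in> N" if x: "x \<in> car M" for x
 proof -
  have "N +>\<^bsub>M\<^esub> (g \<odot>\<^sub>M x) = g \<odot>\<^sub>?Q (N +>\<^bsub>M\<^esub> x)"
   using smult_quot_module[OF M N lbD(1) x] by simp
  also have "... = (\<Oplus>\<^sub>?Q i\<in>{..<b}. \<gamma> i (N +>\<^bsub>M\<^esub> x) \<odot>\<^sub>?Q c i)"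
   by (rule lbD(4)) (use x in \<open>auto simp: carrier_quot_module\<close>)
  also have "... = (\<Oplus>\<^sub>?Q i\<in>{..<b}. N +>\<^bsub>M\<^esub> (\<delta> i x \<odot>\<^sub>M l i))"
   using l x \<delta>c by (intro Q.M.finsum_cong')
    (auto simp: \<delta>_def smult_quot_module[OF M N] carrier_quot_module)
  also have "... = N +>\<^bsub>M\<^esub> s x"
   unfolding s_def by (rule mod_hom_finsum[OF M Q.module_axioms q, symmetric]) (use l x \<delta>c in auto)
  finally show ?thesis
   using coset_eq_iff[OF M N, of "g \<odot>\<^sub>M x" "s x"] sc[OF x] x lbD(1) by (simp add: \<pi>_def)
 qed
 have "local_splitting R M N g b l \<delta> \<pi>"
  unfolding local_splitting_def
 proof (intro conjI allI impI ballI)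
  show "\<pi> \<in> mod_hom R M (M\<lparr>carrier := N\<rparr>)"
   by (rule mod_homI) (use \<pi>N mod_hom_add[OF \<pi>M] mod_hom_smult[OF \<pi>M] in auto)
  show "g \<odot>\<^sub>M x = \<pi> x \<oplus>\<^sub>M (\<Oplus>\<^sub>M i\<in>{..<b}. \<delta> i x \<odot>\<^sub>M l i)" if "x \<in> car M" for x
   unfolding s_def[symmetric] \<pi>_def using that sc lbD(1) by (simp add: M.minus_add_cancel)
  show "\<pi> x = g \<odot>\<^sub>M x" if x: "x \<in> N" for x
  proof -
   have "s x = \<zero>\<^sub>M" unfolding s_def by (rule M.finsum_all_zero) (use \<delta>N[OF _ x] l in auto)
   then show ?thesis using Nc(1)[OF x] lbD(1) by (simp add: \<pi>_def M.minus_zero_right)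
  qed
  show "\<pi> (l j) = \<zero>\<^sub>M" if j: "j < b" for j
  proof -
   have "s (l j) = (\<Oplus>\<^sub>M i\<in>{..<b}. if i = j then g \<odot>\<^sub>M l j else \<zero>\<^sub>M)"
    unfolding s_def using l \<delta>l j lbD(1) by (intro M.finsum_cong') auto
   also have "... = g \<odot>\<^sub>M l j" using j l lbD(1) by (intro M.finsum_delta) auto
   finally show ?thesis using l(1)[OF j] lbD(1) by (simp add: \<pi>_def M.right_minus_eq)
  qed
 qed (use l \<delta> \<delta>l \<delta>N in auto)
 then show ?thesis by blast
qed

text \<open>Join the basis of \<open>N\<close> to lifts of the basis of \<open>M/N\<close>. The
  projection to \<open>N\<close> contributes the factor \<open>g\<close> to the first coordinates;
  the remaining ones are multiplied by \<open>f\<close>, so that all have the common denominator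
  \<open>f g\<close>.\<close>

lemma local_basis_extension:
 fixes R :: "('r, 'z) ring_scheme" (structure) and M :: "('r, 'm) module"
 assumes M: "module R M" and N: "submodule N R M"
  and lbN: "local_basis R (M\<lparr>carrier := N\<rparr>) f a m \<mu>"
  and lbQ: "local_basis R (quot_module M N) g b c \<gamma>"
 shows "\<exists>m \<mu>. local_basis R M (f \<otimes> g) (a + b) m \<mu>"
proof -
 interpret module R M by (rule M)
 interpret N: module R "M\<lparr>carrier := N\<rparr>" by (rule submodule.submodule_is_module[OF N M])
 note Nc = submodule_closed[OF N] and D = local_basisD[OF lbN]
 have g: "g \<in> car R" using local_basisD(1)[OF lbQ] .
 note reg = module_regular[OF R.is_cring]
 from local_basis_quotient_splits[OF M N lbQ]
 obtain l \<delta> \<pi> where ls: "local_splitting R M N g b l \<delta> \<pi>" by (elim exE)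
 note l = local_splittingD(1)[OF ls] and \<delta> = local_splittingD(2)[OF ls] and \<delta>l = local_splittingD(3)[OF ls]
  and \<delta>N = local_splittingD(4)[OF ls] and \<pi> = local_splittingD(5)[OF ls] and \<pi>s = local_splittingD(6)[OF ls]
  and \<pi>N = local_splittingD(7)[OF ls] and \<pi>l = local_splittingD(8)[OF ls]
 have \<delta>c: "\<delta> i x \<in> car R" if "i < b" "x \<in> car M" for i x
  using mod_hom_closed[OF \<delta>] that by auto
 have mN: "m i \<in> N" if "i < a" for i using D(2)[OF that] by simp
 have \<pi>c: "\<pi> x \<in> N" if "x \<in> car M" for x using mod_hom_closed[OF \<pi> that] by simp
 have \<mu>c: "\<mu> i x \<in> car R" if "i < a" "x \<in> N" for i x using D(6) that by simp
 define m' where "m' i = (if i < a then m i else l (i - a))" for i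
 define \<mu>' where "\<mu>' i = (if i < a then (\<lambda>x. \<mu> i (\<pi> x)) else (\<lambda>x. f \<otimes> \<delta> (i - a) x))" for i
 have m': "m' i \<in> car M" if "i < a + b" for i
  using that mN Nc(1) l by (auto simp: m'_def)
 have \<mu>': "\<mu>' i \<in> lin R M" if "i < a + b" for i
 proof (cases "i < a")
  case True
  then show ?thesis using mod_hom_comp[OF \<pi> D(3)[OF True]] by (simp add: \<mu>'_def)
 next
  case False
  then show ?thesis using that R.functional_scale[OF \<delta> M D(1), of "i - a"] by (simp add: \<mu>'_def)
 qed
 have \<mu>'c: "\<mu>' i x \<in> car R" if "i < a + b" "x \<in> car M" for i x
  using mod_hom_closed[OF \<mu>'[OF that(1)] that(2)] by simp
 have "local_basis R M (f \<otimes> g) (a + b) m' \<mu>'"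
  unfolding local_basis_def
 proof (intro conjI allI impI ballI)
  fix x assume x: "x \<in> car M"
  have "(\<Oplus>\<^sub>M i\<in>{..<a + b}. \<mu>' i x \<odot>\<^sub>M m' i)
   = (\<Oplus>\<^sub>M i\<in>{..<a}. \<mu>' i x \<odot>\<^sub>M m' i) \<oplus>\<^sub>M (\<Oplus>\<^sub>M i\<in>{..<b}. \<mu>' (a + i) x \<odot>\<^sub>M m' (a + i))"
   by (rule M.finsum_add_index) (use \<mu>'c x m' in auto)
  also have "(\<Oplus>\<^sub>M i\<in>{..<a}. \<mu>' i x \<odot>\<^sub>M m' i) = f \<odot>\<^sub>M \<pi> x"
  proof -
   have "f \<odot>\<^sub>M \<pi> x = (\<Oplus>\<^bsub>M\<lparr>carrier := N\<rparr>\<^esub>i\<in>{..<a}. \<mu> i (\<pi> x) \<odot>\<^sub>M m i)"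
    using D(4)[of "\<pi> x"] \<pi>c[OF x] by simp
   also have "... = (\<Oplus>\<^sub>M i\<in>{..<a}. \<mu> i (\<pi> x) \<odot>\<^sub>M m i)"
    by (rule finsum_submodule[OF M N]) (use \<mu>c[OF _ \<pi>c[OF x]] mN Nc(6) in auto)
   also have "... = (\<Oplus>\<^sub>M i\<in>{..<a}. \<mu>' i x \<odot>\<^sub>M m' i)"
    using \<mu>c[OF _ \<pi>c[OF x]] mN Nc(1) by (intro M.finsum_cong') (auto simp: \<mu>'_def m'_def)
   finally show ?thesis by simp
  qed
  also have "(\<Oplus>\<^sub>M i\<in>{..<b}. \<mu>' (a + i) x \<odot>\<^sub>M m' (a + i))
   = (\<Oplus>\<^sub>M i\<in>{..<b}. f \<odot>\<^sub>M (\<delta> i x \<odot>\<^sub>M l i))"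
   using \<delta>c[OF _ x] l D(1) by (intro M.finsum_cong') (auto simp: \<mu>'_def m'_def smult_assoc1)
  also have "... = f \<odot>\<^sub>M (\<Oplus>\<^sub>M i\<in>{..<b}. \<delta> i x \<odot>\<^sub>M l i)"
   by (rule finsum_smult_ldistr[symmetric]) (use \<delta>c[OF _ x] l D(1) in auto)
  also have "f \<odot>\<^sub>M \<pi> x \<oplus>\<^sub>M ... = f \<odot>\<^sub>M (g \<odot>\<^sub>M x)"
   unfolding \<pi>s[OF x] using D(1) Nc(1)[OF \<pi>c[OF x]] \<delta>c[OF _ x] l
   by (intro smult_r_distr[symmetric]) (auto intro!: M.finsum_closed)
  finally show "(f \<otimes> g) \<odot>\<^sub>M x = (\<Oplus>\<^sub>M i\<in>{..<a + b}. \<mu>' i x \<odot>\<^sub>M m' i)"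
   using D(1) g x by (simp add: smult_assoc1)
 next
  fix i j assume i: "i < a + b" and j: "j < a + b"
  show "\<mu>' i (m' j) = (if i = j then f \<otimes> g else \<zero>)"
  proof (cases "i < a")
   case True
   note \<mu>i = D(3)[OF True]
   show ?thesis
   proof (cases "j < a")
    case j': True
    have "\<mu> i (g \<odot>\<^sub>M m j) = g \<otimes> \<mu> i (m j)"
     using mod_hom_smult[OF \<mu>i g, of "m j"] mN[OF j'] by simp
    then show ?thesis
     using True j' g D(1) D(5)[OF True j'] mN[OF j'] by (auto simp: \<mu>'_def m'_def \<pi>N R.m_comm)
   next
    case False
    then show ?thesis
     using True j \<pi>l[of "j - a"] mod_hom_zero[OF N.module_axioms reg \<mu>i]
     by (auto simp: \<mu>'_def m'_def)
   qed
  next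
   case False
   then show ?thesis
    using i j \<delta>N[of "i - a" "m j"] mN[of j] \<delta>l[of "i - a" "j - a"] D(1)
    by (auto simp: \<mu>'_def m'_def)
  qed
 qed (use m' \<mu>' D(1) g in auto)
 then show ?thesis by blast
qed

section \<open>Exchange of basis vectors and the rank of a kernel\<close>

lemma local_basis_swap:
 fixes R :: "('r, 'z) ring_scheme" (structure) and M :: "('r, 'm) module"
 assumes M: "module R M" and lb: "local_basis R M f n e \<mu>" and "i < n" "j < n"
 shows "local_basis R M f n (e \<circ> Fun.swap i j id) (\<mu> \<circ> Fun.swap i j id)"
proof -
 interpret module R M by (rule M)
 define \<sigma> where "\<sigma> = Fun.swap i j (id :: nat => nat)"
 have \<sigma>: "\<sigma> l < n \<longleftrightarrow> l < n" "\<sigma> l = \<sigma> l' \<longleftrightarrow> l = l'" "\<sigma> (\<sigma> l) = l" for l l'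
  using assms(3,4) by (auto simp: \<sigma>_def Fun.swap_def)
 have im: "\<sigma> ` {..<n} = {..<n}"
 proof (intro equalityI subsetI)
  fix l assume "l \<in> {..<n}"
  then have "\<sigma> l \<in> {..<n}" using \<sigma>(1) by simp
  then show "l \<in> \<sigma> ` {..<n}" using \<sigma>(3)[of l] by (metis imageI)
 qed (use \<sigma>(1) in auto)
 note D = local_basisD[OF lb]
 show ?thesis
  unfolding local_basis_def \<sigma>_def[symmetric]
 proof (intro conjI allI impI ballI)
  fix x assume x: "x \<in> car M"
  have "f \<odot>\<^sub>M x = (\<Oplus>\<^sub>M l\<in>\<sigma> ` {..<n}. \<mu> l x \<odot>\<^sub>M e l)" unfolding im using D(4)[OF x] .
  also have "... = (\<Oplus>\<^sub>M l\<in>{..<n}. \<mu> (\<sigma> l) x \<odot>\<^sub>M e (\<sigma> l))"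
   by (rule M.finsum_reindex) (use D x \<sigma> in \<open>auto simp: inj_on_def\<close>)
  finally show "f \<odot>\<^sub>M x = (\<Oplus>\<^sub>M l\<in>{..<n}. (\<mu> \<circ> \<sigma>) l x \<odot>\<^sub>M (e \<circ> \<sigma>) l)" by simp
 qed (use D \<sigma> in auto)
qed

text \<open>The replacement step of linear algebra without division. With
  \<open>u = \<mu> j v\<close>, the coordinates in the new basis are \<open>\<mu> j x / u\<close>
  along \<open>v\<close> and \<open>(\<mu> l x - \<mu> j x \<mu> l v / u) / f\<close> along
  \<open>e l\<close>; multiplication by \<open>f u\<close> gives the functionals
  \<open>\<mu>'\<close>.\<close>

lemma local_basis_replace:
 fixes R :: "('r, 'z) ring_scheme" (structure) and M :: "('r, 'm) module"
 assumes M: "module R M" and lb: "local_basis R M f n e \<mu>" and j: "j < n" and v: "v \<in> car M"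
 shows "\<exists>\<mu>'. local_basis R M (f \<otimes> \<mu> j v) n (e(j := v)) \<mu>'"
proof -
 interpret module R M by (rule M)
 note D = local_basisD[OF lb]
 define u where "u = \<mu> j v"
 have u: "u \<in> car R" using D(6)[OF j v] by (simp add: u_def)
 define \<mu>' where "\<mu>' l = (if l = j then (\<lambda>x. f \<otimes> \<mu> j x) else (\<lambda>x. u \<otimes> \<mu> l x \<ominus> \<mu> l v \<otimes> \<mu> j x))" for l
 have \<mu>': "\<mu>' l \<in> lin R M" if l: "l < n" for l
  unfolding \<mu>'_def using D l j u D(6)[OF l v]
  by (auto intro!: R.functional_scale R.functional_diff M)
 define K where "K = {..<n} - {j}"
 have K: "{..<n} = insert j K" "j \<notin> K" "finite K" using j by (auto simp: K_def)
 have Kn: "l < n" if "l \<in> K" for l using that by (simp add: K_def)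
 define s where "s y = (\<Oplus>\<^sub>M l\<in>K. \<mu> l y \<odot>\<^sub>M e l)" for y
 have s: "s y \<in> car M" if "y \<in> car M" for y
  unfolding s_def using that D Kn by (auto intro!: M.finsum_closed)
 have split: "f \<odot>\<^sub>M y = \<mu> j y \<odot>\<^sub>M e j \<oplus>\<^sub>M s y" if y: "y \<in> car M" for y
  using D(4)[OF y] unfolding K(1) s_def
  by (subst (asm) M.finsum_insert) (use K D y j Kn in auto)
 have "local_basis R M (f \<otimes> u) n (e(j := v)) \<mu>'"
  unfolding local_basis_def
 proof (intro conjI allI impI ballI)
  fix x assume x: "x \<in> car M"
  have c: "\<mu> l x \<in> car R" "\<mu> l v \<in> car R" if "l < n" for l using D(6)[OF that] x v by auto
  have "(\<Oplus>\<^sub>M l\<in>{..<n}. \<mu>' l x \<odot>\<^sub>M (e(j := v)) l) =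
   (f \<otimes> \<mu> j x) \<odot>\<^sub>M v \<oplus>\<^sub>M (\<Oplus>\<^sub>M l\<in>K. \<mu>' l x \<odot>\<^sub>M (e(j := v)) l)"
   unfolding K(1) using K D(1,2) c j Kn u v
   by (subst M.finsum_insert) (auto simp: \<mu>'_def)
  also have "(\<Oplus>\<^sub>M l\<in>K. \<mu>' l x \<odot>\<^sub>M (e(j := v)) l) =
   (\<Oplus>\<^sub>M l\<in>K. u \<odot>\<^sub>M (\<mu> l x \<odot>\<^sub>M e l) \<oplus>\<^sub>M (\<ominus> \<mu> j x) \<odot>\<^sub>M (\<mu> l v \<odot>\<^sub>M e l))"
  proof (rule M.finsum_cong')
   fix l assume l: "l \<in> K"
   have "\<mu>' l x \<odot>\<^sub>M (e(j := v)) l = (u \<otimes> \<mu> l x \<oplus> (\<ominus> \<mu> j x) \<otimes> \<mu> l v) \<odot>\<^sub>M e l"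
    using l K(2) c[OF Kn[OF l]] c[OF j] u by (auto simp: \<mu>'_def a_minus_def R.l_minus R.m_comm[of "\<mu> l v" "\<mu> j x"])
   then show "\<mu>' l x \<odot>\<^sub>M (e(j := v)) l =
     u \<odot>\<^sub>M (\<mu> l x \<odot>\<^sub>M e l) \<oplus>\<^sub>M (\<ominus> \<mu> j x) \<odot>\<^sub>M (\<mu> l v \<odot>\<^sub>M e l)"
    using c[OF Kn[OF l]] c[OF j] u D(2)[OF Kn[OF l]] by (simp add: smult_l_distr smult_assoc1)
  qed (use c j u D(2) Kn in auto)
  also have "... = u \<odot>\<^sub>M s x \<oplus>\<^sub>M (\<ominus> \<mu> j x) \<odot>\<^sub>M s v"
   unfolding s_def using c j u D(2) Kn K(3)
   by (subst M.finsum_addf) (auto simp: finsum_smult_ldistr)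
  also have "(f \<otimes> \<mu> j x) \<odot>\<^sub>M v = \<mu> j x \<odot>\<^sub>M (u \<odot>\<^sub>M e j \<oplus>\<^sub>M s v)"
   using split[OF v] c[OF j] D(1) v by (simp add: u_def smult_assoc1 smult_lcomm[of f])
  also have "\<mu> j x \<odot>\<^sub>M (u \<odot>\<^sub>M e j \<oplus>\<^sub>M s v) \<oplus>\<^sub>M (u \<odot>\<^sub>M s x \<oplus>\<^sub>M (\<ominus> \<mu> j x) \<odot>\<^sub>M s v)
   = u \<odot>\<^sub>M (\<mu> j x \<odot>\<^sub>M e j \<oplus>\<^sub>M s x)"
  proof -
   let ?p = "\<mu> j x \<odot>\<^sub>M (u \<odot>\<^sub>M e j)" and ?q = "\<mu> j x \<odot>\<^sub>M s v" and ?r = "u \<odot>\<^sub>M s x"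
   have car: "?p \<in> car M" "?q \<in> car M" "?r \<in> car M"
    using c[OF j] u D(2)[OF j] s x v by auto
   have "(?p \<oplus>\<^sub>M ?q) \<oplus>\<^sub>M (?r \<oplus>\<^sub>M \<ominus>\<^sub>M ?q) = (?p \<oplus>\<^sub>M ?r) \<oplus>\<^sub>M (?q \<oplus>\<^sub>M \<ominus>\<^sub>M ?q)"
    using car by (simp add: M.a_ac)
   also have "... = ?p \<oplus>\<^sub>M ?r" using car by (simp add: M.r_neg)
   finally show ?thesis
    using c[OF j] u D(2)[OF j] s x v
    by (simp add: smult_r_distr smult_l_minus smult_lcomm[of u "\<mu> j x"])
  qed
  also have "... = (f \<otimes> u) \<odot>\<^sub>M x"
   unfolding split[OF x, symmetric] using D(1) u x by (simp add: smult_assoc1 smult_lcomm[of u])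
  finally show "(f \<otimes> u) \<odot>\<^sub>M x = (\<Oplus>\<^sub>M l\<in>{..<n}. \<mu>' l x \<odot>\<^sub>M (e(j := v)) l)" by simp
 next
  fix l k assume l: "l < n" and k: "k < n"
  have vj: "\<mu> l v \<in> car R" using D(6)[OF l v] .
  show "\<mu>' l ((e(j := v)) k) = (if l = k then f \<otimes> u else \<zero>)"
   using l k j D(1) D(5)[OF l k] D(5)[OF j k] u vj
   by (auto simp: \<mu>'_def u_def[symmetric] R.m_comm R.right_minus_eq R.minus_zero_right)
 qed (use D u j v \<mu>' in auto)
 then show ?thesis unfolding u_def by blast
qed

text \<open>Steinitz exchange at the prime \<open>p\<close>: the \<open>v i\<close> are independent
  there because the functionals \<open>\<delta> i\<close> separate them up to \<open>g\<close>, so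
  each can be put in place of an old basis vector whose coefficient lies outside
  \<open>p\<close>.\<close>

lemma local_basis_exchange:
 fixes R :: "('r, 'z) ring_scheme" (structure) and M :: "('r, 'm) module"
 assumes M: "module R M" and p: "primeideal p R" and lb: "local_basis R M f n e \<mu>" "f \<notin> p"
  and v: "\<And>i. i < r ==> v i \<in> car M"
  and \<delta>: "\<And>i. i < r ==> \<delta> i \<in> lin R M"
  and \<delta>v: "\<And>i j. i < r ==> j < r ==> \<delta> i (v j) = (if i = j then g else \<zero>)"
  and g: "g \<in> car R" "g \<notin> p"
 shows "r \<le> n \<and> (\<exists>f e \<mu>. f \<notin> p \<and> local_basis R M f n e \<mu> \<and> (\<forall>i<r. e i = v i))"
proof -
 interpret module R M by (rule M)
 interpret p: primeideal p R by (rule p)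
 have "s \<le> r ==> s \<le> n \<and> (\<exists>f e \<mu>. f \<notin> p \<and> local_basis R M f n e \<mu> \<and> (\<forall>i<s. e i = v i))" for s
 proof (induction s)
  case 0
  then show ?case using lb by blast
 next
  case (Suc s)
  then obtain f e \<mu> where f: "f \<notin> p" and lb: "local_basis R M f n e \<mu>" and ev: "\<And>i. i < s ==> e i = v i"
   by force
  note D = local_basisD[OF lb]
  have s: "s < r" "s \<le> n" using Suc by auto
  have vs: "v s \<in> car M" using v s by blast
  \<comment> \<open>The search for a pivot. If all coordinates of \<open>v s\<close> from
    \<open>s\<close> on were in \<open>p\<close>, applying \<open>\<delta> s\<close> to
    \<open>f v s\<close> would put \<open>f g\<close> into \<open>p\<close>; the earlier basis
    vectors contribute nothing, since they are vectors \<open>v i\<close> that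
    \<open>\<delta> s\<close> kills.\<close>
  have "\<exists>i<n. s \<le> i \<and> \<mu> i (v s) \<notin> p"
  proof (rule ccontr)
   assume none: "\<not> ?thesis"
   have "f \<otimes> g = \<delta> s (f \<odot>\<^sub>M v s)"
    using mod_hom_smult[OF \<delta>[OF s(1)] D(1) vs] \<delta>v[OF s(1) s(1)] by simp
   also have "... = (\<Oplus>i\<in>{..<n}. \<mu> i (v s) \<otimes> \<delta> s (e i))"
    unfolding D(4)[OF vs] by (rule functional_lincomb[OF M \<delta>[OF s(1)]]) (use D vs in auto)
   also have "... = finsum (regular_module R) (\<lambda>i. \<mu> i (v s) \<otimes> \<delta> s (e i)) {..<n}" by simp
   also have "... \<in> p"
   proof (rule module.submodule_finsum[OF module_regular[OF R.is_cring]
      submodule_of_ideal[OF R.is_cring p.is_ideal]], rule Pi_I)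
    fix i assume "i \<in> {..<n}"
    then have i: "i < n" by simp
    have c: "\<delta> s (e i) \<in> car R" "\<mu> i (v s) \<in> car R"
     using mod_hom_closed[OF \<delta>[OF s(1)] D(2)[OF i]] D(6)[OF i vs] by auto
    show "\<mu> i (v s) \<otimes> \<delta> s (e i) \<in> p"
    proof (cases "i < s")
     case True
     then have "\<delta> s (e i) = \<zero>" using ev \<delta>v[OF s(1), of i] s by auto
     then show ?thesis using c p.zero_closed by simp
    next
     case False
     then have "\<mu> i (v s) \<in> p" using none i by auto
     then show ?thesis using c by (intro p.I_r_closed)
    qed
   qed
   finally show False using p.I_prime[OF D(1) g(1)] f g(2) by blast
  qed
  then obtain i where i: "i < n" "s \<le> i" "\<mu> i (v s) \<notin> p" by blast
  then have sn: "s < n" by simp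
  let ?\<sigma> = "Fun.swap i s id :: nat => nat"
  have lb1: "local_basis R M f n (e \<circ> ?\<sigma>) (\<mu> \<circ> ?\<sigma>)"
   by (rule local_basis_swap[OF M lb i(1) sn])
  have \<sigma>s: "?\<sigma> s = i" by (simp add: Fun.swap_def)
  obtain \<mu>' where lb2: "local_basis R M (f \<otimes> \<mu> i (v s)) n ((e \<circ> ?\<sigma>)(s := v s)) \<mu>'"
   using local_basis_replace[OF M lb1 sn vs] \<sigma>s by auto
  have "f \<otimes> \<mu> i (v s) \<notin> p" using p.I_prime[OF D(1) D(6)[OF i(1) vs]] f i(3) by blast
  moreover have "((e \<circ> ?\<sigma>)(s := v s)) j = v j" if "j < Suc s" for j
   using that ev i by (auto simp: less_Suc_eq Fun.swap_def)
  ultimately have "\<exists>f e \<mu>. f \<notin> p \<and> local_basis R M f n e \<mu> \<and> (\<forall>i<Suc s. e i = v i)"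
   using lb2 by (intro exI[of _ "f \<otimes> \<mu> i (v s)"] exI[of _ "(e \<circ> ?\<sigma>)(s := v s)"] exI[of _ \<mu>']) blast
  then show ?case using sn by (simp add: Suc_le_eq)
 qed
 then show ?thesis by blast
qed

text \<open>After the exchange the first \<open>r\<close> basis vectors lift the basis of
  \<open>M/N\<close>, and the projections to \<open>N\<close> of the other \<open>n - r\<close> form
  a local basis of \<open>N\<close>. This fixes the rank of the kernel, which projectivity alone
  would not. The coordinate functionals stay defined on all of \<open>M\<close>, as
  \<open>C'_local_basis\<close> requires.\<close>

lemma local_basis_kernel:
 fixes R :: "('r, 'z) ring_scheme" (structure) and M :: "('r, 'm) module"
 assumes M: "module R M" and N: "submodule N R M" and p: "primeideal p R"
  and lb: "local_basis R M f n e \<mu>" "f \<notin> p"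
  and lbQ: "local_basis R (quot_module M N) g r c \<gamma>" "g \<notin> p"
 shows "\<exists>h w \<xi>. h \<in> car R - p \<and>
  (\<forall>l<n - r. w l \<in> N \<and> \<xi> l \<in> lin R M) \<and>
  (\<forall>x\<in>N. h \<odot>\<^sub>M x = (\<Oplus>\<^sub>M l\<in>{..<n - r}. \<xi> l x \<odot>\<^sub>M w l)) \<and>
  (\<forall>l<n - r. \<forall>k<n - r. \<xi> l (w k) = (if l = k then h else \<zero>))"
proof -
 interpret module R M by (rule M)
 interpret p: primeideal p R by (rule p)
 note Nc = submodule_closed[OF N]
 have g: "g \<in> car R" using local_basisD(1)[OF lbQ(1)] .
 from local_basis_quotient_splits[OF M N lbQ(1)]
 obtain v \<delta> \<pi> where ls: "local_splitting R M N g r v \<delta> \<pi>" by (elim exE)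
 note v = local_splittingD(1)[OF ls] and \<delta> = local_splittingD(2)[OF ls] and \<delta>v = local_splittingD(3)[OF ls]
  and \<delta>N = local_splittingD(4)[OF ls] and \<pi> = local_splittingD(5)[OF ls] and \<pi>s = local_splittingD(6)[OF ls]
  and \<pi>N = local_splittingD(7)[OF ls] and \<pi>v = local_splittingD(8)[OF ls]
 have "r \<le> n \<and> (\<exists>f e \<mu>. f \<notin> p \<and> local_basis R M f n e \<mu> \<and> (\<forall>i<r. e i = v i))"
  by (rule local_basis_exchange[OF M p lb v \<delta> \<delta>v g lbQ(2)])
 then obtain f e \<mu> where rn: "r \<le> n" and f: "f \<notin> p" and lb: "local_basis R M f n e \<mu>"
  and ev: "\<And>i. i < r ==> e i = v i" by blast
 note D = local_basisD[OF lb]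
 have \<pi>c: "\<pi> x \<in> N" if "x \<in> car M" for x using mod_hom_closed[OF \<pi> that] by simp
 have \<pi>M: "\<pi> \<in> mod_hom R M M"
  by (rule mod_homI) (use \<pi>c Nc(1) mod_hom_add[OF \<pi>] mod_hom_smult[OF \<pi>] in auto)
 define w where "w l = \<pi> (e (r + l))" for l
 define \<xi> where "\<xi> l = \<mu> (r + l)" for l
 have wN: "w l \<in> N" if "l < n - r" for l unfolding w_def using that by (intro \<pi>c D) auto
 have \<xi>: "\<xi> l \<in> lin R M" if "l < n - r" for l
  unfolding \<xi>_def using that by (intro D) auto
 have \<xi>c: "\<xi> l x \<in> car R" if "l < n - r" "x \<in> car M" for l x
  unfolding \<xi>_def using that by (intro D) auto
 have dec: "(f \<otimes> g) \<odot>\<^sub>M x = (\<Oplus>\<^sub>M l\<in>{..<n - r}. \<xi> l x \<odot>\<^sub>M w l)" if x: "x \<in> N" for x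
 proof -
  have xM: "x \<in> car M" using Nc(1)[OF x] .
  have "(f \<otimes> g) \<odot>\<^sub>M x = f \<odot>\<^sub>M \<pi> x" using xM x D(1) g \<pi>N by (simp add: smult_assoc1)
  also have "... = \<pi> (f \<odot>\<^sub>M x)" using mod_hom_smult[OF \<pi>M D(1) xM] by simp
  also have "... = (\<Oplus>\<^sub>M i\<in>{..<n}. \<pi> (\<mu> i x \<odot>\<^sub>M e i))"
   unfolding D(4)[OF xM] by (rule mod_hom_finsum[OF M M \<pi>M]) (use D xM in auto)
  also have "... = (\<Oplus>\<^sub>M i\<in>{..<r + (n - r)}. \<mu> i x \<odot>\<^sub>M \<pi> (e i))"
   using rn D xM mod_hom_smult[OF \<pi>M] mod_hom_closed[OF \<pi>M] by (intro M.finsum_cong') auto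
  also have "... = (\<Oplus>\<^sub>M i\<in>{..<r}. \<mu> i x \<odot>\<^sub>M \<pi> (e i)) \<oplus>\<^sub>M (\<Oplus>\<^sub>M i\<in>{..<n - r}. \<mu> (r + i) x \<odot>\<^sub>M \<pi> (e (r + i)))"
   by (rule M.finsum_add_index) (use D xM mod_hom_closed[OF \<pi>M] rn in auto)
  also have "(\<Oplus>\<^sub>M i\<in>{..<r}. \<mu> i x \<odot>\<^sub>M \<pi> (e i)) = \<zero>\<^sub>M"
   by (rule M.finsum_all_zero) (use D xM ev \<pi>v rn in auto)
  finally show ?thesis
   using wN Nc(1) \<xi>c[OF _ xM] by (simp add: w_def \<xi>_def M.finsum_closed Pi_def)
 qed
 have orth: "\<xi> l (w k) = (if l = k then f \<otimes> g else \<zero>)" if l: "l < n - r" and k: "k < n - r" for l k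
 proof -
  have ek: "e (r + k) \<in> car M" using k by (intro D) auto
  have rl: "r + l < n" and rk: "r + k < n" using l k by auto
  have "(\<Oplus>\<^sub>M i\<in>{..<r}. \<delta> i (e (r + k)) \<odot>\<^sub>M v i) \<in> car M"
   using mod_hom_closed[OF \<delta> ek] v by (auto intro!: M.finsum_closed)
  moreover have "\<xi> l (\<Oplus>\<^sub>M i\<in>{..<r}. \<delta> i (e (r + k)) \<odot>\<^sub>M v i) = (\<Oplus>i\<in>{..<r}. \<delta> i (e (r + k)) \<otimes> \<xi> l (v i))"
   by (rule functional_lincomb[OF M \<xi>[OF l]]) (use mod_hom_closed[OF \<delta> ek] v in auto)
  moreover have "... = \<zero>"
  proof (rule R.finsum_all_zero)
   fix i assume "i \<in> {..<r}"
   then have i: "i < r" by simp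
   then have "\<xi> l (v i) = \<zero>"
    unfolding \<xi>_def ev[OF i, symmetric] using D(5)[OF rl, of i] rn by simp
   then show "\<delta> i (e (r + k)) \<otimes> \<xi> l (v i) = \<zero>" using mod_hom_closed[OF \<delta>[OF i] ek] by simp
  qed
  ultimately have "\<xi> l (g \<odot>\<^sub>M e (r + k)) = \<xi> l (w k)"
   unfolding \<pi>s[OF ek] using mod_hom_add[OF \<xi>[OF l], of "w k"] Nc(1)[OF wN[OF k]] \<xi>c[OF l]
   by (simp add: w_def)
  then have "\<xi> l (w k) = g \<otimes> \<xi> l (e (r + k))" using mod_hom_smult[OF \<xi>[OF l] g ek] by simp
  then show ?thesis using D(5)[OF rl rk] D(1) g by (auto simp: \<xi>_def R.m_comm)
 qed
 show ?thesis
  by (intro exI[of _ "f \<otimes> g"] exI[of _ w] exI[of _ \<xi>])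
   (use D(1) g f lbQ(2) p.I_prime[OF D(1) g] wN \<xi> dec orth in auto)
qed

subsection \<open>Dual bases\<close>

text \<open>The dual basis criterion for finitely generated projective modules; no orthogonality
  between the \<open>m i\<close> and the \<open>\<mu> i\<close> is demanded.\<close>

definition dual_basis :: "('r, 'z) ring_scheme => ('r, 'm) module => nat => (nat => 'm) => (nat => 'm => 'r) => bool"
 where "dual_basis R M n m \<mu> \<longleftrightarrow>
  (\<forall>i<n. m i \<in> car M \<and> \<mu> i \<in> lin R M) \<and>
  (\<forall>x\<in>car M. x = (\<Oplus>\<^sub>M i\<in>{..<n}. \<mu> i x \<odot>\<^sub>M m i))"

text \<open>The scalars \<open>a\<close> for which \<open>a\<close> times the identity is a finite
  sum of maps \<open>x \<mapsto> \<mu> x m\<close> form an ideal. A local basis puts its denominator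
  into this ideal, so no prime contains it.\<close>

lemma dual_basis_exists:
 fixes R :: "('r, 'z) ring_scheme" (structure) and M :: "('r, 'm) module"
 assumes M: "module R M" and loc: "\<And>p. primeideal p R ==> \<exists>f r m \<mu>. f \<notin> p \<and> local_basis R M f r m \<mu>"
 shows "\<exists>n m \<mu>. dual_basis R M n m \<mu>"
proof -
 interpret module R M by (rule M)
 define good where "good a n m \<mu> \<longleftrightarrow> a \<in> car R \<and>
  (\<forall>i<n. m i \<in> car M \<and> \<mu> i \<in> lin R M) \<and>
  (\<forall>x\<in>car M. a \<odot>\<^sub>M x = (\<Oplus>\<^sub>M i\<in>{..<n}. \<mu> i x \<odot>\<^sub>M m i))" for a and n :: nat and m \<mu>
 define J where "J = {a. \<exists>n m \<mu>. good a n m \<mu>}"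
 have JI: "a \<in> J" if "good a n m \<mu>" for a n m \<mu> using that by (auto simp: J_def)
 have add: "a \<oplus> a' \<in> J" if "a \<in> J" "a' \<in> J" for a a'
 proof -
  from that obtain n m \<mu> n' m' \<mu>' where g: "good a n m \<mu>" "good a' n' m' \<mu>'" by (auto simp: J_def)
  define m'' where "m'' i = (if i < n then m i else m' (i - n))" for i
  define \<mu>'' where "\<mu>'' i = (if i < n then \<mu> i else \<mu>' (i - n))" for i
  have mc: "m'' i \<in> car M" "\<mu>'' i \<in> lin R M" if "i < n + n'" for i
   using that g by (auto simp: good_def m''_def \<mu>''_def)
  have "(a \<oplus> a') \<odot>\<^sub>M x = (\<Oplus>\<^sub>M i\<in>{..<n + n'}. \<mu>'' i x \<odot>\<^sub>M m'' i)" if x: "x \<in> car M" for x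
  proof -
   have c: "\<mu>'' i x \<in> car R" if "i < n + n'" for i using mod_hom_closed[OF mc(2)[OF that] x] by simp
   have "(\<Oplus>\<^sub>M i\<in>{..<n + n'}. \<mu>'' i x \<odot>\<^sub>M m'' i) =
    (\<Oplus>\<^sub>M i\<in>{..<n}. \<mu>'' i x \<odot>\<^sub>M m'' i) \<oplus>\<^sub>M (\<Oplus>\<^sub>M i\<in>{..<n'}. \<mu>'' (n + i) x \<odot>\<^sub>M m'' (n + i))"
    by (rule M.finsum_add_index) (use c mc in auto)
   also have "(\<Oplus>\<^sub>M i\<in>{..<n}. \<mu>'' i x \<odot>\<^sub>M m'' i) = (\<Oplus>\<^sub>M i\<in>{..<n}. \<mu> i x \<odot>\<^sub>M m i)"
   proof (rule M.finsum_cong')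
    have "\<mu> i x \<odot>\<^sub>M m i \<in> car M" if "i < n" for i
     using c[of i] mc(1)[of i] that by (simp add: \<mu>''_def m''_def)
    then show "(\<lambda>i. \<mu> i x \<odot>\<^sub>M m i) \<in> {..<n} \<rightarrow> car M" by auto
   qed (auto simp: \<mu>''_def m''_def)
   also have "(\<Oplus>\<^sub>M i\<in>{..<n'}. \<mu>'' (n + i) x \<odot>\<^sub>M m'' (n + i)) = (\<Oplus>\<^sub>M i\<in>{..<n'}. \<mu>' i x \<odot>\<^sub>M m' i)"
    by (simp add: \<mu>''_def m''_def)
   finally show ?thesis using g x by (simp add: good_def smult_l_distr)
  qed
  then have "good (a \<oplus> a') (n + n') m'' \<mu>''" using mc g by (simp add: good_def)
  then show ?thesis by (rule JI)
 qed
 have scale: "b \<otimes> a \<in> J" if "a \<in> J" "b \<in> car R" for a b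
 proof -
  from that obtain n m \<mu> where g: "good a n m \<mu>" by (auto simp: J_def)
  have "(b \<otimes> a) \<odot>\<^sub>M x = (\<Oplus>\<^sub>M i\<in>{..<n}. (b \<otimes> \<mu> i x) \<odot>\<^sub>M m i)" if x: "x \<in> car M" for x
  proof -
   have c: "\<mu> i x \<in> car R" "m i \<in> car M" if "i < n" for i
    using g that mod_hom_closed[of "\<mu> i" R M "regular_module R" x] x by (auto simp: good_def)
   have "(b \<otimes> a) \<odot>\<^sub>M x = b \<odot>\<^sub>M (\<Oplus>\<^sub>M i\<in>{..<n}. \<mu> i x \<odot>\<^sub>M m i)"
    using g x \<open>b \<in> car R\<close> by (simp add: good_def smult_assoc1)
   also have "... = (\<Oplus>\<^sub>M i\<in>{..<n}. b \<odot>\<^sub>M (\<mu> i x \<odot>\<^sub>M m i))"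
    by (rule finsum_smult_ldistr) (use c \<open>b \<in> car R\<close> in auto)
   also have "... = (\<Oplus>\<^sub>M i\<in>{..<n}. (b \<otimes> \<mu> i x) \<odot>\<^sub>M m i)"
    using c \<open>b \<in> car R\<close> by (intro M.finsum_cong') (auto simp: smult_assoc1)
   finally show ?thesis .
  qed
  then have "good (b \<otimes> a) n m (\<lambda>i x. b \<otimes> \<mu> i x)"
   using g \<open>b \<in> car R\<close> by (auto simp: good_def intro!: R.functional_scale M)
  then show ?thesis by (rule JI)
 qed
 have Jc: "a \<in> car R" if "a \<in> J" for a using that by (auto simp: J_def good_def)
 have zero: "\<zero> \<in> J" by (rule JI[of _ 0]) (auto simp: good_def M.finsum_empty)
 have "ideal J R"
 proof (rule idealI)
  show "subgroup J (add_monoid R)"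
  proof (rule R.add.subgroupI)
   fix x assume x: "x \<in> J"
   have "\<ominus> \<one> \<otimes> x = \<ominus> x" using Jc[OF x] by (simp add: R.l_minus)
   then show "\<ominus> x \<in> J" using scale[OF x, of "\<ominus> \<one>"] by simp
  qed (use Jc zero add in auto)
 qed (use scale Jc in \<open>auto simp: R.ring_axioms R.m_comm\<close>)
 moreover have "\<exists>f\<in>J. f \<notin> p" if p: "primeideal p R" for p
 proof -
  obtain f r m \<mu> where f: "f \<notin> p" "local_basis R M f r m \<mu>" using loc[OF p] by blast
  then have "good f r m \<mu>" by (auto simp: good_def local_basis_def)
  then show ?thesis using f(1) JI by blast
 qed
 ultimately have "\<one> \<in> J" by (rule R.one_in_ideal_if_local)
 then obtain n m \<mu> where "good \<one> n m \<mu>" by (auto simp: J_def)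
 then have "dual_basis R M n m \<mu>" by (simp add: good_def dual_basis_def)
 then show ?thesis by blast
qed

section \<open>Free modules and tensor products\<close>

lemma (in abelian_monoid) finsum_neutral_superset:
 assumes "finite B" "A \<subseteq> B" "f \<in> A \<rightarrow> car G" "\<And>x. x \<in> B - A ==> f x = \<zero>"
 shows "finsum G f B = finsum G f A"
proof -
 have fA: "finite A" using assms finite_subset by blast
 have B: "B = A \<union> (B - A)" using assms(2) by blast
 have "finsum G f (A \<union> (B - A)) = finsum G f A \<oplus> finsum G f (B - A)"
  by (rule finsum_Un_disjoint) (use assms fA in auto)
 also have "finsum G f (B - A) = \<zero>" by (rule finsum_all_zero) (rule assms(4))
 finally show ?thesis using B finsum_closed[OF assms(3)] by simp
qed

context
 fixes R :: "('r, 'z) ring_scheme" (structure) and X :: "'x set"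
 assumes R: "cring R"
begin

interpretation cring R by (rule R)

abbreviation (input) "E \<equiv> free_module R X"

lemma free_module_carrier:
 "f \<in> car E \<longleftrightarrow> f \<in> X \<rightarrow>\<^sub>E car R \<and> finite {x \<in> X. f x \<noteq> \<zero>}"
 by (simp add: free_module_def)

lemma free_module_eval: "f \<in> car E ==> x \<in> X ==> f x \<in> car R"
 by (auto simp: free_module_carrier)

lemma free_module_ops:
 "\<zero>\<^sub>E = (\<lambda>x\<in>X. \<zero>)" "f \<oplus>\<^sub>E g = (\<lambda>x\<in>X. f x \<oplus> g x)" "c \<odot>\<^sub>E f = (\<lambda>x\<in>X. c \<otimes> f x)"
 by (simp_all add: free_module_def)

lemma free_module_add_closed:
 assumes "f \<in> car E" "g \<in> car E"
 shows "(\<lambda>x\<in>X. f x \<oplus> g x) \<in> car E"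
proof -
 have "{x \<in> X. (\<lambda>x\<in>X. f x \<oplus> g x) x \<noteq> \<zero>} \<subseteq> {x \<in> X. f x \<noteq> \<zero>} \<union> {x \<in> X. g x \<noteq> \<zero>}" by auto
 then have "finite {x \<in> X. (\<lambda>x\<in>X. f x \<oplus> g x) x \<noteq> \<zero>}"
  using assms by (rule_tac finite_subset) (auto simp: free_module_carrier)
 then show ?thesis using assms by (auto simp: free_module_carrier)
qed

lemma free_module_scale_closed:
 assumes "f \<in> car E" "c \<in> car R"
 shows "(\<lambda>x\<in>X. c \<otimes> f x) \<in> car E"
proof -
 have "{x \<in> X. (\<lambda>x\<in>X. c \<otimes> f x) x \<noteq> \<zero>} \<subseteq> {x \<in> X. f x \<noteq> \<zero>}" using assms(2) by auto
 then have "finite {x \<in> X. (\<lambda>x\<in>X. c \<otimes> f x) x \<noteq> \<zero>}"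
  using assms by (rule_tac finite_subset) (auto simp: free_module_carrier)
 then show ?thesis using assms by (auto simp: free_module_carrier)
qed

lemma free_module_extI:
 assumes "f \<in> extensional X" "g \<in> extensional X" "\<And>x. x \<in> X ==> f x = g x"
 shows "f = g"
 using assms by (rule extensionalityI)

lemma module_free_module: "module R E"
proof -
 have "abelian_group E"
 proof (rule abelian_groupI)
  show "\<zero>\<^sub>E \<in> car E"
   by (auto simp: free_module_carrier free_module_ops)
  fix f assume f: "f \<in> car E"
  show "\<exists>g\<in>car E. g \<oplus>\<^sub>E f = \<zero>\<^sub>E"
  proof (rule bexI)
   show "(\<lambda>x\<in>X. (\<ominus> \<one>) \<otimes> f x) \<in> car E" by (rule free_module_scale_closed[OF f]) simp
   show "(\<lambda>x\<in>X. (\<ominus> \<one>) \<otimes> f x) \<oplus>\<^sub>E f = \<zero>\<^sub>E"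
    using free_module_eval[OF f] by (auto simp: free_module_ops l_minus l_neg)
  qed
  show "\<zero>\<^sub>E \<oplus>\<^sub>E f = f"
   using f free_module_eval[OF f]
   by (intro free_module_extI) (auto simp: free_module_ops free_module_carrier PiE_iff)
 qed (use free_module_add_closed free_module_eval in \<open>auto simp: free_module_ops a_ac\<close>)
 then show ?thesis
 proof (rule moduleI[OF R])
  fix f assume f: "f \<in> car E"
  then show "\<one> \<odot>\<^sub>E f = f"
   using free_module_eval[OF f]
   by (intro free_module_extI) (auto simp: free_module_ops free_module_carrier PiE_iff)
 qed (use free_module_scale_closed free_module_eval in \<open>auto simp: free_module_ops l_distr r_distr m_assoc\<close>)
qed

lemma free_gen_carrier: "x \<in> X ==> free_gen R X x \<in> car E"
proof -
 assume "x \<in> X"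
 have "{y \<in> X. free_gen R X x y \<noteq> \<zero>} \<subseteq> {x}" by (auto simp: free_gen_def)
 then have "finite {y \<in> X. free_gen R X x y \<noteq> \<zero>}" by (rule finite_subset) simp
 then show ?thesis by (auto simp: free_module_carrier free_gen_def)
qed

lemma free_module_induct:
 assumes f: "f \<in> car E" and zero: "P \<zero>\<^sub>E"
  and step: "\<And>g c x. g \<in> car E ==> c \<in> car R ==> x \<in> X ==> P g ==> P (g \<oplus>\<^sub>E c \<odot>\<^sub>E free_gen R X x)"
 shows "P f"
proof -
 have "finite Y ==> f \<in> car E ==> {x \<in> X. f x \<noteq> \<zero>} \<subseteq> Y ==> P f" for Y f
 proof (induction Y arbitrary: f rule: finite_induct)
  case empty
  then have "f = \<zero>\<^sub>E"
   by (intro free_module_extI) (auto simp: free_module_ops free_module_carrier PiE_iff)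
  then show ?case using zero by simp
 next
  case (insert y Y)
  show ?case
  proof (cases "y \<in> X")
   case False
   then have "{x \<in> X. f x \<noteq> \<zero>} \<subseteq> Y" using insert.prems by auto
   then show ?thesis using insert by blast
  next
   case True
   define g where "g = (\<lambda>x\<in>X. if x = y then \<zero> else f x)"
   have "{x \<in> X. g x \<noteq> \<zero>} \<subseteq> {x \<in> X. f x \<noteq> \<zero>}" by (auto simp: g_def)
   then have fin: "finite {x \<in> X. g x \<noteq> \<zero>}"
    using insert.prems(1) by (auto simp: free_module_carrier intro: finite_subset)
   have g: "g \<in> car E"
    using fin free_module_eval[OF insert.prems(1)] by (auto simp: free_module_carrier g_def)
   have "{x \<in> X. g x \<noteq> \<zero>} \<subseteq> Y" using insert.prems(2) by (auto simp: g_def)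
   then have "P g" using insert.IH g by blast
   then have "P (g \<oplus>\<^sub>E f y \<odot>\<^sub>E free_gen R X y)"
    using step g True free_module_eval[OF insert.prems(1) True] by blast
   also have "g \<oplus>\<^sub>E f y \<odot>\<^sub>E free_gen R X y = f"
    using insert.prems(1) free_module_eval[OF insert.prems(1)] True
    by (intro free_module_extI)
     (auto simp: free_module_ops g_def free_gen_def free_module_carrier PiE_iff)
   finally show ?thesis .
  qed
 qed
 then show ?thesis using f by (auto simp: free_module_carrier)
qed

lemma free_module_hom_eqI:
 assumes "f \<in> mod_hom R E N" "g \<in> mod_hom R E N" "module R N"
  and "\<And>x. x \<in> X ==> f (free_gen R X x) = g (free_gen R X x)" and t: "t \<in> car E"
 shows "f t = g t"
proof -
 interpret EM: module R E by (rule module_free_module)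
 show ?thesis
  using t
 proof (rule free_module_induct)
  show "f \<zero>\<^sub>E = g \<zero>\<^sub>E"
   using mod_hom_zero[OF module_free_module assms(3,1)] mod_hom_zero[OF module_free_module assms(3,2)] by simp
  fix h c x assume h: "h \<in> car E" "c \<in> car R" "x \<in> X" "f h = g h"
  note gen = free_gen_carrier[OF h(3)]
  have "c \<odot>\<^sub>E free_gen R X x \<in> car E" using EM.smult_closed[OF h(2) gen] .
  then show "f (h \<oplus>\<^sub>E c \<odot>\<^sub>E free_gen R X x) = g (h \<oplus>\<^sub>E c \<odot>\<^sub>E free_gen R X x)"
   using mod_hom_add[OF assms(1) h(1)] mod_hom_add[OF assms(2) h(1)] h(4)
    mod_hom_smult[OF assms(1) h(2) gen] mod_hom_smult[OF assms(2) h(2) gen] assms(4)[OF h(3)]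
   by simp
 qed
qed

definition free_lift :: "('r, 'n) module => ('x => 'n) => ('x => 'r) => 'n" where
 "free_lift N \<beta> f = (\<Oplus>\<^sub>N x\<in>{x \<in> X. f x \<noteq> \<zero>}. f x \<odot>\<^sub>N \<beta> x)"

lemma free_lift_hom:
 assumes N: "module R N" and \<beta>: "\<And>x. x \<in> X ==> \<beta> x \<in> car N"
 shows "free_lift N \<beta> \<in> mod_hom R E N"
proof -
 interpret N: module R N by (rule N)
 have super: "free_lift N \<beta> f = (\<Oplus>\<^sub>N x\<in>Y. f x \<odot>\<^sub>N \<beta> x)"
  if "f \<in> car E" "finite Y" "Y \<subseteq> X" "{x \<in> X. f x \<noteq> \<zero>} \<subseteq> Y" for f Y
  unfolding free_lift_def
  by (rule N.M.finsum_neutral_superset[symmetric]) (use that \<beta> free_module_eval[OF that(1)] in auto)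
 have supp: "finite {x \<in> X. f x \<noteq> \<zero>}" if "f \<in> car E" for f
  using that by (simp add: free_module_carrier)
 show ?thesis
 proof (rule mod_homI)
  fix f g assume f: "f \<in> car E" and g: "g \<in> car E"
  show "free_lift N \<beta> f \<in> car N"
   unfolding free_lift_def using \<beta> free_module_eval[OF f] by (auto intro!: N.M.finsum_closed)
  define Y where "Y = {x \<in> X. f x \<noteq> \<zero>} \<union> {x \<in> X. g x \<noteq> \<zero>}"
  have Y: "finite Y" "Y \<subseteq> X" using supp f g by (auto simp: Y_def)
  have fg: "f \<oplus>\<^sub>E g \<in> car E" unfolding free_module_ops by (rule free_module_add_closed[OF f g])
  have "free_lift N \<beta> (f \<oplus>\<^sub>E g) = (\<Oplus>\<^sub>N x\<in>Y. (f \<oplus>\<^sub>E g) x \<odot>\<^sub>N \<beta> x)"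
   by (rule super[OF fg Y]) (auto simp: Y_def free_module_ops)
  also have "... = (\<Oplus>\<^sub>N x\<in>Y. f x \<odot>\<^sub>N \<beta> x \<oplus>\<^sub>N g x \<odot>\<^sub>N \<beta> x)"
   using Y \<beta> free_module_eval[OF f] free_module_eval[OF g]
   by (intro N.M.finsum_cong') (auto simp: free_module_ops N.smult_l_distr subset_iff)
  also have "... = (\<Oplus>\<^sub>N x\<in>Y. f x \<odot>\<^sub>N \<beta> x) \<oplus>\<^sub>N (\<Oplus>\<^sub>N x\<in>Y. g x \<odot>\<^sub>N \<beta> x)"
   using Y \<beta> free_module_eval[OF f] free_module_eval[OF g]
   by (intro N.M.finsum_addf) (auto simp: subset_iff)
  also have "... = free_lift N \<beta> f \<oplus>\<^sub>N free_lift N \<beta> g"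
   using super[OF f Y] super[OF g Y] by (simp add: Y_def)
  finally show "free_lift N \<beta> (f \<oplus>\<^sub>E g) = free_lift N \<beta> f \<oplus>\<^sub>N free_lift N \<beta> g" .
 next
  fix c f assume c: "c \<in> car R" and f: "f \<in> car E"
  define Y where "Y = {x \<in> X. f x \<noteq> \<zero>}"
  have Y: "finite Y" "Y \<subseteq> X" using supp f by (auto simp: Y_def)
  have cf: "c \<odot>\<^sub>E f \<in> car E" unfolding free_module_ops by (rule free_module_scale_closed[OF f c])
  have "free_lift N \<beta> (c \<odot>\<^sub>E f) = (\<Oplus>\<^sub>N x\<in>Y. (c \<odot>\<^sub>E f) x \<odot>\<^sub>N \<beta> x)"
   by (rule super[OF cf Y]) (use c in \<open>auto simp: Y_def free_module_ops\<close>)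
  also have "... = (\<Oplus>\<^sub>N x\<in>Y. c \<odot>\<^sub>N (f x \<odot>\<^sub>N \<beta> x))"
   using Y \<beta> free_module_eval[OF f] c
   by (intro N.M.finsum_cong') (auto simp: free_module_ops N.smult_assoc1 subset_iff)
  also have "... = c \<odot>\<^sub>N free_lift N \<beta> f"
   unfolding free_lift_def Y_def[symmetric]
   by (rule N.finsum_smult_ldistr[symmetric])
    (use Y \<beta> free_module_eval[OF f] c in \<open>auto simp: subset_iff\<close>)
  finally show "free_lift N \<beta> (c \<odot>\<^sub>E f) = c \<odot>\<^sub>N free_lift N \<beta> f" .
 qed
qed

lemma free_lift_gen:
 assumes N: "module R N" and \<beta>: "\<And>x. x \<in> X ==> \<beta> x \<in> car N" and x: "x \<in> X"
 shows "free_lift N \<beta> (free_gen R X x) = \<beta> x"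
proof -
 interpret N: module R N by (rule N)
 \<comment> \<open>Over the zero ring a free generator has empty support and its lift is the empty
   sum; the value \<open>\<beta> x\<close> must then be zero too.\<close>
 have trivial: "\<beta> x = \<zero>\<^sub>N" if "\<one> = \<zero>"
  using N.smult_one[OF \<beta>[OF x]] N.smult_l_null[OF \<beta>[OF x]] that by simp
 have "free_lift N \<beta> (free_gen R X x) = (\<Oplus>\<^sub>N y\<in>{x}. free_gen R X x y \<odot>\<^sub>N \<beta> y)"
  unfolding free_lift_def
  by (rule N.M.finsum_neutral_superset[symmetric])
   (use x \<beta> trivial in \<open>auto simp: free_gen_def\<close>)
 also have "... = \<one> \<odot>\<^sub>N \<beta> x"
  using x \<beta> by (simp add: free_gen_def N.M.finsum_insert N.M.finsum_empty del: N.smult_one)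
 also have "... = \<beta> x" using x \<beta> by simp
 finally show ?thesis .
qed

end

text \<open>\<open>free_map\<close> adds coefficients over the fibres of \<open>g\<close>, and these
  are the coordinates of the lift. The universal property thereby becomes available for
  \<open>tensor_map\<close>.\<close>

lemma free_map_eq_free_lift:
 assumes R: "cring R" and g: "\<And>x. x \<in> X ==> g x \<in> Y" and f: "f \<in> car (free_module R X)"
 shows "free_map R X Y g f = free_lift R X (free_module R Y) (\<lambda>x. free_gen R Y (g x)) f"
proof -
 interpret cring R by (rule R)
 interpret Y: module R "free_module R Y" by (rule module_free_module[OF R])
 let ?l = "free_lift R X (free_module R Y) (\<lambda>x. free_gen R Y (g x))"
 define K where "K = {x \<in> X. f x \<noteq> \<zero>\<^sub>R}"
 have K: "finite K" "K \<subseteq> X" using f by (auto simp: K_def free_module_carrier[OF R])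
 have fc: "f x \<in> car R" if "x \<in> X" for x by (rule free_module_eval[OF R f that])
 have gen: "free_gen R Y (g x) \<in> car (free_module R Y)" if "x \<in> X" for x
  using free_gen_carrier[OF R g[OF that]] .
 have l: "?l \<in> mod_hom R (free_module R X) (free_module R Y)"
  by (rule free_lift_hom[OF R Y.module_axioms gen])
 have val: "?l f y = finsum R f {x \<in> X. f x \<noteq> \<zero>\<^sub>R \<and> g x = y}" if y: "y \<in> Y" for y
 proof -
  have ev: "(\<lambda>h. h y) \<in> lin R (free_module R Y)"
   using y by (intro mod_homI) (auto simp: free_module_ops[OF R] free_module_eval[OF R])
  have "?l f y = (\<Oplus>\<^sub>R x\<in>K. (f x \<odot>\<^bsub>free_module R Y\<^esub> free_gen R Y (g x)) y)"
   unfolding free_lift_def[OF R] K_def[symmetric]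
   by (rule functional_finsum[OF Y.module_axioms ev K(1)]) (use K gen fc in auto)
  also have "... = (\<Oplus>\<^sub>R x\<in>K. if g x = y then f x else \<zero>\<^sub>R)"
   using y K fc by (intro finsum_cong') (auto simp: free_module_ops[OF R] free_gen_def subset_iff)
  also have "... = (\<Oplus>\<^sub>R x\<in>{x \<in> K. g x = y}. if g x = y then f x else \<zero>\<^sub>R)"
   by (rule finsum_neutral_superset) (use K fc in auto)
  also have "... = finsum R f {x \<in> X. f x \<noteq> \<zero>\<^sub>R \<and> g x = y}"
   using fc by (intro finsum_cong') (auto simp: K_def)
  finally show ?thesis .
 qed
 have "?l f \<in> car (free_module R Y)" by (rule mod_hom_closed[OF l f])
 then show ?thesis
  using val by (intro extensionalityI[of _ Y]) (auto simp: free_map_def free_module_carrier[OF R] PiE_iff)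
qed

section \<open>Tensor products by generators and relations\<close>

lemma submodule_submod_span:
 assumes "module R M" "S \<subseteq> car M"
 shows "submodule (submod_span R M S) R M" "S \<subseteq> submod_span R M S"
  "submodule H R M ==> S \<subseteq> H ==> submod_span R M S \<subseteq> H"
proof -
 interpret module R M by fact
 show "submodule (submod_span R M S) R M"
 proof (rule submoduleI)
  show "submod_span R M S \<subseteq> car M"
   using carrier_is_submodule assms(2) by (auto simp: submod_span_def)
 qed (auto simp: submod_span_def submodule_closed)
qed (auto simp: submod_span_def)

definition tens :: "('k, 'z) ring_scheme => ('k, 'm) module => ('k, 'n) module => 'm => 'n => ('m \<times> 'n => 'k) set"
 where "tens k M N m n = tensor_rels k M N +>\<^bsub>free_module k (car M \<times> car N)\<^esub>
  free_gen k (car M \<times> car N) (m, n)"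

context
 fixes k :: "('k, 'z) ring_scheme" and M :: "('k, 'm) module" and N :: "('k, 'n) module"
 assumes M: "module k M" and N: "module k N"
begin

interpretation M: module k M by (rule M)
interpretation N: module k N by (rule N)

private abbreviation "X \<equiv> car M \<times> car N"
private abbreviation "FX \<equiv> free_module k X"
private abbreviation "e m n \<equiv> free_gen k X (m, n)"

private definition "rel_gens =
  {e (m \<oplus>\<^sub>M m') n \<ominus>\<^sub>FX (e m n \<oplus>\<^sub>FX e m' n) |m m' n.
     m \<in> car M \<and> m' \<in> car M \<and> n \<in> car N} \<union>
    {e m (n \<oplus>\<^sub>N n') \<ominus>\<^sub>FX (e m n \<oplus>\<^sub>FX e m n') |m n n'.
     m \<in> car M \<and> n \<in> car N \<and> n' \<in> car N} \<union>
    {e (c \<odot>\<^sub>M m) n \<ominus>\<^sub>FX c \<odot>\<^sub>FX e m n |c m n.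
     c \<in> car k \<and> m \<in> car M \<and> n \<in> car N} \<union>
    {e m (c \<odot>\<^sub>N n) \<ominus>\<^sub>FX c \<odot>\<^sub>FX e m n |c m n.
     c \<in> car k \<and> m \<in> car M \<and> n \<in> car N}"

private lemma rels: "tensor_rels k M N = submod_span k FX rel_gens"
 by (simp add: tensor_rels_def rel_gens_def Let_def)

private lemma kc: "cring k" by (rule M.R.is_cring)

interpretation FX: module k FX by (rule module_free_module[OF kc])

private lemma gen: "m \<in> car M ==> n \<in> car N ==> e m n \<in> car FX"
 by (rule free_gen_carrier[OF kc]) simp

private lemma rel_gens_carrier: "rel_gens \<subseteq> car FX"
 unfolding rel_gens_def by (auto intro!: FX.M.minus_closed FX.M.a_closed FX.smult_closed gen)

lemma submodule_tensor_rels: "submodule (tensor_rels k M N) k FX"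
 unfolding rels by (rule submodule_submod_span(1)[OF FX.module_axioms rel_gens_carrier])

lemma tensor_proj_hom: "(\<lambda>f. tensor_rels k M N +>\<^bsub>FX\<^esub> f) \<in> mod_hom k FX (tensor k M N)"
 unfolding tensor_def by (rule quot_module_hom[OF FX.module_axioms submodule_tensor_rels])

lemma module_tensor: "module k (tensor k M N)"
 unfolding tensor_def by (rule module_quot_module[OF FX.module_axioms submodule_tensor_rels])

lemma tens_closed: "m \<in> car M ==> n \<in> car N ==> tens k M N m n \<in> car (tensor k M N)"
 unfolding tens_def using mod_hom_closed[OF tensor_proj_hom gen] .

private lemma rel_eq:
 assumes "x \<ominus>\<^sub>FX y \<in> rel_gens" "x \<in> car FX" "y \<in> car FX"
 shows "tensor_rels k M N +>\<^bsub>FX\<^esub> x = tensor_rels k M N +>\<^bsub>FX\<^esub> y"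
proof -
 have "x \<ominus>\<^sub>FX y \<in> tensor_rels k M N"
  unfolding rels using submodule_submod_span(2)[OF FX.module_axioms rel_gens_carrier] assms(1) by blast
 then show ?thesis using coset_eq_iff[OF FX.module_axioms submodule_tensor_rels assms(2,3)] by simp
qed

lemma tens_add_left:
 assumes "m \<in> car M" "m' \<in> car M" "n \<in> car N"
 shows "tens k M N (m \<oplus>\<^sub>M m') n = tens k M N m n \<oplus>\<^bsub>tensor k M N\<^esub> tens k M N m' n"
proof -
 have "tens k M N (m \<oplus>\<^sub>M m') n = tensor_rels k M N +>\<^bsub>FX\<^esub> (e m n \<oplus>\<^sub>FX e m' n)"
  unfolding tens_def
  by (rule rel_eq, unfold rel_gens_def, use assms in blast)
   (use assms gen in \<open>auto intro!: FX.M.a_closed\<close>)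
 then show ?thesis unfolding tens_def using mod_hom_add[OF tensor_proj_hom gen gen] assms by simp
qed

lemma tens_add_right:
 assumes "m \<in> car M" "n \<in> car N" "n' \<in> car N"
 shows "tens k M N m (n \<oplus>\<^sub>N n') = tens k M N m n \<oplus>\<^bsub>tensor k M N\<^esub> tens k M N m n'"
proof -
 have "tens k M N m (n \<oplus>\<^sub>N n') = tensor_rels k M N +>\<^bsub>FX\<^esub> (e m n \<oplus>\<^sub>FX e m n')"
  unfolding tens_def
  by (rule rel_eq, unfold rel_gens_def, use assms in blast)
   (use assms gen in \<open>auto intro!: FX.M.a_closed\<close>)
 then show ?thesis unfolding tens_def using mod_hom_add[OF tensor_proj_hom gen gen] assms by simp
qed

lemma tens_smult_left:
 assumes "c \<in> car k" "m \<in> car M" "n \<in> car N"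
 shows "tens k M N (c \<odot>\<^sub>M m) n = c \<odot>\<^bsub>tensor k M N\<^esub> tens k M N m n"
proof -
 have "tens k M N (c \<odot>\<^sub>M m) n = tensor_rels k M N +>\<^bsub>FX\<^esub> (c \<odot>\<^sub>FX e m n)"
  unfolding tens_def
  by (rule rel_eq, unfold rel_gens_def, use assms in blast)
   (use assms gen in \<open>auto intro!: FX.smult_closed\<close>)
 then show ?thesis unfolding tens_def using mod_hom_smult[OF tensor_proj_hom assms(1) gen] assms by simp
qed

lemma tens_smult_right:
 assumes "c \<in> car k" "m \<in> car M" "n \<in> car N"
 shows "tens k M N m (c \<odot>\<^sub>N n) = c \<odot>\<^bsub>tensor k M N\<^esub> tens k M N m n"
proof -
 have "tens k M N m (c \<odot>\<^sub>N n) = tensor_rels k M N +>\<^bsub>FX\<^esub> (c \<odot>\<^sub>FX e m n)"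
  unfolding tens_def
  by (rule rel_eq, unfold rel_gens_def, use assms in blast)
   (use assms gen in \<open>auto intro!: FX.smult_closed\<close>)
 then show ?thesis unfolding tens_def using mod_hom_smult[OF tensor_proj_hom assms(1) gen] assms by simp
qed

text \<open>Coefficients can be absorbed into the first factor, so sums of pure tensors exhaust the
  tensor product.\<close>

lemma tensor_induct:
 assumes t: "t \<in> car (tensor k M N)" and zero: "P \<zero>\<^bsub>tensor k M N\<^esub>"
  and tens: "\<And>m n. m \<in> car M ==> n \<in> car N ==> P (tens k M N m n)"
  and add: "\<And>s t. s \<in> car (tensor k M N) ==> t \<in> car (tensor k M N) ==> P s ==> P t ==>
   P (s \<oplus>\<^bsub>tensor k M N\<^esub> t)"
 shows "P t"
proof -
 let ?q = "\<lambda>f. tensor_rels k M N +>\<^bsub>FX\<^esub> f"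
 have "P (?q f)" if f: "f \<in> car FX" for f
  using kc f
 proof (rule free_module_induct)
  show "P (?q \<zero>\<^sub>FX)"
   using zero mod_hom_zero[OF FX.module_axioms module_tensor tensor_proj_hom] by simp
  fix g c x assume g: "g \<in> car FX" "c \<in> car k" "x \<in> X" "P (?q g)"
  obtain m n where x: "x = (m, n)" "m \<in> car M" "n \<in> car N" using g(3) by blast
  have ce: "c \<odot>\<^sub>FX e m n \<in> car FX" using g(2) gen x by simp
  have "?q (c \<odot>\<^sub>FX e m n) = tens k M N (c \<odot>\<^sub>M m) n"
   using tens_smult_left[OF g(2) x(2,3)] mod_hom_smult[OF tensor_proj_hom g(2) gen[OF x(2,3)]]
   by (simp add: tens_def)
  then have "P (?q (c \<odot>\<^sub>FX e m n))" using tens[of "c \<odot>\<^sub>M m" n] g(2) x by simp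
  then show "P (?q (g \<oplus>\<^sub>FX c \<odot>\<^sub>FX free_gen k X x))"
   using add[OF mod_hom_closed[OF tensor_proj_hom g(1)] mod_hom_closed[OF tensor_proj_hom ce] g(4)]
    mod_hom_add[OF tensor_proj_hom g(1) ce] by (simp add: x(1))
 qed
 moreover obtain f where "f \<in> car FX" "t = ?q f"
  using t by (auto simp: tensor_def carrier_quot_module)
 ultimately show ?thesis by blast
qed

text \<open>Bilinearity says that the lift to the free module kills the generating relations. Its
  kernel is a submodule, hence contains their span, and the lift descends.\<close>

lemma tensor_lift:
 assumes P: "module k P"
  and closed: "\<And>m n. m \<in> car M ==> n \<in> car N ==> \<beta> m n \<in> car P"
  and addl: "\<And>m m' n. m \<in> car M ==> m' \<in> car M ==> n \<in> car N ==>
   \<beta> (m \<oplus>\<^sub>M m') n = \<beta> m n \<oplus>\<^sub>P \<beta> m' n"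
  and addr: "\<And>m n n'. m \<in> car M ==> n \<in> car N ==> n' \<in> car N ==>
   \<beta> m (n \<oplus>\<^sub>N n') = \<beta> m n \<oplus>\<^sub>P \<beta> m n'"
  and smultl: "\<And>c m n. c \<in> car k ==> m \<in> car M ==> n \<in> car N ==>
   \<beta> (c \<odot>\<^sub>M m) n = c \<odot>\<^sub>P \<beta> m n"
  and smultr: "\<And>c m n. c \<in> car k ==> m \<in> car M ==> n \<in> car N ==>
   \<beta> m (c \<odot>\<^sub>N n) = c \<odot>\<^sub>P \<beta> m n"
 shows "\<exists>h \<in> mod_hom k (tensor k M N) P. \<forall>m\<in>car M. \<forall>n\<in>car N. h (tens k M N m n) = \<beta> m n"
proof -
 interpret P: module k P by (rule P)
 define lam where "lam = free_lift k X P (\<lambda>(m, n). \<beta> m n)"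
 have b: "(\<lambda>(m, n). \<beta> m n) x \<in> car P" if "x \<in> X" for x using closed that by auto
 have hom: "lam \<in> mod_hom k FX P" unfolding lam_def by (rule free_lift_hom[OF kc P b])
 have val: "lam (e m n) = \<beta> m n" if "m \<in> car M" "n \<in> car N" for m n
  unfolding lam_def using free_lift_gen[OF kc P b, where x = "(m, n)"] that by simp
 define K where "K = {f \<in> car FX. lam f = \<zero>\<^sub>P}"
 have K: "submodule K k FX"
  by (rule FX.submoduleI)
   (auto simp: K_def mod_hom_zero[OF FX.module_axioms P hom] mod_hom_uminus[OF FX.module_axioms P hom]
    mod_hom_add[OF hom] mod_hom_smult[OF hom])
 have diff: "x \<ominus>\<^sub>FX y \<in> K" if "x \<in> car FX" "y \<in> car FX" "lam x = lam y" for x y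
  using that mod_hom_minus[OF FX.module_axioms P hom that(1,2)] mod_hom_closed[OF hom]
  by (simp add: K_def P.M.right_minus_eq)
 have "rel_gens \<subseteq> K"
  unfolding rel_gens_def
  by (auto intro!: diff gen FX.M.a_closed FX.smult_closed
   simp: mod_hom_add[OF hom] mod_hom_smult[OF hom] gen val addl addr smultl smultr)
 then have "tensor_rels k M N \<subseteq> K"
  unfolding rels by (intro submodule_submod_span(3)[OF FX.module_axioms rel_gens_carrier K])
 then have "lam x = \<zero>\<^sub>P" if "x \<in> tensor_rels k M N" for x using that by (auto simp: K_def)
 from quot_module_lift[OF FX.module_axioms P submodule_tensor_rels hom this]
 obtain g where "g \<in> mod_hom k (tensor k M N) P"
  "\<And>x. x \<in> car FX ==> g (tensor_rels k M N +>\<^bsub>FX\<^esub> x) = lam x"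
  unfolding tensor_def by blast
 then show ?thesis by (intro bexI[of _ g]) (auto simp: tens_def gen val)
qed

lemma tensor_hom_eqI:
 assumes P: "module k P" and f: "f \<in> mod_hom k (tensor k M N) P" and g: "g \<in> mod_hom k (tensor k M N) P"
  and eq: "\<And>m n. m \<in> car M ==> n \<in> car N ==> f (tens k M N m n) = g (tens k M N m n)"
  and t: "t \<in> car (tensor k M N)"
 shows "f t = g t"
 using t
proof (rule tensor_induct)
 show "f \<zero>\<^bsub>tensor k M N\<^esub> = g \<zero>\<^bsub>tensor k M N\<^esub>"
  using mod_hom_zero[OF module_tensor P f] mod_hom_zero[OF module_tensor P g] by simp
qed (simp_all add: eq mod_hom_add[OF f] mod_hom_add[OF g])

end

text \<open>\<open>tensor_map\<close> is a union over representatives in the free module. It is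
  compared with the map \<open>h\<close> from the universal property: both agree on every
  representative, so the union has a single member.\<close>

lemma tensor_map_hom:
 fixes k :: "('k, 'z) ring_scheme" and M :: "('k, 'm) module" and N :: "('k, 'n) module"
  and N' :: "('k, 'p) module"
 assumes M: "module k M" and N: "module k N" and N': "module k N'" and v: "v \<in> mod_hom k N N'"
 shows "tensor_map k M N N' v \<in> mod_hom k (tensor k M N) (tensor k M N')"
  and "\<And>m n. m \<in> car M ==> n \<in> car N ==> tensor_map k M N N' v (tens k M N m n) = tens k M N' m (v n)"
proof -
 interpret M: module k M by (rule M)
 have kc: "cring k" by (rule M.R.is_cring)
 let ?X = "car M \<times> car N" and ?Y = "car M \<times> car N'"
 let ?FX = "free_module k ?X" and ?FY = "free_module k ?Y"
 let ?q = "\<lambda>f. tensor_rels k M N +>\<^bsub>?FX\<^esub> f" and ?q' = "\<lambda>f. tensor_rels k M N' +>\<^bsub>?FY\<^esub> f"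
 interpret FX: module k ?FX by (rule module_free_module[OF kc])
 interpret FY: module k ?FY by (rule module_free_module[OF kc])
 interpret T: module k "tensor k M N" by (rule module_tensor[OF M N])
 interpret T': module k "tensor k M N'" by (rule module_tensor[OF M N'])
 interpret H: abelian_subgroup "tensor_rels k M N" ?FX
  by (rule FX.submodule_abelian_subgroup[OF submodule_tensor_rels[OF M N]])
 have vc: "v n \<in> car N'" if "n \<in> car N" for n by (rule mod_hom_closed[OF v that])
 have "\<exists>h \<in> mod_hom k (tensor k M N) (tensor k M N').
   \<forall>m\<in>car M. \<forall>n\<in>car N. h (tens k M N m n) = tens k M N' m (v n)"
  by (rule tensor_lift[OF M N T'.module_axioms])
   (simp_all add: vc tens_closed[OF M N'] tens_add_left[OF M N'] tens_add_right[OF M N']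
    tens_smult_left[OF M N'] tens_smult_right[OF M N'] mod_hom_add[OF v] mod_hom_smult[OF v])
 then obtain h where h: "h \<in> mod_hom k (tensor k M N) (tensor k M N')"
  and hv: "\<And>m n. m \<in> car M ==> n \<in> car N ==> h (tens k M N m n) = tens k M N' m (v n)" by blast
 let ?g = "\<lambda>(m, n). (m, v n)"
 have g: "?g x \<in> ?Y" if "x \<in> ?X" for x using that vc by auto
 let ?l = "free_lift k ?X ?FY (\<lambda>x. free_gen k ?Y (?g x))"
 have gen: "free_gen k ?Y (?g x) \<in> car ?FY" if "x \<in> ?X" for x
  by (rule free_gen_carrier[OF kc g[OF that]])
 have l: "?l \<in> mod_hom k ?FX ?FY" by (rule free_lift_hom[OF kc FY.module_axioms gen])
 have agree: "?q' (free_map k ?X ?Y ?g f) = h (?q f)" if f: "f \<in> car ?FX" for f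
 proof -
  have "?q' (?l f) = h (?q f)"
  proof (rule free_module_hom_eqI[OF kc _ _ T'.module_axioms _ f])
   show "(\<lambda>f. ?q' (?l f)) \<in> mod_hom k ?FX (tensor k M N')"
    by (rule mod_hom_comp[OF l tensor_proj_hom[OF M N']])
   show "(\<lambda>f. h (?q f)) \<in> mod_hom k ?FX (tensor k M N')"
    by (rule mod_hom_comp[OF tensor_proj_hom[OF M N] h])
   fix x assume x: "x \<in> ?X"
   then obtain m n where mn: "x = (m, n)" "m \<in> car M" "n \<in> car N" by blast
   show "?q' (?l (free_gen k ?X x)) = h (?q (free_gen k ?X x))"
    using free_lift_gen[OF kc FY.module_axioms gen x] hv[OF mn(2,3)] by (simp add: mn(1) tens_def)
  qed
  then show ?thesis using free_map_eq_free_lift[OF kc g f] by simp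
 qed
 have eq: "tensor_map k M N N' v T = h T" if T: "T \<in> car (tensor k M N)" for T
 proof -
  obtain f where f: "f \<in> car ?FX" "T = ?q f" using T by (auto simp: tensor_def carrier_quot_module)
  have "?q' (free_map k ?X ?Y ?g f') = h T" if f': "f' \<in> T" for f'
  proof -
   have "f' \<in> car ?FX" using H.a_elemrcos_carrier[OF f(1)] f' f(2) by blast
   moreover have "?q f' = T" using H.a_repr_independence'[OF _ f(1)] f' f(2) by blast
   ultimately show ?thesis using agree by simp
  qed
  moreover have "f \<in> T" unfolding f(2) by (rule H.a_rcos_self[OF f(1)])
  ultimately show ?thesis unfolding tensor_map_def by (intro UN_constant_eq) auto
 qed
 show "tensor_map k M N N' v \<in> mod_hom k (tensor k M N) (tensor k M N')"
  by (rule mod_hom_cong[OF T.module_axioms h]) (simp add: eq)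
 show "tensor_map k M N N' v (tens k M N m n) = tens k M N' m (v n)" if "m \<in> car M" "n \<in> car N" for m n
  using eq[OF tens_closed[OF M N that]] hv[OF that] by simp
qed

subsection \<open>Tensor products with an \<open>A\<close>-module\<close>

lemma tensor_alg_simps [simp]:
 "car (tensor_alg k A M N) = car (tensor k M (restrict_scalars A N))"
 "zero (tensor_alg k A M N) = zero (tensor k M (restrict_scalars A N))"
 "add (tensor_alg k A M N) = add (tensor k M (restrict_scalars A N))"
 "a \<odot>\<^bsub>tensor_alg k A M N\<^esub> t =
  tensor_map k M (restrict_scalars A N) (restrict_scalars A N) (\<lambda>n. a \<odot>\<^sub>N n) t"
 by (simp_all add: tensor_alg_def Let_def)

lemma smult_mod_hom:
 assumes "algebra k A" "module A N" "a \<in> car A"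
 shows "(\<lambda>n. a \<odot>\<^sub>N n) \<in> mod_hom k (restrict_scalars A N) (restrict_scalars A N)"
proof -
 interpret A: algebra k A by fact
 interpret N: module A N by fact
 show ?thesis
  by (rule mod_homI) (use assms(3) N.smult_lcomm in \<open>auto simp: N.smult_r_distr\<close>)
qed

context
 fixes k :: "('k, 'z) ring_scheme" and A :: "('k, 'a) module" and M :: "('k, 'm) module"
  and N :: "('a, 'n) module"
 assumes A: "algebra k A" and M: "module k M" and N: "module A N"
begin

interpretation A: algebra k A by (rule A)
interpretation M: module k M by (rule M)
interpretation N: module A N by (rule N)

private abbreviation "Nk \<equiv> restrict_scalars A N"
private abbreviation "T \<equiv> tensor k M Nk"
private abbreviation "TA \<equiv> tensor_alg k A M N"

private lemma Nk: "module k Nk" by (rule module_restrict_scalars[OF A N])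

interpretation T: module k T by (rule module_tensor[OF M Nk])

abbreviation (input) ten :: "'m => 'n => ('m \<times> 'n => 'k) set" where
 "ten \<equiv> tens k M Nk"

lemma ten_closed: "m \<in> car M ==> n \<in> car N ==> ten m n \<in> car TA"
 using tens_closed[OF M Nk] by simp

lemma ten_add_left: "m \<in> car M ==> m' \<in> car M ==> n \<in> car N ==>
  ten (m \<oplus>\<^sub>M m') n = ten m n \<oplus>\<^sub>TA ten m' n"
 using tens_add_left[OF M Nk] by simp

lemma ten_add_right: "m \<in> car M ==> n \<in> car N ==> n' \<in> car N ==>
  ten m (n \<oplus>\<^sub>N n') = ten m n \<oplus>\<^sub>TA ten m n'"
 using tens_add_right[OF M Nk] by simp

lemma ten_smult: "a \<in> car A ==> m \<in> car M ==> n \<in> car N ==>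
  a \<odot>\<^sub>TA ten m n = ten m (a \<odot>\<^sub>N n)"
 using tensor_map_hom(2)[OF M Nk Nk smult_mod_hom[OF A N]] by simp

private lemma sm: "a \<in> car A ==> (\<lambda>t. a \<odot>\<^sub>TA t) \<in> mod_hom k T T"
 using tensor_map_hom(1)[OF M Nk Nk smult_mod_hom[OF A N]] by simp

text \<open>Each axiom for the action of \<open>A\<close> is an identity between
  \<open>k\<close>-linear maps and is checked on pure tensors.\<close>

lemma module_tensor_alg: "module A TA"
proof -
 have grp: "abelian_group TA" by (rule abelian_group_cong[OF T.M.abelian_group_axioms]) simp_all
 show ?thesis
 proof (rule moduleI[OF A.M_cring grp])
  show "\<one>\<^sub>A \<odot>\<^sub>TA x = x" if "x \<in> car TA" for x
   using that mod_hom_add[OF sm[OF A.one_closed]] mod_hom_zero[OF T.module_axioms T.module_axioms sm[OF A.one_closed]]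
   by (intro tensor_induct[OF M Nk, of x "\<lambda>x. \<one>\<^sub>A \<odot>\<^sub>TA x = x"]) (simp_all add: ten_smult del: tensor_alg_simps(4))
 next
  fix a x assume a: "a \<in> car A" and x: "x \<in> car TA"
  show "a \<odot>\<^sub>TA x \<in> car TA" using mod_hom_closed[OF sm[OF a]] x by simp
  fix b assume b: "b \<in> car A"
  show "(a \<oplus>\<^sub>A b) \<odot>\<^sub>TA x = a \<odot>\<^sub>TA x \<oplus>\<^sub>TA b \<odot>\<^sub>TA x"
  proof -
   have "(\<lambda>t. a \<odot>\<^sub>TA t \<oplus>\<^sub>T b \<odot>\<^sub>TA t) \<in> mod_hom k T T"
    by (rule mod_hom_sum2[OF T.module_axioms T.module_axioms sm[OF a] sm[OF b]])
   then have "(a \<oplus>\<^sub>A b) \<odot>\<^sub>TA x = a \<odot>\<^sub>TA x \<oplus>\<^sub>T b \<odot>\<^sub>TA x"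
    by (rule tensor_hom_eqI[OF M Nk T.module_axioms sm[OF A.a_closed[OF a b]]])
     (use a b x in \<open>simp_all add: ten_smult N.smult_l_distr ten_add_right del: tensor_alg_simps(4)\<close>)
   then show ?thesis by simp
  qed
  show "(a \<otimes>\<^sub>A b) \<odot>\<^sub>TA x = a \<odot>\<^sub>TA (b \<odot>\<^sub>TA x)"
   by (rule tensor_hom_eqI[OF M Nk T.module_axioms sm[OF A.m_closed[OF a b]] mod_hom_comp[OF sm[OF b] sm[OF a]]])
    (use a b x in \<open>simp_all add: ten_smult N.smult_assoc1 del: tensor_alg_simps(4)\<close>)
  fix y assume y: "y \<in> car TA"
  show "a \<odot>\<^sub>TA (x \<oplus>\<^sub>TA y) = a \<odot>\<^sub>TA x \<oplus>\<^sub>TA a \<odot>\<^sub>TA y"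
   using mod_hom_add[OF sm[OF a]] x y by simp
 qed
qed

lemma ten_smult_left: "c \<in> car k ==> m \<in> car M ==> n \<in> car N ==>
  ten (c \<odot>\<^sub>M m) n = ten m ((c \<odot>\<^sub>A \<one>\<^sub>A) \<odot>\<^sub>N n)"
 using tens_smult_left[OF M Nk, of c m n] tens_smult_right[OF M Nk, of c m n] by simp

lemma restrict_scalars_tensor_alg_smult:
 assumes c: "c \<in> car k" and t: "t \<in> car TA"
 shows "c \<odot>\<^sub>T t = (c \<odot>\<^sub>A \<one>\<^sub>A) \<odot>\<^sub>TA t"
proof -
 have ca: "c \<odot>\<^sub>A \<one>\<^sub>A \<in> car A" using c by simp
 have id: "(\<lambda>x. x) \<in> mod_hom k T T" by (rule mod_homI) auto
 show ?thesis
  by (rule tensor_hom_eqI[OF M Nk T.module_axioms mod_hom_scale[OF T.module_axioms T.module_axioms id c] sm[OF ca]])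
   (use c ca t tens_smult_right[OF M Nk c] in \<open>simp_all add: ten_smult del: tensor_alg_simps(4)\<close>)
qed

lemma tensor_alg_induct:
 assumes "t \<in> car TA" "P \<zero>\<^sub>TA"
  "\<And>m n. m \<in> car M ==> n \<in> car N ==> P (ten m n)"
  "\<And>s t. s \<in> car TA ==> t \<in> car TA ==> P s ==> P t ==> P (s \<oplus>\<^sub>TA t)"
 shows "P t"
 using assms tensor_induct[OF M Nk, of t P] by simp

lemma tensor_alg_hom_eqI:
 assumes P: "module R P" and f: "f \<in> mod_hom R TA P" and g: "g \<in> mod_hom R TA P" and TA: "module R TA"
  and eq: "\<And>m n. m \<in> car M ==> n \<in> car N ==> f (ten m n) = g (ten m n)"
  and t: "t \<in> car TA"
 shows "f t = g t"
 using t
proof (rule tensor_alg_induct)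
 show "f \<zero>\<^sub>TA = g \<zero>\<^sub>TA"
  using mod_hom_zero[OF TA P f] mod_hom_zero[OF TA P g] by simp
qed (simp_all only: eq mod_hom_add[OF f] mod_hom_add[OF g])

lemma tensor_alg_lift:
 assumes P: "module A P"
  and closed: "\<And>m n. m \<in> car M ==> n \<in> car N ==> \<beta> m n \<in> car P"
  and addl: "\<And>m m' n. m \<in> car M ==> m' \<in> car M ==> n \<in> car N ==>
   \<beta> (m \<oplus>\<^sub>M m') n = \<beta> m n \<oplus>\<^sub>P \<beta> m' n"
  and addr: "\<And>m n n'. m \<in> car M ==> n \<in> car N ==> n' \<in> car N ==>
   \<beta> m (n \<oplus>\<^sub>N n') = \<beta> m n \<oplus>\<^sub>P \<beta> m n'"
  and smultl: "\<And>c m n. c \<in> car k ==> m \<in> car M ==> n \<in> car N ==>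
   \<beta> (c \<odot>\<^sub>M m) n = (c \<odot>\<^sub>A \<one>\<^sub>A) \<odot>\<^sub>P \<beta> m n"
  and smultr: "\<And>a m n. a \<in> car A ==> m \<in> car M ==> n \<in> car N ==>
   \<beta> m (a \<odot>\<^sub>N n) = a \<odot>\<^sub>P \<beta> m n"
 shows "\<exists>h \<in> mod_hom A TA P. \<forall>m\<in>car M. \<forall>n\<in>car N. h (ten m n) = \<beta> m n"
proof -
 let ?Pk = "restrict_scalars A P"
 have Pk: "module k ?Pk" by (rule module_restrict_scalars[OF A P])
 interpret P: module A P by (rule P)
 have "\<exists>h \<in> mod_hom k T ?Pk. \<forall>m\<in>car M. \<forall>n\<in>car Nk. h (tens k M Nk m n) = \<beta> m n"
  by (rule tensor_lift[OF M Nk Pk]) (simp_all add: closed addl addr smultl smultr)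
 then obtain h where h: "h \<in> mod_hom k T ?Pk"
  and hv: "\<And>m n. m \<in> car M ==> n \<in> car N ==> h (ten m n) = \<beta> m n" by auto
 have "h \<in> mod_hom A TA P"
 proof (rule mod_homI)
  show "h t \<in> car P" if "t \<in> car TA" for t using mod_hom_closed[OF h] that by simp
  show "h (s \<oplus>\<^sub>TA t) = h s \<oplus>\<^sub>P h t" if "s \<in> car TA" "t \<in> car TA" for s t
   using mod_hom_add[OF h] that by simp
  fix a t assume a: "a \<in> car A" and t: "t \<in> car TA"
  have "h (a \<odot>\<^sub>TA t) = a \<odot>\<^sub>P h t"
   by (rule tensor_hom_eqI[OF M Nk Pk mod_hom_comp[OF sm[OF a] h] mod_hom_comp[OF h smult_mod_hom[OF A P a]]])
    (use a t in \<open>simp_all add: ten_smult hv smultr del: tensor_alg_simps(4)\<close>)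
  then show "h (a \<odot>\<^sub>TA t) = a \<odot>\<^sub>P h t" .
 qed
 then show ?thesis using hv by blast
qed

end

section \<open>Frames of augmented Gorenstein algebras\<close>

text \<open>The filtration survives only through \<open>\<epsilon>\<close>, whose kernel is
  \<open>F 1\<close> and consists of nilpotent elements; projectivity over \<open>k\<close> is
  recorded as a dual basis.\<close>

locale augmented_algebra = algebra k A for k :: "('k, 'z) ring_scheme" and A :: "('k, 'a) module" (structure) +
 fixes \<epsilon> :: "'a => 'k"
 assumes eps_hom: "\<epsilon> \<in> lin k A"
  and eps_mult: "\<And>a b. a \<in> car A ==> b \<in> car A ==> \<epsilon> (a \<otimes> b) = \<epsilon> a \<otimes>\<^sub>k \<epsilon> b"
  and eps_one: "\<epsilon> \<one> = \<one>\<^sub>k"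
  and eps_nilpotent: "\<And>a. a \<in> car A ==> \<epsilon> a = \<zero>\<^sub>k ==> \<exists>m::nat. a [^] m = \<zero>"
  and projective: "\<exists>n m \<mu>. dual_basis k A n m \<mu>"
begin

abbreviation "Lin \<equiv> lin k A"

definition "socle = {s \<in> car A. \<forall>a\<in>car A. \<epsilon> a = \<zero>\<^sub>k --> a \<otimes> s = \<zero>}"

lemma Lin_closed: "\<psi> \<in> Lin ==> x \<in> car A ==> \<psi> x \<in> car k"
 using mod_hom_closed[of \<psi> k A "regular_module k" x] by simp

lemma Lin_add: "\<psi> \<in> Lin ==> x \<in> car A ==> y \<in> car A ==> \<psi> (x \<oplus> y) = \<psi> x \<oplus>\<^sub>k \<psi> y"
 using mod_hom_add[of \<psi> k A "regular_module k" x y] by simp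

lemma Lin_smult: "\<psi> \<in> Lin ==> c \<in> car k ==> x \<in> car A ==> \<psi> (c \<odot> x) = c \<otimes>\<^sub>k \<psi> x"
 using mod_hom_smult[of \<psi> k A "regular_module k" c x] by simp

lemma Lin_zero: "\<psi> \<in> Lin ==> \<psi> \<zero> = \<zero>\<^sub>k"
 using mod_hom_zero[OF module_axioms module_regular[OF R_cring], of \<psi>] by simp

lemma Lin_minus: "\<psi> \<in> Lin ==> x \<in> car A ==> y \<in> car A ==> \<psi> (x \<ominus> y) = \<psi> x \<ominus>\<^sub>k \<psi> y"
 using mod_hom_minus[OF module_axioms module_regular[OF R_cring], of \<psi> x y]
 by (simp add: R.minus_regular_module)

lemma Lin_uminus:
 assumes "\<psi> \<in> Lin" "x \<in> car A"
 shows "\<psi> (\<ominus> x) = \<ominus>\<^sub>k \<psi> x"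
proof -
 have "\<ominus>\<^bsub>regular_module k\<^esub> y = \<ominus>\<^sub>k y" for y by (simp add: a_inv_def m_inv_def)
 then show ?thesis using mod_hom_uminus[OF module_axioms module_regular[OF R_cring] assms] by simp
qed

lemma LinI:
 assumes "\<And>x. x \<in> car A ==> f x \<in> car k"
  "\<And>x y. x \<in> car A ==> y \<in> car A ==> f (x \<oplus> y) = f x \<oplus>\<^sub>k f y"
  "\<And>c x. c \<in> car k ==> x \<in> car A ==> f (c \<odot> x) = c \<otimes>\<^sub>k f x"
 shows "f \<in> Lin"
 by (rule mod_homI) (use assms in auto)

lemma smult_assoc3:
 assumes "c \<in> car k" "x \<in> car A" "y \<in> car A"
 shows "x \<otimes> (c \<odot> y) = c \<odot> (x \<otimes> y)"
proof -
 have "x \<otimes> (c \<odot> y) = (c \<odot> y) \<otimes> x" using assms by (simp add: m_comm)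
 also have "... = c \<odot> (y \<otimes> x)" using assms by (simp add: smult_assoc2)
 finally show ?thesis using assms by (simp add: m_comm)
qed

lemma Lin_mult: "\<psi> \<in> Lin ==> a \<in> car A ==> (\<lambda>x. \<psi> (a \<otimes> x)) \<in> Lin"
 by (rule LinI) (simp_all add: Lin_closed Lin_add Lin_smult r_distr smult_assoc3)

lemma Lin_sum: "\<psi> \<in> Lin ==> \<psi>' \<in> Lin ==> (\<lambda>x. \<psi> x \<oplus>\<^sub>k \<psi>' x) \<in> Lin"
 by (rule LinI) (simp_all add: Lin_closed Lin_add Lin_smult R.r_distr R.a_ac)

lemma Lin_lincomb: "\<psi> \<in> Lin ==> finite I ==> m \<in> I \<rightarrow> car A ==> c \<in> I \<rightarrow> car k ==>
  \<psi> (\<Oplus>i\<in>I. c i \<odot> m i) = (\<Oplus>\<^sub>k i\<in>I. c i \<otimes>\<^sub>k \<psi> (m i))"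
 by (rule functional_lincomb[OF module_axioms])

text \<open>All coordinates of \<open>a\<close> in a dual basis vanish.\<close>

lemma Lin_separates:
 assumes "a \<in> car A" "\<And>\<psi>. \<psi> \<in> Lin ==> \<psi> a = \<zero>\<^sub>k"
 shows "a = \<zero>"
proof -
 obtain n m \<mu> where "dual_basis k A n m \<mu>" using projective by blast
 then have mu: "\<And>i. i < n ==> m i \<in> car A" "\<And>i. i < n ==> \<mu> i \<in> Lin"
  and a: "a = (\<Oplus>i\<in>{..<n}. \<mu> i a \<odot> m i)"
  using assms(1) by (auto simp: dual_basis_def)
 have "(\<Oplus>i\<in>{..<n}. \<mu> i a \<odot> m i) = \<zero>"
  by (rule M.finsum_all_zero) (use mu(1) assms(2)[OF mu(2)] in auto)
 with a show ?thesis by simp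
qed

lemma eps_Lin: "\<epsilon> \<in> Lin" by (rule eps_hom)

lemma socleI:
 "s \<in> car A ==> (\<And>a. a \<in> car A ==> \<epsilon> a = \<zero>\<^sub>k ==> a \<otimes> s = \<zero>) ==> s \<in> socle"
 by (simp add: socle_def)

lemma socle_carrier: "s \<in> socle ==> s \<in> car A"
 by (simp add: socle_def)

text \<open>The algebra acts on its socle through \<open>\<epsilon>\<close>, because
  \<open>a\<close> minus the scalar \<open>\<epsilon> a\<close> lies in the augmentation
  ideal.\<close>

lemma socle_mult:
 assumes "a \<in> car A" "s \<in> socle"
 shows "a \<otimes> s = \<epsilon> a \<odot> s"
proof -
 have s: "s \<in> car A" using assms by (simp add: socle_def)
 have e: "\<epsilon> a \<in> car k" by (rule Lin_closed[OF eps_Lin assms(1)])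
 let ?z = "a \<ominus> \<epsilon> a \<odot> \<one>"
 have "\<epsilon> ?z = \<zero>\<^sub>k"
  using e assms(1) by (simp add: Lin_minus[OF eps_Lin] Lin_smult[OF eps_Lin] eps_one R.right_minus_eq)
 then have "?z \<otimes> s = \<zero>" using assms e by (simp add: socle_def)
 also have "?z \<otimes> s = a \<otimes> s \<ominus> \<epsilon> a \<odot> s"
  using assms(1) e s by (simp add: a_minus_def l_distr l_minus smult_assoc2)
 finally show ?thesis using assms(1) e s by (simp add: M.right_minus_eq)
qed

lemma socle_smult: "c \<in> car k ==> s \<in> socle ==> c \<odot> s \<in> socle"
 by (auto simp: socle_def smult_assoc3)

lemma socle_add: "s \<in> socle ==> s' \<in> socle ==> s \<oplus> s' \<in> socle"
 by (auto simp: socle_def r_distr)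

lemma socle_submodule: "submodule socle k A"
 by (rule submoduleI) (auto simp: socle_def r_distr smult_assoc3 r_minus)

lemma smult_one_pow: "c \<in> car k ==> (c \<odot> \<one>) [^] (m::nat) = (c [^]\<^bsub>k\<^esub> m) \<odot> \<one>"
 by (induction m) (simp_all add: smult_assoc2 smult_assoc3 smult_assoc1 R.m_comm flip: smult_assoc1)

lemma smult_one_mult: "c \<in> car k ==> x \<in> car A ==> (c \<odot> \<one>) \<otimes> x = c \<odot> x"
 by (simp add: smult_assoc2)

text \<open>Modulo \<open>f\<close>, the powers of \<open>a\<close> are those of
  \<open>a - f\<close>, which is nilpotent. In the applications \<open>a\<close> is a scalar, so
  that inverting a scalar of \<open>k\<close> inverts \<open>f\<close>.\<close>

lemma power_multiple_mod_nilpotent: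
 assumes a: "a \<in> car A" and f: "f \<in> car A" and "\<epsilon> a = \<epsilon> f"
 shows "\<exists>m::nat. \<exists>g\<in>car A. a [^] m = f \<otimes> g"
proof -
 have *: "\<exists>g\<in>car A. a [^] (m::nat) = (a \<ominus> f) [^] m \<oplus> f \<otimes> g" for m
 proof (induction m)
  case 0
  then show ?case using f by (intro bexI[of _ "\<zero>"]) auto
 next
  case (Suc m)
  then obtain g where g: "g \<in> car A" "a [^] m = (a \<ominus> f) [^] m \<oplus> f \<otimes> g" by blast
  let ?d = "a \<ominus> f" and ?p = "(a \<ominus> f) [^] m"
  have d: "?d \<in> car A" "?p \<in> car A" using a f by auto
  have "a [^] Suc m = ?p \<otimes> a \<oplus> (f \<otimes> g) \<otimes> a"
   using g d a f by (simp add: l_distr)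
  also have "?p \<otimes> a = ?p \<otimes> (?d \<oplus> f)" using a f by (simp add: M.minus_add_cancel)
  also have "... \<oplus> (f \<otimes> g) \<otimes> a = ?p \<otimes> ?d \<oplus> f \<otimes> (?p \<oplus> g \<otimes> a)"
   using g(1) d a f by (simp add: r_distr m_ac M.a_ac)
  finally show ?case using g(1) d a f by (intro bexI[of _ "?p \<oplus> g \<otimes> a"]) auto
 qed
 have "\<epsilon> (a \<ominus> f) = \<zero>\<^sub>k"
  using assms Lin_closed[OF eps_Lin] by (simp add: Lin_minus[OF eps_Lin] R.right_minus_eq)
 then obtain m :: nat where "(a \<ominus> f) [^] m = \<zero>" using eps_nilpotent[of "a \<ominus> f"] a f by auto
 with *[of m] f show ?thesis by (intro exI[of _ m]) auto
qed

text \<open>\<open>\<phi>\<close> generates the \<open>A\<close>-module \<open>A\<^sup>*\<close> up to the factor \<open>c\<close>.\<close>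

definition generates :: "'k => ('a => 'k) => bool" where
 "generates c \<phi> \<longleftrightarrow> c \<in> car k \<and> \<phi> \<in> Lin \<and>
  (\<forall>\<psi>\<in>Lin. \<exists>a\<in>car A. \<forall>x\<in>car A. c \<otimes>\<^sub>k \<psi> x = \<phi> (a \<otimes> x))"

text \<open>For every functional \<open>\<psi>\<close> the multiple \<open>c \<psi>\<close> is
  \<open>\<phi>\<close> composed with a multiplication, so \<open>c z\<close> is killed by all
  functionals, and functionals separate points.\<close>

lemma generates_faithful:
 assumes g: "generates c \<phi>" and z: "z \<in> car A" and 0: "\<And>x. x \<in> car A ==> \<phi> (z \<otimes> x) = \<zero>\<^sub>k"
 shows "c \<odot> z = \<zero>"
proof (rule Lin_separates)
 have c: "c \<in> car k" using g by (simp add: generates_def)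
 then show "c \<odot> z \<in> car A" using z by simp
 fix \<psi> assume \<psi>: "\<psi> \<in> Lin"
 then obtain a where a: "a \<in> car A" "\<And>x. x \<in> car A ==> c \<otimes>\<^sub>k \<psi> x = \<phi> (a \<otimes> x)"
  using g by (auto simp: generates_def)
 have "\<psi> (c \<odot> z) = \<phi> (a \<otimes> z)" using Lin_smult[OF \<psi> c z] a(2)[OF z] by simp
 also have "... = \<zero>\<^sub>k" using 0[OF a(1)] a(1) z by (simp add: m_comm)
 finally show "\<psi> (c \<odot> z) = \<zero>\<^sub>k" .
qed

text \<open>
 Since the kernel of \<open>\<epsilon>\<close> consists of nilpotent elements, every \<open>f \<in> A\<close> divides a power of \<open>\<epsilon> f\<close>; so
 the local generators of \<open>A\<^sup>*\<close> live over principal open sets of the spectrum of \<open>k\<close>.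
\<close>

lemma gorenstein_generates:
 assumes gor: "gorenstein k A" and p: "primeideal p k"
 shows "\<exists>c \<phi>. c \<notin> p \<and> generates c \<phi>"
proof -
 interpret p: primeideal p k by (rule p)
 let ?D = "dual_alg k A (regular_module A)"
 \<comment> \<open>The preimage of \<open>p\<close> under the augmentation is a prime of
   \<open>A\<close>, at which the invertibility of the dual can be applied.\<close>
 define P where "P = {a \<in> car A. \<epsilon> a \<in> p}"
 have idP: "ideal P A"
 proof (rule idealI)
  show "subgroup P (add_monoid A)"
   by (rule add.subgroupI)
    (auto simp: P_def Lin_add[OF eps_Lin] Lin_zero[OF eps_Lin] Lin_uminus[OF eps_Lin]
     intro!: exI[of _ "\<zero>"])
  fix a x assume "a \<in> P" "x \<in> car A"
  then show "x \<otimes> a \<in> P" "a \<otimes> x \<in> P"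
   using Lin_closed[OF eps_Lin] by (auto simp: P_def eps_mult p.I_l_closed p.I_r_closed)
 qed (rule ring_axioms)
 have "primeideal P A"
 proof (rule primeidealI[OF idP M_cring])
  have "\<one> \<notin> P" using eps_one p.one_imp_carrier p.I_notcarr by (auto simp: P_def)
  then show "car A \<noteq> P" by auto
  fix a b assume "a \<in> car A" "b \<in> car A" "a \<otimes> b \<in> P"
  then show "a \<in> P \<or> b \<in> P"
   using p.I_prime[of "\<epsilon> a" "\<epsilon> b"] Lin_closed[OF eps_Lin] by (auto simp: P_def eps_mult)
 qed
 then obtain f m where f: "f \<in> car A" "f \<notin> P" and fb: "frac_basis A ?D f 1 m"
  using gor unfolding gorenstein_def invertible_module_def locally_free_rank_iff by blast
 define \<phi> where "\<phi> = m 0"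
 have \<phi>D: "\<phi> \<in> car ?D" using fb by (simp add: frac_basis_def \<phi>_def)
 have LinD: "g \<in> car ?D ==> g \<in> Lin" for g
  by (auto intro!: LinI simp: mod_hom_def smult_one_mult)
 have DLin: "restrict g (car A) \<in> car ?D" if "g \<in> Lin" for g
  using that by (auto simp: mod_hom_def smult_one_mult)
 have \<phi>: "\<phi> \<in> Lin" using LinD[OF \<phi>D] .
 interpret D: module A ?D
  by (rule module_dual_alg[OF algebra_axioms module_regular[OF M_cring]])
 have gen0: "\<exists>N::nat. \<exists>a\<in>car A. \<forall>x\<in>car A. \<psi> (f [^] N \<otimes> x) = \<phi> (a \<otimes> x)" if \<psi>: "\<psi> \<in> Lin" for \<psi>
 proof -
  from fb have "\<forall>y\<in>car ?D. \<exists>(N::nat) c. (\<forall>i<1. c i \<in> car A) \<and>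
    f [^] N \<odot>\<^sub>?D y = (\<Oplus>\<^sub>?D i\<in>{..<1}. c i \<odot>\<^sub>?D m i)"
   unfolding frac_basis_def by (elim conjE)
  from bspec[OF this DLin[OF \<psi>]] obtain N :: nat and c where "\<forall>i<1::nat. c i \<in> car A"
   and c2: "f [^] N \<odot>\<^sub>?D restrict \<psi> (car A) = (\<Oplus>\<^sub>?D i\<in>{..<1}. c i \<odot>\<^sub>?D m i)"
   by (elim exE conjE)
  then have c: "c 0 \<in> car A" by simp
  have "(\<Oplus>\<^sub>?D i\<in>{..<1}. c i \<odot>\<^sub>?D m i) = c 0 \<odot>\<^sub>?D \<phi>"
   using D.smult_closed[OF c \<phi>D]
   by (simp add: \<phi>_def lessThan_Suc D.M.finsum_insert D.M.finsum_empty del: dual_alg_simps)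
  then have eq: "f [^] N \<odot>\<^sub>?D restrict \<psi> (car A) = c 0 \<odot>\<^sub>?D \<phi>" by (simp only: c2)
  have "\<psi> (f [^] N \<otimes> x) = \<phi> (c 0 \<otimes> x)" if "x \<in> car A" for x
   using fun_cong[OF eq, of x] that f(1) by simp
  then show ?thesis using c by blast
 qed
 have ef: "\<epsilon> f \<in> car k" "\<epsilon> f \<notin> p" using f Lin_closed[OF eps_Lin] by (auto simp: P_def)
 have "\<epsilon> (\<epsilon> f \<odot> \<one>) = \<epsilon> f" using ef by (simp add: Lin_smult[OF eps_Lin] eps_one)
 then obtain q :: nat and g where g: "g \<in> car A" "(\<epsilon> f \<odot> \<one>) [^] q = f \<otimes> g"
  using power_multiple_mod_nilpotent[of "\<epsilon> f \<odot> \<one>" f] f ef by auto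
 define d where "d = \<epsilon> f [^]\<^bsub>k\<^esub> q"
 have d: "d \<in> car k" "d \<notin> p" using ef p.nat_pow_notin by (auto simp: d_def)
 have dfg: "d \<odot> \<one> = f \<otimes> g" using g(2) ef by (simp add: smult_one_pow d_def)
 have gen1: "\<exists>N::nat. \<exists>a\<in>car A. \<forall>x\<in>car A. d [^]\<^bsub>k\<^esub> N \<otimes>\<^sub>k \<psi> x = \<phi> (a \<otimes> x)" if \<psi>: "\<psi> \<in> Lin" for \<psi>
 proof -
  obtain N :: nat and a where a: "a \<in> car A"
   "\<And>x. x \<in> car A ==> \<psi> (f [^] N \<otimes> x) = \<phi> (a \<otimes> x)" using gen0[OF \<psi>] by blast
  have "d [^]\<^bsub>k\<^esub> N \<otimes>\<^sub>k \<psi> x = \<phi> ((a \<otimes> g [^] N) \<otimes> x)" if x: "x \<in> car A" for x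
  proof -
   have "d [^]\<^bsub>k\<^esub> N \<otimes>\<^sub>k \<psi> x = \<psi> ((d \<odot> \<one>) [^] N \<otimes> x)"
    using d x \<psi> by (simp add: smult_one_pow smult_one_mult Lin_smult)
   also have "... = \<psi> (f [^] N \<otimes> (g [^] N \<otimes> x))"
    unfolding dfg using f g x by (simp add: nat_pow_distrib m_assoc)
   also have "... = \<phi> ((a \<otimes> g [^] N) \<otimes> x)" using a g x by (simp add: m_assoc)
   finally show ?thesis .
  qed
  then show ?thesis using a(1) g(1) by (intro exI[of _ N] bexI[of _ "a \<otimes> g [^] N"]) auto
 qed
 \<comment> \<open>So far the exponent depends on the functional. A dual basis leaves finitely many
   functionals to treat and thus allows a common exponent.\<close>
 obtain n e \<mu> where "dual_basis k A n e \<mu>" using projective by blast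
 then have e: "\<And>i. i < n ==> e i \<in> car A" and \<mu>: "\<And>i. i < n ==> \<mu> i \<in> Lin"
  and exp: "\<And>x. x \<in> car A ==> x = (\<Oplus>i\<in>{..<n}. \<mu> i x \<odot> e i)"
  by (auto simp: dual_basis_def)
 have "\<forall>i\<in>{..<n}. \<exists>N::nat. \<exists>a\<in>car A. \<forall>x\<in>car A. d [^]\<^bsub>k\<^esub> N \<otimes>\<^sub>k \<mu> i x = \<phi> (a \<otimes> x)"
  using gen1 \<mu> by blast
 from bchoice[OF this] obtain N :: "nat => nat" where
  N: "\<forall>i\<in>{..<n}. \<exists>a\<in>car A. \<forall>x\<in>car A. d [^]\<^bsub>k\<^esub> N i \<otimes>\<^sub>k \<mu> i x = \<phi> (a \<otimes> x)" by (elim exE)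
 define K where "K = Max (insert 0 (N ` {..<n}))"
 define c where "c = d [^]\<^bsub>k\<^esub> K"
 have c: "c \<in> car k" "c \<notin> p" using d p.nat_pow_notin by (auto simp: c_def)
 have "\<forall>i\<in>{..<n}. \<exists>a. a \<in> car A \<and> (\<forall>x\<in>car A. c \<otimes>\<^sub>k \<mu> i x = \<phi> (a \<otimes> x))"
 proof
  fix i assume i: "i \<in> {..<n}"
  then obtain a where a: "a \<in> car A"
   "\<And>x. x \<in> car A ==> d [^]\<^bsub>k\<^esub> N i \<otimes>\<^sub>k \<mu> i x = \<phi> (a \<otimes> x)" using N by blast
  have "N i \<le> K" using i by (simp add: K_def)
  then have ck: "c = d [^]\<^bsub>k\<^esub> (K - N i) \<otimes>\<^sub>k d [^]\<^bsub>k\<^esub> N i" using d by (simp add: c_def R.nat_pow_mult)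
  let ?b = "d [^]\<^bsub>k\<^esub> (K - N i)"
  have "c \<otimes>\<^sub>k \<mu> i x = \<phi> ((?b \<odot> a) \<otimes> x)" if x: "x \<in> car A" for x
  proof -
   have "c \<otimes>\<^sub>k \<mu> i x = ?b \<otimes>\<^sub>k (d [^]\<^bsub>k\<^esub> N i \<otimes>\<^sub>k \<mu> i x)"
    unfolding ck using d Lin_closed[OF \<mu>] i x by (intro R.m_assoc) auto
   also have "... = \<phi> ((?b \<odot> a) \<otimes> x)"
    unfolding a(2)[OF x] using a(1) x d \<phi> by (simp add: smult_assoc2 Lin_smult)
   finally show ?thesis .
  qed
  then show "\<exists>a. a \<in> car A \<and> (\<forall>x\<in>car A. c \<otimes>\<^sub>k \<mu> i x = \<phi> (a \<otimes> x))"
   using a(1) d by (intro exI[of _ "?b \<odot> a"]) auto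
 qed
 from bchoice[OF this] obtain a where "\<forall>i\<in>{..<n}. a i \<in> car A \<and>
   (\<forall>x\<in>car A. c \<otimes>\<^sub>k \<mu> i x = \<phi> (a i \<otimes> x))" by (elim exE)
 then have a: "\<And>i. i < n ==> a i \<in> car A"
  "\<And>i x. i < n ==> x \<in> car A ==> c \<otimes>\<^sub>k \<mu> i x = \<phi> (a i \<otimes> x)" by auto
 have "generates c \<phi>"
  unfolding generates_def
 proof (intro conjI ballI c(1) \<phi>)
  fix \<psi> assume \<psi>: "\<psi> \<in> Lin"
  define b where "b = (\<Oplus>i\<in>{..<n}. \<psi> (e i) \<odot> a i)"
  have \<psi>e: "\<psi> (e i) \<in> car k" if "i < n" for i using Lin_closed[OF \<psi> e[OF that]] .
  have b: "b \<in> car A" unfolding b_def using \<psi>e a by (auto intro!: M.finsum_closed)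
  have "c \<otimes>\<^sub>k \<psi> x = \<phi> (b \<otimes> x)" if x: "x \<in> car A" for x
  proof -
   have \<mu>x: "\<mu> i x \<in> car k" if "i < n" for i using Lin_closed[OF \<mu>[OF that] x] .
   have "\<psi> x = \<psi> (\<Oplus>i\<in>{..<n}. \<mu> i x \<odot> e i)" using exp[OF x] by simp
   also have "... = (\<Oplus>\<^sub>k i\<in>{..<n}. \<mu> i x \<otimes>\<^sub>k \<psi> (e i))"
    by (rule Lin_lincomb[OF \<psi>]) (use e \<mu>x in auto)
   finally have "c \<otimes>\<^sub>k \<psi> x = (\<Oplus>\<^sub>k i\<in>{..<n}. c \<otimes>\<^sub>k (\<mu> i x \<otimes>\<^sub>k \<psi> (e i)))"
    using \<mu>x \<psi>e c(1) by (simp add: R.finsum_rdistr Pi_def)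
   also have "... = (\<Oplus>\<^sub>k i\<in>{..<n}. \<psi> (e i) \<otimes>\<^sub>k \<phi> (a i \<otimes> x))"
    using \<mu>x \<psi>e c(1) a x Lin_closed[OF \<phi>]
    by (intro R.finsum_cong') (auto simp: R.m_ac simp flip: a(2))
   also have "... = \<phi> (\<Oplus>i\<in>{..<n}. \<psi> (e i) \<odot> (a i \<otimes> x))"
    by (rule Lin_lincomb[OF \<phi>, symmetric]) (use a x \<psi>e in auto)
   also have "(\<Oplus>i\<in>{..<n}. \<psi> (e i) \<odot> (a i \<otimes> x)) = b \<otimes> x"
    unfolding b_def using a x \<psi>e
    by (subst finsum_ldistr) (auto simp: smult_assoc2 intro!: M.finsum_cong')
   finally show ?thesis .
  qed
  then show "\<exists>a\<in>car A. \<forall>x\<in>car A. c \<otimes>\<^sub>k \<psi> x = \<phi> (a \<otimes> x)" using b by blast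
 qed
 then show ?thesis using c(2) by blast
qed

text \<open>Up to the factor \<open>c\<close>, the socle is free of rank one on \<open>t\<close>,
  with coordinate \<open>\<phi>\<close>.\<close>

definition generates_with_socle :: "'k => ('a => 'k) => 'a => bool" where
 "generates_with_socle c \<phi> t \<longleftrightarrow> generates c \<phi> \<and> t \<in> socle \<and> \<phi> t = c \<and>
  (\<forall>s\<in>socle. c \<odot> s = \<phi> s \<odot> t)"

text \<open>\<open>\<epsilon>\<close> is itself a functional, so \<open>c \<epsilon>\<close> is
  \<open>\<phi>\<close> composed with multiplication by some \<open>t0\<close>. The augmentation
  ideal kills \<open>\<epsilon>\<close>, hence \<open>t' = c t0\<close> lies in the socle. The three
  factors \<open>c\<close> come from this relation, from faithfulness in showing that
  \<open>t'\<close> is in the socle, and from faithfulness again in comparing \<open>s\<close> with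
  \<open>t'\<close>.\<close>

lemma generates_with_socle_exists:
 assumes g: "generates c \<phi>"
 shows "\<exists>t. generates_with_socle (c [^]\<^bsub>k\<^esub> (3::nat)) \<phi> t"
proof -
 have c: "c \<in> car k" and \<phi>: "\<phi> \<in> Lin" using g by (auto simp: generates_def)
 have c3: "c [^]\<^bsub>k\<^esub> (3::nat) = c \<otimes>\<^sub>k (c \<otimes>\<^sub>k c)" using c by (simp add: numeral_3_eq_3 R.m_assoc)
 obtain t0 where t0: "t0 \<in> car A" "\<And>x. x \<in> car A ==> c \<otimes>\<^sub>k \<epsilon> x = \<phi> (t0 \<otimes> x)"
  using g eps_Lin by (auto simp: generates_def)
 have ec: "\<epsilon> x \<in> car k" if "x \<in> car A" for x using Lin_closed[OF eps_Lin that] .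
 define t' where "t' = c \<odot> t0"
 have t'A: "t' \<in> car A" using c t0 by (simp add: t'_def)
 have t'S: "t' \<in> socle"
 proof (rule socleI[OF t'A])
  fix a assume a: "a \<in> car A" "\<epsilon> a = \<zero>\<^sub>k"
  have "c \<odot> (a \<otimes> t0) = \<zero>"
  proof (rule generates_faithful[OF g])
   fix x assume x: "x \<in> car A"
   have "\<phi> ((a \<otimes> t0) \<otimes> x) = \<phi> (t0 \<otimes> (a \<otimes> x))" using a t0(1) x by (simp add: m_ac)
   also have "... = \<zero>\<^sub>k" using t0(2)[of "a \<otimes> x"] a x c ec by (simp add: eps_mult)
   finally show "\<phi> ((a \<otimes> t0) \<otimes> x) = \<zero>\<^sub>k" .
  qed (use a t0 in simp)
  then show "a \<otimes> t' = \<zero>" using a c t0 by (simp add: t'_def smult_assoc3)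
 qed
 have \<phi>t': "\<phi> (t' \<otimes> x) = (c \<otimes>\<^sub>k c) \<otimes>\<^sub>k \<epsilon> x" if "x \<in> car A" for x
  using that c t0 \<phi> ec t0(2)[OF that, symmetric] by (simp add: t'_def smult_assoc2 Lin_smult R.m_assoc)
 define t where "t = c \<odot> t'"
 have "\<phi> t' = c \<otimes>\<^sub>k c" using \<phi>t'[of "\<one>"] t'A c by (simp add: eps_one)
 then have \<phi>t: "\<phi> t = c [^]\<^bsub>k\<^esub> (3::nat)" using c t'A \<phi> by (simp add: t_def Lin_smult c3)
 have "c [^]\<^bsub>k\<^esub> (3::nat) \<odot> s = \<phi> s \<odot> t" if s: "s \<in> socle" for s
 proof -
  have sA: "s \<in> car A" using socle_carrier[OF s] .
  have \<phi>s: "\<phi> s \<in> car k" using Lin_closed[OF \<phi> sA] .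
  let ?z = "(c \<otimes>\<^sub>k c) \<odot> s \<ominus> \<phi> s \<odot> t'"
  have "c \<odot> ?z = \<zero>"
  proof (rule generates_faithful[OF g])
   fix x assume x: "x \<in> car A"
   have "\<phi> (s \<otimes> x) = \<epsilon> x \<otimes>\<^sub>k \<phi> s"
    using socle_mult[OF x s] m_comm[OF sA x] Lin_smult[OF \<phi> ec[OF x] sA] by simp
   moreover have "?z \<otimes> x = (c \<otimes>\<^sub>k c) \<odot> (s \<otimes> x) \<ominus> \<phi> s \<odot> (t' \<otimes> x)"
    using c \<phi>s sA t'A x by (simp add: a_minus_def l_distr l_minus smult_assoc2)
   ultimately show "\<phi> (?z \<otimes> x) = \<zero>\<^sub>k"
    using c \<phi>s sA t'A x ec[OF x]
    by (simp add: Lin_minus[OF \<phi>] Lin_smult[OF \<phi>] \<phi>t' R.right_minus_eq R.m_ac)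
  qed (use c \<phi>s sA t'A in simp)
  then have "c \<odot> ((c \<otimes>\<^sub>k c) \<odot> s) \<ominus> c \<odot> (\<phi> s \<odot> t') = \<zero>"
   using c \<phi>s sA t'A by (simp add: a_minus_def smult_r_distr smult_r_minus)
  then have "c \<odot> ((c \<otimes>\<^sub>k c) \<odot> s) = c \<odot> (\<phi> s \<odot> t')"
   using c \<phi>s sA t'A by (simp add: M.right_minus_eq)
  then show ?thesis
   using c \<phi>s sA t'A smult_lcomm[OF c \<phi>s t'A] by (simp add: c3 t_def smult_assoc1)
 qed
 moreover have "generates (c [^]\<^bsub>k\<^esub> (3::nat)) \<phi>"
  unfolding generates_def
 proof (intro conjI ballI)
  fix \<psi> assume \<psi>: "\<psi> \<in> Lin"
  then obtain a where a: "a \<in> car A" "\<And>x. x \<in> car A ==> c \<otimes>\<^sub>k \<psi> x = \<phi> (a \<otimes> x)"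
   using g by (auto simp: generates_def)
  have "c [^]\<^bsub>k\<^esub> (3::nat) \<otimes>\<^sub>k \<psi> x = \<phi> (((c \<otimes>\<^sub>k c) \<odot> a) \<otimes> x)" if x: "x \<in> car A" for x
  proof -
   have "c [^]\<^bsub>k\<^esub> (3::nat) \<otimes>\<^sub>k \<psi> x = (c \<otimes>\<^sub>k c) \<otimes>\<^sub>k (c \<otimes>\<^sub>k \<psi> x)"
    using c Lin_closed[OF \<psi> x] by (simp add: c3 R.m_ac)
   then show ?thesis using a c x \<phi> by (simp add: smult_assoc2 Lin_smult)
  qed
  then show "\<exists>a\<in>car A. \<forall>x\<in>car A. c [^]\<^bsub>k\<^esub> (3::nat) \<otimes>\<^sub>k \<psi> x = \<phi> (a \<otimes> x)"
   using a(1) c by (intro bexI[of _ "(c \<otimes>\<^sub>k c) \<odot> a"]) auto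
 qed (use c \<phi> in auto)
 moreover have "t \<in> socle" unfolding t_def by (rule socle_smult[OF c t'S])
 ultimately show ?thesis using \<phi>t unfolding generates_with_socle_def by blast
qed

end

text \<open>The \<open>s i\<close> and \<open>\<phi> i\<close> play the part of a dual basis of the
  socle with trace one. The third clause expresses rank one, and holds on all of \<open>A\<close> in
  the variable \<open>x\<close>; the last is surjectivity of the map from \<open>A\<close> to
  \<open>Soc(A)\<close> tensor the dual, with \<open>a\<close> as preimage of the tensor of
  \<open>t\<close> and \<open>\<psi>\<close>.\<close>

definition (in augmented_algebra) frame :: "nat => (nat => 'a) => (nat => 'a => 'k) => bool" where
 "frame n s \<phi> \<longleftrightarrow> (\<forall>i<n. s i \<in> socle \<and> \<phi> i \<in> Lin) \<and>
  (\<Oplus>\<^sub>k i\<in>{..<n}. \<phi> i (s i)) = \<one>\<^sub>k \<and>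
  (\<forall>i<n. \<forall>j<n. \<forall>t\<in>socle. \<forall>x\<in>car A. \<phi> i t \<otimes>\<^sub>k \<phi> j x = \<phi> j t \<otimes>\<^sub>k \<phi> i x) \<and>
  (\<forall>t\<in>socle. \<forall>\<psi>\<in>Lin. \<exists>a\<in>car A. \<forall>i<n. \<forall>x\<in>car A. \<phi> i (a \<otimes> x) = \<phi> i t \<otimes>\<^sub>k \<psi> x)"

context augmented_algebra
begin

text \<open>Where the socle is generated by \<open>t\<close> up to \<open>c\<close>, both sides
  times \<open>c c\<close> are the multiple of \<open>t\<close> by
  \<open>\<psi> t \<phi> s \<phi> s'\<close>, which is symmetric in \<open>s\<close> and
  \<open>s'\<close>.\<close>

lemma socle_rank_one_aux:
 assumes gor: "gorenstein k A" and \<psi>: "\<psi> \<in> Lin" and s: "s \<in> socle" "s' \<in> socle"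
 shows "\<psi> s \<odot> s' = \<psi> s' \<odot> s"
proof -
 note sA = socle_carrier[OF s(1)] socle_carrier[OF s(2)]
 note \<psi>s = Lin_closed[OF \<psi> sA(1)] Lin_closed[OF \<psi> sA(2)]
 let ?z = "\<psi> s \<odot> s' \<ominus> \<psi> s' \<odot> s"
 have "?z = \<zero>"
 proof (rule zero_if_locally_zero)
  show "?z \<in> car A" using \<psi>s sA by simp
  fix p assume p: "primeideal p k"
  obtain c0 \<phi> where "c0 \<notin> p" and g0: "generates c0 \<phi>" using gorenstein_generates[OF gor p] by blast
  then have c0: "c0 \<in> car k" "c0 \<notin> p" by (auto simp: generates_def)
  obtain t where gs: "generates_with_socle (c0 [^]\<^bsub>k\<^esub> (3::nat)) \<phi> t"
   using generates_with_socle_exists[OF g0] by blast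
  define c where "c = c0 [^]\<^bsub>k\<^esub> (3::nat)"
  have c: "c \<in> car k" "c \<notin> p" using c0 primeideal.nat_pow_notin[OF p c0] by (auto simp: c_def)
  have \<phi>: "\<phi> \<in> Lin" and t: "t \<in> socle" "t \<in> car A"
   and ct: "\<And>s. s \<in> socle ==> c \<odot> s = \<phi> s \<odot> t"
   using gs socle_carrier by (auto simp: generates_with_socle_def generates_def c_def)
  have key: "(c \<otimes>\<^sub>k c) \<odot> (\<psi> s \<odot> s') = (\<psi> t \<otimes>\<^sub>k (\<phi> s \<otimes>\<^sub>k \<phi> s')) \<odot> t"
   if s: "s \<in> socle" "s' \<in> socle" for s s'
  proof -
   note sA = socle_carrier[OF s(1)] socle_carrier[OF s(2)]
   note v = Lin_closed[OF \<psi> sA(1)] Lin_closed[OF \<phi> sA(1)] Lin_closed[OF \<phi> sA(2)] Lin_closed[OF \<psi> t(2)]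
   have "c \<otimes>\<^sub>k \<psi> s = \<psi> (c \<odot> s)" using Lin_smult[OF \<psi> c(1) sA(1)] by simp
   also have "... = \<phi> s \<otimes>\<^sub>k \<psi> t" unfolding ct[OF s(1)] by (rule Lin_smult[OF \<psi> v(2) t(2)])
   finally have c\<psi>: "c \<otimes>\<^sub>k \<psi> s = \<phi> s \<otimes>\<^sub>k \<psi> t" .
   have "(c \<otimes>\<^sub>k c) \<odot> (\<psi> s \<odot> s') = (c \<otimes>\<^sub>k \<psi> s) \<odot> (c \<odot> s')"
    using c(1) v sA by (simp add: R.m_ac flip: smult_assoc1)
   also have "... = (\<phi> s \<otimes>\<^sub>k \<psi> t) \<odot> (\<phi> s' \<odot> t)" unfolding c\<psi> ct[OF s(2)] ..
   also have "... = (\<psi> t \<otimes>\<^sub>k (\<phi> s \<otimes>\<^sub>k \<phi> s')) \<odot> t"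
    using v t by (simp add: R.m_ac flip: smult_assoc1)
   finally show ?thesis .
  qed
  have "(c \<otimes>\<^sub>k c) \<odot> ?z = (c \<otimes>\<^sub>k c) \<odot> (\<psi> s \<odot> s') \<ominus> (c \<otimes>\<^sub>k c) \<odot> (\<psi> s' \<odot> s)"
   using c(1) \<psi>s sA by (simp add: a_minus_def smult_r_distr smult_r_minus)
  also have "... = \<zero>"
   unfolding key[OF s] key[OF s(2,1)]
   using Lin_closed[OF \<psi> t(2)] Lin_closed[OF \<phi> sA(1)] Lin_closed[OF \<phi> sA(2)] t
   by (simp add: M.right_minus_eq R.m_ac)
  finally show "\<exists>f\<in>car k - p. f \<odot> ?z = \<zero>"
   using c primeideal.I_prime[OF p c(1) c(1)] by (intro bexI[of _ "c \<otimes>\<^sub>k c"]) auto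
 qed
 then show ?thesis using \<psi>s sA by (simp add: M.right_minus_eq)
qed

text \<open>
 The local generators \<open>\<phi>\<close> of \<open>A\<^sup>*\<close> are first corrected to \<open>\<tau> \<phi>\<close>, which depends only on the restriction of
 \<open>\<phi>\<close> to the socle; by nilpotency \<open>\<tau> \<phi>\<close> is still a local generator, and any two of these
 differ locally by a scalar in \<open>k\<close>.
\<close>

lemma frame_exists:
 assumes gor: "gorenstein k A"
 shows "\<exists>n s \<phi>. frame n s \<phi>"
proof -
 have loc1: "\<forall>p. primeideal p k --> (\<exists>c \<in> car k - p. \<exists>\<phi> t. generates_with_socle c \<phi> t)"
 proof (intro allI impI)
  fix p assume p: "primeideal p k"
  obtain c \<phi> where c: "c \<notin> p" "generates c \<phi>" using gorenstein_generates[OF gor p] by blast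
  then have "c \<in> car k" by (simp add: generates_def)
  then show "\<exists>c \<in> car k - p. \<exists>\<phi> t. generates_with_socle c \<phi> t"
   using generates_with_socle_exists[OF c(2)] primeideal.nat_pow_notin[OF p _ c(1)]
   by (intro bexI[of _ "c [^]\<^bsub>k\<^esub> (3::nat)"]) auto
 qed
 from R.partition_of_unity[OF loc1] obtain n :: nat and b c where
  bc: "\<forall>i<n. b i \<in> car k \<and> c i \<in> car k \<and> (\<exists>\<phi> t. generates_with_socle (c i) \<phi> t)"
  and one: "(\<Oplus>\<^sub>k i\<in>{..<n}. b i \<otimes>\<^sub>k c i) = \<one>\<^sub>k" by (elim exE conjE)
 then have "\<forall>i\<in>{..<n}. \<exists>\<phi>. \<exists>t. generates_with_socle (c i) \<phi> t" by blast
 from bchoice[OF this] obtain \<phi> where "\<forall>i\<in>{..<n}. \<exists>t. generates_with_socle (c i) (\<phi> i) t" by (elim exE)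
 from bchoice[OF this] obtain t where gs: "\<forall>i\<in>{..<n}. generates_with_socle (c i) (\<phi> i) (t i)" by (elim exE)
 have b: "\<And>i. i < n ==> b i \<in> car k" and c: "\<And>i. i < n ==> c i \<in> car k" using bc by auto
 have \<phi>: "\<And>i. i < n ==> \<phi> i \<in> Lin" and t: "\<And>i. i < n ==> t i \<in> socle"
  and ct: "\<And>i s. i < n ==> s \<in> socle ==> c i \<odot> s = \<phi> i s \<odot> t i"
  using gs by (auto simp: generates_with_socle_def generates_def)
 note tA = socle_carrier[OF t]
 \<comment> \<open>By the partition of unity, the \<open>\<sigma> i\<close> with the coordinates
   \<open>\<phi> i\<close> expand every element of the socle. Off the socle the
   \<open>\<phi> i\<close> are still unrelated.\<close>
 define \<sigma> where "\<sigma> i = b i \<odot> t i" for i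
 have \<sigma>S: "\<sigma> i \<in> socle" if "i < n" for i unfolding \<sigma>_def by (rule socle_smult[OF b[OF that] t[OF that]])
 note \<sigma>A = socle_carrier[OF \<sigma>S]
 have expand: "(\<Oplus>i\<in>{..<n}. \<phi> i s \<odot> \<sigma> i) = s" if s: "s \<in> socle" for s
 proof -
  have sA: "s \<in> car A" by (rule socle_carrier[OF s])
  have "(\<Oplus>i\<in>{..<n}. \<phi> i s \<odot> \<sigma> i) = (\<Oplus>i\<in>{..<n}. (b i \<otimes>\<^sub>k c i) \<odot> s)"
  proof (rule M.finsum_cong')
   fix i assume "i \<in> {..<n}"
   then have i: "i < n" by simp
   have "\<phi> i s \<odot> \<sigma> i = b i \<odot> (\<phi> i s \<odot> t i)"
    unfolding \<sigma>_def by (rule smult_lcomm) (use b i tA Lin_closed[OF \<phi> sA] in auto)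
   then show "\<phi> i s \<odot> \<sigma> i = (b i \<otimes>\<^sub>k c i) \<odot> s"
    using b[OF i] c[OF i] sA by (simp add: smult_assoc1 ct[OF i s])
  qed (use b c sA in auto)
  also have "... = (\<Oplus>\<^sub>k i\<in>{..<n}. b i \<otimes>\<^sub>k c i) \<odot> s"
   by (rule finsum_smult_rdistr[symmetric]) (use b c sA in auto)
  finally show ?thesis using one sA by simp
 qed
 define \<tau> where "\<tau> \<psi> x = (\<Oplus>\<^sub>k i\<in>{..<n}. \<psi> (\<sigma> i) \<otimes>\<^sub>k \<phi> i x)" for \<psi> x
 have \<tau>: "\<tau> \<psi> \<in> Lin" if "\<psi> \<in> Lin" for \<psi>
 proof -
  have "(\<lambda>x. \<Oplus>\<^bsub>regular_module k\<^esub>i\<in>{..<n}. \<phi> i x \<odot>\<^bsub>regular_module k\<^esub> \<psi> (\<sigma> i)) \<in> Lin"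
   by (rule mod_hom_lincomb[OF module_axioms module_regular[OF R_cring]])
    (use \<phi> Lin_closed[OF that \<sigma>A] in auto)
  then have L: "(\<lambda>x. \<Oplus>\<^sub>k i\<in>{..<n}. \<phi> i x \<otimes>\<^sub>k \<psi> (\<sigma> i)) \<in> Lin" by simp
  show ?thesis
   by (rule mod_hom_cong[OF module_axioms L])
    (use Lin_closed[OF that \<sigma>A] Lin_closed[OF \<phi>] in \<open>auto simp: \<tau>_def R.m_comm intro!: R.finsum_cong'\<close>)
 qed
 have \<tau>s: "\<tau> \<psi> s = \<psi> s" if \<psi>: "\<psi> \<in> Lin" and s: "s \<in> socle" for \<psi> s
 proof -
  have sA: "s \<in> car A" by (rule socle_carrier[OF s])
  have "\<psi> s = \<psi> (\<Oplus>i\<in>{..<n}. \<phi> i s \<odot> \<sigma> i)" by (simp only: expand[OF s])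
  also have "... = (\<Oplus>\<^sub>k i\<in>{..<n}. \<phi> i s \<otimes>\<^sub>k \<psi> (\<sigma> i))"
   by (rule Lin_lincomb[OF \<psi>]) (use \<sigma>A Lin_closed[OF \<phi> sA] in auto)
  also have "... = \<tau> \<psi> s"
   unfolding \<tau>_def using Lin_closed[OF \<psi> \<sigma>A] Lin_closed[OF \<phi> sA]
   by (intro R.finsum_cong') (auto simp: R.m_comm)
  finally show ?thesis by simp
 qed
 \<comment> \<open>This is where the correction pays: \<open>\<tau> \<psi>\<close> uses only the
   values of \<open>\<psi>\<close> at the \<open>\<sigma> i\<close>, so the rank-one identity of the
   socle passes to \<open>\<tau> \<psi>\<close> on all of \<open>A\<close>.\<close>
 have \<tau>comm: "\<psi> s \<otimes>\<^sub>k \<tau> \<psi>' x = \<psi>' s \<otimes>\<^sub>k \<tau> \<psi> x"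
  if \<psi>: "\<psi> \<in> Lin" "\<psi>' \<in> Lin" and s: "s \<in> socle" and x: "x \<in> car A" for \<psi> \<psi>' s x
 proof -
  have sA: "s \<in> car A" by (rule socle_carrier[OF s])
  note v = Lin_closed[OF \<psi>(1) sA] Lin_closed[OF \<psi>(2) sA] Lin_closed[OF \<psi>(1) \<sigma>A] Lin_closed[OF \<psi>(2) \<sigma>A]
   Lin_closed[OF \<phi> x]
  have "\<psi> s \<otimes>\<^sub>k \<tau> \<psi>' x = (\<Oplus>\<^sub>k i\<in>{..<n}. \<psi> s \<otimes>\<^sub>k (\<psi>' (\<sigma> i) \<otimes>\<^sub>k \<phi> i x))"
   unfolding \<tau>_def using v by (simp add: R.finsum_rdistr Pi_def)
  also have "... = (\<Oplus>\<^sub>k i\<in>{..<n}. \<psi>' s \<otimes>\<^sub>k (\<psi> (\<sigma> i) \<otimes>\<^sub>k \<phi> i x))"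
  proof (rule R.finsum_cong')
   fix i assume "i \<in> {..<n}"
   then have i: "i < n" by simp
   have "\<psi> s \<otimes>\<^sub>k \<psi>' (\<sigma> i) = \<psi>' (\<psi> s \<odot> \<sigma> i)" using Lin_smult[OF \<psi>(2) v(1) \<sigma>A[OF i]] by simp
   also have "... = \<psi>' (\<psi> (\<sigma> i) \<odot> s)" using socle_rank_one_aux[OF gor \<psi>(1) s \<sigma>S[OF i]] by simp
   also have "... = \<psi> (\<sigma> i) \<otimes>\<^sub>k \<psi>' s" by (rule Lin_smult[OF \<psi>(2) v(3)[OF i] sA])
   finally have eq: "\<psi> s \<otimes>\<^sub>k \<psi>' (\<sigma> i) = \<psi>' s \<otimes>\<^sub>k \<psi> (\<sigma> i)" using v i by (simp add: R.m_comm)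
   have "\<psi> s \<otimes>\<^sub>k (\<psi>' (\<sigma> i) \<otimes>\<^sub>k \<phi> i x) = (\<psi> s \<otimes>\<^sub>k \<psi>' (\<sigma> i)) \<otimes>\<^sub>k \<phi> i x"
    using v i by (simp add: R.m_assoc)
   also have "... = \<psi>' s \<otimes>\<^sub>k (\<psi> (\<sigma> i) \<otimes>\<^sub>k \<phi> i x)"
    unfolding eq using v i by (simp add: R.m_assoc)
   finally show "\<psi> s \<otimes>\<^sub>k (\<psi>' (\<sigma> i) \<otimes>\<^sub>k \<phi> i x) = \<psi>' s \<otimes>\<^sub>k (\<psi> (\<sigma> i) \<otimes>\<^sub>k \<phi> i x)" .
  qed (use v in auto)
  also have "... = \<psi>' s \<otimes>\<^sub>k \<tau> \<psi> x"
   unfolding \<tau>_def using v by (simp add: R.finsum_rdistr Pi_def)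
  finally show ?thesis .
 qed
 have loc2: "\<forall>p. primeideal p k --> (\<exists>c \<in> car k - p. \<exists>\<psi>. \<exists>t. \<psi> \<in> Lin \<and> generates_with_socle c (\<tau> \<psi>) t)"
 proof (intro allI impI)
  fix p assume p: "primeideal p k"
  interpret p: primeideal p k by (rule p)
  obtain c \<psi> t where c: "c \<in> car k" "c \<notin> p" and gs: "generates_with_socle c \<psi> t"
   using loc1 p by blast
  then have \<psi>: "\<psi> \<in> Lin" and t: "t \<in> socle" and \<psi>t: "\<psi> t = c"
   and gen: "\<And>\<chi>. \<chi> \<in> Lin ==> \<exists>a\<in>car A. \<forall>x\<in>car A. c \<otimes>\<^sub>k \<chi> x = \<psi> (a \<otimes> x)"
   by (auto simp: generates_with_socle_def generates_def)
  have tA: "t \<in> car A" by (rule socle_carrier[OF t])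
  let ?\<psi>' = "\<tau> \<psi>"
  obtain u where u: "u \<in> car A" "\<And>x. x \<in> car A ==> c \<otimes>\<^sub>k ?\<psi>' x = \<psi> (u \<otimes> x)"
   using gen[OF \<tau>[OF \<psi>]] by blast
  have eu: "\<epsilon> u \<in> car k" using Lin_closed[OF eps_Lin u(1)] .
  \<comment> \<open>Values at \<open>t\<close> are compared: \<open>\<psi>\<close> and
    \<open>\<tau> \<psi>\<close> both give \<open>c\<close> there, and \<open>u\<close> acts on the
    socle through \<open>\<epsilon>\<close>. Hence \<open>c u\<close> agrees with the scalar
    \<open>c c\<close> modulo the augmentation ideal and divides a power of it, which makes
    \<open>\<tau> \<psi>\<close> a local generator.\<close>
  have "c \<otimes>\<^sub>k c = \<epsilon> u \<otimes>\<^sub>k c"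
   using u(2)[OF tA] \<tau>s[OF \<psi> t] \<psi>t socle_mult[OF u(1) t] Lin_smult[OF \<psi> eu tA] by simp
  then have eq: "\<epsilon> ((c \<otimes>\<^sub>k c) \<odot> \<one>) = \<epsilon> (c \<odot> u)"
   using c(1) u(1) eu by (simp add: Lin_smult[OF eps_Lin] eps_one R.m_comm)
  obtain m :: nat and g where g: "g \<in> car A"
   "((c \<otimes>\<^sub>k c) \<odot> \<one>) [^] m = (c \<odot> u) \<otimes> g"
   using power_multiple_mod_nilpotent[OF _ _ eq] c(1) u(1) by auto
  define d where "d = (c \<otimes>\<^sub>k c) [^]\<^bsub>k\<^esub> m"
  have cc: "c \<otimes>\<^sub>k c \<in> car k" "c \<otimes>\<^sub>k c \<notin> p" using c p.I_prime[OF c(1) c(1)] by auto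
  have d: "d \<in> car k" "d \<notin> p" using cc p.nat_pow_notin[OF cc] by (auto simp: d_def)
  have dug: "d \<odot> \<one> = c \<odot> (u \<otimes> g)"
   using g c(1) u(1) by (simp add: d_def smult_one_pow smult_assoc2)
  have "generates (d \<otimes>\<^sub>k c) ?\<psi>'"
   unfolding generates_def
  proof (intro conjI ballI)
   fix \<chi> assume \<chi>: "\<chi> \<in> Lin"
   obtain a where a: "a \<in> car A" "\<And>x. x \<in> car A ==> c \<otimes>\<^sub>k \<chi> x = \<psi> (a \<otimes> x)" using gen[OF \<chi>] by blast
   let ?a = "(c \<otimes>\<^sub>k c) \<odot> (g \<otimes> a)"
   have "(d \<otimes>\<^sub>k c) \<otimes>\<^sub>k \<chi> x = ?\<psi>' (?a \<otimes> x)" if x: "x \<in> car A" for x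
   proof -
    have "(d \<otimes>\<^sub>k c) \<otimes>\<^sub>k \<chi> x = d \<otimes>\<^sub>k \<psi> (a \<otimes> x)"
     using d c(1) Lin_closed[OF \<chi> x] a(2)[OF x] by (simp add: R.m_assoc)
    also have "... = \<psi> ((d \<odot> \<one>) \<otimes> (a \<otimes> x))"
     using d(1) a(1) x \<psi> by (simp add: smult_one_mult Lin_smult)
    also have "... = c \<otimes>\<^sub>k \<psi> (u \<otimes> ((g \<otimes> a) \<otimes> x))"
     unfolding dug using c(1) u(1) g(1) a(1) x \<psi> by (simp add: smult_assoc2 Lin_smult m_assoc)
    also have "... = c \<otimes>\<^sub>k (c \<otimes>\<^sub>k ?\<psi>' ((g \<otimes> a) \<otimes> x))"
     using g(1) a(1) x by (subst u(2)) auto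
    also have "... = ?\<psi>' (?a \<otimes> x)"
     using c(1) g(1) a(1) x Lin_closed[OF \<tau>[OF \<psi>], of "(g \<otimes> a) \<otimes> x"]
     by (simp add: smult_assoc2 Lin_smult[OF \<tau>[OF \<psi>]] R.m_assoc)
    finally show ?thesis .
   qed
   then show "\<exists>a\<in>car A. \<forall>x\<in>car A. (d \<otimes>\<^sub>k c) \<otimes>\<^sub>k \<chi> x = ?\<psi>' (a \<otimes> x)"
    using c(1) g(1) a(1) by (intro bexI[of _ ?a]) auto
  qed (use d c(1) \<tau>[OF \<psi>] in auto)
  from generates_with_socle_exists[OF this]
  obtain t' where t': "generates_with_socle ((d \<otimes>\<^sub>k c) [^]\<^bsub>k\<^esub> (3::nat)) ?\<psi>' t'" by (elim exE)
  have "d \<otimes>\<^sub>k c \<notin> p" using p.I_prime[OF d(1) c(1)] d(2) c(2) by blast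
  then have "(d \<otimes>\<^sub>k c) [^]\<^bsub>k\<^esub> (3::nat) \<notin> p" using p.nat_pow_notin[of "d \<otimes>\<^sub>k c"] d c by auto
  then show "\<exists>c \<in> car k - p. \<exists>\<psi>. \<exists>t. \<psi> \<in> Lin \<and> generates_with_socle c (\<tau> \<psi>) t"
   using t' \<psi> d(1) c(1)
   by (intro bexI[of _ "(d \<otimes>\<^sub>k c) [^]\<^bsub>k\<^esub> (3::nat)"] exI[of _ \<psi>] exI[of _ t']) auto
 qed
 from R.partition_of_unity[OF loc2] obtain N :: nat and b' c' where
  bc': "\<forall>i<N. b' i \<in> car k \<and> c' i \<in> car k \<and> (\<exists>\<psi> t. \<psi> \<in> Lin \<and> generates_with_socle (c' i) (\<tau> \<psi>) t)"
  and one': "(\<Oplus>\<^sub>k i\<in>{..<N}. b' i \<otimes>\<^sub>k c' i) = \<one>\<^sub>k" by (elim exE conjE)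
 then have "\<forall>i\<in>{..<N}. \<exists>\<psi>. \<exists>t. \<psi> \<in> Lin \<and> generates_with_socle (c' i) (\<tau> \<psi>) t" by blast
 from bchoice[OF this] obtain \<psi> where
  "\<forall>i\<in>{..<N}. \<exists>t. \<psi> i \<in> Lin \<and> generates_with_socle (c' i) (\<tau> (\<psi> i)) t" by (elim exE)
 from bchoice[OF this] obtain t' where
  gs': "\<forall>i\<in>{..<N}. \<psi> i \<in> Lin \<and> generates_with_socle (c' i) (\<tau> (\<psi> i)) (t' i)" by (elim exE)
 have b': "\<And>i. i < N ==> b' i \<in> car k" and c': "\<And>i. i < N ==> c' i \<in> car k" using bc' by auto
 have \<psi>: "\<And>i. i < N ==> \<psi> i \<in> Lin" and t': "\<And>i. i < N ==> t' i \<in> socle"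
  and \<psi>t': "\<And>i. i < N ==> \<tau> (\<psi> i) (t' i) = c' i"
  and gen': "\<And>i \<chi>. i < N ==> \<chi> \<in> Lin ==>
   \<exists>a\<in>car A. \<forall>x\<in>car A. c' i \<otimes>\<^sub>k \<chi> x = \<tau> (\<psi> i) (a \<otimes> x)"
  using gs' by (auto simp: generates_with_socle_def generates_def)
 have comm: "\<tau> (\<psi> i) s \<otimes>\<^sub>k \<tau> (\<psi> j) x = \<tau> (\<psi> j) s \<otimes>\<^sub>k \<tau> (\<psi> i) x"
  if "i < N" "j < N" "s \<in> socle" "x \<in> car A" for i j s x
  using \<tau>comm[OF \<psi>[OF that(1)] \<psi>[OF that(2)] that(3,4)] \<tau>s[OF \<psi> that(3)] that by simp
 have "frame N (\<lambda>i. b' i \<odot> t' i) (\<lambda>i. \<tau> (\<psi> i))"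
  unfolding frame_def
 proof (intro conjI allI impI ballI)
  show "(\<Oplus>\<^sub>k i\<in>{..<N}. \<tau> (\<psi> i) (b' i \<odot> t' i)) = \<one>\<^sub>k"
  proof -
   have "(\<Oplus>\<^sub>k i\<in>{..<N}. \<tau> (\<psi> i) (b' i \<odot> t' i)) = (\<Oplus>\<^sub>k i\<in>{..<N}. b' i \<otimes>\<^sub>k c' i)"
    using b' c' \<psi>t' socle_carrier[OF t'] Lin_smult[OF \<tau>[OF \<psi>]] by (intro R.finsum_cong') auto
   with one' show ?thesis by simp
  qed
 next
  fix s \<chi> assume s: "s \<in> socle" and \<chi>: "\<chi> \<in> Lin"
  have sA: "s \<in> car A" by (rule socle_carrier[OF s])
  have "\<forall>i\<in>{..<N}. \<exists>a. a \<in> car A \<and> (\<forall>x\<in>car A. c' i \<otimes>\<^sub>k \<chi> x = \<tau> (\<psi> i) (a \<otimes> x))"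
   using gen'[OF _ \<chi>] by blast
  from bchoice[OF this] obtain a where "\<forall>i\<in>{..<N}. a i \<in> car A \<and>
   (\<forall>x\<in>car A. c' i \<otimes>\<^sub>k \<chi> x = \<tau> (\<psi> i) (a i \<otimes> x))" by (elim exE)
  then have a: "\<And>i. i < N ==> a i \<in> car A"
   "\<And>i x. i < N ==> x \<in> car A ==> \<tau> (\<psi> i) (a i \<otimes> x) = c' i \<otimes>\<^sub>k \<chi> x" by auto
  \<comment> \<open>The local solutions \<open>a i\<close> of
    \<open>c' i \<chi> = \<tau> (\<psi> i)\<close> composed with \<open>a i\<close> are glued with
    the weights \<open>b' i \<tau> (\<psi> i) s\<close>. By \<open>comm\<close>, applying
    \<open>\<tau> (\<psi> l)\<close> pulls out \<open>\<tau> (\<psi> l) s\<close>, and what remains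
    is the sum of the \<open>b' i c' i\<close>, which is one.\<close>
  define q where "q i = b' i \<otimes>\<^sub>k \<tau> (\<psi> i) s" for i
  have q: "q i \<in> car k" if "i < N" for i using that b' Lin_closed[OF \<tau>[OF \<psi>] sA] by (simp add: q_def)
  define z where "z = (\<Oplus>i\<in>{..<N}. q i \<odot> a i)"
  have z: "z \<in> car A" unfolding z_def using q a by (auto intro!: M.finsum_closed)
  have "\<tau> (\<psi> l) (z \<otimes> x) = \<tau> (\<psi> l) s \<otimes>\<^sub>k \<chi> x" if l: "l < N" and x: "x \<in> car A" for l x
  proof -
   note v = Lin_closed[OF \<tau>[OF \<psi>] sA] Lin_closed[OF \<chi> x]
   have "z \<otimes> x = (\<Oplus>i\<in>{..<N}. q i \<odot> (a i \<otimes> x))"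
    unfolding z_def using a q x by (subst finsum_ldistr) (auto simp: smult_assoc2 intro!: M.finsum_cong')
   then have "\<tau> (\<psi> l) (z \<otimes> x) = (\<Oplus>\<^sub>k i\<in>{..<N}. q i \<otimes>\<^sub>k \<tau> (\<psi> l) (a i \<otimes> x))"
    using Lin_lincomb[OF \<tau>[OF \<psi>[OF l]], of "{..<N}" "\<lambda>i. a i \<otimes> x" q] a q x by auto
   also have "... = (\<Oplus>\<^sub>k i\<in>{..<N}. (b' i \<otimes>\<^sub>k c' i) \<otimes>\<^sub>k (\<tau> (\<psi> l) s \<otimes>\<^sub>k \<chi> x))"
   proof (rule R.finsum_cong')
    fix i assume "i \<in> {..<N}"
    then have i: "i < N" by simp
    have ax: "a i \<otimes> x \<in> car A" using a i x by simp
    have "q i \<otimes>\<^sub>k \<tau> (\<psi> l) (a i \<otimes> x) = b' i \<otimes>\<^sub>k (\<tau> (\<psi> i) s \<otimes>\<^sub>k \<tau> (\<psi> l) (a i \<otimes> x))"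
     unfolding q_def using b' i v l Lin_closed[OF \<tau>[OF \<psi>] ax] by (simp add: R.m_assoc)
    also have "... = b' i \<otimes>\<^sub>k (\<tau> (\<psi> l) s \<otimes>\<^sub>k (c' i \<otimes>\<^sub>k \<chi> x))"
     unfolding comm[OF i l s ax] a(2)[OF i x] ..
    finally show "q i \<otimes>\<^sub>k \<tau> (\<psi> l) (a i \<otimes> x) = (b' i \<otimes>\<^sub>k c' i) \<otimes>\<^sub>k (\<tau> (\<psi> l) s \<otimes>\<^sub>k \<chi> x)"
     using b' c' i l v by (simp add: R.m_ac)
   qed (use b' c' v l in auto)
   also have "... = (\<Oplus>\<^sub>k i\<in>{..<N}. b' i \<otimes>\<^sub>k c' i) \<otimes>\<^sub>k (\<tau> (\<psi> l) s \<otimes>\<^sub>k \<chi> x)"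
    by (rule R.finsum_ldistr[symmetric]) (use b' c' v l in auto)
   finally show ?thesis using v l by (simp add: one')
  qed
  then show "\<exists>a\<in>car A. \<forall>i<N. \<forall>x\<in>car A. \<tau> (\<psi> i) (a \<otimes> x) = \<tau> (\<psi> i) s \<otimes>\<^sub>k \<chi> x"
   using z by blast
 qed (use comm \<tau>[OF \<psi>] socle_smult[OF b' t'] in auto)
 then show ?thesis by blast
qed

end

section \<open>The inverse isomorphism and the socle in terms of a frame\<close>

locale framed_algebra = augmented_algebra k A \<epsilon> for k :: "('k, 'z) ring_scheme" and A :: "('k, 'a) module" (structure) and \<epsilon> +
 fixes n :: nat and s :: "nat => 'a" and \<phi> :: "nat => 'a => 'k"
 assumes frame: "frame n s \<phi>"
begin

lemma
 assumes "i < n"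
 shows frame_socle: "s i \<in> socle" and frame_carrier: "s i \<in> car A" and frame_Lin: "\<phi> i \<in> Lin"
 using frame assms socle_carrier by (auto simp: frame_def)

lemma frame_one: "(\<Oplus>\<^sub>k i\<in>{..<n}. \<phi> i (s i)) = \<one>\<^sub>k"
 using frame by (simp add: frame_def)

lemma frame_unit_notin:
 assumes p: "primeideal p k"
 shows "\<exists>i<n. \<phi> i (s i) \<notin> p"
proof (rule ccontr)
 interpret p: primeideal p k by (rule p)
 assume "\<not> ?thesis"
 then have "(\<lambda>i. \<phi> i (s i)) \<in> {..<n} \<rightarrow> p" by auto
 then have "finsum (regular_module k) (\<lambda>i. \<phi> i (s i)) {..<n} \<in> p"
  by (rule module.submodule_finsum[OF module_regular[OF R_cring] submodule_of_ideal[OF R_cring p.is_ideal]])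
 then show False using p.one_imp_carrier p.I_notcarr by (simp add: frame_one)
qed

lemma frame_comm: "i < n ==> j < n ==> t \<in> socle ==> x \<in> car A ==>
  \<phi> i t \<otimes>\<^sub>k \<phi> j x = \<phi> j t \<otimes>\<^sub>k \<phi> i x"
 using frame by (simp add: frame_def)

lemma frame_closed: "i < n ==> x \<in> car A ==> \<phi> i x \<in> car k"
 by (rule Lin_closed[OF frame_Lin])

text \<open>By the last clause of a frame, \<open>\<phi> i (s i) \<psi>\<close> is
  \<open>\<phi> i\<close> composed with a multiplication, so it vanishes at \<open>a\<close>. The
  factors \<open>\<phi> i (s i)\<close> add up to one, so \<open>\<psi> a = 0\<close> for every
  \<open>\<psi>\<close>.\<close>

lemma frame_faithful:
 assumes a: "a \<in> car A" and 0: "\<And>i x. i < n ==> x \<in> car A ==> \<phi> i (a \<otimes> x) = \<zero>\<^sub>k"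
 shows "a = \<zero>"
proof (rule Lin_separates[OF a])
 fix \<psi> assume \<psi>: "\<psi> \<in> Lin"
 have \<psi>a: "\<psi> a \<in> car k" by (rule Lin_closed[OF \<psi> a])
 have "\<phi> i (s i) \<otimes>\<^sub>k \<psi> a = \<zero>\<^sub>k" if i: "i < n" for i
 proof -
  obtain b where b: "b \<in> car A" "\<And>x. x \<in> car A ==> \<phi> i (b \<otimes> x) = \<phi> i (s i) \<otimes>\<^sub>k \<psi> x"
   using frame \<psi> frame_socle[OF i] i unfolding frame_def by meson
  have "\<phi> i (s i) \<otimes>\<^sub>k \<psi> a = \<phi> i (a \<otimes> b)" using b(2)[OF a] a b(1) by (simp add: m_comm)
  then show ?thesis using 0[OF i b(1)] by simp
 qed
 then have "(\<Oplus>\<^sub>k i\<in>{..<n}. \<phi> i (s i) \<otimes>\<^sub>k \<psi> a) = \<zero>\<^sub>k" by (intro R.finsum_all_zero) auto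
 then have "(\<Oplus>\<^sub>k i\<in>{..<n}. \<phi> i (s i)) \<otimes>\<^sub>k \<psi> a = \<zero>\<^sub>k"
  using \<psi>a frame_closed frame_carrier by (subst R.finsum_ldistr) auto
 then show "\<psi> a = \<zero>\<^sub>k" using \<psi>a by (simp add: frame_one)
qed

lemma frame_eqI:
 assumes "a \<in> car A" "b \<in> car A"
  and eq: "\<And>i x. i < n ==> x \<in> car A ==> \<phi> i (a \<otimes> x) = \<phi> i (b \<otimes> x)"
 shows "a = b"
proof -
 have "a \<ominus> b = \<zero>"
 proof (rule frame_faithful)
  fix i x assume i: "i < n" and x: "x \<in> car A"
  have "(a \<ominus> b) \<otimes> x = a \<otimes> x \<ominus> b \<otimes> x"
   using assms(1,2) x by (simp add: a_minus_def l_distr l_minus)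
  then show "\<phi> i ((a \<ominus> b) \<otimes> x) = \<zero>\<^sub>k"
   using eq[OF i x] assms(1,2) x frame_closed[OF i] by (simp add: Lin_minus[OF frame_Lin[OF i]] R.right_minus_eq)
 qed (use assms in simp)
 then show ?thesis using assms by (simp add: M.right_minus_eq)
qed

text \<open>\<open>\<theta>\<close> induces the inverse of the isomorphism \<open>A \<rightarrow> Soc(A) \<otimes> A\<^sup>*\<close>, \<open>a \<mapsto> \<Sum> s\<^sub>i \<otimes> a \<phi>\<^sub>i\<close>.\<close>

definition \<theta> :: "'a => ('a => 'k) => 'a" where
 "\<theta> t \<psi> = (SOME a. a \<in> car A \<and> (\<forall>i<n. \<forall>x\<in>car A. \<phi> i (a \<otimes> x) = \<phi> i t \<otimes>\<^sub>k \<psi> x))"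

lemma
 assumes "t \<in> socle" "\<psi> \<in> Lin"
 shows \<theta>_closed: "\<theta> t \<psi> \<in> car A"
  and \<theta>_eq: "\<And>i x. i < n ==> x \<in> car A ==> \<phi> i (\<theta> t \<psi> \<otimes> x) = \<phi> i t \<otimes>\<^sub>k \<psi> x"
proof -
 have "\<forall>t\<in>socle. \<forall>\<psi>\<in>Lin. \<exists>a\<in>car A. \<forall>i<n. \<forall>x\<in>car A. \<phi> i (a \<otimes> x) = \<phi> i t \<otimes>\<^sub>k \<psi> x"
  using frame unfolding frame_def by (elim conjE)
 from bspec[OF bspec[OF this assms(1)] assms(2)]
 have "\<exists>a. a \<in> car A \<and> (\<forall>i<n. \<forall>x\<in>car A. \<phi> i (a \<otimes> x) = \<phi> i t \<otimes>\<^sub>k \<psi> x)"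
  unfolding Bex_def .
 from someI_ex[OF this] show "\<theta> t \<psi> \<in> car A"
  "\<And>i x. i < n ==> x \<in> car A ==> \<phi> i (\<theta> t \<psi> \<otimes> x) = \<phi> i t \<otimes>\<^sub>k \<psi> x"
  unfolding \<theta>_def by auto
qed

text \<open>Faithfulness makes the defining equations determine \<open>\<theta>\<close>, so each of
  its rules is verified after applying the \<open>\<phi> i\<close>.\<close>

lemma \<theta>I:
 assumes "t \<in> socle" "\<psi> \<in> Lin" "a \<in> car A"
  "\<And>i x. i < n ==> x \<in> car A ==> \<phi> i (a \<otimes> x) = \<phi> i t \<otimes>\<^sub>k \<psi> x"
 shows "\<theta> t \<psi> = a"
 by (rule frame_eqI[OF \<theta>_closed[OF assms(1,2)] assms(3)]) (simp add: \<theta>_eq[OF assms(1,2)] assms(4))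

lemma \<theta>_cong:
 assumes "t \<in> socle" "\<psi> \<in> Lin" "\<psi>' \<in> Lin" "\<And>x. x \<in> car A ==> \<psi> x = \<psi>' x"
 shows "\<theta> t \<psi> = \<theta> t \<psi>'"
 by (rule \<theta>I[OF assms(1,2) \<theta>_closed[OF assms(1,3)]]) (simp add: \<theta>_eq[OF assms(1,3)] assms(4))

lemma \<theta>_add_left:
 assumes t: "t \<in> socle" "t' \<in> socle" and \<psi>: "\<psi> \<in> Lin"
 shows "\<theta> (t \<oplus> t') \<psi> = \<theta> t \<psi> \<oplus> \<theta> t' \<psi>"
proof (rule \<theta>I[OF socle_add[OF t] \<psi>])
 note c = \<theta>_closed[OF t(1) \<psi>] \<theta>_closed[OF t(2) \<psi>]
 then show "\<theta> t \<psi> \<oplus> \<theta> t' \<psi> \<in> car A" by simp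
 fix i x assume i: "i < n" and x: "x \<in> car A"
 show "\<phi> i ((\<theta> t \<psi> \<oplus> \<theta> t' \<psi>) \<otimes> x) = \<phi> i (t \<oplus> t') \<otimes>\<^sub>k \<psi> x"
  using c t[THEN socle_carrier] x i Lin_closed[OF \<psi> x] frame_closed[OF i]
  by (simp add: l_distr Lin_add[OF frame_Lin[OF i]] \<theta>_eq[OF t(1) \<psi>] \<theta>_eq[OF t(2) \<psi>] R.l_distr)
qed

lemma \<theta>_smult_left:
 assumes t: "t \<in> socle" and \<psi>: "\<psi> \<in> Lin" and b: "b \<in> car k"
 shows "\<theta> (b \<odot> t) \<psi> = b \<odot> \<theta> t \<psi>"
proof (rule \<theta>I[OF socle_smult[OF b t] \<psi>])
 note c = \<theta>_closed[OF t \<psi>]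
 then show "b \<odot> \<theta> t \<psi> \<in> car A" using b by simp
 fix i x assume i: "i < n" and x: "x \<in> car A"
 show "\<phi> i ((b \<odot> \<theta> t \<psi>) \<otimes> x) = \<phi> i (b \<odot> t) \<otimes>\<^sub>k \<psi> x"
  using c b socle_carrier[OF t] x i Lin_closed[OF \<psi> x] frame_closed[OF i]
  by (simp add: smult_assoc2 Lin_smult[OF frame_Lin[OF i]] \<theta>_eq[OF t \<psi>] R.m_assoc)
qed

lemma \<theta>_add_right:
 assumes t: "t \<in> socle" and \<psi>: "\<psi> \<in> Lin" "\<psi>' \<in> Lin"
 shows "\<theta> t (\<lambda>x. \<psi> x \<oplus>\<^sub>k \<psi>' x) = \<theta> t \<psi> \<oplus> \<theta> t \<psi>'"
proof (rule \<theta>I[OF t Lin_sum[OF \<psi>]])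
 note c = \<theta>_closed[OF t \<psi>(1)] \<theta>_closed[OF t \<psi>(2)]
 then show "\<theta> t \<psi> \<oplus> \<theta> t \<psi>' \<in> car A" by simp
 fix i x assume i: "i < n" and x: "x \<in> car A"
 show "\<phi> i ((\<theta> t \<psi> \<oplus> \<theta> t \<psi>') \<otimes> x) = \<phi> i t \<otimes>\<^sub>k (\<psi> x \<oplus>\<^sub>k \<psi>' x)"
  using c socle_carrier[OF t] x i Lin_closed[OF \<psi>(1) x] Lin_closed[OF \<psi>(2) x] frame_closed[OF i]
  by (simp add: l_distr Lin_add[OF frame_Lin[OF i]] \<theta>_eq[OF t \<psi>(1)] \<theta>_eq[OF t \<psi>(2)] R.r_distr)
qed

lemma \<theta>_act:
 assumes t: "t \<in> socle" and \<psi>: "\<psi> \<in> Lin" and a: "a \<in> car A"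
 shows "\<theta> t (\<lambda>x. \<psi> (a \<otimes> x)) = a \<otimes> \<theta> t \<psi>"
proof (rule \<theta>I[OF t Lin_mult[OF \<psi> a]])
 note c = \<theta>_closed[OF t \<psi>]
 then show "a \<otimes> \<theta> t \<psi> \<in> car A" using a by simp
 fix i x assume i: "i < n" and x: "x \<in> car A"
 have "(a \<otimes> \<theta> t \<psi>) \<otimes> x = \<theta> t \<psi> \<otimes> (a \<otimes> x)" using a c x by (simp add: m_ac)
 then show "\<phi> i ((a \<otimes> \<theta> t \<psi>) \<otimes> x) = \<phi> i t \<otimes>\<^sub>k \<psi> (a \<otimes> x)"
  using \<theta>_eq[OF t \<psi> i, of "a \<otimes> x"] a x by simp
qed

lemma \<theta>_zero:
 assumes t: "t \<in> socle" and \<psi>: "\<psi> \<in> Lin" "\<And>x. x \<in> car A ==> \<psi> x = \<zero>\<^sub>k"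
 shows "\<theta> t \<psi> = \<zero>"
 by (rule \<theta>I[OF t \<psi>(1)])
  (use \<psi>(2) frame_closed socle_carrier[OF t] Lin_zero[OF frame_Lin] in auto)

lemma \<theta>_frame:
 assumes t: "t \<in> socle" and l: "l < n"
 shows "\<theta> t (\<phi> l) = \<phi> l t \<odot> \<one>"
proof (rule \<theta>I[OF t frame_Lin[OF l]])
 have \<phi>t: "\<phi> l t \<in> car k" by (rule frame_closed[OF l socle_carrier[OF t]])
 then show "\<phi> l t \<odot> \<one> \<in> car A" by simp
 fix i x assume i: "i < n" and x: "x \<in> car A"
 show "\<phi> i ((\<phi> l t \<odot> \<one>) \<otimes> x) = \<phi> i t \<otimes>\<^sub>k \<phi> l x"
  using x \<phi>t frame_comm[OF i l t x] by (simp add: smult_one_mult Lin_smult[OF frame_Lin[OF i]])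
qed

lemma frame_socle_mult:
 assumes t: "t \<in> socle" and i: "i < n" and x: "x \<in> car A"
 shows "\<phi> i (t \<otimes> x) = \<epsilon> x \<otimes>\<^sub>k \<phi> i t"
 using socle_mult[OF x t] socle_carrier[OF t] x Lin_smult[OF frame_Lin[OF i]] Lin_closed[OF eps_Lin x]
 by (simp add: m_comm)

text \<open>Both sides lie in the socle, where \<open>frame_eqI\<close> compares values of the
  \<open>\<phi> l\<close> only. The rank-one clause turns the value of the left side into
  \<open>\<phi> l t\<close> times the trace, which is one.\<close>

lemma socle_expand:
 assumes t: "t \<in> socle"
 shows "(\<Oplus>i\<in>{..<n}. \<phi> i t \<odot> s i) = t"
proof -
 have tA: "t \<in> car A" by (rule socle_carrier[OF t])
 note v = frame_closed[OF _ tA]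
 have sum: "(\<Oplus>i\<in>{..<n}. \<phi> i t \<odot> s i) \<in> socle"
  by (rule submodule_finsum[OF socle_submodule]) (use v frame_socle socle_smult in auto)
 have val: "\<phi> l (\<Oplus>i\<in>{..<n}. \<phi> i t \<odot> s i) = \<phi> l t" if l: "l < n" for l
 proof -
  have "\<phi> l (\<Oplus>i\<in>{..<n}. \<phi> i t \<odot> s i) = (\<Oplus>\<^sub>k i\<in>{..<n}. \<phi> i t \<otimes>\<^sub>k \<phi> l (s i))"
   by (rule Lin_lincomb[OF frame_Lin[OF l]]) (use v frame_carrier in auto)
  also have "... = (\<Oplus>\<^sub>k i\<in>{..<n}. \<phi> l t \<otimes>\<^sub>k \<phi> i (s i))"
   using v l frame_carrier frame_closed frame_comm[OF _ l t] by (intro R.finsum_cong') auto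
  also have "... = \<phi> l t \<otimes>\<^sub>k (\<Oplus>\<^sub>k i\<in>{..<n}. \<phi> i (s i))"
   by (rule R.finsum_rdistr[symmetric]) (use v l frame_carrier frame_closed in auto)
  finally show ?thesis using v[OF l] by (simp add: frame_one)
 qed
 show ?thesis
  by (rule frame_eqI[OF socle_carrier[OF sum] tA]) (simp add: frame_socle_mult[OF sum] frame_socle_mult[OF t] val)
qed

text \<open>Expanding the argument of \<open>\<psi>\<close> along the frame reduces to
  \<open>\<psi> = \<phi> l\<close>, where the rank-one clause of the frame applies.\<close>

lemma socle_rank_one:
 assumes t: "t \<in> socle" "t' \<in> socle" and \<psi>: "\<psi> \<in> Lin"
 shows "\<psi> t \<odot> t' = \<psi> t' \<odot> t"
proof -
 note tA = t[THEN socle_carrier]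
 have fr: "\<phi> l t \<odot> t' = \<phi> l t' \<odot> t" if l: "l < n" for l
 proof (rule frame_eqI)
  note v = frame_closed[OF l tA(1)] frame_closed[OF l tA(2)]
  show "\<phi> l t \<odot> t' \<in> car A" "\<phi> l t' \<odot> t \<in> car A" using v tA by auto
  fix i x assume i: "i < n" and x: "x \<in> car A"
  note e = Lin_closed[OF eps_Lin x]
  have "\<phi> l t \<otimes>\<^sub>k \<phi> i t' = \<phi> l t' \<otimes>\<^sub>k \<phi> i t"
   using frame_comm[OF l i t(1) tA(2)] frame_closed[OF i tA(1)] v by (simp add: R.m_comm)
  then show "\<phi> i ((\<phi> l t \<odot> t') \<otimes> x) = \<phi> i ((\<phi> l t' \<odot> t) \<otimes> x)"
   using v tA x e frame_closed[OF i tA(1)] frame_closed[OF i tA(2)]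
   by (simp add: smult_assoc2 Lin_smult[OF frame_Lin[OF i]] frame_socle_mult[OF _ i x] t R.m_lcomm[of _ "\<epsilon> x"])
 qed
 have exp: "\<psi> t \<odot> t' = (\<Oplus>i\<in>{..<n}. \<psi> (s i) \<odot> (\<phi> i t \<odot> t'))"
  if t: "t \<in> socle" "t' \<in> socle" for t t'
 proof -
  note tA = t[THEN socle_carrier]
  note v = frame_closed[OF _ tA(1)] Lin_closed[OF \<psi> frame_carrier]
  have "\<psi> t = \<psi> (\<Oplus>i\<in>{..<n}. \<phi> i t \<odot> s i)" by (simp only: socle_expand[OF t(1)])
  also have "... = (\<Oplus>\<^sub>k i\<in>{..<n}. \<phi> i t \<otimes>\<^sub>k \<psi> (s i))"
   by (rule Lin_lincomb[OF \<psi>]) (use v frame_carrier in auto)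
  finally have "\<psi> t \<odot> t' = (\<Oplus>i\<in>{..<n}. (\<phi> i t \<otimes>\<^sub>k \<psi> (s i)) \<odot> t')"
   using v tA by (simp add: finsum_smult_rdistr Pi_def)
  also have "... = (\<Oplus>i\<in>{..<n}. \<psi> (s i) \<odot> (\<phi> i t \<odot> t'))"
   using v tA by (intro M.finsum_cong') (auto simp: smult_assoc1 intro!: smult_lcomm)
  finally show ?thesis .
 qed
 have "(\<Oplus>i\<in>{..<n}. \<psi> (s i) \<odot> (\<phi> i t \<odot> t')) = (\<Oplus>i\<in>{..<n}. \<psi> (s i) \<odot> (\<phi> i t' \<odot> t))"
  using tA Lin_closed[OF \<psi> frame_carrier] frame_closed by (intro M.finsum_cong') (auto simp: fr)
 then show ?thesis using exp[OF t] exp[OF t(2,1)] by simp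
qed

end

section \<open>Linkage in a framed algebra\<close>

lemma coset_regular_module [simp]: "H +>\<^bsub>regular_module A\<^esub> x = H +>\<^bsub>A\<^esub> x"
 by (simp add: a_r_coset_defs)

lemma coset_restrict_scalars [simp]: "H +>\<^bsub>restrict_scalars A N\<^esub> x = H +>\<^bsub>N\<^esub> x"
 by (simp add: a_r_coset_defs)

text \<open>Forming cosets and restricting scalars commute as records, so facts pass between
  quotients over \<open>A\<close> and over \<open>k\<close> by rewriting.\<close>

lemma restrict_scalars_quot_module:
 "restrict_scalars A (quot_module N H) = quot_module (restrict_scalars A N) H"
 unfolding quot_module_def A_RCOSETS_def' rcoset_mult_def set_add_def set_mult_def
 by (simp add: restrict_scalars_def a_r_coset_defs)

lemma submodule_restrict_scalars:
 assumes "algebra k A" "module A N" "submodule H A N"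
 shows "submodule H k (restrict_scalars A N)"
proof -
 interpret A: algebra k A by fact
 interpret N: module A N by fact
 interpret Nk: module k "restrict_scalars A N" by (rule module_restrict_scalars[OF assms(1,2)])
 have "\<ominus>\<^bsub>restrict_scalars A N\<^esub> x = \<ominus>\<^sub>N x" for x by (simp add: a_inv_def m_inv_def)
 then show ?thesis
  using N.submodule_closed[OF assms(3)] by (intro Nk.submoduleI) auto
qed

lemma mod_hom_restrict_regular:
 assumes "algebra k A"
 shows "mod_hom k (restrict_scalars A (regular_module A)) K = mod_hom k A K"
proof -
 interpret A: algebra k A by fact
 show ?thesis by (auto simp: mod_hom_def A.smult_assoc2)
qed

text \<open>\<open>\<pi>\<close> is only \<open>k\<close>-linear; it encodes the projectivity of
  \<open>A/I\<close> over \<open>k\<close>.\<close>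

locale linkage = framed_algebra k A \<epsilon> n s \<phi>
 for k :: "('k, 'z) ring_scheme" and A :: "('k, 'a) module" (structure) and \<epsilon> and n and s and \<phi> +
 fixes I :: "'a set" and \<pi> :: "'a => 'a"
 assumes ideal_I: "ideal I A"
  and retract: "\<pi> \<in> mod_hom k A A" "\<And>a. a \<in> car A ==> \<pi> a \<in> I" "\<And>a. a \<in> I ==> \<pi> a = a"
begin

abbreviation "AA \<equiv> regular_module A"
abbreviation "Ak \<equiv> restrict_scalars A AA"
abbreviation "D \<equiv> dual_alg k A AA"
abbreviation "Dk \<equiv> restrict_scalars A D"
abbreviation "C \<equiv> quot_module AA I"
abbreviation "Ck \<equiv> restrict_scalars A C"
abbreviation "DC \<equiv> dual_alg k A C"
abbreviation "DCk \<equiv> restrict_scalars A DC"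
abbreviation "Soc \<equiv> Ak\<lparr>carrier := socle\<rparr>"

definition "Ann = {a \<in> car A. \<forall>x\<in>I. a \<otimes> x = \<zero>}"

lemma linked_I: "linked A I = Ann"
 unfolding Ann_def by (rule linked_eq_annihilator[OF M_cring ideal_I])

lemma I_carrier: "x \<in> I ==> x \<in> car A"
 using ideal.Icarr[OF ideal_I] .

lemma I_mult: "x \<in> I ==> a \<in> car A ==> x \<otimes> a \<in> I" "x \<in> I ==> a \<in> car A ==> a \<otimes> x \<in> I"
 using ideal.I_r_closed[OF ideal_I] ideal.I_l_closed[OF ideal_I] by auto

lemma ideal_Ann: "ideal Ann A"
proof (rule idealI)
 show "subgroup Ann (add_monoid A)"
  by (rule add.subgroupI) (auto simp: Ann_def I_carrier l_distr l_minus intro!: exI[of _ "\<zero>"])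
 fix a x assume "a \<in> Ann" and x: "x \<in> car A"
 then have a: "a \<in> car A" "\<And>y. y \<in> I ==> a \<otimes> y = \<zero>" by (auto simp: Ann_def)
 have "x \<otimes> a \<otimes> y = \<zero>" if y: "y \<in> I" for y
  using a x I_carrier[OF y] y by (simp add: m_assoc)
 then show "x \<otimes> a \<in> Ann" "a \<otimes> x \<in> Ann"
  using a(1) x m_comm[OF a(1) x] by (auto simp: Ann_def)
qed (rule ring_axioms)

lemma Ann_carrier: "a \<in> Ann ==> a \<in> car A" by (simp add: Ann_def)

lemma module_AA: "module A AA" by (rule module_regular[OF M_cring])
lemma module_Ak: "module k Ak" by (rule module_restrict_scalars[OF algebra_axioms module_AA])
lemma module_D: "module A D" by (rule module_dual_alg[OF algebra_axioms module_AA])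
lemma module_Dk: "module k Dk" by (rule module_restrict_scalars[OF algebra_axioms module_D])
lemma submodule_I: "submodule I A AA" by (rule submodule_of_ideal[OF M_cring ideal_I])
lemma submodule_Ann: "submodule Ann A AA" by (rule submodule_of_ideal[OF M_cring ideal_Ann])
lemma module_C: "module A C" by (rule module_quot_module[OF module_AA submodule_I])
lemma module_Ck: "module k Ck" by (rule module_restrict_scalars[OF algebra_axioms module_C])
lemma module_DC: "module A DC" by (rule module_dual_alg[OF algebra_axioms module_C])
lemma module_DCk: "module k DCk" by (rule module_restrict_scalars[OF algebra_axioms module_DC])

lemma carrier_D: "car D = Lin \<inter> extensional (car A)"
 by (simp add: mod_hom_restrict_regular[OF algebra_axioms])

lemma smult_D: "a \<odot>\<^sub>D f = (\<lambda>x\<in>car A. f (a \<otimes> x))" by simp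

lemma add_D: "f \<oplus>\<^sub>D g = (\<lambda>x\<in>car A. f x \<oplus>\<^sub>k g x)" by simp

lemma Lin_restrict: "\<psi> \<in> Lin ==> restrict \<psi> (car A) \<in> car D"
 unfolding carrier_D by (auto simp: mod_hom_def)

lemma Lin_restrict': "\<psi> \<in> Lin ==> restrict \<psi> (car A) \<in> Lin"
 using Lin_restrict carrier_D by blast

lemma submodule_socle: "submodule socle k Ak"
proof -
 interpret Ak: module k Ak by (rule module_Ak)
 have "\<ominus>\<^bsub>Ak\<^esub> x = \<ominus> x" for x by (simp add: a_inv_def m_inv_def)
 then show ?thesis
  using submodule_closed[OF socle_submodule]
  by (intro Ak.submoduleI) (auto simp: smult_one_mult)
qed

lemma module_Soc: "module k Soc"
 by (rule submodule.submodule_is_module[OF submodule_socle module_Ak])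

text \<open>Multiplication by \<open>y \<in> I\<close> moves into the functional by
  \<open>\<theta>_act\<close>, and \<open>x \<mapsto> \<psi> (y x)\<close> vanishes because
  \<open>I\<close> is an ideal.\<close>

lemma \<theta>_in_Ann:
 assumes t: "t \<in> socle" and \<psi>: "\<psi> \<in> Lin" and 0: "\<And>x. x \<in> I ==> \<psi> x = \<zero>\<^sub>k"
 shows "\<theta> t \<psi> \<in> Ann"
proof -
 have "\<theta> t \<psi> \<otimes> y = \<zero>" if y: "y \<in> I" for y
 proof -
  have yA: "y \<in> car A" by (rule I_carrier[OF y])
  have "\<theta> t \<psi> \<otimes> y = y \<otimes> \<theta> t \<psi>" using \<theta>_closed[OF t \<psi>] yA by (simp add: m_comm)
  also have "... = \<theta> t (\<lambda>x. \<psi> (y \<otimes> x))" by (rule \<theta>_act[OF t \<psi> yA, symmetric])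
  also have "... = \<zero>" by (rule \<theta>_zero[OF t Lin_mult[OF \<psi> yA]]) (use 0 I_mult y in auto)
  finally show ?thesis .
 qed
 then show ?thesis using \<theta>_closed[OF t \<psi>] by (simp add: Ann_def)
qed

text \<open>For any functional \<open>\<psi>\<close>, the difference of \<open>\<psi>\<close> and
  \<open>\<psi>\<close> after \<open>\<pi>\<close> vanishes on \<open>I\<close>, hence at
  \<open>x\<close>. So every functional kills \<open>x - \<pi> x\<close>, which is therefore
  zero.\<close>

lemma I_separates:
 assumes x: "x \<in> car A" and 0: "\<And>\<psi>. \<psi> \<in> Lin ==> (\<And>y. y \<in> I ==> \<psi> y = \<zero>\<^sub>k) ==> \<psi> x = \<zero>\<^sub>k"
 shows "x \<in> I"
proof -
 have \<pi>c: "\<pi> a \<in> car A" if "a \<in> car A" for a by (rule mod_hom_closed[OF retract(1) that])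
 have "x \<ominus> \<pi> x = \<zero>"
 proof (rule Lin_separates)
  show "x \<ominus> \<pi> x \<in> car A" using x \<pi>c by simp
  fix \<psi> assume \<psi>: "\<psi> \<in> Lin"
  have "(\<lambda>a. \<psi> a \<ominus>\<^sub>k \<psi> (\<pi> a)) \<in> Lin"
   by (rule R.functional_diff[OF \<psi> mod_hom_comp[OF retract(1) \<psi>] module_axioms])
  moreover have "\<psi> y \<ominus>\<^sub>k \<psi> (\<pi> y) = \<zero>\<^sub>k" if "y \<in> I" for y
   using that retract(3) Lin_closed[OF \<psi> I_carrier[OF that]] by (simp add: R.right_minus_eq)
  ultimately have "\<psi> x \<ominus>\<^sub>k \<psi> (\<pi> x) = \<zero>\<^sub>k" by (rule 0)
  then show "\<psi> (x \<ominus> \<pi> x) = \<zero>\<^sub>k" using x \<pi>c by (simp add: Lin_minus[OF \<psi>])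
 qed
 then show ?thesis using retract(2)[OF x] x \<pi>c[OF x] by (simp add: M.right_minus_eq)
qed

lemma frame_zeroI:
 assumes "c \<in> car k" "\<And>i. i < n ==> \<phi> i (s i) \<otimes>\<^sub>k c = \<zero>\<^sub>k"
 shows "c = \<zero>\<^sub>k"
proof -
 have "(\<Oplus>\<^sub>k i\<in>{..<n}. \<phi> i (s i)) \<otimes>\<^sub>k c = (\<Oplus>\<^sub>k i\<in>{..<n}. \<phi> i (s i) \<otimes>\<^sub>k c)"
  by (rule R.finsum_ldistr) (use assms(1) frame_closed frame_carrier in auto)
 also have "... = \<zero>\<^sub>k" by (rule R.finsum_all_zero) (use assms(2) in auto)
 finally show ?thesis using assms(1) by (simp add: frame_one)
qed

text \<open>Enough elements of \<open>Ann\<close> are supplied by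
  \<open>\<theta> (s i) \<psi>\<close> with \<open>\<psi>\<close> vanishing on \<open>I\<close>: if
  \<open>x\<close> kills them all, applying \<open>\<phi> i\<close> gives
  \<open>\<phi> i (s i) \<psi> x = 0\<close> for every \<open>i\<close>, and so
  \<open>\<psi> x = 0\<close>.\<close>

lemma Ann_Ann: "I = {a \<in> car A. \<forall>x\<in>Ann. a \<otimes> x = \<zero>}"
proof (intro equalityI subsetI)
 fix x assume "x \<in> I"
 then show "x \<in> {a \<in> car A. \<forall>x\<in>Ann. a \<otimes> x = \<zero>}"
  using I_carrier by (auto simp: Ann_def m_comm)
next
 fix x assume "x \<in> {a \<in> car A. \<forall>x\<in>Ann. a \<otimes> x = \<zero>}"
 then have x: "x \<in> car A" and ann: "\<And>y. y \<in> Ann ==> x \<otimes> y = \<zero>" by auto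
 show "x \<in> I"
 proof (rule I_separates[OF x])
  fix \<psi> assume \<psi>: "\<psi> \<in> Lin" and 0: "\<And>y. y \<in> I ==> \<psi> y = \<zero>\<^sub>k"
  show "\<psi> x = \<zero>\<^sub>k"
  proof (rule frame_zeroI[OF Lin_closed[OF \<psi> x]])
   fix i assume i: "i < n"
   have "\<theta> (s i) \<psi> \<otimes> x = \<zero>"
    using ann[OF \<theta>_in_Ann[OF frame_socle[OF i] \<psi> 0]] x \<theta>_closed[OF frame_socle[OF i] \<psi>] by (simp add: m_comm)
   then show "\<phi> i (s i) \<otimes>\<^sub>k \<psi> x = \<zero>\<^sub>k"
    using \<theta>_eq[OF frame_socle[OF i] \<psi> i x] Lin_zero[OF frame_Lin[OF i]] by simp
  qed
 qed
qed

lemma linked_linked: "I = linked A (linked A I)"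
 unfolding linked_I linked_eq_annihilator[OF M_cring ideal_Ann] by (rule Ann_Ann)

subsection \<open>The isomorphism of \<open>A\<close> with the socle tensor the dual\<close>

abbreviation "SD \<equiv> tensor_alg k A Soc D"
abbreviation "SDC \<equiv> tensor_alg k A Soc DC"
abbreviation "tn \<equiv> tens k Soc Dk"
abbreviation "tnC \<equiv> tens k Soc DCk"

lemmas SD_module = module_tensor_alg[OF algebra_axioms module_Soc module_D]
lemmas SDC_module = module_tensor_alg[OF algebra_axioms module_Soc module_DC]

lemma smult_Soc: "c \<in> car k ==> t \<in> socle ==> c \<odot>\<^bsub>Soc\<^esub> t = c \<odot> t"
 using socle_carrier by (simp add: restrict_scalars_def smult_one_mult)

lemma carrier_Soc: "car Soc = socle" by simp

text \<open>The canonical element of \<open>Soc(A)\<close> tensor the dual of \<open>A\<close>; it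
  is the image of one under the isomorphism.\<close>

definition "w = (\<Oplus>\<^sub>SD i\<in>{..<n}. tn (s i) (restrict (\<phi> i) (car A)))"

lemma tn_closed: "t \<in> socle ==> \<psi> \<in> car D ==> tn t \<psi> \<in> car SD"
 by (rule ten_closed[OF algebra_axioms module_Soc module_D]) auto

lemma tnC_closed: "t \<in> socle ==> g \<in> car DC ==> tnC t g \<in> car SDC"
 by (rule ten_closed[OF algebra_axioms module_Soc module_DC]) auto

lemma frame_D: "i < n ==> restrict (\<phi> i) (car A) \<in> car D"
 by (rule Lin_restrict[OF frame_Lin])

lemma w_closed: "w \<in> car SD"
proof -
 interpret SD: module A SD by (rule SD_module)
 show ?thesis unfolding w_def using tn_closed frame_socle frame_D by (intro SD.M.finsum_closed) blast
qed

lemma smult_w: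
 assumes a: "a \<in> car A"
 shows "a \<odot>\<^sub>SD w = (\<Oplus>\<^sub>SD i\<in>{..<n}. tn (s i) (a \<odot>\<^sub>D restrict (\<phi> i) (car A)))"
proof -
 interpret SD: module A SD by (rule SD_module)
 have "a \<odot>\<^sub>SD w = (\<Oplus>\<^sub>SD i\<in>{..<n}. a \<odot>\<^sub>SD tn (s i) (restrict (\<phi> i) (car A)))"
  unfolding w_def by (rule SD.finsum_smult_ldistr) (use tn_closed frame_socle frame_D a in blast)+
 also have "... = (\<Oplus>\<^sub>SD i\<in>{..<n}. tn (s i) (a \<odot>\<^sub>D restrict (\<phi> i) (car A)))"
 proof (rule SD.M.finsum_cong')
  fix i assume "i \<in> {..<n}"
  then have i: "i < n" by simp
  show "a \<odot>\<^sub>SD tn (s i) (restrict (\<phi> i) (car A)) = tn (s i) (a \<odot>\<^sub>D restrict (\<phi> i) (car A))"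
   by (rule ten_smult[OF algebra_axioms module_Soc module_D a _ frame_D[OF i]]) (use frame_socle[OF i] in simp)
 qed (use tn_closed frame_socle module.smult_closed[OF module_D a frame_D] in blast)+
 finally show ?thesis .
qed

lemma \<Theta>_exists: "\<exists>h \<in> mod_hom A SD AA. \<forall>t\<in>socle. \<forall>\<psi>\<in>car D. h (tn t \<psi>) = \<theta> t \<psi>"
proof -
 have DL: "\<psi> \<in> Lin" if "\<psi> \<in> car D" for \<psi> using that unfolding carrier_D by blast
 have "\<exists>h \<in> mod_hom A SD AA. \<forall>t\<in>car Soc. \<forall>\<psi>\<in>car D. h (tn t \<psi>) = \<theta> t \<psi>"
 proof (rule tensor_alg_lift[OF algebra_axioms module_Soc module_D module_AA], unfold carrier_Soc)
  fix t \<psi> assume t: "t \<in> socle" and \<psi>: "\<psi> \<in> car D"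
  note \<psi>L = DL[OF \<psi>]
  show "\<theta> t \<psi> \<in> car AA" using \<theta>_closed[OF t \<psi>L] by simp
  show "\<theta> (t \<oplus>\<^bsub>Soc\<^esub> t') \<psi> = \<theta> t \<psi> \<oplus>\<^sub>AA \<theta> t' \<psi>" if "t' \<in> socle" for t'
   using \<theta>_add_left[OF t that \<psi>L] by simp
  show "\<theta> t (\<psi> \<oplus>\<^sub>D \<psi>') = \<theta> t \<psi> \<oplus>\<^sub>AA \<theta> t \<psi>'" if "\<psi>' \<in> car D" for \<psi>'
   unfolding add_D using \<theta>_add_right[OF t \<psi>L DL[OF that]]
    \<theta>_cong[OF t Lin_restrict'[OF Lin_sum[OF \<psi>L DL[OF that]]] Lin_sum[OF \<psi>L DL[OF that]]] by simp
  show "\<theta> (c \<odot>\<^bsub>Soc\<^esub> t) \<psi> = (c \<odot> \<one>) \<odot>\<^sub>AA \<theta> t \<psi>" if "c \<in> car k" for c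
   using \<theta>_smult_left[OF t \<psi>L that] \<theta>_closed[OF t \<psi>L] that by (simp only: smult_Soc[OF that t]) (simp add: smult_one_mult)
  show "\<theta> t (a \<odot>\<^sub>D \<psi>) = a \<odot>\<^sub>AA \<theta> t \<psi>" if "a \<in> car A" for a
   unfolding smult_D using \<theta>_act[OF t \<psi>L that]
    \<theta>_cong[OF t Lin_restrict'[OF Lin_mult[OF \<psi>L that]] Lin_mult[OF \<psi>L that]] by simp
 qed
 then show ?thesis by simp
qed

definition "\<Theta> = (SOME h. h \<in> mod_hom A SD AA \<and> (\<forall>t\<in>socle. \<forall>\<psi>\<in>car D. h (tn t \<psi>) = \<theta> t \<psi>))"

lemma \<Theta>_hom: "\<Theta> \<in> mod_hom A SD AA"
 and \<Theta>_tn: "t \<in> socle ==> \<psi> \<in> car D ==> \<Theta> (tn t \<psi>) = \<theta> t \<psi>"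
proof -
 have "\<exists>h. h \<in> mod_hom A SD AA \<and> (\<forall>t\<in>socle. \<forall>\<psi>\<in>car D. h (tn t \<psi>) = \<theta> t \<psi>)"
  using \<Theta>_exists unfolding Bex_def .
 from someI_ex[OF this] show "\<Theta> \<in> mod_hom A SD AA"
  "t \<in> socle ==> \<psi> \<in> car D ==> \<Theta> (tn t \<psi>) = \<theta> t \<psi>"
  unfolding \<Theta>_def by auto
qed

lemma \<theta>_frame_restrict: "i < n ==> \<theta> (s i) (restrict (\<phi> i) (car A)) = \<phi> i (s i) \<odot> \<one>"
 using \<theta>_cong[OF frame_socle Lin_restrict'[OF frame_Lin] frame_Lin, of i i i] \<theta>_frame[OF frame_socle, of i i] by simp

lemma \<Theta>_w: "\<Theta> w = \<one>"
proof -
 have "\<Theta> w = (\<Oplus>\<^sub>AA i\<in>{..<n}. \<Theta> (tn (s i) (restrict (\<phi> i) (car A))))"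
  unfolding w_def by (rule mod_hom_finsum[OF SD_module module_AA \<Theta>_hom]) (use tn_closed frame_socle frame_D in blast)+
 also have "... = (\<Oplus>i\<in>{..<n}. \<phi> i (s i) \<odot> \<one>)"
  unfolding finsum_regular
 proof (rule M.finsum_cong')
  fix i assume "i \<in> {..<n}"
  then have i: "i < n" by simp
  show "\<Theta> (tn (s i) (restrict (\<phi> i) (car A))) = \<phi> i (s i) \<odot> \<one>"
   using \<Theta>_tn[OF frame_socle[OF i] frame_D[OF i]] \<theta>_frame_restrict[OF i] by simp
 qed (use frame_closed frame_carrier in auto)
 also have "... = (\<Oplus>\<^sub>k i\<in>{..<n}. \<phi> i (s i)) \<odot> \<one>"
  by (rule finsum_smult_rdistr[symmetric]) (use frame_closed frame_carrier in auto)
 finally show ?thesis by (simp add: frame_one)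
qed

lemma \<Theta>_smult_w: "a \<in> car A ==> \<Theta> (a \<odot>\<^sub>SD w) = a"
 using mod_hom_smult[OF \<Theta>_hom _ w_closed, of a] by (simp add: \<Theta>_w del: tensor_alg_simps)

lemma tn_left_hom:
 assumes "\<psi> \<in> car D"
 shows "(\<lambda>t. tn t \<psi>) \<in> mod_hom k Soc (tensor k Soc Dk)"
proof -
 have \<psi>: "\<psi> \<in> car Dk" using assms by (simp only: restrict_scalars_simps)
 show ?thesis
  by (rule mod_homI) (rule tens_closed[OF module_Soc module_Dk _ \<psi>]
   tens_add_left[OF module_Soc module_Dk _ _ \<psi>] tens_smult_left[OF module_Soc module_Dk _ _ \<psi>]; assumption)+
qed

lemma finsum_Soc:
 assumes "finite K" "f \<in> K \<rightarrow> socle"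
 shows "finsum Soc f K = finsum A f K"
 using finsum_submodule[OF module_Ak submodule_socle assms] by simp

lemma finsum_SD: "finsum SD = finsum (tensor k Soc Dk)"
 by (rule finsum_cong_structure) simp_all

text \<open>Acting by \<open>\<theta> t \<psi>\<close> turns each \<open>\<phi> i\<close> into
  \<open>\<phi> i t \<psi>\<close>. Moved across the tensor sign, the scalars
  \<open>\<phi> i t\<close> reassemble \<open>t\<close> from the \<open>s i\<close>.\<close>

lemma smult_w_\<theta>:
 assumes t: "t \<in> socle" and \<psi>: "\<psi> \<in> car D"
 shows "\<theta> t \<psi> \<odot>\<^sub>SD w = tn t \<psi>"
proof -
 have \<psi>L: "\<psi> \<in> Lin" using \<psi> unfolding carrier_D by blast
 note \<theta>c = \<theta>_closed[OF t \<psi>L]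
 have ft: "\<phi> i t \<in> car k" if "i < n" for i by (rule frame_closed[OF that socle_carrier[OF t]])
 interpret SD: module A SD by (rule SD_module)
 have "\<theta> t \<psi> \<odot>\<^sub>SD w = (\<Oplus>\<^sub>SD i\<in>{..<n}. tn (s i) (\<theta> t \<psi> \<odot>\<^sub>D restrict (\<phi> i) (car A)))"
  by (rule smult_w[OF \<theta>c])
 also have "... = (\<Oplus>\<^sub>SD i\<in>{..<n}. tn (\<phi> i t \<odot> s i) \<psi>)"
 proof (rule SD.M.finsum_cong')
  fix i assume "i \<in> {..<n}"
  then have i: "i < n" by simp
  have "\<theta> t \<psi> \<odot>\<^sub>D restrict (\<phi> i) (car A) = (\<phi> i t \<odot> \<one>) \<odot>\<^sub>D \<psi>"
   unfolding smult_D using \<theta>_eq[OF t \<psi>L i] \<theta>c ft[OF i] Lin_smult[OF \<psi>L]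
   by (auto intro!: restrict_ext simp: smult_one_mult)
  then show "tn (s i) (\<theta> t \<psi> \<odot>\<^sub>D restrict (\<phi> i) (car A)) = tn (\<phi> i t \<odot> s i) \<psi>"
   using ten_smult_left[OF algebra_axioms module_Soc module_D ft[OF i] _ \<psi>, of "s i"] frame_socle[OF i]
   by (simp add: smult_Soc[OF ft[OF i] frame_socle[OF i], simplified] del: dual_alg_simps)
 qed (use tn_closed socle_smult[OF ft frame_socle] \<psi> in blast)+
 also have "... = tn (finsum Soc (\<lambda>i. \<phi> i t \<odot> s i) {..<n}) \<psi>"
  unfolding finsum_SD
  by (rule mod_hom_finsum[OF module_Soc module_tensor[OF module_Soc module_Dk] tn_left_hom[OF \<psi>], symmetric])
   (use socle_smult[OF ft frame_socle] in auto)
 also have "finsum Soc (\<lambda>i. \<phi> i t \<odot> s i) {..<n} = t"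
  using finsum_Soc[of "{..<n}" "\<lambda>i. \<phi> i t \<odot> s i"] socle_smult[OF ft frame_socle] socle_expand[OF t] by auto
 finally show ?thesis .
qed

lemma \<Theta>_w_smult:
 assumes x: "x \<in> car SD"
 shows "\<Theta> x \<odot>\<^sub>SD w = x"
proof -
 interpret SD: module A SD by (rule SD_module)
 have h1: "(\<lambda>x. \<Theta> x \<odot>\<^sub>SD w) \<in> mod_hom A SD SD"
 proof (rule mod_homI)
  fix x y assume x: "x \<in> car SD" and y: "y \<in> car SD"
  have \<Theta>c: "\<Theta> z \<in> car A" if "z \<in> car SD" for z using mod_hom_closed[OF \<Theta>_hom that] by simp
  show "\<Theta> x \<odot>\<^sub>SD w \<in> car SD" by (rule SD.smult_closed[OF \<Theta>c[OF x] w_closed])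
  have "\<Theta> (x \<oplus>\<^sub>SD y) = \<Theta> x \<oplus> \<Theta> y" using mod_hom_add[OF \<Theta>_hom x y] by simp
  then show "\<Theta> (x \<oplus>\<^sub>SD y) \<odot>\<^sub>SD w = \<Theta> x \<odot>\<^sub>SD w \<oplus>\<^sub>SD \<Theta> y \<odot>\<^sub>SD w"
   using SD.smult_l_distr[OF \<Theta>c[OF x] \<Theta>c[OF y] w_closed] by (simp only:)
  fix a assume a: "a \<in> car A"
  have "\<Theta> (a \<odot>\<^sub>SD x) = a \<otimes> \<Theta> x" using mod_hom_smult[OF \<Theta>_hom a x] by simp
  then show "\<Theta> (a \<odot>\<^sub>SD x) \<odot>\<^sub>SD w = a \<odot>\<^sub>SD (\<Theta> x \<odot>\<^sub>SD w)"
   using SD.smult_assoc1[OF a \<Theta>c[OF x] w_closed] by (simp only:)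
 qed
 have h2: "(\<lambda>x. x) \<in> mod_hom A SD SD" by (rule mod_homI) auto
 show ?thesis
 proof (rule tensor_alg_hom_eqI[OF algebra_axioms module_Soc module_D SD_module h1 h2 SD_module _ x], unfold carrier_Soc)
  fix t \<psi> assume t: "t \<in> socle" "\<psi> \<in> car D"
  show "\<Theta> (tn t \<psi>) \<odot>\<^sub>SD w = tn t \<psi>" unfolding \<Theta>_tn[OF t] by (rule smult_w_\<theta>[OF t])
 qed
qed

lemma A_iso_SD: "(\<lambda>a. a \<odot>\<^sub>SD w) \<in> mod_iso A AA SD"
proof -
 interpret SD: module A SD by (rule SD_module)
 have "(\<lambda>a. a \<odot>\<^sub>SD w) \<in> mod_hom A AA SD"
 proof (rule mod_homI)
  fix a b assume "a \<in> car AA" "b \<in> car AA"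
  then have ab: "a \<in> car A" "b \<in> car A" by auto
  show "a \<odot>\<^sub>SD w \<in> car SD" by (rule SD.smult_closed[OF ab(1) w_closed])
  show "(a \<oplus>\<^sub>AA b) \<odot>\<^sub>SD w = a \<odot>\<^sub>SD w \<oplus>\<^sub>SD b \<odot>\<^sub>SD w"
   using SD.smult_l_distr[OF ab w_closed] by (simp only: regular_module_simps)
 next
  fix a b assume "a \<in> car A" "b \<in> car AA"
  then have ab: "a \<in> car A" "b \<in> car A" by auto
  show "(a \<odot>\<^sub>AA b) \<odot>\<^sub>SD w = a \<odot>\<^sub>SD (b \<odot>\<^sub>SD w)"
   using SD.smult_assoc1[OF ab w_closed] by (simp only: regular_module_simps)
 qed
 moreover have "bij_betw (\<lambda>a. a \<odot>\<^sub>SD w) (car AA) (car SD)"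
 proof (rule bij_betw_byWitness[where f' = \<Theta>])
  show "\<forall>a\<in>car AA. \<Theta> (a \<odot>\<^sub>SD w) = a" using \<Theta>_smult_w by simp
  show "\<forall>x\<in>car SD. \<Theta> x \<odot>\<^sub>SD w = x" using \<Theta>_w_smult by blast
  show "(\<lambda>a. a \<odot>\<^sub>SD w) ` car AA \<subseteq> car SD"
   using SD.smult_closed[OF _ w_closed] by (auto simp del: tensor_alg_simps)
  show "\<Theta> ` car SD \<subseteq> car AA" using mod_hom_closed[OF \<Theta>_hom] by blast
 qed
 ultimately show ?thesis by (simp add: mod_iso_def)
qed

end

lemma tens_zero_right:
 assumes "module k M" "module k N" "m \<in> car M"
 shows "tens k M N m \<zero>\<^sub>N = \<zero>\<^bsub>tensor k M N\<^esub>"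
proof -
 interpret N: module k N by fact
 interpret T: module k "tensor k M N" by (rule module_tensor[OF assms(1,2)])
 have "tens k M N m (\<zero>\<^sub>k \<odot>\<^sub>N \<zero>\<^sub>N) = \<zero>\<^sub>k \<odot>\<^bsub>tensor k M N\<^esub> tens k M N m \<zero>\<^sub>N"
  by (rule tens_smult_right[OF assms(1,2)]) (use assms(3) in auto)
 then show ?thesis using tens_closed[OF assms(1,2,3)] by simp
qed

context linkage
begin

subsection \<open>The dual of the quotient\<close>

lemma add_DC: "f \<oplus>\<^sub>DC g = (\<lambda>X\<in>car C. f X \<oplus>\<^sub>k g X)" by simp

lemma smult_DC: "a \<odot>\<^sub>DC f = (\<lambda>X\<in>car C. f (a \<odot>\<^sub>C X))" by simp

lemma zero_DC: "\<zero>\<^sub>DC = (\<lambda>X\<in>car C. \<zero>\<^sub>k)" by simp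

lemma carrier_C: "car C = (\<lambda>a. I +> a) ` car A"
 by (simp add: carrier_quot_module)

lemma coset_closed: "a \<in> car A ==> I +> a \<in> car C"
 by (simp add: carrier_C)

lemma smult_C: "a \<in> car A ==> b \<in> car A ==> a \<odot>\<^sub>C (I +> b) = I +> (a \<otimes> b)"
 using smult_quot_module[OF module_AA submodule_I, of a b] by simp

lemma minus_AA: "x \<ominus>\<^sub>AA y = x \<ominus> y"
 by (simp add: a_minus_def a_inv_def m_inv_def)

lemma coset_eq_C: "a \<in> car A ==> b \<in> car A ==>
  I +> a = I +> b \<longleftrightarrow> a \<ominus> b \<in> I"
 using coset_eq_iff[OF module_AA submodule_I, of a b] by (simp add: minus_AA)

lemma coset_zero_C: "a \<in> car A ==> I +> a = \<zero>\<^sub>C \<longleftrightarrow> a \<in> I"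
 using coset_zero_iff[OF module_AA submodule_I, of a] by simp

lemma DC_hom: "g \<in> car DC ==> g \<in> lin k Ck"
 by simp

lemma pullback_Lin:
 assumes "g \<in> lin k Ck"
 shows "(\<lambda>a. g (I +> a)) \<in> Lin"
proof -
 have q: "(\<lambda>a. I +> a) \<in> mod_hom k Ak Ck"
  using mod_hom_restrict_scalars[OF algebra_axioms quot_module_hom[OF module_AA submodule_I]] by simp
 show ?thesis
  using mod_hom_comp[OF q assms] by (simp add: mod_hom_restrict_regular[OF algebra_axioms])
qed

lemma descend_Lin:
 assumes \<psi>: "\<psi> \<in> Lin" and 0: "\<And>x. x \<in> I ==> \<psi> x = \<zero>\<^sub>k"
 shows "\<exists>g\<in>car DC. \<forall>a\<in>car A. g (I +> a) = \<psi> a"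
proof -
 have sub: "submodule I k Ak" by (rule submodule_restrict_scalars[OF algebra_axioms module_AA submodule_I])
 have \<psi>': "\<psi> \<in> lin k Ak" using \<psi> by (simp add: mod_hom_restrict_regular[OF algebra_axioms])
 have \<psi>0: "\<And>x. x \<in> I ==> \<psi> x = \<zero>\<^bsub>regular_module k\<^esub>" using 0 by simp
 obtain g where g: "g \<in> lin k (quot_module Ak I)"
  "\<And>x. x \<in> car Ak ==> g (I +>\<^bsub>Ak\<^esub> x) = \<psi> x"
  using quot_module_lift[OF module_Ak module_regular[OF R_cring] sub \<psi>' \<psi>0] by blast
 have gC: "g \<in> lin k Ck" using g(1) by (simp only: restrict_scalars_quot_module)
 \<comment> \<open>The lift is arbitrary off the cosets, whereas members of the dual are
   extensional.\<close>
 have "restrict g (car C) \<in> lin k Ck"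
  by (rule mod_hom_cong[OF module_Ck gC]) simp
 then have "restrict g (car C) \<in> car DC" by simp
 moreover have "restrict g (car C) (I +> a) = \<psi> a" if "a \<in> car A" for a
  using g(2)[of a] coset_closed[OF that] that by simp
 ultimately show ?thesis by blast
qed

abbreviation "incl \<equiv> quot_dual_incl A I"

lemma incl_hom: "incl \<in> mod_hom A DC D"
proof (rule mod_homI)
 fix f g assume f: "f \<in> car DC" and g: "g \<in> car DC"
 show "incl f \<in> car D"
  unfolding quot_dual_incl_def by (rule Lin_restrict[OF pullback_Lin[OF DC_hom[OF f]]])
 show "incl (f \<oplus>\<^sub>DC g) = incl f \<oplus>\<^sub>D incl g"
  unfolding add_DC add_D using coset_closed by (auto simp: quot_dual_incl_def)
next
 fix a f assume a: "a \<in> car A" and f: "f \<in> car DC"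
 show "incl (a \<odot>\<^sub>DC f) = a \<odot>\<^sub>D incl f"
  unfolding smult_DC smult_D using coset_closed a by (auto simp: quot_dual_incl_def smult_C)
qed

lemma incl_vanishes:
 assumes "\<psi> \<in> car D" "\<And>x. x \<in> I ==> \<psi> x = \<zero>\<^sub>k"
 shows "\<exists>g\<in>car DC. incl g = \<psi>"
proof -
 have \<psi>: "\<psi> \<in> Lin" "\<psi> \<in> extensional (car A)" using assms(1) unfolding carrier_D by auto
 from descend_Lin[OF \<psi>(1) assms(2)] obtain g where g: "g \<in> car DC" "\<forall>a\<in>car A. g (I +> a) = \<psi> a"
  by blast
 have "incl g = \<psi>"
  by (rule extensionalityI[of _ "car A"]) (use g(2) \<psi>(2) in \<open>auto simp: quot_dual_incl_def\<close>)
 then show ?thesis using g(1) by blast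
qed

text \<open>Composition with the \<open>k\<close>-linear section of the quotient map that sends the
  coset of \<open>a\<close> to \<open>a - \<pi> a\<close>. Unlike injectivity of
  \<open>incl\<close>, a retraction survives tensoring.\<close>

lemma incl_retraction: "\<exists>\<rho> \<in> mod_hom k Dk DCk. \<forall>g\<in>car DC. \<rho> (incl g) = g"
proof -
 have sub: "submodule I k Ak" by (rule submodule_restrict_scalars[OF algebra_axioms module_AA submodule_I])
 have \<pi>c: "\<pi> a \<in> car A" if "a \<in> car A" for a by (rule mod_hom_closed[OF retract(1) that])
 have id: "(\<lambda>a. a) \<in> mod_hom k A A" by (rule mod_homI) auto
 have f: "(\<lambda>a. a \<ominus> \<pi> a) \<in> mod_hom k A A"
  by (rule mod_hom_diff[OF module_axioms module_axioms id retract(1)])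
 then have f': "(\<lambda>a. a \<ominus> \<pi> a) \<in> mod_hom k Ak Ak"
  unfolding mod_hom_restrict_regular[OF algebra_axioms]
  using mod_homD[OF f] \<pi>c by (intro mod_homI) (simp_all add: smult_one_mult)
 have f0: "x \<ominus> \<pi> x = \<zero>\<^bsub>Ak\<^esub>" if "x \<in> I" for x
  using retract(3)[OF that] I_carrier[OF that] by (simp add: M.right_minus_eq)
 obtain sec where sec: "sec \<in> mod_hom k (quot_module Ak I) Ak"
  "\<And>x. x \<in> car Ak ==> sec (I +>\<^bsub>Ak\<^esub> x) = x \<ominus> \<pi> x"
  using quot_module_lift[OF module_Ak module_Ak sub f' f0] by blast
 have secC: "sec \<in> mod_hom k Ck Ak" using sec(1) by (simp only: restrict_scalars_quot_module)
 have sec_closed: "sec X \<in> car A" if "X \<in> car C" for X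
  using mod_hom_closed[OF secC, of X] that by simp
 have sec_smult: "sec ((c \<odot> \<one>) \<odot>\<^sub>C X) = (c \<odot> \<one>) \<otimes> sec X" if "c \<in> car k" "X \<in> car C" for c X
  using mod_hom_smult[OF secC that(1), of X] that(2) by simp
 have smC: "(c \<odot> \<one>) \<odot>\<^sub>C X \<in> car C" if "c \<in> car k" "X \<in> car C" for c X
  using module.smult_closed[OF module_C, of "c \<odot> \<one>" X] that by simp
 define \<rho> where "\<rho> \<psi> = (\<lambda>X\<in>car C. \<psi> (sec X))" for \<psi> :: "'a => 'k"
 have "\<rho> \<in> mod_hom k Dk DCk"
 proof (rule mod_homI)
  fix \<psi> \<chi> assume "\<psi> \<in> car Dk" "\<chi> \<in> car Dk"
  then have \<psi>: "\<psi> \<in> car D" and \<chi>: "\<chi> \<in> car D" by (simp_all only: restrict_scalars_simps)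
  then have \<psi>h: "\<psi> \<in> lin k Ak" by simp
  have "\<rho> \<psi> \<in> lin k Ck"
   by (rule mod_hom_cong[OF module_Ck mod_hom_comp[OF secC \<psi>h]]) (simp add: \<rho>_def)
  then show "\<rho> \<psi> \<in> car DCk" by (simp add: \<rho>_def)
  have "\<rho> (\<psi> \<oplus>\<^sub>D \<chi>) = \<rho> \<psi> \<oplus>\<^sub>DC \<rho> \<chi>"
   unfolding add_D add_DC using sec_closed by (auto simp: \<rho>_def)
  then show "\<rho> (\<psi> \<oplus>\<^bsub>Dk\<^esub> \<chi>) = \<rho> \<psi> \<oplus>\<^bsub>DCk\<^esub> \<rho> \<chi>" by (simp only: restrict_scalars_simps)
 next
  fix c \<psi> assume c: "c \<in> car k" and "\<psi> \<in> car Dk"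
  have "\<rho> ((c \<odot> \<one>) \<odot>\<^sub>D \<psi>) = (c \<odot> \<one>) \<odot>\<^sub>DC \<rho> \<psi>"
   unfolding smult_D smult_DC using sec_closed sec_smult[OF c] smC[OF c] by (auto simp: \<rho>_def)
  then show "\<rho> (c \<odot>\<^bsub>Dk\<^esub> \<psi>) = c \<odot>\<^bsub>DCk\<^esub> \<rho> \<psi>" by (simp only: restrict_scalars_simps)
 qed
 moreover have "\<rho> (incl g) = g" if g: "g \<in> car DC" for g
 proof (rule extensionalityI[of _ "car C"])
  show "\<rho> (incl g) \<in> extensional (car C)" by (simp add: \<rho>_def)
  show "g \<in> extensional (car C)" using g by simp
  fix X assume X: "X \<in> car C"
  then obtain a where a: "a \<in> car A" "X = I +> a" by (auto simp: carrier_C)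
  have sX: "sec X = a \<ominus> \<pi> a" using sec(2)[of a] a by simp
  have "a \<ominus> (a \<ominus> \<pi> a) = \<pi> a"
   using a(1) \<pi>c[OF a(1)] by (simp add: a_minus_def minus_add minus_minus M.a_assoc[symmetric] r_neg)
  then have "I +> a = I +> (a \<ominus> \<pi> a)"
   using coset_eq_C[of a "a \<ominus> \<pi> a"] retract(2)[OF a(1)] a(1) \<pi>c[OF a(1)] by simp
  then have "I +> sec X = X" unfolding sX using a(2) by simp
  then show "\<rho> (incl g) X = g X" using X sec_closed[OF X] by (simp add: \<rho>_def quot_dual_incl_def)
 qed
 ultimately show ?thesis by blast
qed

abbreviation "J \<equiv> tensor_map k Soc DCk Dk incl"

lemma
 shows J_hom_k: "J \<in> mod_hom k (tensor k Soc DCk) (tensor k Soc Dk)"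
  and J_tn: "t \<in> socle ==> g \<in> car DC ==> J (tnC t g) = tn t (incl g)"
proof -
 note incl_k = mod_hom_restrict_scalars[OF algebra_axioms incl_hom]
 show "J \<in> mod_hom k (tensor k Soc DCk) (tensor k Soc Dk)"
  by (rule tensor_map_hom(1)[OF module_Soc module_DCk module_Dk incl_k])
 show "t \<in> socle ==> g \<in> car DC ==> J (tnC t g) = tn t (incl g)"
  using tensor_map_hom(2)[OF module_Soc module_DCk module_Dk incl_k, of t g]
  by (simp only: restrict_scalars_simps carrier_Soc)
qed

lemma J_hom: "J \<in> mod_hom A SDC SD"
proof (rule mod_homI)
 interpret SD: module A SD by (rule SD_module)
 interpret SDC: module A SDC by (rule SDC_module)
 have closed: "J x \<in> car SD" if "x \<in> car SDC" for x
  using mod_hom_closed[OF J_hom_k] that by simp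
 have add: "J (x \<oplus>\<^sub>SDC y) = J x \<oplus>\<^sub>SD J y" if "x \<in> car SDC" "y \<in> car SDC" for x y
  using mod_hom_add[OF J_hom_k] that by simp
 have zero: "J \<zero>\<^sub>SDC = \<zero>\<^sub>SD"
  using mod_hom_zero[OF module_tensor[OF module_Soc module_DCk] module_tensor[OF module_Soc module_Dk] J_hom_k] by simp
 show "J x \<in> car SD" if "x \<in> car SDC" for x by (rule closed[OF that])
 show "J (x \<oplus>\<^sub>SDC y) = J x \<oplus>\<^sub>SD J y" if "x \<in> car SDC" "y \<in> car SDC" for x y by (rule add[OF that])
 fix a x assume a: "a \<in> car A" and x: "x \<in> car SDC"
 show "J (a \<odot>\<^sub>SDC x) = a \<odot>\<^sub>SD J x"
  using algebra_axioms module_Soc module_DC x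
 proof (rule tensor_alg_induct)
  show "J (a \<odot>\<^sub>SDC \<zero>\<^sub>SDC) = a \<odot>\<^sub>SD J \<zero>\<^sub>SDC"
   using SDC.smult_r_null[OF a] SD.smult_r_null[OF a] zero by (simp only:)
  fix t g assume "t \<in> car Soc" and g: "g \<in> car DC"
  then have t: "t \<in> socle" by simp
  have "a \<odot>\<^sub>SDC tnC t g = tnC t (a \<odot>\<^sub>DC g)"
   by (rule ten_smult[OF algebra_axioms module_Soc module_DC a _ g]) (use t in simp)
  moreover have "a \<odot>\<^sub>SD tn t (incl g) = tn t (a \<odot>\<^sub>D incl g)"
   by (rule ten_smult[OF algebra_axioms module_Soc module_D a _ mod_hom_closed[OF incl_hom g]]) (use t in simp)
  ultimately show "J (a \<odot>\<^sub>SDC tnC t g) = a \<odot>\<^sub>SD J (tnC t g)"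
   using J_tn[OF t g] J_tn[OF t module.smult_closed[OF module_DC a g]] mod_hom_smult[OF incl_hom a g] by (simp only:)
 next
  fix x y assume x: "x \<in> car SDC" "y \<in> car SDC"
   and IH: "J (a \<odot>\<^sub>SDC x) = a \<odot>\<^sub>SD J x" "J (a \<odot>\<^sub>SDC y) = a \<odot>\<^sub>SD J y"
  show "J (a \<odot>\<^sub>SDC (x \<oplus>\<^sub>SDC y)) = a \<odot>\<^sub>SD J (x \<oplus>\<^sub>SDC y)"
   using SDC.smult_r_distr[OF a x] SD.smult_r_distr[OF a closed[OF x(1)] closed[OF x(2)]]
    add[OF x] add[OF SDC.smult_closed[OF a x(1)] SDC.smult_closed[OF a x(2)]] IH by (simp only:)
 qed
qed

lemma I_kills_SDC:
 assumes y: "y \<in> I" and x: "x \<in> car SDC"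
 shows "y \<odot>\<^sub>SDC x = \<zero>\<^sub>SDC"
proof -
 interpret SDC: module A SDC by (rule SDC_module)
 have yA: "y \<in> car A" by (rule I_carrier[OF y])
 show ?thesis
  using algebra_axioms module_Soc module_DC x
 proof (rule tensor_alg_induct)
  show "y \<odot>\<^sub>SDC \<zero>\<^sub>SDC = \<zero>\<^sub>SDC" by (rule SDC.smult_r_null[OF yA])
  fix t g assume t: "t \<in> car Soc" and g: "g \<in> car DC"
  have "g (y \<odot>\<^sub>C X) = \<zero>\<^sub>k" if X: "X \<in> car C" for X
  proof -
   obtain b where b: "b \<in> car A" "X = I +> b" using X by (auto simp: carrier_C)
   have "y \<odot>\<^sub>C X = \<zero>\<^sub>C"
    using smult_C[OF yA b(1)] coset_zero_C[of "y \<otimes> b"] I_mult(1)[OF y b(1)] yA b by simp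
   then show ?thesis
    using mod_hom_zero[OF module_Ck module_regular[OF R_cring] DC_hom[OF g]] by simp
  qed
  then have "y \<odot>\<^sub>DC g = \<zero>\<^bsub>DCk\<^esub>"
   unfolding smult_DC restrict_scalars_simps zero_DC by (intro restrict_ext) auto
  then have "y \<odot>\<^sub>SDC tnC t g = tnC t \<zero>\<^bsub>DCk\<^esub>"
   using ten_smult[OF algebra_axioms module_Soc module_DC yA t g] by (simp only:)
  also have "... = \<zero>\<^sub>SDC" using tens_zero_right[OF module_Soc module_DCk t] by (simp only: tensor_alg_simps)
  finally show "y \<odot>\<^sub>SDC tnC t g = \<zero>\<^sub>SDC" .
 next
  fix x z assume "x \<in> car SDC" "z \<in> car SDC" "y \<odot>\<^sub>SDC x = \<zero>\<^sub>SDC" "y \<odot>\<^sub>SDC z = \<zero>\<^sub>SDC"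
  then show "y \<odot>\<^sub>SDC (x \<oplus>\<^sub>SDC z) = \<zero>\<^sub>SDC"
   using SDC.smult_r_distr[OF yA, of x z] SDC.M.l_zero[OF SDC.M.zero_closed] by (simp only:)
 qed
qed

text \<open>Tensoring the retraction of \<open>incl\<close> gives a left inverse of
  \<open>J\<close>.\<close>

lemma J_inj: "inj_on J (car SDC)"
proof -
 obtain \<rho> where \<rho>: "\<rho> \<in> mod_hom k Dk DCk" "\<And>g. g \<in> car DC ==> \<rho> (incl g) = g"
  using incl_retraction by blast
 let ?T = "tensor_map k Soc Dk DCk \<rho>"
 have id: "(\<lambda>x. x) \<in> mod_hom k (tensor k Soc DCk) (tensor k Soc DCk)" by (rule mod_homI) auto
 have "?T (J x) = x" if x: "x \<in> car (tensor k Soc DCk)" for x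
 proof (rule tensor_hom_eqI[OF module_Soc module_DCk module_tensor[OF module_Soc module_DCk] _ id _ x])
  show "(\<lambda>x. ?T (J x)) \<in> mod_hom k (tensor k Soc DCk) (tensor k Soc DCk)"
   by (rule mod_hom_comp[OF J_hom_k tensor_map_hom(1)[OF module_Soc module_Dk module_DCk \<rho>(1)]])
  fix t g assume t: "t \<in> car Soc" and "g \<in> car DCk"
  then have g: "g \<in> car DC" by (simp only: restrict_scalars_simps)
  have ig: "incl g \<in> car Dk" using mod_hom_closed[OF incl_hom g] by (simp only: restrict_scalars_simps)
  have "?T (tn t (incl g)) = tnC t (\<rho> (incl g))"
   by (rule tensor_map_hom(2)[OF module_Soc module_Dk module_DCk \<rho>(1) t ig])
  then show "?T (J (tnC t g)) = tnC t g" using J_tn[of t g] t g \<rho>(2)[OF g] by simp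
 qed
 then show ?thesis by (intro inj_on_inverseI[of _ ?T]) simp
qed

text \<open>If \<open>I\<close> kills \<open>x\<close> and \<open>a = \<Theta> x\<close>, then
  \<open>x = a w\<close> is the sum of the tensors of \<open>s i\<close> with
  \<open>\<phi> i\<close> translated by \<open>a\<close>. As \<open>I\<close> kills
  \<open>a\<close>, each of these functionals vanishes on \<open>I\<close> and comes from
  \<open>A/I\<close>.\<close>

lemma J_image: "J ` car SDC = {x \<in> car SD. \<forall>y\<in>I. y \<odot>\<^sub>SD x = \<zero>\<^sub>SD}"
proof (intro equalityI subsetI)
 fix x assume "x \<in> J ` car SDC"
 then obtain z where z: "z \<in> car SDC" "x = J z" by blast
 have "y \<odot>\<^sub>SD J z = \<zero>\<^sub>SD" if y: "y \<in> I" for y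
  using mod_hom_smult[OF J_hom I_carrier[OF y] z(1)] I_kills_SDC[OF y z(1)]
   mod_hom_zero[OF SDC_module SD_module J_hom] by (simp only:)
 then show "x \<in> {x \<in> car SD. \<forall>y\<in>I. y \<odot>\<^sub>SD x = \<zero>\<^sub>SD}" using mod_hom_closed[OF J_hom z(1)] z(2) by blast
next
 fix x assume "x \<in> {x \<in> car SD. \<forall>y\<in>I. y \<odot>\<^sub>SD x = \<zero>\<^sub>SD}"
 then have x: "x \<in> car SD" and kill: "\<And>y. y \<in> I ==> y \<odot>\<^sub>SD x = \<zero>\<^sub>SD" by blast+
 interpret SDC: module A SDC by (rule SDC_module)
 define a where "a = \<Theta> x"
 have a: "a \<in> car A" using mod_hom_closed[OF \<Theta>_hom x] by (simp add: a_def)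
 have ya: "y \<otimes> a = \<zero>" if y: "y \<in> I" for y
 proof -
  have "y \<otimes> a = \<Theta> (y \<odot>\<^sub>SD x)" unfolding a_def using mod_hom_smult[OF \<Theta>_hom I_carrier[OF y] x] by simp
  also have "... = \<zero>" using mod_hom_zero[OF SD_module module_AA \<Theta>_hom] unfolding kill[OF y] by simp
  finally show ?thesis .
 qed
 let ?\<psi> = "\<lambda>i. a \<odot>\<^sub>D restrict (\<phi> i) (car A)"
 have "\<forall>i\<in>{..<n}. \<exists>g. g \<in> car DC \<and> incl g = ?\<psi> i"
 proof
  fix i assume "i \<in> {..<n}"
  then have i: "i < n" by simp
  have "?\<psi> i y = \<zero>\<^sub>k" if y: "y \<in> I" for y
  proof -
   have "a \<otimes> y = \<zero>" using ya[OF y] a I_carrier[OF y] by (simp add: m_comm)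
   then show ?thesis unfolding smult_D using a I_carrier[OF y] Lin_zero[OF frame_Lin[OF i]] by simp
  qed
  then show "\<exists>g. g \<in> car DC \<and> incl g = ?\<psi> i"
   using incl_vanishes[OF module.smult_closed[OF module_D a frame_D[OF i]]] by blast
 qed
 from bchoice[OF this] obtain g where g: "\<forall>i\<in>{..<n}. g i \<in> car DC \<and> incl (g i) = ?\<psi> i" by (elim exE)
 define z where "z = (\<Oplus>\<^sub>SDC i\<in>{..<n}. tnC (s i) (g i))"
 have tc: "(\<lambda>i. tnC (s i) (g i)) \<in> {..<n} \<rightarrow> car SDC"
  using tnC_closed frame_socle g by blast
 have z: "z \<in> car SDC" unfolding z_def by (rule SDC.M.finsum_closed[OF tc])
 interpret SD: module A SD by (rule SD_module)
 have "J z = (\<Oplus>\<^sub>SD i\<in>{..<n}. J (tnC (s i) (g i)))"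
  unfolding z_def by (rule mod_hom_finsum[OF SDC_module SD_module J_hom _ tc]) simp
 also have "... = (\<Oplus>\<^sub>SD i\<in>{..<n}. tn (s i) (?\<psi> i))"
 proof (rule SD.M.finsum_cong')
  fix i assume i: "i \<in> {..<n}"
  then have gi: "g i \<in> car DC" "incl (g i) = ?\<psi> i" using g by blast+
  show "J (tnC (s i) (g i)) = tn (s i) (?\<psi> i)"
   using J_tn[OF frame_socle gi(1)] i gi(2) by simp
 next
  show "(\<lambda>i. tn (s i) (?\<psi> i)) \<in> {..<n} \<rightarrow> car SD"
   using tn_closed frame_socle module.smult_closed[OF module_D a frame_D] by blast
 qed simp
 also have "... = a \<odot>\<^sub>SD w" by (rule smult_w[OF a, symmetric])
 also have "... = x" unfolding a_def by (rule \<Theta>_w_smult[OF x])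
 finally show "x \<in> J ` car SDC" using z by blast
qed

lemma iso_image_Ann:
 assumes f: "f \<in> mod_iso A AA SD"
 shows "f ` Ann = {x \<in> car SD. \<forall>y\<in>I. y \<odot>\<^sub>SD x = \<zero>\<^sub>SD}"
proof -
 have fh: "f \<in> mod_hom A AA SD" and fb: "bij_betw f (car A) (car SD)"
  using f by (auto simp: mod_iso_def simp del: tensor_alg_simps)
 have f0: "f \<zero> = \<zero>\<^sub>SD" using mod_hom_zero[OF module_AA SD_module fh] by simp
 have sm: "y \<odot>\<^sub>SD f a = f (y \<otimes> a)" if "y \<in> car A" "a \<in> car A" for y a
  using mod_hom_smult[OF fh that(1), of a] that by (simp del: tensor_alg_simps)
 have iff: "y \<odot>\<^sub>SD f a = \<zero>\<^sub>SD \<longleftrightarrow> a \<otimes> y = \<zero>" if y: "y \<in> I" and a: "a \<in> car A" for y a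
 proof -
  have yA: "y \<in> car A" by (rule I_carrier[OF y])
  have "y \<odot>\<^sub>SD f a = \<zero>\<^sub>SD \<longleftrightarrow> f (y \<otimes> a) = f \<zero>" unfolding sm[OF yA a] f0 ..
  also have "... \<longleftrightarrow> y \<otimes> a = \<zero>"
   using fb yA a by (auto simp: bij_betw_def inj_on_def simp del: tensor_alg_simps)
  finally show ?thesis using m_comm[OF yA a] by (simp only:)
 qed
 show ?thesis
 proof (intro equalityI subsetI)
  fix x assume "x \<in> f ` Ann"
  then obtain a where a: "a \<in> Ann" "x = f a" by blast
  have aA: "a \<in> car A" by (rule Ann_carrier[OF a(1)])
  have "f a \<in> car SD" using mod_hom_closed[OF fh] aA by (simp del: tensor_alg_simps)
  moreover have "\<forall>y\<in>I. y \<odot>\<^sub>SD f a = \<zero>\<^sub>SD" using iff[OF _ aA] a(1) unfolding Ann_def by blast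
  ultimately show "x \<in> {x \<in> car SD. \<forall>y\<in>I. y \<odot>\<^sub>SD x = \<zero>\<^sub>SD}" unfolding a(2) by blast
 next
  fix x assume x: "x \<in> {x \<in> car SD. \<forall>y\<in>I. y \<odot>\<^sub>SD x = \<zero>\<^sub>SD}"
  then have "x \<in> f ` car A" using bij_betw_imp_surj_on[OF fb] by blast
  then obtain a where a: "a \<in> car A" "x = f a" by blast
  then have "a \<in> Ann" using x iff[OF _ a(1)] unfolding Ann_def by blast
  then show "x \<in> f ` Ann" using a(2) by blast
 qed
qed

lemma J_iso:
 assumes f: "f \<in> mod_iso A AA SD"
 shows "J \<in> mod_iso A SDC (SD\<lparr>carrier := f ` Ann\<rparr>)"
proof -
 have im: "J ` car SDC = f ` Ann" unfolding J_image iso_image_Ann[OF f] ..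
 have "J \<in> mod_hom A SDC (SD\<lparr>carrier := f ` Ann\<rparr>)"
 proof (rule mod_homI)
  show "J x \<in> car (SD\<lparr>carrier := f ` Ann\<rparr>)" if "x \<in> car SDC" for x
   using im that by (auto simp del: tensor_alg_simps)
  show "J (x \<oplus>\<^sub>SDC y) = J x \<oplus>\<^bsub>SD\<lparr>carrier := f ` Ann\<rparr>\<^esub> J y" if "x \<in> car SDC" "y \<in> car SDC" for x y
   using mod_hom_add[OF J_hom that] by (simp del: tensor_alg_simps)
  show "J (a \<odot>\<^sub>SDC x) = a \<odot>\<^bsub>SD\<lparr>carrier := f ` Ann\<rparr>\<^esub> J x" if "a \<in> car A" "x \<in> car SDC" for a x
   using mod_hom_smult[OF J_hom that] by (simp del: tensor_alg_simps)
 qed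
 moreover have "bij_betw J (car SDC) (f ` Ann)" using J_inj im by (rule bij_betw_imageI)
 ultimately show ?thesis by (simp add: mod_iso_def del: tensor_alg_simps)
qed

subsection \<open>The linked quotient\<close>

abbreviation "C' \<equiv> quot_module AA Ann"
abbreviation "HomI \<equiv> hom_module A (AA\<lparr>carrier := I\<rparr>) AA"

lemma module_I: "module A (AA\<lparr>carrier := I\<rparr>)"
 by (rule submodule.submodule_is_module[OF submodule_I module_AA])

text \<open>A self-injectivity argument. Composing with \<open>\<pi>\<close> extends
  \<open>u\<close> to a \<open>k\<close>-linear map on \<open>A\<close>, and \<open>a\<close> is the
  sum of the \<open>\<theta> (s l)\<close> of \<open>\<phi> l\<close> after this extension. On
  \<open>I\<close> the extension satisfies \<open>u (x y) = u x y\<close>, so multiplying the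
  \<open>l\<close>-th summand by \<open>x\<close> gives \<open>\<phi> l (s l) u x\<close>; the trace
  is one.\<close>

lemma hom_I_is_mult:
 assumes u: "u \<in> mod_hom A (AA\<lparr>carrier := I\<rparr>) AA"
 shows "\<exists>a\<in>car A. \<forall>x\<in>I. u x = a \<otimes> x"
proof -
 have uc: "u x \<in> car A" if "x \<in> I" for x using mod_hom_closed[OF u, of x] that by simp
 have um: "u (x \<otimes> y) = u x \<otimes> y" if "x \<in> I" "y \<in> car A" for x y
  using mod_hom_smult[OF u that(2), of x] that uc[OF that(1)] I_carrier[OF that(1)] by (simp add: m_comm)
 have u_k: "(\<lambda>x. u (\<pi> x)) \<in> mod_hom k A A"
 proof (rule mod_homI)
  show "u (\<pi> x) \<in> car A" if "x \<in> car A" for x using uc retract(2) that by blast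
  show "u (\<pi> (x \<oplus> y)) = u (\<pi> x) \<oplus> u (\<pi> y)" if "x \<in> car A" "y \<in> car A" for x y
   using mod_hom_add[OF retract(1) that] mod_hom_add[OF u, of "\<pi> x" "\<pi> y"] retract(2) that by simp
  fix c x assume c: "c \<in> car k" and x: "x \<in> car A"
  have p: "\<pi> x \<in> I" "\<pi> x \<in> car A" using retract(2)[OF x] I_carrier by auto
  have "u (\<pi> (c \<odot> x)) = u (\<pi> x \<otimes> (c \<odot> \<one>))"
   using mod_hom_smult[OF retract(1) c x] p c by (simp add: smult_assoc3)
  also have "... = c \<odot> u (\<pi> x)" using um[OF p(1), of "c \<odot> \<one>"] c uc[OF p(1)] by (simp add: smult_assoc3)
  finally show "u (\<pi> (c \<odot> x)) = c \<odot> u (\<pi> x)" .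
 qed
 let ?\<psi> = "\<lambda>l x. \<phi> l (u (\<pi> x))"
 have \<psi>: "?\<psi> l \<in> Lin" if "l < n" for l by (rule mod_hom_comp[OF u_k frame_Lin[OF that]])
 define a where "a = (\<Oplus>l\<in>{..<n}. \<theta> (s l) (?\<psi> l))"
 have tc: "\<theta> (s l) (?\<psi> l) \<in> car A" if "l < n" for l by (rule \<theta>_closed[OF frame_socle[OF that] \<psi>[OF that]])
 have a: "a \<in> car A" unfolding a_def using tc by (auto intro!: M.finsum_closed)
 have "u x = a \<otimes> x" if x: "x \<in> I" for x
 proof -
  have xA: "x \<in> car A" by (rule I_carrier[OF x])
  have "a \<otimes> x = (\<Oplus>l\<in>{..<n}. \<theta> (s l) (?\<psi> l) \<otimes> x)"
   unfolding a_def by (rule finsum_ldistr) (use tc xA in auto)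
  also have "... = (\<Oplus>l\<in>{..<n}. \<phi> l (s l) \<odot> u x)"
  proof (rule M.finsum_cong')
   fix l assume "l \<in> {..<n}"
   then have l: "l < n" by simp
   have fl: "\<phi> l (s l) \<in> car k" by (rule frame_closed[OF l frame_carrier[OF l]])
   have "\<theta> (s l) (?\<psi> l) \<otimes> x = \<theta> (s l) (\<lambda>y. ?\<psi> l (x \<otimes> y))"
    using \<theta>_act[OF frame_socle[OF l] \<psi>[OF l] xA] tc[OF l] xA by (simp add: m_comm)
   also have "... = \<theta> (s l) (\<lambda>y. \<phi> l (u x \<otimes> y))"
    by (rule \<theta>_cong[OF frame_socle[OF l] Lin_mult[OF \<psi>[OF l] xA] Lin_mult[OF frame_Lin[OF l] uc[OF x]]])
     (simp add: retract(3) I_mult(1)[OF x] um[OF x])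
   also have "... = u x \<otimes> \<theta> (s l) (\<phi> l)" by (rule \<theta>_act[OF frame_socle[OF l] frame_Lin[OF l] uc[OF x]])
   also have "... = \<phi> l (s l) \<odot> u x"
    using \<theta>_frame[OF frame_socle[OF l] l] fl uc[OF x] by (simp add: smult_assoc3)
   finally show "\<theta> (s l) (?\<psi> l) \<otimes> x = \<phi> l (s l) \<odot> u x" .
  qed (use frame_closed frame_carrier uc[OF x] in auto)
  also have "... = (\<Oplus>\<^sub>k l\<in>{..<n}. \<phi> l (s l)) \<odot> u x"
   by (rule finsum_smult_rdistr[symmetric]) (use frame_closed frame_carrier uc[OF x] in auto)
  finally show ?thesis using uc[OF x] by (simp add: frame_one)
 qed
 then show ?thesis using a by blast
qed

lemma C'_iso_Hom:
 "\<exists>\<psi> \<in> mod_iso A C' HomI. \<forall>a\<in>car A. \<psi> (Ann +> a) = (\<lambda>x\<in>I. a \<otimes> x)"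
proof -
 define f where "f a = (\<lambda>x\<in>I. a \<otimes> x)" for a
 have mH: "module A HomI" by (rule module_hom_module[OF module_I module_AA])
 have fh: "f \<in> mod_hom A AA HomI"
 proof (rule mod_homI)
  fix a b assume "a \<in> car AA" "b \<in> car AA"
  then have ab: "a \<in> car A" "b \<in> car A" by auto
  show "f a \<in> car HomI"
   using ab(1) I_carrier I_mult ideal.axioms(1)[OF ideal_I] ideal_I
   by (auto simp: f_def mod_hom_def r_distr m_lcomm additive_subgroup.a_closed)
  show "f (a \<oplus>\<^sub>AA b) = f a \<oplus>\<^bsub>HomI\<^esub> f b"
   using ab I_carrier by (auto simp: f_def l_distr intro!: restrict_ext)
 next
  fix r a assume "r \<in> car A" "a \<in> car AA"
  then show "f (r \<odot>\<^sub>AA a) = r \<odot>\<^bsub>HomI\<^esub> f a"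
   using I_carrier by (auto simp: f_def m_assoc intro!: restrict_ext)
 qed
 have f0: "f a = \<zero>\<^bsub>HomI\<^esub>" if "a \<in> Ann" for a
  using that by (auto simp: f_def Ann_def intro!: restrict_ext)
 obtain g where g: "g \<in> mod_hom A C' HomI" "\<And>a. a \<in> car AA ==> g (Ann +>\<^bsub>AA\<^esub> a) = f a"
  using quot_module_lift[OF module_AA mH submodule_Ann fh f0] by blast
 have gA: "g (Ann +> a) = f a" if "a \<in> car A" for a using g(2)[of a] that by simp
 have carC': "car C' = (\<lambda>a. Ann +> a) ` car A" by (simp add: carrier_quot_module)
 have eqC': "Ann +> a = Ann +> b \<longleftrightarrow> a \<ominus> b \<in> Ann" if "a \<in> car A" "b \<in> car A" for a b
  using coset_eq_iff[OF module_AA submodule_Ann, of a b] that by (simp add: minus_AA)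
 have "bij_betw g (car C') (car HomI)"
 proof (rule bij_betw_imageI)
  show "inj_on g (car C')"
  proof (rule inj_onI)
   fix X Y assume "X \<in> car C'" "Y \<in> car C'" and eq: "g X = g Y"
   then obtain a b where ab: "a \<in> car A" "X = Ann +> a" "b \<in> car A" "Y = Ann +> b"
    by (auto simp: carC')
   have "f a = f b" using eq gA ab by simp
   have "(a \<ominus> b) \<otimes> x = \<zero>" if x: "x \<in> I" for x
   proof -
    have "a \<otimes> x = b \<otimes> x" using fun_cong[OF \<open>f a = f b\<close>, of x] x by (simp add: f_def)
    then show ?thesis using ab I_carrier[OF x] by (simp add: a_minus_def l_distr l_minus r_neg)
   qed
   then have "a \<ominus> b \<in> Ann" using ab by (simp add: Ann_def)
   then show "X = Y" using ab eqC' by simp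
  qed
  show "g ` car C' = car HomI"
  proof (intro equalityI subsetI)
   fix u assume "u \<in> g ` car C'"
   then show "u \<in> car HomI" using mod_hom_closed[OF g(1)] by blast
  next
   fix u assume u: "u \<in> car HomI"
   then have uh: "u \<in> mod_hom A (AA\<lparr>carrier := I\<rparr>) AA" and ue: "u \<in> extensional I" by auto
   obtain a where a: "a \<in> car A" "\<forall>x\<in>I. u x = a \<otimes> x" using hom_I_is_mult[OF uh] by blast
   have "u = f a" by (rule extensionalityI[OF ue]) (use a(2) in \<open>auto simp: f_def\<close>)
   then have "u = g (Ann +> a)" using gA[OF a(1)] by simp
   then show "u \<in> g ` car C'" unfolding carC' using a(1) by blast
  qed
 qed
 then show ?thesis
  using g(1) gA by (intro bexI[of _ g]) (auto simp: mod_iso_def f_def simp del: hom_module_simps)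
qed

text \<open>If \<open>\<xi>\<^sub>l\<close> is dual to a local basis \<open>v\<^sub>l\<close> of \<open>I\<close>, the elements \<open>\<theta>(s\<^sub>i, \<xi>\<^sub>l)\<close> form a local basis of
 \<open>A/I'\<close>, dual to the functionals \<open>a \<mapsto> \<phi>\<^sub>i(a v\<^sub>l)\<close>.\<close>

lemma C'_local_basis:
 assumes p: "primeideal p k" and h: "h \<in> car k" "h \<notin> p"
  and vI: "\<And>l. l < N ==> v l \<in> I" and \<xi>: "\<And>l. l < N ==> \<xi> l \<in> Lin"
  and dec: "\<And>x. x \<in> I ==> h \<odot> x = (\<Oplus>l\<in>{..<N}. \<xi> l x \<odot> v l)"
  and orth: "\<And>l m. l < N ==> m < N ==> \<xi> l (v m) = (if l = m then h else \<zero>\<^sub>k)"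
 shows "\<exists>f m \<mu>. f \<notin> p \<and> local_basis k (restrict_scalars A C') f N m \<mu>"
proof -
 interpret p: primeideal p k by (rule p)
 obtain i where i: "i < n" "\<phi> i (s i) \<notin> p" using frame_unit_notin[OF p] by blast
 note si = frame_socle[OF i(1)]
 define c where "c = \<phi> i (s i)"
 have c: "c \<in> car k" "c \<notin> p" using i frame_closed[OF i(1) frame_carrier[OF i(1)]] by (auto simp: c_def)
 have vA: "v l \<in> car A" if "l < N" for l using I_carrier[OF vI[OF that]] .
 have tc: "\<theta> (s i) (\<xi> l) \<in> car A" if "l < N" for l by (rule \<theta>_closed[OF si \<xi>[OF that]])
 let ?Q = "quot_module Ak Ann"
 have sub: "submodule Ann k Ak" by (rule submodule_restrict_scalars[OF algebra_axioms module_AA submodule_Ann])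
 have "\<forall>l\<in>{..<N}. \<exists>g. g \<in> mod_hom k ?Q (regular_module k) \<and> (\<forall>a\<in>car A. g (Ann +> a) = \<phi> i (a \<otimes> v l))"
 proof
  fix l assume "l \<in> {..<N}"
  then have l: "l < N" by simp
  have "(\<lambda>a. \<phi> i (v l \<otimes> a)) \<in> lin k Ak"
   using Lin_mult[OF frame_Lin[OF i(1)] vA[OF l]] by (simp add: mod_hom_restrict_regular[OF algebra_axioms])
  then have lin: "(\<lambda>a. \<phi> i (a \<otimes> v l)) \<in> lin k Ak"
   by (rule mod_hom_cong[OF module_Ak]) (use vA[OF l] in \<open>simp add: m_comm\<close>)
  have z: "\<phi> i (a \<otimes> v l) = \<zero>\<^bsub>regular_module k\<^esub>" if "a \<in> Ann" for a
   using that vI[OF l] Lin_zero[OF frame_Lin[OF i(1)]] by (simp add: Ann_def)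
  obtain g where "g \<in> mod_hom k ?Q (regular_module k)"
   "\<And>a. a \<in> car Ak ==> g (Ann +>\<^bsub>Ak\<^esub> a) = \<phi> i (a \<otimes> v l)"
   using quot_module_lift[OF module_Ak module_regular[OF R_cring] sub lin z] by blast
  then show "\<exists>g. g \<in> mod_hom k ?Q (regular_module k) \<and> (\<forall>a\<in>car A. g (Ann +> a) = \<phi> i (a \<otimes> v l))"
   by (intro exI[of _ g]) simp
 qed
 from bchoice[OF this] obtain \<mu> where "\<forall>l\<in>{..<N}. \<mu> l \<in> mod_hom k ?Q (regular_module k) \<and>
   (\<forall>a\<in>car A. \<mu> l (Ann +> a) = \<phi> i (a \<otimes> v l))" by (elim exE)
 then have \<mu>: "\<And>l. l < N ==> \<mu> l \<in> mod_hom k ?Q (regular_module k)"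
  and \<mu>_eq: "\<And>l a. l < N ==> a \<in> car A ==> \<mu> l (Ann +> a) = \<phi> i (a \<otimes> v l)" by auto
 define m where "m l = Ann +> \<theta> (s i) (\<xi> l)" for l
 have hc: "h \<otimes>\<^sub>k c \<in> car k" using h c by simp
 interpret Q: module k ?Q by (rule module_quot_module[OF module_Ak sub])
 have q: "(\<lambda>a. Ann +> a) \<in> mod_hom k Ak ?Q" using quot_module_hom[OF module_Ak sub] by simp
 have "local_basis k ?Q (h \<otimes>\<^sub>k c) N m \<mu>"
  unfolding local_basis_def
 proof (intro conjI allI impI ballI hc)
  fix l assume "l < N"
  then show "m l \<in> car ?Q" "\<mu> l \<in> mod_hom k ?Q (regular_module k)"
   using tc \<mu> by (auto simp: m_def carrier_quot_module)
 next
  fix X assume "X \<in> car ?Q"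
  then obtain a where a: "a \<in> car A" "X = Ann +> a" by (auto simp: carrier_quot_module)
  define r where "r l = \<phi> i (a \<otimes> v l)" for l
  have r: "r l \<in> car k" if "l < N" for l using frame_closed[OF i(1)] a vA[OF that] by (simp add: r_def)
  define z where "z = (\<Oplus>l\<in>{..<N}. r l \<odot> \<theta> (s i) (\<xi> l))"
  have z: "z \<in> car A" unfolding z_def using r tc by (auto intro!: M.finsum_closed)
  \<comment> \<open>Two elements have the same coset modulo \<open>Ann\<close> when they act equally
    on \<open>I\<close>; hence the multiplication by \<open>y\<close>, after which the frame
    compares the products.\<close>
  have zy: "z \<otimes> y = ((h \<otimes>\<^sub>k c) \<odot> a) \<otimes> y" if y: "y \<in> I" for y
  proof (rule frame_eqI)
   have yA: "y \<in> car A" by (rule I_carrier[OF y])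
   show "z \<otimes> y \<in> car A" "((h \<otimes>\<^sub>k c) \<odot> a) \<otimes> y \<in> car A" using z yA hc a by auto
   fix j x assume j: "j < n" and x: "x \<in> car A"
   have yx: "y \<otimes> x \<in> I" "y \<otimes> x \<in> car A" using I_mult(1)[OF y x] yA x by auto
   have sj: "\<phi> j (s i) \<in> car k" by (rule frame_closed[OF j frame_carrier[OF i(1)]])
   have \<xi>c: "\<xi> l (y \<otimes> x) \<in> car k" if "l < N" for l by (rule Lin_closed[OF \<xi>[OF that] yx(2)])
   have "(z \<otimes> y) \<otimes> x = (\<Oplus>l\<in>{..<N}. r l \<odot> (\<theta> (s i) (\<xi> l) \<otimes> (y \<otimes> x)))"
   proof -
    have "(z \<otimes> y) \<otimes> x = z \<otimes> (y \<otimes> x)" by (rule m_assoc[OF z yA x])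
    also have "... = (\<Oplus>l\<in>{..<N}. (r l \<odot> \<theta> (s i) (\<xi> l)) \<otimes> (y \<otimes> x))"
     unfolding z_def by (rule finsum_ldistr[OF _ yx(2)]) (use r tc in auto)
    also have "... = (\<Oplus>l\<in>{..<N}. r l \<odot> (\<theta> (s i) (\<xi> l) \<otimes> (y \<otimes> x)))"
     using smult_assoc2[OF r tc yx(2)] r tc yx(2) by (intro M.finsum_cong') auto
    finally show ?thesis .
   qed
   then have "\<phi> j ((z \<otimes> y) \<otimes> x) = (\<Oplus>\<^sub>k l\<in>{..<N}. r l \<otimes>\<^sub>k \<phi> j (\<theta> (s i) (\<xi> l) \<otimes> (y \<otimes> x)))"
    using Lin_lincomb[OF frame_Lin[OF j], of "{..<N}" "\<lambda>l. \<theta> (s i) (\<xi> l) \<otimes> (y \<otimes> x)" r] r tc yx(2) by auto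
   also have "... = (\<Oplus>\<^sub>k l\<in>{..<N}. \<phi> j (s i) \<otimes>\<^sub>k (\<xi> l (y \<otimes> x) \<otimes>\<^sub>k \<phi> i (a \<otimes> v l)))"
    using r \<xi>c sj \<theta>_eq[OF si \<xi> j yx(2)] by (intro R.finsum_cong') (auto simp: R.m_ac simp flip: r_def)
   also have "... = \<phi> j (s i) \<otimes>\<^sub>k (\<Oplus>\<^sub>k l\<in>{..<N}. \<xi> l (y \<otimes> x) \<otimes>\<^sub>k \<phi> i (a \<otimes> v l))"
    by (rule R.finsum_rdistr[symmetric]) (use r \<xi>c sj in \<open>auto simp flip: r_def\<close>)
   also have "(\<Oplus>\<^sub>k l\<in>{..<N}. \<xi> l (y \<otimes> x) \<otimes>\<^sub>k \<phi> i (a \<otimes> v l)) = \<phi> i (a \<otimes> (h \<odot> (y \<otimes> x)))"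
   proof -
    have "a \<otimes> (h \<odot> (y \<otimes> x)) = (\<Oplus>l\<in>{..<N}. \<xi> l (y \<otimes> x) \<odot> (a \<otimes> v l))"
     unfolding dec[OF yx(1)] using a vA \<xi>c
     by (subst finsum_rdistr) (auto simp: smult_assoc3 intro!: M.finsum_cong')
    then show ?thesis
     using Lin_lincomb[OF frame_Lin[OF i(1)], of "{..<N}" "\<lambda>l. a \<otimes> v l" "\<lambda>l. \<xi> l (y \<otimes> x)"] a vA \<xi>c by auto
   qed
   also have "... = h \<otimes>\<^sub>k \<phi> i (a \<otimes> (y \<otimes> x))"
    using a yx(2) h(1) by (simp add: smult_assoc3 Lin_smult[OF frame_Lin[OF i(1)]])
   also have "\<phi> j (s i) \<otimes>\<^sub>k (h \<otimes>\<^sub>k \<phi> i (a \<otimes> (y \<otimes> x))) = h \<otimes>\<^sub>k (\<phi> j (s i) \<otimes>\<^sub>k \<phi> i (a \<otimes> (y \<otimes> x)))"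
    using sj h(1) frame_closed[OF i(1), of "a \<otimes> (y \<otimes> x)"] a yx(2) by (simp add: R.m_lcomm)
   \<comment> \<open>The rank-one clause exchanges the index \<open>i\<close>, chosen for the prime,
     with the index \<open>j\<close> that tests equality.\<close>
   also have "\<phi> j (s i) \<otimes>\<^sub>k \<phi> i (a \<otimes> (y \<otimes> x)) = c \<otimes>\<^sub>k \<phi> j (a \<otimes> (y \<otimes> x))"
    unfolding c_def using frame_comm[OF j i(1) si, of "a \<otimes> (y \<otimes> x)"] a yx(2) by simp
   also have "h \<otimes>\<^sub>k ... = \<phi> j (((h \<otimes>\<^sub>k c) \<odot> a) \<otimes> y \<otimes> x)"
    using a yA x h(1) c(1) hc frame_closed[OF j, of "a \<otimes> (y \<otimes> x)"]
    by (simp add: smult_assoc2 m_assoc Lin_smult[OF frame_Lin[OF j]] R.m_assoc)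
   finally show "\<phi> j ((z \<otimes> y) \<otimes> x) = \<phi> j (((h \<otimes>\<^sub>k c) \<odot> a) \<otimes> y \<otimes> x)" .
  qed
  have "((h \<otimes>\<^sub>k c) \<odot> a \<ominus> z) \<otimes> y = \<zero>" if y: "y \<in> I" for y
   using zy[OF y] z hc a I_carrier[OF y] by (simp add: a_minus_def l_distr l_minus r_neg)
  then have "(h \<otimes>\<^sub>k c) \<odot> a \<ominus> z \<in> Ann" using z hc a by (simp add: Ann_def)
  then have "Ann +> ((h \<otimes>\<^sub>k c) \<odot> a) = Ann +> z"
   using coset_eq_iff[OF module_AA submodule_Ann, of "(h \<otimes>\<^sub>k c) \<odot> a" z] z hc a by (simp add: minus_AA)
  moreover have "(h \<otimes>\<^sub>k c) \<odot>\<^sub>?Q X = Ann +> ((h \<otimes>\<^sub>k c) \<odot> a)"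
   unfolding a(2) using smult_quot_module[OF module_Ak sub hc, of a] a(1) hc by (simp add: smult_one_mult)
  moreover have "Ann +> z = (\<Oplus>\<^sub>?Q l\<in>{..<N}. \<mu> l X \<odot>\<^sub>?Q m l)"
  proof -
   have z': "z = finsum Ak (\<lambda>l. r l \<odot> \<theta> (s i) (\<xi> l)) {..<N}" by (simp add: z_def)
   have "Ann +> z = (\<Oplus>\<^sub>?Q l\<in>{..<N}. Ann +> (r l \<odot> \<theta> (s i) (\<xi> l)))"
    unfolding z' by (rule mod_hom_finsum[OF module_Ak Q.module_axioms q]) (use r tc in auto)
   also have "... = (\<Oplus>\<^sub>?Q l\<in>{..<N}. \<mu> l X \<odot>\<^sub>?Q m l)"
   proof (rule Q.M.finsum_cong')
    fix l assume "l \<in> {..<N}"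
    then have l: "l < N" by simp
    show "Ann +> (r l \<odot> \<theta> (s i) (\<xi> l)) = \<mu> l X \<odot>\<^sub>?Q m l"
     using smult_quot_module[OF module_Ak sub r[OF l], of "\<theta> (s i) (\<xi> l)"] tc[OF l] r[OF l]
      \<mu>_eq[OF l a(1)] by (simp add: a(2) m_def smult_one_mult flip: r_def)
   next
    show "(\<lambda>l. \<mu> l X \<odot>\<^sub>?Q m l) \<in> {..<N} \<rightarrow> car ?Q"
    proof
     fix l assume "l \<in> {..<N}"
     then have l: "l < N" by simp
     have "\<mu> l X \<in> car k" using \<mu>_eq[OF l a(1)] r[OF l] by (simp add: a(2) r_def)
     moreover have "m l \<in> car ?Q" using tc[OF l] by (auto simp: m_def carrier_quot_module)
     ultimately show "\<mu> l X \<odot>\<^sub>?Q m l \<in> car ?Q" by (rule Q.smult_closed)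
    qed
   qed simp
   finally show ?thesis .
  qed
  ultimately show "(h \<otimes>\<^sub>k c) \<odot>\<^sub>?Q X = (\<Oplus>\<^sub>?Q l\<in>{..<N}. \<mu> l X \<odot>\<^sub>?Q m l)" by simp
 next
  fix l j assume l: "l < N" and j: "j < N"
  have "\<mu> l (m j) = \<phi> i (s i) \<otimes>\<^sub>k \<xi> j (v l)"
   unfolding m_def using \<mu>_eq[OF l tc[OF j]] \<theta>_eq[OF si \<xi>[OF j] i(1) vA[OF l]] by simp
  then show "\<mu> l (m j) = (if l = j then h \<otimes>\<^sub>k c else \<zero>\<^sub>k)"
   using orth[OF j l] c h by (auto simp: R.m_comm simp flip: c_def)
 qed
 moreover have "h \<otimes>\<^sub>k c \<notin> p" using p.I_prime[OF h(1) c(1)] h(2) c(2) by blast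
 ultimately show ?thesis unfolding restrict_scalars_quot_module by blast
qed

end

lemma mod_iso_inverse:
 assumes M: "module R M" and N: "module R N" and f: "f \<in> mod_iso R M N"
 shows "the_inv_into (car M) f \<in> mod_iso R N M"
proof -
 interpret M: module R M by (rule M)
 have fh: "f \<in> mod_hom R M N" and fb: "bij_betw f (car M) (car N)" using f by (auto simp: mod_iso_def)
 let ?g = "the_inv_into (car M) f"
 have inj: "inj_on f (car M)" using fb by (simp add: bij_betw_def)
 have gf: "?g (f x) = x" if "x \<in> car M" for x by (rule the_inv_into_f_f[OF inj that])
 have fg: "f (?g y) = y" and gc: "?g y \<in> car M" if "y \<in> car N" for y
  using that fb f_the_inv_into_f[OF inj] the_inv_into_into[OF inj] by (auto simp: bij_betw_def)
 have "?g \<in> mod_hom R N M"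
 proof (rule mod_homI)
  fix x y assume xy: "x \<in> car N" "y \<in> car N"
  show "?g x \<in> car M" by (rule gc[OF xy(1)])
  have "?g (f (?g x \<oplus>\<^sub>M ?g y)) = ?g x \<oplus>\<^sub>M ?g y" using gc xy by (intro gf) simp
  then show "?g (x \<oplus>\<^sub>N y) = ?g x \<oplus>\<^sub>M ?g y" using mod_hom_add[OF fh gc gc] fg xy by simp
 next
  fix r y assume r: "r \<in> car R" and y: "y \<in> car N"
  have "?g (f (r \<odot>\<^sub>M ?g y)) = r \<odot>\<^sub>M ?g y" using gc[OF y] r by (intro gf) simp
  then show "?g (r \<odot>\<^sub>N y) = r \<odot>\<^sub>M ?g y" using mod_hom_smult[OF fh r gc[OF y]] fg[OF y] by simp
 qed
 then show ?thesis using bij_betw_the_inv_into[OF fb] by (simp add: mod_iso_def)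
qed

lemma invertible_local_generator:
 fixes k :: "('k, 'z) ring_scheme" and L :: "('k, 'l) module"
 assumes "noetherian_ring k" "invertible_module k L" "primeideal p k"
 shows "\<exists>c l \<kappa>. c \<in> car k \<and> c \<notin> p \<and> l \<in> car L \<and> \<kappa> \<in> lin k L \<and> \<kappa> l = c \<and>
  (\<forall>x\<in>car L. c \<odot>\<^sub>L x = \<kappa> x \<odot>\<^sub>L l)"
proof -
 have lf: "locally_free_rank k L 1" using assms(2) by (simp add: invertible_module_def)
 then interpret L: module k L by (simp add: locally_free_rank_def)
 obtain c m \<mu> where c: "c \<notin> p" "local_basis k L c 1 m \<mu>"
  by (rule local_basis_if_locally_free[OF assms(1) lf assms(3)])
 note D = local_basisD[OF c(2)]
 have "c \<odot>\<^sub>L x = \<mu> 0 x \<odot>\<^sub>L m 0" if x: "x \<in> car L" for x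
  using D(4)[OF x] D(2)[of 0] D(6)[of 0 x] x by (simp add: lessThan_Suc L.M.finsum_insert L.M.finsum_empty)
 then show ?thesis
  using c(1) D(1) D(2)[of 0] D(3)[of 0] D(5)[of 0 0]
  by (intro exI[of _ c] exI[of _ "m 0"] exI[of _ "\<mu> 0"]) simp
qed

subsection \<open>The quotient algebra\<close>

context linkage
begin

text \<open>\<open>B\<close> and \<open>C\<close> share carrier and addition: \<open>B\<close>
  carries the ring structure and the action of \<open>k\<close>, \<open>C\<close> the action of
  \<open>A\<close>.\<close>

abbreviation "B \<equiv> quot_module A I"

lemma submodule_I_k: "submodule I k A"
proof -
 have "x \<in> I ==> c \<in> car k ==> c \<odot> x \<in> I" for c x
  using I_mult(1)[of x "c \<odot> \<one>"] I_carrier[of x] by (simp add: smult_assoc3)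
 then show ?thesis
  using additive_subgroup.a_subgroup[OF ideal.axioms(1)[OF ideal_I]]
  by (simp add: submodule_def submodule_axioms_def)
qed

lemma carrier_B: "car B = (\<lambda>a. I +> a) ` car A"
 by (rule carrier_quot_module)

lemma add_B: "a \<in> car A ==> b \<in> car A ==>
  (I +> a) \<oplus>\<^sub>B (I +> b) = I +> (a \<oplus> b)"
 by (rule add_quot_module[OF module_axioms submodule_I_k])

lemma smult_B: "c \<in> car k ==> a \<in> car A ==> c \<odot>\<^sub>B (I +> a) = I +> (c \<odot> a)"
 by (rule smult_quot_module[OF module_axioms submodule_I_k])

lemma mult_B: "a \<in> car A ==> b \<in> car A ==>
  (I +> a) \<otimes>\<^sub>B (I +> b) = I +> (a \<otimes> b)"
 using ideal.rcoset_mult_add[OF ideal_I, of a b] by (simp add: quot_module_def)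

lemma zero_B: "\<zero>\<^sub>B = I +> \<zero>"
 by (rule zero_quot_module[OF module_axioms submodule_I_k])

lemma one_B: "\<one>\<^sub>B = I +> \<one>"
 by (simp add: quot_module_def)

lemma algebra_B: "algebra k B"
 by (rule algebra_surj_image[OF algebra_axioms carrier_B])
  (simp_all add: add_B smult_B mult_B zero_B one_B)

lemma carrier_B_C: "car B = car C"
 by (simp add: carrier_B carrier_C)

lemma add_B_C: "add B = add C"
 by (simp add: quot_module_def set_add_def set_mult_def fun_eq_iff)

lemma smult_B_C: "c \<in> car k ==> X \<in> car C ==> c \<odot>\<^sub>B X = (c \<odot> \<one>) \<odot>\<^sub>C X"
 by (auto simp: carrier_C smult_B smult_C smult_one_mult)

lemma mod_hom_B_C: "mod_hom k B K = mod_hom k Ck K"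
 unfolding mod_hom_def by (auto simp: carrier_B_C add_B_C smult_B_C)

lemma Lin_B_lift:
 assumes "\<psi> \<in> Lin" "\<And>x. x \<in> I ==> \<psi> x = \<zero>\<^sub>k"
 shows "\<exists>g\<in>lin k B \<inter> extensional (car B). \<forall>a\<in>car A. g (I +> a) = \<psi> a"
 using descend_Lin[OF assms] unfolding mod_hom_B_C carrier_B_C by simp

lemma Lin_B_pullback:
 assumes "g \<in> lin k B"
 shows "(\<lambda>a. g (I +> a)) \<in> Lin" and "\<And>x. x \<in> I ==> g (I +> x) = \<zero>\<^sub>k"
proof -
 have g: "g \<in> lin k Ck" using assms by (simp only: mod_hom_B_C)
 show "(\<lambda>a. g (I +> a)) \<in> Lin" by (rule pullback_Lin[OF g])
 fix x assume x: "x \<in> I"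
 then show "g (I +> x) = \<zero>\<^sub>k"
  using mod_hom_zero[OF module_Ck module_regular[OF R_cring] g] coset_zero_C[OF I_carrier[OF x]] by simp
qed

end

subsection \<open>Cyclic twists of the linked ideal\<close>

locale twist = linkage k A \<epsilon> n s \<phi> I \<pi>
 for k :: "('k, 'z) ring_scheme" and A :: "('k, 'a) module" (structure) and \<epsilon> and n and s and \<phi> and I and \<pi> +
 fixes L :: "('k, 'l) module"
 assumes module_L: "module k L"
begin

abbreviation "AI \<equiv> (regular_module A)\<lparr>carrier := Ann\<rparr>"
abbreviation "AIk \<equiv> restrict_scalars A AI"
abbreviation "LI \<equiv> tensor_alg k A L AI"
abbreviation "LIk \<equiv> tensor k L AIk"
abbreviation "tL \<equiv> tens k L AIk"

lemma module_AI: "module A AI"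
 by (rule submodule.submodule_is_module[OF submodule_Ann module_AA])

lemma module_AIk: "module k AIk" by (rule module_restrict_scalars[OF algebra_axioms module_AI])

lemma module_LI: "module A LI" by (rule module_tensor_alg[OF algebra_axioms module_L module_AI])

lemma module_LIk: "module k (tensor k L AIk)" by (rule module_tensor[OF module_L module_AIk])

lemma tL_closed: "x \<in> car L ==> i \<in> Ann ==> tL x i \<in> car LI"
 by (rule ten_closed[OF algebra_axioms module_L module_AI]) auto

lemma tL_smult: "a \<in> car A ==> x \<in> car L ==> i \<in> Ann ==> a \<odot>\<^sub>LI tL x i = tL x (a \<otimes> i)"
 using ten_smult[OF algebra_axioms module_L module_AI, of a x i] by (simp del: tensor_alg_simps)

lemma tL_smult_left: "c \<in> car k ==> x \<in> car L ==> i \<in> Ann ==> tL (c \<odot>\<^sub>L x) i = tL x (c \<odot> i)"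
 using ten_smult_left[OF algebra_axioms module_L module_AI, of c x i] Ann_carrier[of i]
 by (simp add: smult_one_mult)

lemma tL_smult_k: "c \<in> car k ==> x \<in> car L ==> i \<in> Ann ==> c \<odot>\<^bsub>tensor k L AIk\<^esub> tL x i = tL (c \<odot>\<^sub>L x) i"
 using tens_smult_left[OF module_L module_AIk, of c x i] by simp

lemma tL_zero: "x \<in> car L ==> tL x \<zero> = \<zero>\<^sub>LI"
 using tens_zero_right[OF module_L module_AIk, of x] by simp

lemma I_kills_LI:
 assumes y: "y \<in> I" and x: "x \<in> car LI"
 shows "y \<odot>\<^sub>LI x = \<zero>\<^sub>LI"
proof -
 interpret LI: module A LI by (rule module_LI)
 have yA: "y \<in> car A" by (rule I_carrier[OF y])
 show ?thesis
  using algebra_axioms module_L module_AI x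
 proof (rule tensor_alg_induct)
  show "y \<odot>\<^sub>LI \<zero>\<^sub>LI = \<zero>\<^sub>LI" by (rule LI.smult_r_null[OF yA])
  fix x i assume x: "x \<in> car L" and "i \<in> car AI"
  then have i: "i \<in> Ann" by simp
  have "y \<otimes> i = \<zero>" using i y yA Ann_carrier[OF i] by (simp add: Ann_def m_comm)
  then show "y \<odot>\<^sub>LI tL x i = \<zero>\<^sub>LI" using tL_smult[OF yA x i] tL_zero[OF x] by (simp only:)
 next
  fix x z assume "x \<in> car LI" "z \<in> car LI" "y \<odot>\<^sub>LI x = \<zero>\<^sub>LI" "y \<odot>\<^sub>LI z = \<zero>\<^sub>LI"
  then show "y \<odot>\<^sub>LI (x \<oplus>\<^sub>LI z) = \<zero>\<^sub>LI"
   using LI.smult_r_distr[OF yA, of x z] LI.M.l_zero[OF LI.M.zero_closed] by (simp only:)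
 qed
qed

end

locale cyclic_twist = twist k A \<epsilon> n s \<phi> I \<pi> L
 for k :: "('k, 'z) ring_scheme" and A :: "('k, 'a) module" (structure) and \<epsilon> and n and s and \<phi> and I and \<pi>
  and L :: "('k, 'l) module" +
 fixes g :: "('l \<times> 'a => 'k) set"
 assumes noeth: "noetherian_ring k" and invertible: "invertible_module k L"
  and g_gen: "g \<in> car LI" "car LI = {a \<odot>\<^sub>LI g |a. a \<in> car A}"
begin

text \<open>A functional \<open>\<kappa>\<close> contracts the factor \<open>L\<close>. If
  \<open>\<kappa>\<close> is a local coordinate of \<open>L\<close>, this identifies
  \<open>L \<otimes> I'\<close> with \<open>I'\<close> up to a denominator.\<close>

lemma \<Lambda>_exists:
 assumes \<kappa>: "\<kappa> \<in> lin k L"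
 shows "\<exists>\<Lambda> \<in> mod_hom A LI AI. \<forall>x\<in>car L. \<forall>i\<in>Ann. \<Lambda> (tL x i) = \<kappa> x \<odot> i"
proof -
 have \<kappa>c: "\<kappa> x \<in> car k" if "x \<in> car L" for x using mod_hom_closed[OF \<kappa> that] by simp
 have sub: "c \<odot> i \<in> Ann" if "c \<in> car k" "i \<in> Ann" for c i
  using that I_carrier by (auto simp: Ann_def smult_assoc2)
 have "\<exists>\<Lambda> \<in> mod_hom A LI AI. \<forall>x\<in>car L. \<forall>i\<in>car AI. \<Lambda> (tL x i) = \<kappa> x \<odot> i"
 proof (rule tensor_alg_lift[OF algebra_axioms module_L module_AI module_AI])
  fix x i assume x: "x \<in> car L" and "i \<in> car AI"
  then have i: "i \<in> Ann" "i \<in> car A" using Ann_carrier by auto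
  show "\<kappa> x \<odot> i \<in> car AI" using sub[OF \<kappa>c[OF x] i(1)] by simp
  show "\<kappa> (x \<oplus>\<^sub>L x') \<odot> i = \<kappa> x \<odot> i \<oplus>\<^bsub>AI\<^esub> \<kappa> x' \<odot> i" if "x' \<in> car L" for x'
   using mod_hom_add[OF \<kappa> x that] \<kappa>c[OF x] \<kappa>c[OF that] i by (simp add: smult_l_distr)
  show "\<kappa> x \<odot> (i \<oplus>\<^bsub>AI\<^esub> i') = \<kappa> x \<odot> i \<oplus>\<^bsub>AI\<^esub> \<kappa> x \<odot> i'" if "i' \<in> car AI" for i'
   using \<kappa>c[OF x] i Ann_carrier[of i'] that by (simp add: smult_r_distr)
  show "\<kappa> (c \<odot>\<^sub>L x) \<odot> i = (c \<odot> \<one>) \<odot>\<^bsub>AI\<^esub> (\<kappa> x \<odot> i)" if "c \<in> car k" for c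
   using mod_hom_smult[OF \<kappa> that x] \<kappa>c[OF x] i that by (simp add: smult_one_mult smult_assoc1)
  show "\<kappa> x \<odot> (a \<odot>\<^bsub>AI\<^esub> i) = a \<odot>\<^bsub>AI\<^esub> (\<kappa> x \<odot> i)" if "a \<in> car A" for a
   using \<kappa>c[OF x] i that by (simp add: smult_assoc3)
 qed
 then show ?thesis by simp
qed

text \<open>Locally on the spectrum of \<open>k\<close>, \<open>L\<close> is trivial and the generator of \<open>L \<otimes> I'\<close> becomes a
 generator \<open>j\<close> of \<open>I'\<close>; then \<open>j \<phi>\<^sub>i\<close> generates the module of functionals that vanish on \<open>I\<close>.\<close>

lemma local_generator:
 assumes p: "primeideal p k"
 shows "\<exists>c j i. c \<in> car k \<and> c \<notin> p \<and> i < n \<and> j \<in> Ann \<and>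
  (\<forall>a\<in>car A. a \<odot>\<^sub>LI g = \<zero>\<^sub>LI --> a \<otimes> j = \<zero>) \<and>
  (\<forall>\<psi>\<in>Lin. (\<forall>x\<in>I. \<psi> x = \<zero>\<^sub>k) -->
   (\<exists>a\<in>car A. \<forall>x\<in>car A. c \<otimes>\<^sub>k \<psi> x = \<phi> i (j \<otimes> (a \<otimes> x))))"
proof -
 interpret p: primeideal p k by (rule p)
 obtain c l \<kappa> where c: "c \<in> car k" "c \<notin> p" and l: "l \<in> car L"
  and \<kappa>: "\<kappa> \<in> lin k L" "\<kappa> l = c"
  using invertible_local_generator[OF noeth invertible p] by blast
 obtain \<Lambda> where \<Lambda>: "\<Lambda> \<in> mod_hom A LI AI" "\<And>x i. x \<in> car L ==> i \<in> Ann ==> \<Lambda> (tL x i) = \<kappa> x \<odot> i"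
  using \<Lambda>_exists[OF \<kappa>(1)] by blast
 obtain i where i: "i < n" "\<phi> i (s i) \<notin> p" using frame_unit_notin[OF p] by blast
 have fi: "\<phi> i (s i) \<in> car k" by (rule frame_closed[OF i(1) frame_carrier[OF i(1)]])
 define j where "j = \<Lambda> g"
 have j: "j \<in> Ann" using mod_hom_closed[OF \<Lambda>(1) g_gen(1)] by (simp add: j_def)
 have jA: "j \<in> car A" by (rule Ann_carrier[OF j])
 have \<Lambda>g: "\<Lambda> (a \<odot>\<^sub>LI g) = a \<otimes> j" if "a \<in> car A" for a
  using mod_hom_smult[OF \<Lambda>(1) that g_gen(1)] by (simp add: j_def del: tensor_alg_simps)
 have "a \<otimes> j = \<zero>" if "a \<in> car A" "a \<odot>\<^sub>LI g = \<zero>\<^sub>LI" for a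
  using \<Lambda>g[OF that(1)] mod_hom_zero[OF module_LI module_AI \<Lambda>(1)] unfolding that(2) by simp
 moreover have "\<exists>a\<in>car A. \<forall>x\<in>car A. (c \<otimes>\<^sub>k \<phi> i (s i)) \<otimes>\<^sub>k \<psi> x = \<phi> i (j \<otimes> (a \<otimes> x))"
  if \<psi>: "\<psi> \<in> Lin" "\<forall>x\<in>I. \<psi> x = \<zero>\<^sub>k" for \<psi>
 proof -
  let ?t = "\<theta> (s i) \<psi>"
  have t: "?t \<in> Ann" using \<theta>_in_Ann[OF frame_socle[OF i(1)] \<psi>(1)] \<psi>(2) by blast
  have tA: "?t \<in> car A" by (rule Ann_carrier[OF t])
  \<comment> \<open>\<open>\<Lambda>\<close> maps the tensor of \<open>l\<close> and
    \<open>?t\<close> to \<open>c ?t\<close> and maps \<open>g\<close> to \<open>j\<close>;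
    cyclicity therefore makes \<open>c ?t\<close> a multiple of \<open>j\<close>.\<close>
  obtain a where a: "a \<in> car A" "tL l ?t = a \<odot>\<^sub>LI g"
   using tL_closed[OF l t] unfolding g_gen(2) by blast
  have ct: "c \<odot> ?t = a \<otimes> j"
   using \<Lambda>g[OF a(1)] \<Lambda>(2)[OF l t] \<kappa>(2) unfolding a(2)[symmetric] by simp
  have "(c \<otimes>\<^sub>k \<phi> i (s i)) \<otimes>\<^sub>k \<psi> x = \<phi> i (j \<otimes> (a \<otimes> x))" if x: "x \<in> car A" for x
  proof -
   have "(c \<otimes>\<^sub>k \<phi> i (s i)) \<otimes>\<^sub>k \<psi> x = c \<otimes>\<^sub>k \<phi> i (?t \<otimes> x)"
    using \<theta>_eq[OF frame_socle[OF i(1)] \<psi>(1) i(1) x] c fi Lin_closed[OF \<psi>(1) x] by (simp add: R.m_assoc)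
   also have "... = \<phi> i ((c \<odot> ?t) \<otimes> x)" using c x tA by (simp add: smult_assoc2 Lin_smult[OF frame_Lin[OF i(1)]])
   also have "... = \<phi> i (j \<otimes> (a \<otimes> x))" unfolding ct using a(1) jA x by (simp add: m_ac)
   finally show ?thesis .
  qed
  then show ?thesis using a(1) by blast
 qed
 moreover have "c \<otimes>\<^sub>k \<phi> i (s i) \<notin> p" using p.I_prime[OF c(1) fi] c(2) i(2) by blast
 ultimately show ?thesis
  using c(1) fi i(1) j by (intro exI[of _ "c \<otimes>\<^sub>k \<phi> i (s i)"] exI[of _ j] exI[of _ i]) auto
qed

text \<open>If \<open>a\<close> kills \<open>g\<close>, it kills each local generator
  \<open>j\<close>. For \<open>\<psi>\<close> vanishing on \<open>I\<close> the value
  \<open>c (\<psi> a)\<close> is \<open>\<phi> i (j b a) = 0\<close>, so \<open>\<psi> a\<close> is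
  locally zero, and such \<open>\<psi>\<close> separate \<open>A/I\<close>.\<close>

lemma annihilator_of_generator:
 assumes a: "a \<in> car A" "a \<odot>\<^sub>LI g = \<zero>\<^sub>LI"
 shows "a \<in> I"
proof (rule I_separates[OF a(1)])
 fix \<psi> assume \<psi>: "\<psi> \<in> Lin" and 0: "\<And>y. y \<in> I ==> \<psi> y = \<zero>\<^sub>k"
 have \<psi>a: "\<psi> a \<in> car k" by (rule Lin_closed[OF \<psi> a(1)])
 have "\<psi> a = \<zero>\<^bsub>regular_module k\<^esub>"
 proof (rule module.zero_if_locally_zero[OF module_regular[OF R_cring]])
  fix p assume p: "primeideal p k"
  obtain c j i where c: "c \<in> car k" "c \<notin> p" and i: "i < n" and j: "j \<in> Ann"
   and kill: "\<forall>a\<in>car A. a \<odot>\<^sub>LI g = \<zero>\<^sub>LI --> a \<otimes> j = \<zero>"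
   and gen: "\<forall>\<psi>\<in>Lin. (\<forall>x\<in>I. \<psi> x = \<zero>\<^sub>k) -->
    (\<exists>a\<in>car A. \<forall>x\<in>car A. c \<otimes>\<^sub>k \<psi> x = \<phi> i (j \<otimes> (a \<otimes> x)))"
   using local_generator[OF p] by (elim exE conjE)
  have jA: "j \<in> car A" by (rule Ann_carrier[OF j])
  obtain b where b: "b \<in> car A" "\<forall>x\<in>car A. c \<otimes>\<^sub>k \<psi> x = \<phi> i (j \<otimes> (b \<otimes> x))"
   using gen \<psi> 0 by blast
  have aj: "a \<otimes> j = \<zero>" using kill a by blast
  have "j \<otimes> (b \<otimes> a) = b \<otimes> (a \<otimes> j)" using jA b(1) a(1) by (simp add: m_ac)
  then have "c \<otimes>\<^sub>k \<psi> a = \<zero>\<^sub>k" using b a(1) aj Lin_zero[OF frame_Lin[OF i]] by simp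
  then show "\<exists>f\<in>car k - p. f \<odot>\<^bsub>regular_module k\<^esub> \<psi> a = \<zero>\<^bsub>regular_module k\<^esub>" using c by auto
 qed (use \<psi>a in simp)
 then show "\<psi> a = \<zero>\<^sub>k" by simp
qed

lemma C_iso_LI: "\<exists>G \<in> mod_iso A C LI. \<forall>a\<in>car A. G (I +> a) = a \<odot>\<^sub>LI g"
proof -
 interpret LI: module A LI by (rule module_LI)
 have f: "(\<lambda>a. a \<odot>\<^sub>LI g) \<in> mod_hom A AA LI"
 proof (rule mod_homI)
  fix a b assume "a \<in> car AA" "b \<in> car AA"
  then have ab: "a \<in> car A" "b \<in> car A" by auto
  show "a \<odot>\<^sub>LI g \<in> car LI" by (rule LI.smult_closed[OF ab(1) g_gen(1)])
  show "(a \<oplus>\<^sub>AA b) \<odot>\<^sub>LI g = a \<odot>\<^sub>LI g \<oplus>\<^sub>LI b \<odot>\<^sub>LI g"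
   using LI.smult_l_distr[OF ab g_gen(1)] by (simp only: regular_module_simps)
 next
  fix a b assume "a \<in> car A" "b \<in> car AA"
  then have ab: "a \<in> car A" "b \<in> car A" by auto
  show "(a \<odot>\<^sub>AA b) \<odot>\<^sub>LI g = a \<odot>\<^sub>LI (b \<odot>\<^sub>LI g)"
   using LI.smult_assoc1[OF ab g_gen(1)] by (simp only: regular_module_simps)
 qed
 obtain G where G: "G \<in> mod_hom A C LI" "\<And>a. a \<in> car AA ==> G (I +>\<^bsub>AA\<^esub> a) = a \<odot>\<^sub>LI g"
  using quot_module_lift[OF module_AA module_LI submodule_I f I_kills_LI[OF _ g_gen(1)]] by blast
 have GA: "G (I +> a) = a \<odot>\<^sub>LI g" if "a \<in> car A" for a
  using G(2)[of a] that by (simp del: tensor_alg_simps)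
 have "bij_betw G (car C) (car LI)"
 proof (rule bij_betw_imageI)
  show "inj_on G (car C)"
  proof (rule inj_onI)
   fix X Y assume "X \<in> car C" "Y \<in> car C" and eq: "G X = G Y"
   then obtain a b where ab: "a \<in> car A" "X = I +> a" "b \<in> car A" "Y = I +> b"
    by (auto simp: carrier_C)
   have "a \<odot>\<^sub>LI g = b \<odot>\<^sub>LI g" using eq GA ab by (simp del: tensor_alg_simps)
   then have "(a \<ominus> b) \<odot>\<^sub>LI g = \<zero>\<^sub>LI"
    using ab g_gen(1) LI.smult_closed[OF ab(3) g_gen(1)]
    by (simp add: a_minus_def LI.smult_l_distr LI.smult_l_minus LI.M.r_neg del: tensor_alg_simps)
   then have "a \<ominus> b \<in> I" using annihilator_of_generator[of "a \<ominus> b"] ab by simp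
   then show "X = Y" using coset_eq_C ab by simp
  qed
  show "G ` car C = car LI"
   unfolding g_gen(2) carrier_C using GA by (auto simp: image_iff simp del: tensor_alg_simps)
 qed
 then show ?thesis using G(1) GA unfolding mod_iso_def by blast
qed

text \<open>Invertibility must be shown at the primes of \<open>B\<close>, while the generators are
  known at primes of \<open>k\<close>. Contracting \<open>P\<close> to \<open>k\<close> gives a
  scalar \<open>c\<close> outside it and a functional \<open>x \<mapsto> \<phi> i (j x)\<close> that
  descends to \<open>B\<close> and is a basis of the dual with the image of \<open>c\<close> as
  denominator.\<close>

lemma gorenstein_B: "gorenstein k B"
proof -
 interpret B: algebra k B by (rule algebra_B)
 let ?DB = "dual_alg k B (regular_module B)"
 have mDB: "module B ?DB" by (rule module_dual_alg[OF algebra_B module_regular[OF B.M_cring]])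
 interpret DB: module B ?DB by (rule mDB)
 have carDB: "car ?DB = lin k B \<inter> extensional (car B)"
  by (simp add: mod_hom_restrict_regular[OF algebra_B])
 have smDB: "Y \<odot>\<^bsub>?DB\<^esub> h = (\<lambda>X\<in>car B. h (Y \<otimes>\<^sub>B X))" for Y h by simp
 have zeroDB: "\<zero>\<^bsub>?DB\<^esub> = (\<lambda>X\<in>car B. \<zero>\<^sub>k)" by simp
 have cosB: "I +> a \<in> car B" if "a \<in> car A" for a using that by (auto simp: carrier_B)
 have "\<exists>f\<in>car B - P. \<exists>m. frac_basis B ?DB f 1 m" if P: "primeideal P B" for P
 proof -
  interpret P: primeideal P B by (rule P)
  let ?e = "\<lambda>c. I +> (c \<odot> \<one>)"
  have e_add: "?e (c \<oplus>\<^sub>k d) = ?e c \<oplus>\<^sub>B ?e d" and e_mult: "?e (c \<otimes>\<^sub>k d) = ?e c \<otimes>\<^sub>B ?e d"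
   if "c \<in> car k" "d \<in> car k" for c d
   using that by (simp_all add: add_B mult_B smult_l_distr smult_assoc1 smult_assoc2)
  have e_c: "?e c \<in> car B" if "c \<in> car k" for c using cosB that by simp
  define p where "p = {c \<in> car k. ?e c \<in> P}"
  have idp: "ideal p k"
  proof (rule idealI)
   have e0: "?e \<zero>\<^sub>k = \<zero>\<^sub>B" by (simp add: zero_B)
   have em: "?e (\<ominus>\<^sub>k c) = \<ominus>\<^sub>B ?e c" if c: "c \<in> car k" for c
    using e_add[of "\<ominus>\<^sub>k c" c] c e0 e_c by (intro B.minus_equality[symmetric]) (auto simp: R.l_neg)
   show "subgroup p (add_monoid k)"
    by (rule R.add.subgroupI) (auto simp: p_def e0 em e_add simp flip: zero_B intro!: exI[of _ "\<zero>\<^sub>k"])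
   fix a x assume "a \<in> p" "x \<in> car k"
   then show "x \<otimes>\<^sub>k a \<in> p" "a \<otimes>\<^sub>k x \<in> p"
    using e_c[of x] by (auto simp: p_def e_mult P.I_l_closed P.I_r_closed)
  qed (rule R.ring_axioms)
  have pp: "primeideal p k"
  proof (rule primeidealI[OF idp R_cring])
   have "?e \<one>\<^sub>k = \<one>\<^sub>B" by (simp add: one_B)
   then have "\<one>\<^sub>k \<notin> p" using P.one_imp_carrier P.I_notcarr by (auto simp: p_def)
   then show "car k \<noteq> p" by auto
   fix a b assume "a \<in> car k" "b \<in> car k" "a \<otimes>\<^sub>k b \<in> p"
   then show "a \<in> p \<or> b \<in> p" using P.I_prime[of "?e a" "?e b"] e_c by (auto simp: p_def e_mult)
  qed
  obtain c j i where c: "c \<in> car k" "c \<notin> p" and i: "i < n" and j: "j \<in> Ann"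
   and gen: "\<forall>\<psi>\<in>Lin. (\<forall>x\<in>I. \<psi> x = \<zero>\<^sub>k) -->
    (\<exists>a\<in>car A. \<forall>x\<in>car A. c \<otimes>\<^sub>k \<psi> x = \<phi> i (j \<otimes> (a \<otimes> x)))"
   using local_generator[OF pp] by (elim exE conjE)
  have jA: "j \<in> car A" by (rule Ann_carrier[OF j])
  have "\<phi> i (j \<otimes> x) = \<zero>\<^sub>k" if "x \<in> I" for x
   using j that Lin_zero[OF frame_Lin[OF i]] by (simp add: Ann_def)
  from Lin_B_lift[OF Lin_mult[OF frame_Lin[OF i] jA] this]
  obtain \<chi> where \<chi>: "\<chi> \<in> car ?DB" "\<And>a. a \<in> car A ==> \<chi> (I +> a) = \<phi> i (j \<otimes> a)"
   unfolding carDB by blast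
  have ec: "?e c \<in> car B - P" using c e_c by (auto simp: p_def)
  have sum1: "(\<Oplus>\<^bsub>?DB\<^esub>l\<in>{..<1}. Y l \<odot>\<^bsub>?DB\<^esub> \<chi>) = Y 0 \<odot>\<^bsub>?DB\<^esub> \<chi>" if "Y (0::nat) \<in> car B" for Y
   using DB.smult_closed[OF that \<chi>(1)]
   by (simp add: lessThan_Suc DB.M.finsum_insert DB.M.finsum_empty del: dual_alg_simps)
  have eX: "?e c \<otimes>\<^sub>B (I +> x) = I +> (c \<odot> x)" if "x \<in> car A" for x
   using that c by (simp add: mult_B smult_one_mult)
  have ec1: "?e c [^]\<^bsub>B\<^esub> (1::nat) = ?e c" using e_c[OF c(1)] by simp
  have "frac_basis B ?DB (?e c) 1 (\<lambda>_. \<chi>)"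
   unfolding frac_basis_def
  proof (intro conjI allI ballI impI \<chi>(1))
   fix h assume "h \<in> car ?DB"
   then have h: "h \<in> lin k B" unfolding carDB by blast
   note h' = Lin_B_pullback[OF h]
   obtain a where a: "a \<in> car A"
    "\<forall>x\<in>car A. c \<otimes>\<^sub>k h (I +> x) = \<phi> i (j \<otimes> (a \<otimes> x))"
    using bspec[OF gen h'(1)] h'(2) by (elim impE bexE) simp_all
   have "?e c \<odot>\<^bsub>?DB\<^esub> h = (I +> a) \<odot>\<^bsub>?DB\<^esub> \<chi>"
    unfolding smDB
   proof (rule restrict_ext)
    fix X assume "X \<in> car B"
    then obtain x where x: "x \<in> car A" "X = I +> x" by (auto simp: carrier_B)
    have "h (?e c \<otimes>\<^sub>B X) = c \<otimes>\<^sub>k h X"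
     using mod_hom_smult[OF h c(1) cosB[OF x(1)]] x c by (simp add: eX smult_B)
    also have "... = \<chi> ((I +> a) \<otimes>\<^sub>B X)" using a x \<chi>(2) by (simp add: mult_B)
    finally show "h (?e c \<otimes>\<^sub>B X) = \<chi> ((I +> a) \<otimes>\<^sub>B X)" .
   qed
   then have "?e c [^]\<^bsub>B\<^esub> (1::nat) \<odot>\<^bsub>?DB\<^esub> h = (\<Oplus>\<^bsub>?DB\<^esub>l\<in>{..<1::nat}. (I +> a) \<odot>\<^bsub>?DB\<^esub> \<chi>)"
    using sum1[of "\<lambda>_. I +> a", OF cosB[OF a(1)]] by (simp only: ec1)
   then show "\<exists>(N::nat) Y. (\<forall>l<1::nat. Y l \<in> car B) \<and>
     ?e c [^]\<^bsub>B\<^esub> N \<odot>\<^bsub>?DB\<^esub> h = (\<Oplus>\<^bsub>?DB\<^esub>l\<in>{..<1}. Y l \<odot>\<^bsub>?DB\<^esub> \<chi>)"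
    using cosB[OF a(1)] by (intro exI[of _ 1] exI[of _ "\<lambda>_. I +> a"] conjI allI impI)
  next
   fix Y assume Y: "(\<forall>l<1::nat. Y l \<in> car B) \<and> (\<Oplus>\<^bsub>?DB\<^esub>l\<in>{..<1}. Y l \<odot>\<^bsub>?DB\<^esub> \<chi>) = \<zero>\<^bsub>?DB\<^esub>"
   then have Y0: "Y 0 \<in> car B" by simp
   then obtain b where b: "b \<in> car A" "Y 0 = I +> b" by (auto simp: carrier_B)
   have eq: "(\<lambda>X\<in>car B. \<chi> (Y 0 \<otimes>\<^sub>B X)) = (\<lambda>X\<in>car B. \<zero>\<^sub>k)"
    using Y sum1[of Y, OF Y0] by (simp only: smDB zeroDB)
   have "\<chi> (Y 0 \<otimes>\<^sub>B (I +> x)) = \<zero>\<^sub>k" if "x \<in> car A" for x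
    using fun_cong[OF eq, of "I +> x"] by (simp only: restrict_apply'[OF cosB[OF that]])
   then have kill: "\<phi> i (j \<otimes> (b \<otimes> x)) = \<zero>\<^sub>k" if "x \<in> car A" for x
    using that b \<chi>(2)[of "b \<otimes> x"] by (simp add: mult_B)
   \<comment> \<open>Freeness: every functional vanishing on \<open>I\<close> takes at
     \<open>c b\<close> a value of the form \<open>\<phi> i (j (a b))\<close>, and these are zero by
     \<open>kill\<close>.\<close>
   have "c \<odot> b \<in> I"
   proof (rule I_separates)
    fix \<psi> assume \<psi>: "\<psi> \<in> Lin" "\<And>y. y \<in> I ==> \<psi> y = \<zero>\<^sub>k"
    then obtain a where a: "a \<in> car A" "\<forall>x\<in>car A. c \<otimes>\<^sub>k \<psi> x = \<phi> i (j \<otimes> (a \<otimes> x))"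
     using gen by blast
    have "\<psi> (c \<odot> b) = \<phi> i (j \<otimes> (a \<otimes> b))" using a b(1) Lin_smult[OF \<psi>(1) c(1) b(1)] by simp
    also have "... = \<zero>\<^sub>k" using kill[OF a(1)] m_comm[OF a(1) b(1)] by simp
    finally show "\<psi> (c \<odot> b) = \<zero>\<^sub>k" .
   qed (use b c in simp)
   then have "I +> (c \<odot> b) = \<zero>\<^sub>B"
    using coset_zero_iff[OF module_axioms submodule_I_k, of "c \<odot> b"] b c by simp
   then have "?e c [^]\<^bsub>B\<^esub> (1::nat) \<otimes>\<^sub>B Y 0 = \<zero>\<^sub>B"
    unfolding ec1 b(2) using eX[OF b(1)] by simp
   then show "\<exists>N::nat. \<forall>l<1::nat. ?e c [^]\<^bsub>B\<^esub> N \<otimes>\<^sub>B Y l = \<zero>\<^sub>B" by (intro exI[of _ 1]) simp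
  qed
  then show ?thesis using ec by blast
 qed
 then have "locally_free_rank B ?DB 1" unfolding locally_free_rank_iff using mDB by blast
 then show ?thesis unfolding gorenstein_def invertible_module_def using algebra_B by blast
qed

end

section \<open>The twisting module recovered from the socles\<close>

lemma finsum_tens_right:
 assumes M: "module k M" and N: "module k N" and "x \<in> car M" "finite I" "f \<in> I \<rightarrow> car N"
 shows "tens k M N x (finsum N f I) = (\<Oplus>\<^bsub>tensor k M N\<^esub>i\<in>I. tens k M N x (f i))"
 by (rule mod_hom_finsum[OF N module_tensor[OF M N] _ assms(4,5)], rule mod_homI)
  (use assms in \<open>auto simp: tens_closed tens_add_right tens_smult_right\<close>)

lemma hom_finsum_apply:
 assumes M: "module k M" and N: "module k N" and x: "x \<in> car M" and "finite I"
  "f \<in> I \<rightarrow> car (hom_module k M N)"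
 shows "(finsum (hom_module k M N) f I) x = (\<Oplus>\<^sub>N i\<in>I. f i x)"
proof (rule mod_hom_finsum[OF module_hom_module[OF M N] N _ assms(4,5)], rule mod_homI)
 fix h assume "h \<in> car (hom_module k M N)"
 then have "h \<in> mod_hom k M N" by simp
 from mod_hom_closed[OF this x] show "h x \<in> car N" .
qed (use x in simp_all)

text \<open>The pairing \<open>\<eta> : L \<times> S \<rightarrow> X\<close> is perfect because \<open>S\<close> is invertible: the \<open>s\<^sub>i\<close> and \<open>\<phi>\<^sub>i\<close> form a dual
 basis of trace one, and \<open>\<Sum> \<eta>(x, s\<^sub>i) \<otimes> \<phi>\<^sub>i\<close> is the image of \<open>x\<close>.\<close>

lemma tensor_dual_iso_if_pairing:
 fixes k :: "('k, 'z) ring_scheme" and L :: "('k, 'l) module" and S :: "('k, 's) module"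
  and X :: "('k, 'x) module"
 assumes L: "module k L" and S: "module k S" and X: "module k X"
  and s: "\<And>i. i < (n::nat) ==> s i \<in> car S" and \<phi>: "\<And>i. i < n ==> \<phi> i \<in> lin k S"
  and expand: "\<And>t. t \<in> car S ==> (\<Oplus>\<^sub>S i\<in>{..<n}. \<phi> i t \<odot>\<^sub>S s i) = t"
  and one: "(\<Oplus>\<^sub>k i\<in>{..<n}. \<phi> i (s i)) = \<one>\<^sub>k"
  and comm: "\<And>i j t t'. i < n ==> j < n ==> t \<in> car S ==> t' \<in> car S ==>
   \<phi> i t \<otimes>\<^sub>k \<phi> j t' = \<phi> j t \<otimes>\<^sub>k \<phi> i t'"
  and \<eta>: "\<And>t. t \<in> car S ==> (\<lambda>x. \<eta> x t) \<in> mod_hom k L X"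
  and \<xi>: "\<And>i. i < n ==> \<xi> i \<in> mod_hom k X L"
  and \<xi>\<eta>: "\<And>i x t. i < n ==> x \<in> car L ==> t \<in> car S ==> \<xi> i (\<eta> x t) = \<phi> i t \<odot>\<^sub>L x"
  and \<eta>\<xi>: "\<And>i y t. i < n ==> y \<in> car X ==> t \<in> car S ==> \<eta> (\<xi> i y) t = \<phi> i t \<odot>\<^sub>X y"
 shows "mod_isomorphic k L (tensor k X (dual k S))"
proof -
 interpret L: module k L by (rule L)
 interpret S: module k S by (rule S)
 interpret X: module k X by (rule X)
 define D where "D = dual k S"
 have D: "module k D" unfolding D_def by (rule module_dual[OF S])
 interpret D: module k D by (rule D)
 define T where "T = tensor k X D"
 have T: "module k T" unfolding T_def by (rule module_tensor[OF X D])
 interpret T: module k T by (rule T)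
 let ?t = "tens k X D"
 let ?\<phi> = "\<lambda>i. restrict (\<phi> i) (car S)"
 note Ds = dual_simps[of k S, folded D_def]
 have muS: "\<mu> \<in> lin k S" if "\<mu> \<in> car D" for \<mu> using that by (simp add: Ds)
 have muc: "\<mu> x \<in> car k" if "\<mu> \<in> car D" "x \<in> car S" for \<mu> x
  using mod_hom_closed[OF muS[OF that(1)] that(2)] by simp
 have \<phi>D: "?\<phi> i \<in> car D" if "i < n" for i
  using mod_hom_cong[OF S \<phi>[OF that], of "?\<phi> i"] by (simp add: Ds)
 have \<phi>c: "\<phi> i t \<in> car k" if "i < n" "t \<in> car S" for i t using mod_hom_closed[OF \<phi>[OF that(1)] that(2)] by simp
 have \<eta>c: "\<eta> x t \<in> car X" if "x \<in> car L" "t \<in> car S" for x t by (rule mod_hom_closed[OF \<eta>[OF that(2)] that(1)])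
 have Ec: "\<xi> i y \<in> car L" if "i < n" "y \<in> car X" for i y by (rule mod_hom_closed[OF \<xi>[OF that(1)] that(2)])
 have tc: "?t y \<mu> \<in> car T" if "y \<in> car X" "\<mu> \<in> car D" for y \<mu>
  unfolding T_def by (rule tens_closed[OF X D that])
 define \<alpha> where "\<alpha> = (\<lambda>x. \<Oplus>\<^sub>T i\<in>{..<n}. ?t (\<eta> x (s i)) (?\<phi> i))"
 \<comment> \<open>The inverse on the pure tensor of \<open>y\<close> and \<open>\<mu>\<close>: the
   maps \<open>\<xi> i\<close> undo \<open>\<eta>\<close> up to the scalars
   \<open>\<phi> i t\<close>, and the weights \<open>\<mu> (s i)\<close> turn these into the value
   of \<open>\<mu>\<close>.\<close>
 define b where "b = (\<lambda>y \<mu>. \<Oplus>\<^sub>L i\<in>{..<n}. \<mu> (s i) \<odot>\<^sub>L \<xi> i y)"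
 have bc: "b y \<mu> \<in> car L" if "y \<in> car X" "\<mu> \<in> car D" for y \<mu>
  unfolding b_def using that by (intro L.M.finsum_closed) (auto simp: Ec muc s)
 have \<alpha>: "\<alpha> \<in> mod_hom k L T"
 proof (rule mod_homI)
  fix x y assume xy: "x \<in> car L" "y \<in> car L"
  show "\<alpha> x \<in> car T" unfolding \<alpha>_def using xy by (intro T.M.finsum_closed) (auto intro!: tc \<eta>c s \<phi>D)
  have "\<alpha> (x \<oplus>\<^sub>L y) = (\<Oplus>\<^sub>T i\<in>{..<n}. ?t (\<eta> x (s i)) (?\<phi> i) \<oplus>\<^sub>T ?t (\<eta> y (s i)) (?\<phi> i))"
   unfolding \<alpha>_def using xy mod_hom_add[OF \<eta>[OF s] xy] tens_add_left[OF X D \<eta>c[OF xy(1) s] \<eta>c[OF xy(2) s] \<phi>D]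
   by (intro T.M.finsum_cong') (auto intro!: tc \<eta>c s \<phi>D simp: T_def[symmetric])
  then show "\<alpha> (x \<oplus>\<^sub>L y) = \<alpha> x \<oplus>\<^sub>T \<alpha> y"
   unfolding \<alpha>_def using xy by (subst T.M.finsum_addf[symmetric]) (auto intro!: tc \<eta>c s \<phi>D)
 next
  fix c x assume c: "c \<in> car k" and x: "x \<in> car L"
  have "\<alpha> (c \<odot>\<^sub>L x) = (\<Oplus>\<^sub>T i\<in>{..<n}. c \<odot>\<^sub>T ?t (\<eta> x (s i)) (?\<phi> i))"
   unfolding \<alpha>_def using x c mod_hom_smult[OF \<eta>[OF s] c x] tens_smult_left[OF X D c \<eta>c[OF x s] \<phi>D]
   by (intro T.M.finsum_cong') (auto intro!: tc \<eta>c s \<phi>D T.smult_closed simp: T_def[symmetric])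
  then show "\<alpha> (c \<odot>\<^sub>L x) = c \<odot>\<^sub>T \<alpha> x"
   unfolding \<alpha>_def using x c by (subst T.finsum_smult_ldistr) (auto intro!: tc \<eta>c s \<phi>D)
 qed
 have "\<exists>h \<in> mod_hom k (tensor k X D) L. \<forall>y\<in>car X. \<forall>\<mu>\<in>car D. h (tens k X D y \<mu>) = b y \<mu>"
 proof (rule tensor_lift[OF X D L])
  fix y \<mu> assume y: "y \<in> car X" and \<mu>: "\<mu> \<in> car D"
  show "b y \<mu> \<in> car L" by (rule bc[OF y \<mu>])
  show "b (y \<oplus>\<^sub>X y') \<mu> = b y \<mu> \<oplus>\<^sub>L b y' \<mu>" if "y' \<in> car X" for y'
   unfolding b_def using y \<mu> that
   by (subst L.M.finsum_addf[symmetric])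
    (auto simp del: L.M.finsum_addf simp: Ec muc s mod_hom_add[OF \<xi> y that] L.smult_r_distr intro!: L.M.finsum_cong')
  show "b y (\<mu> \<oplus>\<^sub>D \<mu>') = b y \<mu> \<oplus>\<^sub>L b y \<mu>'" if "\<mu>' \<in> car D" for \<mu>'
   unfolding b_def Ds using y \<mu> that
   by (subst L.M.finsum_addf[symmetric])
    (auto simp del: L.M.finsum_addf simp: Ec muc s L.smult_l_distr intro!: L.M.finsum_cong')
  fix c assume c: "c \<in> car k"
  show "b (c \<odot>\<^sub>X y) \<mu> = c \<odot>\<^sub>L b y \<mu>"
   unfolding b_def using y \<mu> c
   by (subst L.finsum_smult_ldistr)
    (auto simp: Ec muc s mod_hom_smult[OF \<xi> c y] L.smult_lcomm[of _ c] intro!: L.M.finsum_cong')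
  show "b y (c \<odot>\<^sub>D \<mu>) = c \<odot>\<^sub>L b y \<mu>"
   unfolding b_def Ds using y \<mu> c
   by (subst L.finsum_smult_ldistr)
    (auto simp: Ec muc s L.smult_assoc1 intro!: L.M.finsum_cong')
 qed
 then obtain \<beta> where \<beta>: "\<beta> \<in> mod_hom k T L" "\<And>y \<mu>. y \<in> car X ==> \<mu> \<in> car D ==> \<beta> (?t y \<mu>) = b y \<mu>"
  unfolding T_def by blast
 have split: "(\<Oplus>\<^sub>L i\<in>{..<n}. \<phi> i (s i) \<odot>\<^sub>L x) = x" if "x \<in> car L" for x
  using L.finsum_smult_rdistr[of "{..<n}" "\<lambda>i. \<phi> i (s i)" x] that by (simp add: one \<phi>c s)
 have \<beta>\<alpha>: "\<beta> (\<alpha> x) = x" if x: "x \<in> car L" for x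
 proof -
  \<comment> \<open>\<open>comm\<close> turns \<open>\<phi> i (s j) \<phi> j (s i)\<close> into
    \<open>\<phi> j (s j) \<phi> i (s i)\<close>, and the sum over \<open>j\<close> is the
    trace.\<close>
  have inner: "b (\<eta> x (s i)) (?\<phi> i) = \<phi> i (s i) \<odot>\<^sub>L x" if i: "i < n" for i
  proof -
   have "b (\<eta> x (s i)) (?\<phi> i) = (\<Oplus>\<^sub>L j\<in>{..<n}. \<phi> j (s j) \<odot>\<^sub>L (\<phi> i (s i) \<odot>\<^sub>L x))"
    unfolding b_def using x i comm[OF i _ s s[OF i]]
    by (intro L.M.finsum_cong') (auto simp: \<xi>\<eta> s \<phi>c simp flip: L.smult_assoc1)
   then show ?thesis using split[of "\<phi> i (s i) \<odot>\<^sub>L x"] x i by (simp add: \<phi>c s)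
  qed
  have "\<beta> (\<alpha> x) = (\<Oplus>\<^sub>L i\<in>{..<n}. \<beta> (?t (\<eta> x (s i)) (?\<phi> i)))"
   unfolding \<alpha>_def by (rule mod_hom_finsum[OF T L \<beta>(1)]) (auto intro!: tc \<eta>c x s \<phi>D)
  also have "... = (\<Oplus>\<^sub>L i\<in>{..<n}. \<phi> i (s i) \<odot>\<^sub>L x)"
   using x by (intro L.M.finsum_cong') (auto simp: \<beta>(2) \<eta>c s \<phi>D inner \<phi>c)
  finally show ?thesis using split[OF x] by simp
 qed
 have \<alpha>b: "\<alpha> (b y \<mu>) = ?t y \<mu>" if y: "y \<in> car X" and \<mu>: "\<mu> \<in> car D" for y \<mu>
 proof -
  have \<mu>exp: "(\<Oplus>\<^sub>k j\<in>{..<n}. \<phi> j t \<otimes>\<^sub>k \<mu> (s j)) = \<mu> t" if t: "t \<in> car S" for t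
   using functional_lincomb[OF S muS[OF \<mu>], of "{..<n}" s "\<lambda>j. \<phi> j t"] t by (simp add: expand \<phi>c s)
  have in1: "\<eta> (b y \<mu>) (s i) = \<mu> (s i) \<odot>\<^sub>X y" if i: "i < n" for i
  proof -
   have "\<eta> (b y \<mu>) (s i) = (\<Oplus>\<^sub>X j\<in>{..<n}. \<eta> (\<mu> (s j) \<odot>\<^sub>L \<xi> j y) (s i))"
    unfolding b_def by (rule mod_hom_finsum[OF L X \<eta>[OF s[OF i]]]) (auto simp: muc \<mu> s Ec y)
   also have "... = (\<Oplus>\<^sub>X j\<in>{..<n}. (\<phi> j (s i) \<otimes>\<^sub>k \<mu> (s j)) \<odot>\<^sub>X y)"
    using y \<mu> i by (intro X.M.finsum_cong')
     (auto simp: mod_hom_smult[OF \<eta>[OF s[OF i]]] muc s Ec \<eta>\<xi> \<phi>c X.smult_assoc1 X.smult_lcomm[of "\<phi> _ _"])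
   also have "... = \<mu> (s i) \<odot>\<^sub>X y"
    using X.finsum_smult_rdistr[of "{..<n}" "\<lambda>j. \<phi> j (s i) \<otimes>\<^sub>k \<mu> (s j)" y] y i \<mu> by (simp add: \<mu>exp \<phi>c s muc)
   finally show ?thesis .
  qed
  have sum: "(\<Oplus>\<^sub>D i\<in>{..<n}. \<mu> (s i) \<odot>\<^sub>D ?\<phi> i) = \<mu>"
  proof (rule extensionalityI[of _ "car S"])
   have "(\<Oplus>\<^sub>D i\<in>{..<n}. \<mu> (s i) \<odot>\<^sub>D ?\<phi> i) \<in> car D"
    by (intro D.M.finsum_closed) (auto intro!: D.smult_closed muc \<mu> s \<phi>D)
   then show "(\<Oplus>\<^sub>D i\<in>{..<n}. \<mu> (s i) \<odot>\<^sub>D ?\<phi> i) \<in> extensional (car S)" by (simp add: Ds(1))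
   show "\<mu> \<in> extensional (car S)" using \<mu> by (simp add: Ds(1))
   fix t assume t: "t \<in> car S"
   have "(\<Oplus>\<^sub>D i\<in>{..<n}. \<mu> (s i) \<odot>\<^sub>D ?\<phi> i) t = (\<Oplus>\<^sub>k i\<in>{..<n}. (\<mu> (s i) \<odot>\<^sub>D ?\<phi> i) t)"
    using hom_finsum_apply[OF S module_regular[OF L.R.is_cring] t, folded dual_def D_def,
      of "{..<n}" "\<lambda>i. \<mu> (s i) \<odot>\<^sub>D ?\<phi> i"] D.smult_closed[OF muc[OF \<mu> s] \<phi>D]
    by (simp only: finsum_regular finite_lessThan lessThan_iff Pi_iff) simp
   also have "... = (\<Oplus>\<^sub>k i\<in>{..<n}. \<phi> i t \<otimes>\<^sub>k \<mu> (s i))"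
    by (intro L.R.finsum_cong') (auto simp: Ds t \<phi>c muc[OF \<mu>] s L.R.m_comm)
   finally show "(\<Oplus>\<^sub>D i\<in>{..<n}. \<mu> (s i) \<odot>\<^sub>D ?\<phi> i) t = \<mu> t" using \<mu>exp[OF t] by simp
  qed
  have "\<alpha> (b y \<mu>) = (\<Oplus>\<^sub>T i\<in>{..<n}. ?t y (\<mu> (s i) \<odot>\<^sub>D ?\<phi> i))"
   unfolding \<alpha>_def
  proof (rule T.M.finsum_cong')
   show "?t (\<eta> (b y \<mu>) (s i)) (?\<phi> i) = ?t y (\<mu> (s i) \<odot>\<^sub>D ?\<phi> i)" if "i \<in> {..<n}" for i
    using that in1[of i] tens_smult_left[OF X D muc[OF \<mu> s] y \<phi>D, of i i] tens_smult_right[OF X D muc[OF \<mu> s] y \<phi>D, of i i]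
    by simp
  qed (auto intro!: tc D.smult_closed muc \<mu> s \<phi>D y)
  also have "... = ?t y (\<Oplus>\<^sub>D i\<in>{..<n}. \<mu> (s i) \<odot>\<^sub>D ?\<phi> i)"
   unfolding T_def by (rule finsum_tens_right[OF X D y, symmetric]) (auto intro!: D.smult_closed muc \<mu> s \<phi>D)
  finally show ?thesis unfolding sum .
 qed
 have \<alpha>\<beta>: "\<alpha> (\<beta> u) = u" if "u \<in> car T" for u
 proof (rule tensor_hom_eqI[OF X D, folded T_def, OF T mod_hom_comp[OF \<beta>(1) \<alpha>] _ _ that])
  show "(\<lambda>u. u) \<in> mod_hom k T T" by (rule mod_homI) auto
 qed (simp add: \<beta>(2) \<alpha>b)
 have "bij_betw \<alpha> (car L) (car T)"
  by (rule bij_betw_byWitness[of _ \<beta>]) (use \<beta>\<alpha> \<alpha>\<beta> mod_hom_closed[OF \<alpha>] mod_hom_closed[OF \<beta>(1)] in auto)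
 then show ?thesis using \<alpha> unfolding mod_isomorphic_def mod_iso_def T_def D_def by blast
qed

context linkage
begin

definition "socle_C = {X \<in> car C. \<forall>a\<in>car A. \<epsilon> a = \<zero>\<^sub>k --> a \<odot>\<^sub>C X = \<zero>\<^sub>C}"

abbreviation "SocC \<equiv> Ck\<lparr>carrier := socle_C\<rparr>"

lemma module_SocC: "module k SocC"
proof -
 interpret C: module A C by (rule module_C)
 have "submodule socle_C A C"
  by (rule C.submoduleI)
   (auto simp: socle_C_def C.smult_r_distr C.smult_r_minus C.smult_r_null C.smult_lcomm[of _ _])
 from submodule.submodule_is_module[OF submodule_restrict_scalars[OF algebra_axioms module_C this] module_Ck]
 show ?thesis .
qed

end

context cyclic_twist
begin

lemma smult_LIk: "c \<in> car k ==> y \<in> car LI ==> c \<odot>\<^sub>LIk y = (c \<odot> \<one>) \<odot>\<^sub>LI y"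
 by (rule restrict_scalars_tensor_alg_smult[OF algebra_axioms module_L module_AI])

lemma LIk_simps: "car LIk = car LI" "add LIk = add LI" "zero LIk = zero LI"
 by simp_all

text \<open>These maps recover \<open>L\<close> from \<open>L \<otimes> I'\<close>; carried over to
  the socle of \<open>A/I\<close>, they become the maps \<open>\<xi>\<close> of the pairing.\<close>

lemma twist_coordinate:
 assumes j: "j < n"
 shows "\<exists>h\<in>mod_hom k LIk L. \<forall>x\<in>car L. \<forall>a\<in>Ann. h (tL x a) = \<phi> j a \<odot>\<^sub>L x"
proof -
 interpret L: module k L by (rule module_L)
 note fc = frame_closed[OF j Ann_carrier]
 have "\<exists>h\<in>mod_hom k LIk L. \<forall>x\<in>car L. \<forall>a\<in>car AIk. h (tL x a) = \<phi> j a \<odot>\<^sub>L x"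
  by (rule tensor_lift[OF module_L module_AIk module_L])
   (auto simp: fc L.smult_r_distr L.smult_l_distr L.smult_lcomm L.smult_assoc1 Lin_add[OF frame_Lin[OF j]]
    Lin_smult[OF frame_Lin[OF j]] smult_one_mult Ann_carrier)
 then show ?thesis by simp
qed

text \<open>Up to a local denominator \<open>c\<close>, the element \<open>y\<close> is the tensor
  of \<open>l\<close> with an element \<open>z\<close> of the socle of \<open>A\<close>. Both sides
  are then compared by \<open>\<phi> j z t = \<phi> j t z\<close>, the rank-one property of that
  socle.\<close>

lemma twist_rank_one:
 assumes j: "j < n" and h: "h \<in> mod_hom k LIk L" "\<And>x a. x \<in> car L ==> a \<in> Ann ==> h (tL x a) = \<phi> j a \<odot>\<^sub>L x"
  and y: "y \<in> car LI" "\<And>a. a \<in> car A ==> \<epsilon> a = \<zero>\<^sub>k ==> a \<odot>\<^sub>LI y = \<zero>\<^sub>LI"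
  and t: "t \<in> socle" "t \<in> Ann"
 shows "tL (h y) t = \<phi> j t \<odot>\<^sub>LIk y"
proof -
 interpret L: module k L by (rule module_L)
 interpret T: module k LIk by (rule module_LIk)
 interpret LI: module A LI by (rule module_LI)
 have hy: "h y \<in> car L" by (rule mod_hom_closed[OF h(1)]) (simp only: LIk_simps y(1))
 have yT: "y \<in> car LIk" by (simp only: LIk_simps y(1))
 have tLc: "tL x i \<in> car LIk" if "x \<in> car L" "i \<in> Ann" for x i using tL_closed[OF that] by (simp only: LIk_simps)
 have tc: "\<phi> j t \<in> car k" by (rule frame_closed[OF j socle_carrier[OF t(1)]])
 have fy: "\<phi> j t \<odot>\<^sub>LIk y \<in> car LIk" by (rule T.smult_closed[OF tc yT])
 have "tL (h y) t \<ominus>\<^sub>LIk \<phi> j t \<odot>\<^sub>LIk y = \<zero>\<^sub>LIk"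
 proof (rule T.zero_if_locally_zero)
  show "tL (h y) t \<ominus>\<^sub>LIk \<phi> j t \<odot>\<^sub>LIk y \<in> car LIk"
   by (rule T.M.minus_closed[OF tLc[OF hy t(2)] fy])
  fix p assume p: "primeideal p k"
  obtain c l \<kappa> where c: "c \<in> car k" "c \<notin> p" and l: "l \<in> car L"
   and \<kappa>: "\<kappa> \<in> lin k L" and \<kappa>l: "\<kappa> l = c"
   and cx: "\<forall>x\<in>car L. c \<odot>\<^sub>L x = \<kappa> x \<odot>\<^sub>L l"
   using invertible_local_generator[OF noeth invertible p] by (elim exE conjE)
  obtain \<Lambda> where \<Lambda>: "\<Lambda> \<in> mod_hom A LI AI" "\<forall>x\<in>car L. \<forall>i\<in>Ann. \<Lambda> (tL x i) = \<kappa> x \<odot> i"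
   using \<Lambda>_exists[OF \<kappa>] by (elim bexE)
  have \<kappa>c: "\<kappa> x \<in> car k" if "x \<in> car L" for x using mod_hom_closed[OF \<kappa> that] by simp
  have \<Lambda>A: "\<Lambda> u \<in> Ann" if "u \<in> car LIk" for u using mod_hom_closed[OF \<Lambda>(1), of u] that by simp
  have \<Lambda>k: "\<Lambda> \<in> mod_hom k LIk AIk"
  proof (rule mod_homI)
   fix c u assume "c \<in> car k" "u \<in> car LIk"
   then show "\<Lambda> (c \<odot>\<^sub>LIk u) = c \<odot>\<^bsub>AIk\<^esub> \<Lambda> u"
    using mod_hom_smult[OF \<Lambda>(1), of "c \<odot> \<one>" u] smult_LIk[of c u] by simp
  qed (use \<Lambda>A mod_hom_add[OF \<Lambda>(1)] in simp_all)
  have r: "(\<lambda>i. tL l i) \<in> mod_hom k AIk LIk"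
   by (rule mod_homI) (rule tens_closed[OF module_L module_AIk l] tens_add_right[OF module_L module_AIk l]
    tens_smult_right[OF module_L module_AIk _ l]; assumption)+
  \<comment> \<open>\<open>c\<close> times the identity of \<open>L \<otimes> I'\<close> factors
    through \<open>I'\<close>, since \<open>L\<close> is free on \<open>l\<close> up to
    \<open>c\<close>; it suffices to look at pure tensors.\<close>
  have cu: "c \<odot>\<^sub>LIk u = tL l (\<Lambda> u)" if u: "u \<in> car LIk" for u
  proof (rule tensor_hom_eqI[OF module_L module_AIk module_LIk _ mod_hom_comp[OF \<Lambda>k r] _ u])
   show "(\<lambda>u. c \<odot>\<^sub>LIk u) \<in> mod_hom k LIk LIk"
    by (rule mod_homI) (simp_all only: T.smult_closed[OF c(1)] T.smult_r_distr[OF c(1)] T.smult_lcomm c(1))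
   fix x i assume x: "x \<in> car L" and "i \<in> car AIk"
   then have i: "i \<in> Ann" by simp
   have "c \<odot>\<^sub>LIk tL x i = tL (\<kappa> x \<odot>\<^sub>L l) i" using tL_smult_k[OF c(1) x i] bspec[OF cx x] by (simp only:)
   also have "... = tL l (\<kappa> x \<odot> i)" by (rule tL_smult_left[OF \<kappa>c[OF x] l i])
   finally show "c \<odot>\<^sub>LIk tL x i = tL l (\<Lambda> (tL x i))" using \<Lambda>(2) x i by simp
  qed
  define z where "z = \<Lambda> y"
  have zA: "z \<in> Ann" unfolding z_def by (rule \<Lambda>A[OF yT])
  have z: "z \<in> socle"
  proof (rule socleI[OF Ann_carrier[OF zA]])
   fix a assume a: "a \<in> car A" "\<epsilon> a = \<zero>\<^sub>k"
   show "a \<otimes> z = \<zero>"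
    using mod_hom_smult[OF \<Lambda>(1) a(1) y(1)] y(2)[OF a] mod_hom_zero[OF module_LI module_AI \<Lambda>(1)]
    by (simp add: z_def del: tensor_alg_simps)
  qed
  have pz: "\<phi> j z \<in> car k" by (rule frame_closed[OF j socle_carrier[OF z]])
  have "c \<odot>\<^sub>L h y = \<phi> j z \<odot>\<^sub>L l"
   using mod_hom_smult[OF h(1) c(1) yT] cu[OF yT] h(2)[OF l zA] by (simp only: z_def)
  then have "c \<odot>\<^sub>LIk tL (h y) t = tL l (\<phi> j z \<odot> t)"
   using tL_smult_k[OF c(1) hy t(2)] tL_smult_left[OF pz l t(2)] by (simp only:)
  also have "... = tL l (\<phi> j t \<odot> z)" by (simp only: socle_rank_one[OF z t(1) frame_Lin[OF j]])
  also have "... = \<phi> j t \<odot>\<^sub>LIk (c \<odot>\<^sub>LIk y)"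
   using tL_smult_left[OF tc l zA] tL_smult_k[OF tc l zA] cu[OF yT] by (simp only: z_def)
  also have "... = c \<odot>\<^sub>LIk (\<phi> j t \<odot>\<^sub>LIk y)" by (rule T.smult_lcomm[OF tc c(1) yT])
  finally have "c \<odot>\<^sub>LIk (tL (h y) t \<ominus>\<^sub>LIk \<phi> j t \<odot>\<^sub>LIk y) = \<zero>\<^sub>LIk"
   using T.smult_closed[OF c(1) fy]
   by (simp add: a_minus_def T.smult_r_distr[OF c(1) tLc[OF hy t(2)] T.M.a_inv_closed[OF fy]]
     T.smult_r_minus[OF c(1) fy] T.M.r_neg)
  then show "\<exists>f\<in>car k - p. f \<odot>\<^sub>LIk (tL (h y) t \<ominus>\<^sub>LIk \<phi> j t \<odot>\<^sub>LIk y) = \<zero>\<^sub>LIk"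
   using c by blast
 qed
 then show ?thesis using T.M.right_minus_eq[OF tLc[OF hy t(2)] fy] by simp
qed

text \<open>As the socle lies in \<open>Ann\<close>, the tensor of \<open>x \<in> L\<close> with a
  socle element \<open>t\<close> belongs to \<open>L \<otimes> I'\<close> and is killed by the
  augmentation ideal. Under \<open>A/I \<cong> L \<otimes> I'\<close> this is a pairing of
  \<open>L\<close> and \<open>Soc(A)\<close> with values in \<open>Soc(A/I)\<close>, and
  \<open>twist_coordinate\<close> inverts it.\<close>

lemma twist_iso:
 assumes sub: "socle \<subseteq> Ann"
 shows "mod_isomorphic k L (tensor k SocC (dual k Soc))"
proof -
 interpret L: module k L by (rule module_L)
 interpret C: module A C by (rule module_C)
 interpret LI: module A LI by (rule module_LI)
 obtain G where G: "G \<in> mod_iso A C LI" using C_iso_LI by blast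
 define H where "H = the_inv_into (car C) G"
 have Gh: "G \<in> mod_hom A C LI" and inj: "inj_on G (car C)" and Gim: "G ` car C = car LI"
  using G by (auto simp: mod_iso_def bij_betw_def simp del: tensor_alg_simps)
 have Hh: "H \<in> mod_hom A LI C"
  using mod_iso_inverse[OF module_C module_LI G] by (simp add: H_def mod_iso_def del: tensor_alg_simps)
 have HG: "H (G X) = X" if "X \<in> car C" for X unfolding H_def by (rule the_inv_into_f_f[OF inj that])
 have GH: "G (H y) = y" if "y \<in> car LI" for y
  unfolding H_def by (rule f_the_inv_into_f[OF inj]) (simp only: Gim that)
 have Gk: "G \<in> mod_hom k Ck LIk"
 proof (rule mod_homI)
  fix c X assume c: "c \<in> car k" and "X \<in> car Ck"
  then have X: "X \<in> car C" by simp
  have "G ((c \<odot> \<one>) \<odot>\<^sub>C X) = (c \<odot> \<one>) \<odot>\<^sub>LI G X" using mod_hom_smult[OF Gh _ X] c by (simp del: tensor_alg_simps)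
  then show "G (c \<odot>\<^sub>Ck X) = c \<odot>\<^sub>LIk G X" by (simp only: restrict_scalars_simps smult_LIk[OF c mod_hom_closed[OF Gh X]])
 qed (use mod_hom_closed[OF Gh] mod_hom_add[OF Gh] in simp_all)
 have Hk: "H \<in> mod_hom k LIk Ck"
 proof (rule mod_homI)
  fix c y assume c: "c \<in> car k" and "y \<in> car LIk"
  then have y: "y \<in> car LI" by simp
  have "H ((c \<odot> \<one>) \<odot>\<^sub>LI y) = (c \<odot> \<one>) \<odot>\<^sub>C H y" using mod_hom_smult[OF Hh _ y] c by (simp del: tensor_alg_simps)
  then show "H (c \<odot>\<^sub>LIk y) = c \<odot>\<^sub>Ck H y" by (simp only: restrict_scalars_simps smult_LIk[OF c y])
 qed (use mod_hom_closed[OF Hh] mod_hom_add[OF Hh] in simp_all)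
 have "\<forall>j\<in>{..<n}. \<exists>h. h \<in> mod_hom k LIk L \<and> (\<forall>x\<in>car L. \<forall>a\<in>Ann. h (tL x a) = \<phi> j a \<odot>\<^sub>L x)"
  using twist_coordinate by blast
 from bchoice[OF this] obtain E1 where E1:
  "\<forall>j\<in>{..<n}. E1 j \<in> mod_hom k LIk L \<and> (\<forall>x\<in>car L. \<forall>a\<in>Ann. E1 j (tL x a) = \<phi> j a \<odot>\<^sub>L x)"
  by (elim exE)
 have E1h: "E1 j \<in> mod_hom k LIk L" and E1v: "x \<in> car L ==> a \<in> Ann ==> E1 j (tL x a) = \<phi> j a \<odot>\<^sub>L x"
  if "j < n" for j x a using E1 that by simp_all
 have SC: "X \<in> car C" if "X \<in> socle_C" for X using that by (simp add: socle_C_def)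
 have \<eta>: "H (tL x t) \<in> socle_C" if x: "x \<in> car L" and t: "t \<in> socle" for x t
 proof -
  have tA: "t \<in> Ann" using sub t by blast
  have "a \<odot>\<^sub>C H (tL x t) = \<zero>\<^sub>C" if a: "a \<in> car A" "\<epsilon> a = \<zero>\<^sub>k" for a
  proof -
   have "a \<otimes> t = \<zero>" using t a by (simp add: socle_def)
   then have "a \<odot>\<^sub>LI tL x t = \<zero>\<^sub>LI" using tL_smult[OF a(1) x tA] tL_zero[OF x] by (simp only:)
   then show ?thesis
    using mod_hom_smult[OF Hh a(1) tL_closed[OF x tA]] mod_hom_zero[OF module_LI module_C Hh] by (simp only:)
  qed
  then show ?thesis using mod_hom_closed[OF Hh tL_closed[OF x tA]] by (simp add: socle_C_def)
 qed
 show ?thesis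
 proof (rule tensor_dual_iso_if_pairing[OF module_L module_Soc module_SocC,
    where \<eta> = "\<lambda>x t. H (tL x t)" and \<xi> = "\<lambda>j X. E1 j (G X)" and s = s and \<phi> = \<phi> and n = n])
  show "\<phi> i \<in> lin k Soc" if "i < n" for i
   using frame_Lin[OF that] socle_carrier by (auto simp: mod_hom_def smult_one_mult)
  show "(\<Oplus>\<^bsub>Soc\<^esub>i\<in>{..<n}. \<phi> i t \<odot>\<^bsub>Soc\<^esub> s i) = t" if "t \<in> car Soc" for t
  proof -
   have t: "t \<in> socle" using that by simp
   have "(\<Oplus>\<^bsub>Soc\<^esub>i\<in>{..<n}. \<phi> i t \<odot>\<^bsub>Soc\<^esub> s i) = (\<Oplus>i\<in>{..<n}. \<phi> i t \<odot>\<^bsub>Soc\<^esub> s i)"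
    by (rule finsum_Soc) (auto simp: smult_one_mult socle_smult frame_socle frame_carrier frame_closed t socle_carrier)
   also have "... = (\<Oplus>i\<in>{..<n}. \<phi> i t \<odot> s i)"
    by (rule M.finsum_cong') (auto simp: smult_one_mult frame_carrier frame_closed t socle_carrier)
   finally show ?thesis using socle_expand[OF t] by simp
  qed
  show "(\<lambda>x. H (tL x t)) \<in> mod_hom k L SocC" if "t \<in> car Soc" for t
  proof (rule mod_homI)
   have t: "t \<in> socle" "t \<in> Ann" using that sub by auto
   fix x assume x: "x \<in> car L"
   show "H (tL x t) \<in> car SocC" using \<eta>[OF x t(1)] by simp
   show "H (tL (x \<oplus>\<^sub>L y) t) = H (tL x t) \<oplus>\<^bsub>SocC\<^esub> H (tL y t)" if "y \<in> car L" for y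
    using ten_add_left[OF algebra_axioms module_L module_AI x that, of t]
     mod_hom_add[OF Hh tL_closed[OF x t(2)] tL_closed[OF that t(2)]] t(2) by simp
   show "H (tL (c \<odot>\<^sub>L x) t) = c \<odot>\<^bsub>SocC\<^esub> H (tL x t)" if "c \<in> car k" for c
    using tL_smult_k[OF that x t(2)] mod_hom_smult[OF Hk that, of "tL x t"] tL_closed[OF x t(2)] by simp
  qed
  have Gs: "G \<in> mod_hom k SocC LIk" using Gk SC by (auto simp: mod_hom_def Pi_def)
  show "(\<lambda>X. E1 i (G X)) \<in> mod_hom k SocC L" if "i < n" for i
   by (rule mod_hom_comp[OF Gs E1h[OF that]])
  show "E1 i (G (H (tL x t))) = \<phi> i t \<odot>\<^sub>L x" if "i < n" "x \<in> car L" "t \<in> car Soc" for i x t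
  proof -
   have t: "t \<in> Ann" using that sub by auto
   show ?thesis unfolding GH[OF tL_closed[OF that(2) t]] by (rule E1v[OF that(1,2) t])
  qed
  show "H (tL (E1 i (G X)) t) = \<phi> i t \<odot>\<^bsub>SocC\<^esub> X" if i: "i < n" and "X \<in> car SocC" "t \<in> car Soc" for i X t
  proof -
   have X: "X \<in> socle_C" and t: "t \<in> socle" "t \<in> Ann" using that sub by auto
   have GX: "G X \<in> car LI" by (rule mod_hom_closed[OF Gh SC[OF X]])
   have "a \<odot>\<^sub>LI G X = \<zero>\<^sub>LI" if "a \<in> car A" "\<epsilon> a = \<zero>\<^sub>k" for a
    using mod_hom_smult[OF Gh that(1) SC[OF X]] X that mod_hom_zero[OF module_C module_LI Gh]
    by (simp add: socle_C_def del: tensor_alg_simps)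
   from twist_rank_one[OF i E1h[OF i] E1v[OF i] GX this t]
   have "tL (E1 i (G X)) t = \<phi> i t \<odot>\<^sub>LIk G X" .
   then show ?thesis
    using mod_hom_smult[OF Hk frame_closed[OF i socle_carrier[OF t(1)]], of "G X"] GX HG[OF SC[OF X]] by simp
  qed
 qed (use frame_socle frame_one frame_comm socle_carrier in auto)
qed

end

section \<open>Existence of the twist over a Gorenstein quotient\<close>

lemma (in abelian_group) finsum_grid:
 fixes n m :: nat
 assumes "\<And>i j. i < n ==> j < m ==> f i j \<in> car G"
 shows "(\<Oplus>p\<in>{..<n * m}. f (p div m) (p mod m)) = (\<Oplus>i\<in>{..<n}. \<Oplus>j\<in>{..<m}. f i j)"
 using assms
proof (induction n)
 case (Suc n)
 have f: "f (p div m) (p mod m) \<in> car G" if "p < n * m + m" for p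
 proof -
  have "m > 0" using that by (cases m) auto
  then show ?thesis using that by (intro Suc.prems) (simp_all add: less_mult_imp_div_less add.commute)
 qed
 have "(\<Oplus>p\<in>{..<n * m + m}. f (p div m) (p mod m)) =
   (\<Oplus>p\<in>{..<n * m}. f (p div m) (p mod m)) \<oplus> (\<Oplus>j\<in>{..<m}. f ((n * m + j) div m) ((n * m + j) mod m))"
  by (rule finsum_add_index) (rule f)
 also have "(\<Oplus>j\<in>{..<m}. f ((n * m + j) div m) ((n * m + j) mod m)) = (\<Oplus>j\<in>{..<m}. f n j)"
  by (rule finsum_cong') (auto simp: Suc.prems)
 also have "(\<Oplus>p\<in>{..<n * m}. f (p div m) (p mod m)) = (\<Oplus>i\<in>{..<n}. \<Oplus>j\<in>{..<m}. f i j)"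
  by (rule Suc.IH) (simp add: Suc.prems)
 finally show ?case
  using Suc.prems by (simp add: lessThan_Suc a_comm finsum_closed Pi_def add.commute)
qed simp

text \<open>In the theorem \<open>L\<close> ranges over modules on one fixed type; a module
  constructed on another type has to be transported there.\<close>

lemma module_copy:
 fixes R :: "('r, 'z) ring_scheme" and M :: "('r, 'm) module" and e :: "'m => 'b"
 assumes M: "module R M" and inj: "inj_on e (car M)"
 shows "\<exists>N :: ('r, 'b) module. \<exists>h. module R N \<and> e \<in> mod_iso R M N \<and> h \<in> mod_hom R N M \<and>
  (\<forall>x\<in>car M. h (e x) = x) \<and> (\<forall>y\<in>car N. e (h y) = y)"
proof -
 interpret M: module R M by (rule M)
 define h where "h = the_inv_into (car M) e"
 have he: "h (e x) = x" if "x \<in> car M" for x unfolding h_def by (rule the_inv_into_f_f[OF inj that])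
 define N :: "('r, 'b) module" where "N = \<lparr>carrier = e ` car M, mult = undefined, one = undefined,
  zero = e \<zero>\<^sub>M, add = (\<lambda>x y. e (h x \<oplus>\<^sub>M h y)), smult = (\<lambda>r x. e (r \<odot>\<^sub>M h x))\<rparr>"
 have N: "car N = e ` car M" "\<zero>\<^sub>N = e \<zero>\<^sub>M" "x \<oplus>\<^sub>N y = e (h x \<oplus>\<^sub>M h y)"
  "r \<odot>\<^sub>N x = e (r \<odot>\<^sub>M h x)" for x y r
  by (simp_all add: N_def)
 have "module R N" by (rule module_surj_image[OF M N(1)]) (simp_all add: N he)
 moreover have "e \<in> mod_iso R M N" unfolding mod_iso_def
  using inj by (auto simp: bij_betw_def N(1) he N(3,4) intro!: mod_homI)
 moreover have "h \<in> mod_hom R N M" by (rule mod_homI) (auto simp: N he)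
 ultimately show ?thesis using he by (intro exI[of _ N] exI[of _ h]) (auto simp: N(1))
qed

lemma local_basis_transfer:
 assumes M: "module R M" and N: "module R N" and e: "e \<in> mod_hom R M N" and h: "h \<in> mod_hom R N M"
  and he: "\<forall>x\<in>car M. h (e x) = x" and eh: "\<forall>y\<in>car N. e (h y) = y" and b: "local_basis R M f r m \<mu>"
 shows "local_basis R N f r (\<lambda>i. e (m i)) (\<lambda>i y. \<mu> i (h y))"
proof -
 interpret M: module R M by (rule M)
 interpret N: module R N by (rule N)
 note D = local_basisD[OF b]
 have "f \<odot>\<^sub>N y = (\<Oplus>\<^sub>N i\<in>{..<r}. \<mu> i (h y) \<odot>\<^sub>N e (m i))" if y: "y \<in> car N" for y
 proof -
  have hy: "h y \<in> car M" by (rule mod_hom_closed[OF h y])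
  have "f \<odot>\<^sub>N y = e (f \<odot>\<^sub>M h y)" using mod_hom_smult[OF e D(1) hy] eh y by simp
  also have "... = (\<Oplus>\<^sub>N i\<in>{..<r}. e (\<mu> i (h y) \<odot>\<^sub>M m i))"
   unfolding D(4)[OF hy] by (rule mod_hom_finsum[OF M N e]) (use D hy in auto)
  also have "... = (\<Oplus>\<^sub>N i\<in>{..<r}. \<mu> i (h y) \<odot>\<^sub>N e (m i))"
   using D(2) D(6)[OF _ hy] by (intro N.M.finsum_cong') (auto simp: mod_hom_smult[OF e] mod_hom_closed[OF e])
  finally show ?thesis .
 qed
 then show ?thesis
  unfolding local_basis_def using D he by (auto intro: mod_hom_closed[OF e] mod_hom_comp[OF h])
qed

text \<open>A dual basis embeds the module into \<open>k\<^sup>N\<close> by its coordinates, and so copies it to any type that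
 contains \<open>k\<^sup>N\<close>.\<close>

lemma small_copy:
 fixes k :: "('k, 'z) ring_scheme" and M :: "('k, 'm) module"
 assumes M: "module k M" and db: "dual_basis k M N xs \<mu>"
  and loc: "\<forall>p. primeideal p k --> (\<exists>f m \<nu>. f \<notin> p \<and> local_basis k M f 1 m \<nu>)"
 shows "\<exists>L :: ('k, (nat => 'k) set) module. \<exists>xs' h. invertible_module k L \<and> h \<in> mod_hom k L M \<and>
  dual_basis k L N xs' (\<lambda>p y. \<mu> p (h y))"
proof -
 interpret M: module k M by (rule M)
 have xs: "xs p \<in> car M" and \<mu>: "\<mu> p \<in> lin k M" if "p < N" for p
  using db that by (auto simp: dual_basis_def)
 have exp: "x = (\<Oplus>\<^sub>M i\<in>{..<N}. \<mu> i x \<odot>\<^sub>M xs i)" if "x \<in> car M" for x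
  using db that unfolding dual_basis_def by (elim conjE) (erule bspec)
 \<comment> \<open>The coordinate vector, padded with zeros, is wrapped in a singleton to match the
   type \<open>(nat => 'k) set\<close> prescribed for \<open>L\<close>.\<close>
 define e :: "'m => (nat => 'k) set" where "e x = {\<lambda>p. if p < N then \<mu> p x else \<zero>\<^sub>k}" for x
 have \<mu>c: "\<mu> p x \<in> car k" if "p < N" "x \<in> car M" for p x using mod_hom_closed[OF \<mu>[OF that(1)] that(2)] by simp
 have "inj_on e (car M)"
 proof (rule inj_onI)
  fix x y assume x: "x \<in> car M" and y: "y \<in> car M" and "e x = e y"
  then have eq: "(\<lambda>p. if p < N then \<mu> p x else \<zero>\<^sub>k) = (\<lambda>p. if p < N then \<mu> p y else \<zero>\<^sub>k)" by (simp add: e_def)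
  have "\<mu> p x = \<mu> p y" if "p < N" for p using fun_cong[OF eq, of p] that by simp
  then have "(\<Oplus>\<^sub>M i\<in>{..<N}. \<mu> i x \<odot>\<^sub>M xs i) = (\<Oplus>\<^sub>M i\<in>{..<N}. \<mu> i y \<odot>\<^sub>M xs i)"
   by (intro M.M.finsum_cong') (auto simp: \<mu>c y xs)
  then show "x = y" using exp[OF x] exp[OF y] by (simp only:)
 qed
 from module_copy[OF M this] obtain L :: "('k, (nat => 'k) set) module" and h where
  L: "module k L" and e: "e \<in> mod_iso k M L" and h: "h \<in> mod_hom k L M"
  and he: "\<forall>x\<in>car M. h (e x) = x" and eh: "\<forall>y\<in>car L. e (h y) = y" by (elim exE conjE)
 interpret L: module k L by (rule L)
 have eh': "e \<in> mod_hom k M L" using e by (simp add: mod_iso_def)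
 have "\<exists>f m \<nu>. f \<notin> p \<and> local_basis k L f 1 m \<nu>" if "primeideal p k" for p
  using loc that local_basis_transfer[OF M L eh' h he eh] by blast
 then have inv: "invertible_module k L" unfolding invertible_module_def by (rule locally_free_if_local_basis[OF L])
 have "y = (\<Oplus>\<^sub>L i\<in>{..<N}. \<mu> i (h y) \<odot>\<^sub>L e (xs i))" if y: "y \<in> car L" for y
 proof -
  have hy: "h y \<in> car M" by (rule mod_hom_closed[OF h y])
  have "y = e (\<Oplus>\<^sub>M i\<in>{..<N}. \<mu> i (h y) \<odot>\<^sub>M xs i)" using exp[OF hy] eh y by simp
  also have "... = (\<Oplus>\<^sub>L i\<in>{..<N}. e (\<mu> i (h y) \<odot>\<^sub>M xs i))"
   by (rule mod_hom_finsum[OF M L eh']) (auto simp: \<mu>c hy xs)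
  also have "... = (\<Oplus>\<^sub>L i\<in>{..<N}. \<mu> i (h y) \<odot>\<^sub>L e (xs i))"
   by (intro L.M.finsum_cong') (auto simp: \<mu>c hy xs mod_hom_smult[OF eh'] mod_hom_closed[OF eh'])
  finally show ?thesis .
 qed
 then have "dual_basis k L N (\<lambda>p. e (xs p)) (\<lambda>p y. \<mu> p (h y))"
  unfolding dual_basis_def using mod_hom_closed[OF eh' xs] mod_hom_comp[OF h \<mu>] by simp
 then show ?thesis using inv h by blast
qed

context twist
begin

text \<open>The generator is the sum of the tensors of \<open>xs p\<close> and
  \<open>\<theta>s p\<close>. The element \<open>a\<close> provided by \<open>act\<close> turns it
  into the sum of the tensors of \<open>\<mu> p x xs p\<close> and \<open>i\<close>, which is the
  tensor of \<open>x\<close> and \<open>i\<close>.\<close>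

lemma cyclic_if_dual_basis:
 assumes db: "dual_basis k L N xs \<mu>" and \<theta>s: "\<And>p. p < N ==> \<theta>s p \<in> Ann"
  and act: "\<And>x i. x \<in> car L ==> i \<in> Ann ==> \<exists>a\<in>car A. \<forall>p<N. a \<otimes> \<theta>s p = \<mu> p x \<odot> i"
 shows "cyclic_module A LI"
proof -
 interpret L: module k L by (rule module_L)
 interpret LI: module A LI by (rule module_LI)
 have xs: "xs p \<in> car L" and \<mu>: "\<mu> p \<in> lin k L" if "p < N" for p
  using db that by (auto simp: dual_basis_def)
 have exp: "x = (\<Oplus>\<^sub>L p\<in>{..<N}. \<mu> p x \<odot>\<^sub>L xs p)" if "x \<in> car L" for x
  using db that unfolding dual_basis_def by (elim conjE) (erule bspec)
 have \<mu>c: "\<mu> p x \<in> car k" if "p < N" "x \<in> car L" for p x using mod_hom_closed[OF \<mu>[OF that(1)] that(2)] by simp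
 define g where "g = (\<Oplus>\<^sub>LI p\<in>{..<N}. tL (xs p) (\<theta>s p))"
 have tc: "(\<lambda>p. tL (xs p) (\<theta>s p)) \<in> {..<N} \<rightarrow> car LI" using tL_closed[OF xs \<theta>s] by blast
 have g: "g \<in> car LI" unfolding g_def by (rule LI.M.finsum_closed[OF tc])
 have ten: "\<exists>a\<in>car A. a \<odot>\<^sub>LI g = tL x i" if x: "x \<in> car L" and i: "i \<in> Ann" for x i
 proof -
  obtain a where a: "a \<in> car A" "\<And>p. p < N ==> a \<otimes> \<theta>s p = \<mu> p x \<odot> i" using act[OF x i] by blast
  have r: "(\<lambda>x. tL x i) \<in> mod_hom k L LIk"
   by (rule mod_homI) (use i in \<open>auto simp: tens_closed[OF module_L module_AIk] tens_add_left[OF module_L module_AIk]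
    tens_smult_left[OF module_L module_AIk]\<close>)
  have "a \<odot>\<^sub>LI g = (\<Oplus>\<^sub>LI p\<in>{..<N}. a \<odot>\<^sub>LI tL (xs p) (\<theta>s p))"
   unfolding g_def by (rule LI.finsum_smult_ldistr) (use a tc in auto)
  also have "... = (\<Oplus>\<^sub>LI p\<in>{..<N}. tL (\<mu> p x \<odot>\<^sub>L xs p) i)"
  proof (rule LI.M.finsum_cong'[OF refl])
   fix p assume "p \<in> {..<N}"
   then have p: "p < N" by simp
   show "a \<odot>\<^sub>LI tL (xs p) (\<theta>s p) = tL (\<mu> p x \<odot>\<^sub>L xs p) i"
    using tL_smult[OF a(1) xs[OF p] \<theta>s[OF p]] a(2)[OF p] tL_smult_left[OF \<mu>c[OF p x] xs[OF p] i] by (simp only:)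
  qed (use tL_closed[OF L.smult_closed[OF \<mu>c[OF _ x] xs] i] in blast)
  also have "... = (\<Oplus>\<^sub>LIk p\<in>{..<N}. tL (\<mu> p x \<odot>\<^sub>L xs p) i)"
   by (rule fun_cong[OF fun_cong[OF finsum_cong_structure]]) simp_all
  also have "... = tL (\<Oplus>\<^sub>L p\<in>{..<N}. \<mu> p x \<odot>\<^sub>L xs p) i"
   by (rule mod_hom_finsum[OF module_L module_LIk r, symmetric]) (use \<mu>c[OF _ x] xs in auto)
  also have "... = tL x i" by (simp only: exp[OF x, symmetric])
  finally show ?thesis using a(1) by blast
 qed
 have "\<exists>a\<in>car A. a \<odot>\<^sub>LI g = y" if "y \<in> car LI" for y
  using algebra_axioms module_L module_AI that
 proof (rule tensor_alg_induct)
  show "\<exists>a\<in>car A. a \<odot>\<^sub>LI g = \<zero>\<^sub>LI" using LI.smult_l_null[OF g] by blast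
  show "\<exists>a\<in>car A. a \<odot>\<^sub>LI g = tL x i" if "x \<in> car L" "i \<in> car AI" for x i
   using ten[OF that(1), of i] that(2) by simp
  fix y z assume "\<exists>a\<in>car A. a \<odot>\<^sub>LI g = y" "\<exists>a\<in>car A. a \<odot>\<^sub>LI g = z"
  then obtain a b where "a \<in> car A" "a \<odot>\<^sub>LI g = y" "b \<in> car A" "b \<odot>\<^sub>LI g = z" by (elim bexE)
  then show "\<exists>a\<in>car A. a \<odot>\<^sub>LI g = y \<oplus>\<^sub>LI z"
   using LI.smult_l_distr[of a b, OF _ _ g] by (intro bexI[of _ "a \<oplus> b"]) (simp_all del: tensor_alg_simps)
 qed
 then have "car LI = {a \<odot>\<^sub>LI g |a. a \<in> car A}"
  using LI.smult_closed[OF _ g] by (intro equalityI subsetI) (blast, blast)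
 then show ?thesis unfolding cyclic_module_def using module_LI g by blast
qed

end

text \<open>Over a Gorenstein quotient \<open>B = A/I\<close>, the invertible module is \<open>L = Hom(Soc A, Soc B)\<close>: the frames of
 \<open>A\<close> and \<open>B\<close> give it a dual basis, and \<open>\<Sum> x\<^sub>p \<otimes> \<theta>\<^sub>p\<close> generates \<open>L \<otimes> I'\<close>.\<close>

locale gorenstein_quotient = linkage k A \<epsilon> n s \<phi> I \<pi> + Q: framed_algebra k "quot_module A I" \<delta> q r \<chi>
 for k :: "('k, 'z) ring_scheme" and A :: "('k, 'a) module" (structure) and \<epsilon> and n and s and \<phi> and I and \<pi>
  and \<delta> :: "'a set => 'k" and q and r and \<chi>
begin

abbreviation "SB \<equiv> B\<lparr>carrier := Q.socle\<rparr>"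
abbreviation "H \<equiv> hom_module k Soc SB"

lemma module_SB: "module k SB"
 by (rule submodule.submodule_is_module[OF Q.socle_submodule Q.module_axioms])

lemma module_H: "module k H" by (rule module_hom_module[OF module_Soc module_SB])

lemma H_value: "x \<in> car H ==> t \<in> socle ==> x t \<in> Q.socle"
 using mod_hom_closed[of x k Soc SB t] by simp

lemma H_smult: "x \<in> car H ==> c \<in> car k ==> t \<in> socle ==> x (c \<odot> t) = c \<odot>\<^sub>B x t"
 using mod_hom_smult[of x k Soc SB c t] by (simp add: smult_one_mult socle_carrier)

lemma H_expand:
 assumes x: "x \<in> car H" and t: "t \<in> socle"
 shows "(\<Oplus>\<^sub>B i\<in>{..<n}. \<phi> i t \<odot>\<^sub>B x (s i)) = x t"
proof -
 have c: "\<phi> i t \<in> car k" if "i < n" for i by (rule frame_closed[OF that socle_carrier[OF t]])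
 have sc: "\<phi> i t \<odot> s i \<in> socle" if "i < n" for i by (rule socle_smult[OF c[OF that] frame_socle[OF that]])
 have "x t = x (\<Oplus>\<^bsub>Soc\<^esub>i\<in>{..<n}. \<phi> i t \<odot> s i)"
  by (subst finsum_Soc) (use sc socle_expand[OF t] in auto)
 also have "... = (\<Oplus>\<^bsub>SB\<^esub>i\<in>{..<n}. x (\<phi> i t \<odot> s i))"
  by (rule mod_hom_finsum[OF module_Soc module_SB]) (use x sc in auto)
 also have "... = (\<Oplus>\<^sub>B i\<in>{..<n}. x (\<phi> i t \<odot> s i))"
  by (rule finsum_submodule[OF Q.module_axioms Q.socle_submodule]) (use H_value[OF x sc] in auto)
 also have "... = (\<Oplus>\<^sub>B i\<in>{..<n}. \<phi> i t \<odot>\<^sub>B x (s i))"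
  by (rule Q.M.finsum_cong'[OF refl])
   (use H_smult[OF x c frame_socle] Q.socle_carrier[OF Q.socle_smult[OF c H_value[OF x frame_socle]]] in auto)
 finally show ?thesis by simp
qed

definition "xs i j = (\<lambda>t\<in>socle. \<phi> i t \<odot>\<^sub>B r j)"

lemma xs_H:
 assumes "i < n" "j < q"
 shows "xs i j \<in> car H"
proof -
 note f = frame_closed[OF assms(1) socle_carrier] and rj = Q.frame_socle[OF assms(2)] Q.frame_carrier[OF assms(2)]
 have "xs i j \<in> mod_hom k Soc SB"
  by (rule mod_homI) (auto simp: xs_def f rj socle_add socle_smult smult_one_mult socle_carrier Q.socle_smult
   Lin_add[OF frame_Lin[OF assms(1)]] Lin_smult[OF frame_Lin[OF assms(1)]] Q.smult_l_distr Q.smult_assoc1)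
 then show ?thesis by (simp add: xs_def)
qed

lemma H_coordinate:
 assumes "i < n" "j < q"
 shows "(\<lambda>x. \<chi> j (x (s i))) \<in> lin k H"
proof (rule mod_homI)
 note si = frame_socle[OF assms(1)]
 note v = Q.socle_carrier[OF H_value[OF _ si]]
 fix x assume x: "x \<in> car H"
 show "\<chi> j (x (s i)) \<in> car (regular_module k)" using Q.frame_closed[OF assms(2) v[OF x]] by simp
 show "\<chi> j ((x \<oplus>\<^sub>H y) (s i)) = \<chi> j (x (s i)) \<oplus>\<^bsub>regular_module k\<^esub> \<chi> j (y (s i))" if "y \<in> car H" for y
  using si Q.Lin_add[OF Q.frame_Lin[OF assms(2)] v[OF x] v[OF that]] by simp
 show "\<chi> j ((c \<odot>\<^sub>H x) (s i)) = c \<odot>\<^bsub>regular_module k\<^esub> \<chi> j (x (s i))" if "c \<in> car k" for c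
  using si Q.Lin_smult[OF Q.frame_Lin[OF assms(2)] that v[OF x]] by simp
qed

lemma H_eqI: "x \<in> car H ==> y \<in> car H ==> (\<And>t. t \<in> socle ==> x t = y t) ==> x = y"
 by (rule extensionalityI[of _ socle]) auto

text \<open>\<open>dual_basis\<close> is indexed by an initial segment of the naturals; a pair of
  frame indices \<open>i\<close>, \<open>j\<close> is coded as \<open>i * q + j\<close>.\<close>

lemma grid_index: "p < n * q ==> p div q < n \<and> p mod q < q"
 by (cases q) (auto simp: less_mult_imp_div_less)

text \<open>Expanding the argument in the frame of \<open>A\<close> and the value in the frame of
  \<open>A/I\<close> writes \<open>x t\<close> as the sum of the
  \<open>\<phi> i t \<chi> j (x (s i)) r j\<close>.\<close>

lemma H_dual_basis:
 "dual_basis k H (n * q) (\<lambda>p. xs (p div q) (p mod q)) (\<lambda>p x. \<chi> (p mod q) (x (s (p div q))))"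
 unfolding dual_basis_def
proof (intro conjI allI impI ballI)
 interpret H: module k H by (rule module_H)
 fix x assume x: "x \<in> car H"
 define c where "c i j = \<chi> j (x (s i))" for i j
 have c: "c i j \<in> car k" if "i < n" "j < q" for i j
  unfolding c_def by (rule Q.frame_closed[OF that(2) Q.socle_carrier[OF H_value[OF x frame_socle[OF that(1)]]]])
 have t1: "(\<lambda>p. c (p div q) (p mod q) \<odot>\<^sub>H xs (p div q) (p mod q)) \<in> {..<n * q} \<rightarrow> car H"
  using grid_index by (auto intro!: H.smult_closed c xs_H simp del: hom_module_simps)
 have "x = (\<Oplus>\<^sub>H p\<in>{..<n * q}. c (p div q) (p mod q) \<odot>\<^sub>H xs (p div q) (p mod q))"
 proof (rule H_eqI[OF x H.M.finsum_closed[OF t1]])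
  fix t assume t: "t \<in> socle"
  have f: "\<phi> i t \<in> car k" if "i < n" for i by (rule frame_closed[OF that socle_carrier[OF t]])
  have v: "c i j \<odot>\<^sub>B (\<phi> i t \<odot>\<^sub>B r j) \<in> Q.socle" if "i < n" "j < q" for i j
   using that by (intro Q.socle_smult c f Q.frame_socle)
  have "(\<Oplus>\<^sub>H p\<in>{..<n * q}. c (p div q) (p mod q) \<odot>\<^sub>H xs (p div q) (p mod q)) t =
    (\<Oplus>\<^bsub>SB\<^esub>p\<in>{..<n * q}. (c (p div q) (p mod q) \<odot>\<^sub>H xs (p div q) (p mod q)) t)"
   by (rule hom_finsum_apply[OF module_Soc module_SB _ _ t1]) (use t in auto)
  also have "... = (\<Oplus>\<^bsub>SB\<^esub>p\<in>{..<n * q}. c (p div q) (p mod q) \<odot>\<^sub>B (\<phi> (p div q) t \<odot>\<^sub>B r (p mod q)))"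
   by (rule abelian_monoid.finsum_cong'[OF _ refl]) (use t v grid_index module_SB in \<open>auto simp: xs_def module_def abelian_group_def\<close>)
  also have "... = (\<Oplus>\<^sub>B p\<in>{..<n * q}. c (p div q) (p mod q) \<odot>\<^sub>B (\<phi> (p div q) t \<odot>\<^sub>B r (p mod q)))"
   by (rule finsum_submodule[OF Q.module_axioms Q.socle_submodule]) (use v grid_index in auto)
  also have "... = (\<Oplus>\<^sub>B i\<in>{..<n}. \<Oplus>\<^sub>B j\<in>{..<q}. c i j \<odot>\<^sub>B (\<phi> i t \<odot>\<^sub>B r j))"
   by (rule Q.M.finsum_grid) (rule Q.socle_carrier[OF v])
  also have "... = (\<Oplus>\<^sub>B i\<in>{..<n}. \<phi> i t \<odot>\<^sub>B x (s i))"
  proof (rule Q.M.finsum_cong'[OF refl])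
   fix i assume "i \<in> {..<n}"
   then have i: "i < n" by simp
   have "(\<Oplus>\<^sub>B j\<in>{..<q}. c i j \<odot>\<^sub>B (\<phi> i t \<odot>\<^sub>B r j)) = (\<Oplus>\<^sub>B j\<in>{..<q}. \<phi> i t \<odot>\<^sub>B (c i j \<odot>\<^sub>B r j))"
    using i by (intro Q.M.finsum_cong') (auto simp: c f Q.frame_carrier Q.smult_lcomm[of "c _ _"])
   also have "... = \<phi> i t \<odot>\<^sub>B (\<Oplus>\<^sub>B j\<in>{..<q}. c i j \<odot>\<^sub>B r j)"
    by (rule Q.finsum_smult_ldistr[symmetric]) (use i c f Q.frame_carrier in auto)
   also have "... = \<phi> i t \<odot>\<^sub>B x (s i)"
    unfolding c_def Q.socle_expand[OF H_value[OF x frame_socle[OF i]]] ..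
   finally show "(\<Oplus>\<^sub>B j\<in>{..<q}. c i j \<odot>\<^sub>B (\<phi> i t \<odot>\<^sub>B r j)) = \<phi> i t \<odot>\<^sub>B x (s i)" .
  qed (use f Q.socle_carrier[OF H_value[OF x frame_socle]] in auto)
  also have "... = x t" by (rule H_expand[OF x t])
  finally show "x t = (\<Oplus>\<^sub>H p\<in>{..<n * q}. c (p div q) (p mod q) \<odot>\<^sub>H xs (p div q) (p mod q)) t" ..
 qed
 then show "x = (\<Oplus>\<^sub>H p\<in>{..<n * q}. \<chi> (p mod q) (x (s (p div q))) \<odot>\<^sub>H xs (p div q) (p mod q))"
  unfolding c_def .
qed (use grid_index xs_H H_coordinate in auto)

text \<open>Where \<open>\<phi> i (s i)\<close> and \<open>\<chi> j (r j)\<close> are invertible,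
  both socles are free of rank one, and \<open>xs i j\<close> generates the homomorphisms between
  them.\<close>

lemma H_local_basis:
 assumes p: "primeideal p k"
 shows "\<exists>f m \<nu>. f \<notin> p \<and> local_basis k H f 1 m \<nu>"
proof -
 interpret p: primeideal p k by (rule p)
 interpret H: module k H by (rule module_H)
 obtain i where i: "i < n" "\<phi> i (s i) \<notin> p" using frame_unit_notin[OF p] by blast
 obtain j where j: "j < q" "\<chi> j (r j) \<notin> p" using Q.frame_unit_notin[OF p] by blast
 let ?c = "\<phi> i (s i)" and ?d = "\<chi> j (r j)"
 have c: "?c \<in> car k" by (rule frame_closed[OF i(1) frame_carrier[OF i(1)]])
 have d: "?d \<in> car k" by (rule Q.frame_closed[OF j(1) Q.frame_carrier[OF j(1)]])
 note si = frame_socle[OF i(1)] and rj = Q.frame_socle[OF j(1)] Q.frame_carrier[OF j(1)]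
 have cd: "(?c \<otimes>\<^sub>k ?d) \<odot>\<^sub>H x = \<chi> j (x (s i)) \<odot>\<^sub>H xs i j" if x: "x \<in> car H" for x
 proof (rule H_eqI)
  note xsi = H_value[OF x si]
  have y: "\<chi> j (x (s i)) \<in> car k" by (rule Q.frame_closed[OF j(1) Q.socle_carrier[OF xsi]])
  show "(?c \<otimes>\<^sub>k ?d) \<odot>\<^sub>H x \<in> car H" using c d x by (intro H.smult_closed) auto
  show "\<chi> j (x (s i)) \<odot>\<^sub>H xs i j \<in> car H" by (rule H.smult_closed[OF y xs_H[OF i(1) j(1)]])
  fix t assume t: "t \<in> socle"
  have f: "\<phi> i t \<in> car k" by (rule frame_closed[OF i(1) socle_carrier[OF t]])
  note xt = Q.socle_carrier[OF H_value[OF x t]]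
  have "\<chi> j (x (s i)) \<odot>\<^sub>B (\<phi> i t \<odot>\<^sub>B r j) = \<phi> i t \<odot>\<^sub>B (\<chi> j (x (s i)) \<odot>\<^sub>B r j)"
   by (rule Q.smult_lcomm[OF y f rj(2)])
  also have "... = \<phi> i t \<odot>\<^sub>B (?d \<odot>\<^sub>B x (s i))"
   by (simp only: Q.socle_rank_one[OF xsi rj(1) Q.frame_Lin[OF j(1)]])
  also have "... = ?d \<odot>\<^sub>B (\<phi> i t \<odot>\<^sub>B x (s i))"
   by (rule Q.smult_lcomm[OF f d Q.socle_carrier[OF xsi]])
  also have "\<phi> i t \<odot>\<^sub>B x (s i) = x (?c \<odot> t)"
   using H_smult[OF x f si] socle_rank_one[OF t si frame_Lin[OF i(1)]] by simp
  also have "x (?c \<odot> t) = ?c \<odot>\<^sub>B x t" by (rule H_smult[OF x c t])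
  also have "?d \<odot>\<^sub>B (?c \<odot>\<^sub>B x t) = (?c \<otimes>\<^sub>k ?d) \<odot>\<^sub>B x t"
   using c d xt by (simp add: Q.smult_lcomm[of ?d] Q.smult_assoc1)
  finally show "((?c \<otimes>\<^sub>k ?d) \<odot>\<^sub>H x) t = (\<chi> j (x (s i)) \<odot>\<^sub>H xs i j) t" using t by (simp add: xs_def)
 qed
 have "local_basis k H (?c \<otimes>\<^sub>k ?d) 1 (\<lambda>_. xs i j) (\<lambda>_ x. \<chi> j (x (s i)))"
  unfolding local_basis_def
 proof (intro conjI allI impI ballI)
  show "\<chi> j (xs i j (s i)) = (if l = l' then ?c \<otimes>\<^sub>k ?d else \<zero>\<^sub>k)" if "l < 1" "l' < 1" for l l' :: nat
   using that c rj si by (simp add: xs_def Q.Lin_smult[OF Q.frame_Lin[OF j(1)]])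
  fix x assume x: "x \<in> car H"
  have "\<chi> j (x (s i)) \<odot>\<^sub>H xs i j \<in> car H"
   by (rule H.smult_closed[OF Q.frame_closed[OF j(1) Q.socle_carrier[OF H_value[OF x si]]] xs_H[OF i(1) j(1)]])
  then show "(?c \<otimes>\<^sub>k ?d) \<odot>\<^sub>H x = (\<Oplus>\<^sub>H l\<in>{..<1::nat}. \<chi> j (x (s i)) \<odot>\<^sub>H xs i j)"
   unfolding cd[OF x] by (simp add: lessThan_Suc H.M.finsum_insert H.M.finsum_empty del: hom_module_simps)
 qed (use c d xs_H[OF i(1) j(1)] H_coordinate[OF i(1) j(1)] in auto)
 moreover have "?c \<otimes>\<^sub>k ?d \<notin> p" using p.I_prime[OF c d] i(2) j(2) by blast
 ultimately show ?thesis by blast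
qed

text \<open>The element of \<open>A\<close> that corresponds to the tensor of \<open>s i\<close> and
  \<open>\<chi> j\<close>, the latter read as a functional on \<open>A\<close>.\<close>

definition "\<theta>s i j = \<theta> (s i) (\<lambda>a. \<chi> j (I +> a))"

lemma \<theta>s_in_Ann: "i < n ==> j < q ==> \<theta>s i j \<in> Ann"
 unfolding \<theta>s_def by (rule \<theta>_in_Ann[OF frame_socle Lin_B_pullback(1)[OF Q.frame_Lin] Lin_B_pullback(2)[OF Q.frame_Lin]])

text \<open>One \<open>a\<close> has to satisfy the equations for all \<open>i\<close> and
  \<open>j\<close>. The functionals \<open>y \<mapsto> \<phi> l (z y)\<close> descend to
  \<open>A/I\<close>; the map \<open>Q.\<theta>\<close> is applied to \<open>x (s l)\<close> and the
  \<open>l\<close>-th of them, and \<open>a\<close> lifts the sum over \<open>l\<close>. The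
  rank-one clause for \<open>A\<close> and the expansion of \<open>x (s i)\<close> collapse the
  resulting sum.\<close>

lemma H_act:
 assumes x: "x \<in> car H" and z: "z \<in> Ann"
 shows "\<exists>a\<in>car A. \<forall>i<n. \<forall>j<q. a \<otimes> \<theta>s i j = \<chi> j (x (s i)) \<odot> z"
proof -
 have zA: "z \<in> car A" by (rule Ann_carrier[OF z])
 have "\<forall>l\<in>{..<n}. \<exists>\<psi>. \<psi> \<in> Q.Lin \<and> (\<forall>a\<in>car A. \<psi> (I +> a) = \<phi> l (z \<otimes> a))"
 proof
  fix l assume "l \<in> {..<n}"
  then have l: "l < n" by simp
  have "\<phi> l (z \<otimes> y) = \<zero>\<^sub>k" if "y \<in> I" for y
   using z that Lin_zero[OF frame_Lin[OF l]] by (simp add: Ann_def)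
  from Lin_B_lift[OF Lin_mult[OF frame_Lin[OF l] zA] this]
  show "\<exists>\<psi>. \<psi> \<in> Q.Lin \<and> (\<forall>a\<in>car A. \<psi> (I +> a) = \<phi> l (z \<otimes> a))" by blast
 qed
 from bchoice[OF this] obtain \<psi> where
  \<psi>all: "\<forall>l\<in>{..<n}. \<psi> l \<in> Q.Lin \<and> (\<forall>a\<in>car A. \<psi> l (I +> a) = \<phi> l (z \<otimes> a))" by (elim exE)
 have \<psi>: "\<psi> l \<in> Q.Lin" and \<psi>v: "a \<in> car A ==> \<psi> l (I +> a) = \<phi> l (z \<otimes> a)" if "l < n" for l a
  using \<psi>all that by simp_all
 define Y where "Y = (\<lambda>l. Q.\<theta> (x (s l)) (\<psi> l))"
 have xs: "x (s l) \<in> Q.socle" if "l < n" for l by (rule H_value[OF x frame_socle[OF that]])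
 have Y: "Y l \<in> car B" if "l < n" for l unfolding Y_def by (rule Q.\<theta>_closed[OF xs[OF that] \<psi>[OF that]])
 have "(\<Oplus>\<^sub>B l\<in>{..<n}. Y l) \<in> car B" using Y by (intro Q.M.finsum_closed) auto
 then obtain a where a: "a \<in> car A" "(\<Oplus>\<^sub>B l\<in>{..<n}. Y l) = I +> a"
  unfolding carrier_B by (rule imageE) (rule that)
 have "a \<otimes> \<theta>s i j = \<chi> j (x (s i)) \<odot> z" if i: "i < n" and j: "j < q" for i j
 proof (rule frame_eqI)
  have tA: "\<theta>s i j \<in> car A" by (rule Ann_carrier[OF \<theta>s_in_Ann[OF i j]])
  have xc: "\<chi> j (x (s l)) \<in> car k" if "l < n" for l by (rule Q.frame_closed[OF j Q.socle_carrier[OF xs[OF that]]])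
  show "a \<otimes> \<theta>s i j \<in> car A" "\<chi> j (x (s i)) \<odot> z \<in> car A" using a(1) tA xc[OF i] zA by auto
  fix l y assume l: "l < n" and y: "y \<in> car A"
  have zy: "z \<otimes> y \<in> car A" using zA y by simp
  note fz = frame_closed[OF _ zy] and fs = frame_closed[OF _ frame_carrier[OF i]]
  have yB: "I +> y \<in> car B" using y by (auto simp: carrier_B)
  have "\<phi> l ((a \<otimes> \<theta>s i j) \<otimes> y) = \<phi> l (\<theta>s i j \<otimes> (a \<otimes> y))" using a(1) tA y by (simp add: m_ac)
  also have "... = \<phi> l (s i) \<otimes>\<^sub>k \<chi> j (I +> (a \<otimes> y))"
   unfolding \<theta>s_def by (rule \<theta>_eq[OF frame_socle[OF i] Lin_B_pullback(1)[OF Q.frame_Lin[OF j]] l]) (use a(1) y in simp)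
  also have "\<chi> j (I +> (a \<otimes> y)) = (\<Oplus>\<^sub>k m\<in>{..<n}. \<chi> j (x (s m)) \<otimes>\<^sub>k \<phi> m (z \<otimes> y))"
  proof -
   have "I +> (a \<otimes> y) = (\<Oplus>\<^sub>B m\<in>{..<n}. Y m) \<otimes>\<^sub>B (I +> y)" using a y by (simp add: mult_B)
   also have "... = (\<Oplus>\<^sub>B m\<in>{..<n}. Y m \<otimes>\<^sub>B (I +> y))" by (rule Q.finsum_ldistr) (use yB Y in auto)
   finally have "\<chi> j (I +> (a \<otimes> y)) = (\<Oplus>\<^sub>k m\<in>{..<n}. \<chi> j (Y m \<otimes>\<^sub>B (I +> y)))"
    using functional_finsum[OF Q.module_axioms Q.frame_Lin[OF j], of "{..<n}" "\<lambda>m. Y m \<otimes>\<^sub>B (I +> y)"] Y yB by simp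
   also have "... = (\<Oplus>\<^sub>k m\<in>{..<n}. \<chi> j (x (s m)) \<otimes>\<^sub>k \<phi> m (z \<otimes> y))"
    using y yB xc fz by (intro R.finsum_cong') (auto simp: Y_def Q.\<theta>_eq[OF xs \<psi> j] \<psi>v)
   finally show ?thesis .
  qed
  also have "\<phi> l (s i) \<otimes>\<^sub>k (\<Oplus>\<^sub>k m\<in>{..<n}. \<chi> j (x (s m)) \<otimes>\<^sub>k \<phi> m (z \<otimes> y)) =
    (\<Oplus>\<^sub>k m\<in>{..<n}. \<phi> l (s i) \<otimes>\<^sub>k (\<chi> j (x (s m)) \<otimes>\<^sub>k \<phi> m (z \<otimes> y)))"
   by (rule R.finsum_rdistr) (use xc fz fs[OF l] in auto)
  also have "... = (\<Oplus>\<^sub>k m\<in>{..<n}. (\<phi> m (s i) \<otimes>\<^sub>k \<chi> j (x (s m))) \<otimes>\<^sub>k \<phi> l (z \<otimes> y))"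
  proof (rule R.finsum_cong'[OF refl])
   fix m assume "m \<in> {..<n}"
   then have m: "m < n" by simp
   have "\<phi> l (s i) \<otimes>\<^sub>k (\<chi> j (x (s m)) \<otimes>\<^sub>k \<phi> m (z \<otimes> y)) = \<chi> j (x (s m)) \<otimes>\<^sub>k (\<phi> l (s i) \<otimes>\<^sub>k \<phi> m (z \<otimes> y))"
    by (rule R.m_lcomm[OF fs[OF l] xc[OF m] fz[OF m]])
   also have "... = \<chi> j (x (s m)) \<otimes>\<^sub>k (\<phi> m (s i) \<otimes>\<^sub>k \<phi> l (z \<otimes> y))"
    by (simp only: frame_comm[OF l m frame_socle[OF i] zy])
   finally show "\<phi> l (s i) \<otimes>\<^sub>k (\<chi> j (x (s m)) \<otimes>\<^sub>k \<phi> m (z \<otimes> y)) = (\<phi> m (s i) \<otimes>\<^sub>k \<chi> j (x (s m))) \<otimes>\<^sub>k \<phi> l (z \<otimes> y)"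
    using xc[OF m] fs[OF m] fz[OF l] by (simp add: R.m_ac)
  qed (use xc fz[OF l] fs in auto)
  also have "... = (\<Oplus>\<^sub>k m\<in>{..<n}. \<phi> m (s i) \<otimes>\<^sub>k \<chi> j (x (s m))) \<otimes>\<^sub>k \<phi> l (z \<otimes> y)"
   by (rule R.finsum_ldistr[symmetric]) (use xc fz[OF l] fs in auto)
  also have "(\<Oplus>\<^sub>k m\<in>{..<n}. \<phi> m (s i) \<otimes>\<^sub>k \<chi> j (x (s m))) = \<chi> j (x (s i))"
   using Q.Lin_lincomb[OF Q.frame_Lin[OF j], of "{..<n}" "\<lambda>m. x (s m)" "\<lambda>m. \<phi> m (s i)"]
    Q.socle_carrier[OF xs] fs H_expand[OF x frame_socle[OF i]] by auto
  also have "\<chi> j (x (s i)) \<otimes>\<^sub>k \<phi> l (z \<otimes> y) = \<phi> l ((\<chi> j (x (s i)) \<odot> z) \<otimes> y)"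
   using xc[OF i] zA y by (simp add: smult_assoc2 Lin_smult[OF frame_Lin[OF l]])
  finally show "\<phi> l ((a \<otimes> \<theta>s i j) \<otimes> y) = \<phi> l ((\<chi> j (x (s i)) \<odot> z) \<otimes> y)" .
 qed
 then show ?thesis using a(1) by blast
qed

lemma cyclic_twist_exists:
 "\<exists>L :: ('k, (nat => 'k) set) module. invertible_module k L \<and>
  cyclic_module A (tensor_alg k A L (AA\<lparr>carrier := Ann\<rparr>))"
proof -
 have "\<forall>p. primeideal p k --> (\<exists>f m \<nu>. f \<notin> p \<and> local_basis k H f 1 m \<nu>)" using H_local_basis by blast
 from small_copy[OF module_H H_dual_basis this]
 obtain L :: "('k, (nat => 'k) set) module" and xs' h where L: "invertible_module k L" and h: "h \<in> mod_hom k L H"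
  and db: "dual_basis k L (n * q) xs' (\<lambda>p y. \<chi> (p mod q) ((h y) (s (p div q))))" by (elim exE conjE)
 interpret twist k A \<epsilon> n s \<phi> I \<pi> L
  by (intro twist.intro linkage_axioms twist_axioms.intro)
   (use L in \<open>simp add: invertible_module_def locally_free_rank_def\<close>)
 have "cyclic_module A LI"
 proof (rule cyclic_if_dual_basis[OF db])
  show "\<theta>s (p div q) (p mod q) \<in> Ann" if "p < n * q" for p using \<theta>s_in_Ann grid_index[OF that] by blast
  fix x z assume x: "x \<in> car L" and z: "z \<in> Ann"
  show "\<exists>a\<in>car A. \<forall>p<n * q. a \<otimes> \<theta>s (p div q) (p mod q) = \<chi> (p mod q) (h x (s (p div q))) \<odot> z"
   using H_act[OF mod_hom_closed[OF h x] z] grid_index by meson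
 qed
 then show ?thesis using L by blast
qed

end

section \<open>Augmentation of the quotient, the degenerate case and the rank of the linked
  quotient\<close>

context linkage
begin

lemma B_nat_pow: "a \<in> car A ==> (I +> a) [^]\<^bsub>B\<^esub> (m::nat) = I +> (a [^] m)"
proof (induction m)
 case (Suc m)
 interpret B: algebra k B by (rule algebra_B)
 show ?case using Suc by (simp add: mult_B)
qed (simp add: nat_pow_def one_B)

lemma B_dual_basis:
 assumes db: "dual_basis k Ck N m \<mu>"
 shows "dual_basis k B N m \<mu>"
proof -
 interpret B: algebra k B by (rule algebra_B)
 have fs: "finsum B = finsum C"
  by (rule finsum_cong_structure) (simp_all add: carrier_B_C add_B_C, simp add: quot_module_def)
 have m: "m i \<in> car C" and \<mu>: "\<mu> i \<in> lin k B" if "i < N" for i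
  using db that by (auto simp: dual_basis_def mod_hom_B_C)
 have "x = (\<Oplus>\<^sub>B i\<in>{..<N}. \<mu> i x \<odot>\<^sub>B m i)" if x: "x \<in> car B" for x
 proof -
  have \<mu>c: "\<mu> i x \<in> car k" if "i < N" for i using mod_hom_closed[OF \<mu>[OF that] x] by simp
  have "x = (\<Oplus>\<^sub>B i\<in>{..<N}. (\<mu> i x \<odot> \<one>) \<odot>\<^sub>C m i)"
   using db x by (simp add: dual_basis_def carrier_B_C fs)
  also have "... = (\<Oplus>\<^sub>B i\<in>{..<N}. \<mu> i x \<odot>\<^sub>B m i)"
  proof (rule B.M.finsum_cong'[OF refl])
   show "(\<lambda>i. \<mu> i x \<odot>\<^sub>B m i) \<in> {..<N} \<rightarrow> car B"
    using B.smult_closed[OF \<mu>c m[folded carrier_B_C]] by blast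
  qed (simp add: smult_B_C \<mu>c m)
  finally show ?thesis .
 qed
 then show ?thesis unfolding dual_basis_def using m \<mu> by (simp add: carrier_B_C)
qed

lemma B_augmented:
 assumes db: "dual_basis k Ck N m \<mu>" and I: "\<And>y. y \<in> I ==> \<epsilon> y = \<zero>\<^sub>k"
 shows "\<exists>\<delta>. augmented_algebra k B \<delta>"
proof -
 obtain \<delta> where \<delta>: "\<delta> \<in> lin k B" "\<forall>a\<in>car A. \<delta> (I +> a) = \<epsilon> a"
  using Lin_B_lift[OF eps_Lin I] by blast
 have "augmented_algebra k B \<delta>"
 proof (intro augmented_algebra.intro augmented_algebra_axioms.intro algebra_B \<delta>(1))
  show "\<exists>n m \<mu>. dual_basis k B n m \<mu>" using B_dual_basis[OF db] by blast
  show "\<delta> \<one>\<^sub>B = \<one>\<^sub>k" using \<delta>(2) by (simp add: one_B eps_one)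
  fix X assume "X \<in> car B"
  then obtain a where a: "a \<in> car A" and X: "X = I +> a" by (auto simp: carrier_B)
  show "\<delta> (X \<otimes>\<^sub>B Y) = \<delta> X \<otimes>\<^sub>k \<delta> Y" if "Y \<in> car B" for Y
   using that a \<delta>(2) by (auto simp: carrier_B X mult_B eps_mult)
  assume "\<delta> X = \<zero>\<^sub>k"
  then have "\<epsilon> a = \<zero>\<^sub>k" using a \<delta>(2) by (simp add: X)
  then obtain m :: nat where "a [^] m = \<zero>" using eps_nilpotent[OF a] by blast
  then show "\<exists>m::nat. X [^]\<^bsub>B\<^esub> m = \<zero>\<^sub>B"
   unfolding X B_nat_pow[OF a] zero_B by (intro exI[of _ m]) simp
 qed
 then show ?thesis by blast
qed

text \<open>A frame of \<open>A/I\<close> requires \<open>\<epsilon>\<close> to factor through the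
  quotient, that is, \<open>I\<close> inside the kernel of \<open>\<epsilon>\<close>; the other
  alternative \<open>I = A\<close> is settled by hand.\<close>

lemma cyclic_twist_exists:
 assumes db: "dual_basis k Ck N m \<mu>" and gor: "gorenstein k B" and I: "I = car A \<or> (\<forall>y\<in>I. \<epsilon> y = \<zero>\<^sub>k)"
 shows "\<exists>L :: ('k, (nat => 'k) set) module. invertible_module k L \<and>
  cyclic_module A (tensor_alg k A L (AA\<lparr>carrier := Ann\<rparr>))"
 using I
proof
 assume "\<forall>y\<in>I. \<epsilon> y = \<zero>\<^sub>k"
 then obtain \<delta> where \<delta>: "augmented_algebra k B \<delta>" using B_augmented[OF db] by blast
 obtain q r \<chi> where "augmented_algebra.frame k B \<delta> q r \<chi>" using augmented_algebra.frame_exists[OF \<delta> gor] by blast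
 then have "framed_algebra k B \<delta> q r \<chi>" by (intro framed_algebra.intro framed_algebra_axioms.intro \<delta>)
 from gorenstein_quotient.cyclic_twist_exists[OF gorenstein_quotient.intro[OF linkage_axioms this]] show ?thesis .
next
 \<comment> \<open>Now \<open>I'\<close> is zero, and a copy of \<open>k\<close> on the prescribed
   type serves as \<open>L\<close>, with zero as the element that enters the generator.\<close>
 assume IA: "I = car A"
 have Ann: "z = \<zero>" if "z \<in> Ann" for z
 proof -
  have "\<forall>x\<in>I. z \<otimes> x = \<zero>" using that by (simp add: Ann_def)
  moreover have "\<one> \<in> I" by (simp add: IA)
  ultimately have "z \<otimes> \<one> = \<zero>" by blast
  then show ?thesis using Ann_carrier[OF that] by simp
 qed
 have mk: "module k (regular_module k)" by (rule module_regular[OF R_cring])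
 have sum: "(\<Oplus>\<^sub>k i\<in>{..<Suc 0}. x) = x" if "x \<in> car k" for x
  using that by (simp add: lessThan_Suc)
 have id: "(\<lambda>x. x) \<in> lin k (regular_module k)" by (rule mod_homI) auto
 have db1: "dual_basis k (regular_module k) 1 (\<lambda>_. \<one>\<^sub>k) (\<lambda>_ x. x)"
  using id by (simp add: dual_basis_def sum)
 have "local_basis k (regular_module k) \<one>\<^sub>k 1 (\<lambda>_. \<one>\<^sub>k) (\<lambda>_ x. x)"
  using id by (simp add: local_basis_def sum)
 moreover have "\<one>\<^sub>k \<notin> p" if "primeideal p k" for p
  using primeideal.I_notcarr[OF that] ideal.one_imp_carrier[OF primeideal.axioms(1)[OF that]] by blast
 ultimately have "\<forall>p. primeideal p k --> (\<exists>f m \<nu>. f \<notin> p \<and> local_basis k (regular_module k) f 1 m \<nu>)" by blast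
 from small_copy[OF mk db1 this]
 obtain L :: "('k, (nat => 'k) set) module" and xs h where L: "invertible_module k L"
  and h: "h \<in> lin k L" and dbL: "dual_basis k L 1 xs (\<lambda>p y. h y)" by (elim exE conjE)
 interpret twist k A \<epsilon> n s \<phi> I \<pi> L
  by (intro twist.intro linkage_axioms twist_axioms.intro)
   (use L in \<open>simp add: invertible_module_def locally_free_rank_def\<close>)
 have z: "\<zero> \<in> Ann" using I_carrier by (simp add: Ann_def)
 have "cyclic_module A LI"
 proof (rule cyclic_if_dual_basis[OF dbL])
  show "\<zero> \<in> Ann" by (rule z)
  show "\<exists>a\<in>car A. \<forall>p<1. a \<otimes> \<zero> = h x \<odot> i" if "x \<in> car L" "i \<in> Ann" for x i
   using Ann[OF that(2)] mod_hom_closed[OF h that(1)] by (intro bexI[of _ "\<zero>"]) auto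
 qed
 then show ?thesis using L by blast
qed

text \<open>The kernel \<open>I\<close> has rank \<open>N - r\<close>, and
  \<open>A/I' \<cong> Hom(I, A)\<close> is the dual of \<open>I\<close> twisted by the socle, hence
  of the same rank.\<close>

lemma C'_locally_free:
 assumes noeth: "noetherian_ring k"
  and A: "\<And>p. primeideal p k ==> \<exists>f e \<mu>. f \<notin> p \<and> local_basis k Ak f N e \<mu>"
  and C: "locally_free_rank k Ck r"
 shows "locally_free_rank k (restrict_scalars A C') (N - r)"
proof (rule locally_free_if_local_basis)
 show "module k (restrict_scalars A C')"
  by (rule module_restrict_scalars[OF algebra_axioms module_quot_module[OF module_AA submodule_Ann]])
 fix p assume p: "primeideal p k"
 have sub: "submodule I k Ak" by (rule submodule_restrict_scalars[OF algebra_axioms module_AA submodule_I])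
 obtain f e \<mu> where f: "f \<notin> p" "local_basis k Ak f N e \<mu>" using A[OF p] by blast
 obtain g c \<gamma> where g: "g \<notin> p" "local_basis k Ck g r c \<gamma>"
  by (rule local_basis_if_locally_free[OF noeth C p])
 from local_basis_kernel[OF module_Ak sub p f(2,1) g(2)[unfolded restrict_scalars_quot_module] g(1)]
 obtain h w \<xi> where h: "h \<in> car k - p"
  and w: "\<forall>l<N - r. w l \<in> I \<and> \<xi> l \<in> lin k Ak"
  and dec: "\<forall>x\<in>I. h \<odot>\<^bsub>Ak\<^esub> x = (\<Oplus>\<^bsub>Ak\<^esub>l\<in>{..<N - r}. \<xi> l x \<odot>\<^bsub>Ak\<^esub> w l)"
  and orth: "\<forall>l<N - r. \<forall>j<N - r. \<xi> l (w j) = (if l = j then h else \<zero>\<^sub>k)" by (elim exE conjE)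
 have \<xi>: "\<xi> l \<in> Lin" if "l < N - r" for l using w that by (simp add: mod_hom_restrict_regular[OF algebra_axioms])
 have "h \<odot> x = (\<Oplus>l\<in>{..<N - r}. \<xi> l x \<odot> w l)" if x: "x \<in> I" for x
 proof -
  have "h \<odot> x = (\<Oplus>l\<in>{..<N - r}. (\<xi> l x \<odot> \<one>) \<otimes> w l)"
   using bspec[OF dec x] h I_carrier[OF x] by (simp add: smult_one_mult)
  also have "... = (\<Oplus>l\<in>{..<N - r}. \<xi> l x \<odot> w l)"
   using w I_carrier Lin_closed[OF \<xi> I_carrier[OF x]] by (intro M.finsum_cong') (auto simp: smult_one_mult)
  finally show ?thesis .
 qed
 then show "\<exists>f m \<mu>. f \<notin> p \<and> local_basis k (restrict_scalars A C') f (N - r) m \<mu>"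
  using h w orth \<xi> by (intro C'_local_basis[OF p, of h "N - r" w \<xi>]) auto
qed

end

section \<open>From filtrations to augmentations, local bases and splittings\<close>

lemma augmentation_exists:
 assumes fil: "filtered_algebra k A F" and aug: "augmented k A F"
 shows "\<exists>\<epsilon>. \<epsilon> \<in> lin k A \<and>
  (\<forall>a\<in>car A. \<forall>b\<in>car A. \<epsilon> (a \<otimes>\<^sub>A b) = \<epsilon> a \<otimes>\<^sub>k \<epsilon> b) \<and> \<epsilon> \<one>\<^sub>A = \<one>\<^sub>k \<and>
  (\<forall>a\<in>car A. \<epsilon> a = \<zero>\<^sub>k \<longleftrightarrow> a \<in> F 1)"
proof -
 interpret A: algebra k A using fil by (simp add: filtered_algebra_def)
 have id: "ideal (F 1) A" using fil by (simp add: filtered_algebra_def)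
 interpret F1: ideal "F 1" A by (rule id)
 define j where "j = (\<lambda>c. F 1 +>\<^bsub>A\<^esub> (c \<odot>\<^sub>A \<one>\<^sub>A))"
 define j' where "j' = inv_into (car k) j"
 have j: "j \<in> ring_iso k (A Quot F 1)" using aug by (simp add: augmented_def j_def)
 have bij: "bij_betw j (car k) (car (A Quot F 1))" using j by (simp add: ring_iso_def)
 have j': "j' \<in> ring_hom (A Quot F 1) k"
  using ring_iso_set_sym[OF A.R.ring_axioms j] by (simp add: ring_iso_def j'_def)
 \<comment> \<open>The quotient map followed by the inverse of the structure map of
   \<open>A/F 1\<close>. Its linearity over \<open>k\<close> rests on \<open>\<epsilon>c\<close>,
   that it returns \<open>c\<close> on the scalar \<open>c\<close>.\<close>
 define \<epsilon> where "\<epsilon> a = j' (F 1 +>\<^bsub>A\<^esub> a)" for a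
 have h: "\<epsilon> \<in> ring_hom A k"
  using ring_hom_trans[OF F1.rcos_ring_hom j'] by (simp add: \<epsilon>_def[abs_def] comp_def)
 have \<epsilon>c: "\<epsilon> (c \<odot>\<^sub>A \<one>\<^sub>A) = c" if "c \<in> car k" for c
  using bij_betw_inv_into_left[OF bij that] by (simp add: \<epsilon>_def j'_def j_def)
 have j\<epsilon>: "j (\<epsilon> a) = F 1 +>\<^bsub>A\<^esub> a" if a: "a \<in> car A" for a
  unfolding \<epsilon>_def j'_def by (rule bij_betw_inv_into_right[OF bij ring_hom_closed[OF F1.rcos_ring_hom a]])
 have cl: "\<epsilon> a \<in> car k" if "a \<in> car A" for a by (rule ring_hom_closed[OF h that])
 have "\<epsilon> \<in> lin k A"
 proof (rule mod_homI)
  fix c a assume c: "c \<in> car k" and a: "a \<in> car A"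
  have "\<epsilon> ((c \<odot>\<^sub>A \<one>\<^sub>A) \<otimes>\<^sub>A a) = c \<otimes>\<^sub>k \<epsilon> a"
   using ring_hom_mult[OF h, of "c \<odot>\<^sub>A \<one>\<^sub>A" a] c a by (simp add: \<epsilon>c)
  then show "\<epsilon> (c \<odot>\<^sub>A a) = c \<odot>\<^bsub>regular_module k\<^esub> \<epsilon> a" using c a by (simp add: A.smult_assoc2)
 qed (use cl ring_hom_add[OF h] in auto)
 moreover have "\<epsilon> a = \<zero>\<^sub>k \<longleftrightarrow> a \<in> F 1" if a: "a \<in> car A" for a
 proof -
  have "\<epsilon> a = \<zero>\<^sub>k \<longleftrightarrow> j (\<epsilon> a) = j \<zero>\<^sub>k"
   using bij cl[OF a] by (auto simp: bij_betw_def inj_on_def)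
  also have "... \<longleftrightarrow> F 1 +>\<^bsub>A\<^esub> a = F 1 +>\<^bsub>A\<^esub> \<zero>\<^sub>A" unfolding j\<epsilon>[OF a] by (simp add: j_def)
  also have "... \<longleftrightarrow> a \<in> F 1"
   using coset_eq_iff[OF module_regular[OF A.M_cring] submodule_of_ideal[OF A.M_cring id], of a "\<zero>\<^sub>A"] a
   by (simp add: cring.minus_regular_module[OF A.M_cring] A.M.minus_zero_right)
  finally show ?thesis .
 qed
 ultimately show ?thesis using ring_hom_mult[OF h] ring_hom_one[OF h] by blast
qed

text \<open>Descending induction along the filtration: each step is an extension by a graded piece.
  The rank is a sum of values of \<open>h\<close> and so does not depend on the prime.\<close>

lemma filtration_local_basis:
 fixes k :: "('k, 'z) ring_scheme"
 assumes noeth: "noetherian_ring k" and fil: "filtered_algebra k A F"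
  and art: "artinian_with_hilbert_function k A F h"
 shows "\<exists>N. \<forall>p. primeideal p k --> (\<exists>f e \<mu>. f \<notin> p \<and> local_basis k (restrict_scalars A (regular_module A)) f N e \<mu>)"
proof -
 interpret A: algebra k A using fil by (simp add: filtered_algebra_def)
 let ?A = "regular_module A" and ?Ak = "restrict_scalars A (regular_module A)"
 have mA: "module A ?A" by (rule module_regular[OF A.M_cring])
 have mAk: "module k ?Ak" by (rule module_restrict_scalars[OF A.algebra_axioms mA])
 have sub: "submodule (F n) k ?Ak" for n
  using submodule_restrict_scalars[OF A.algebra_axioms mA submodule_of_ideal[OF A.M_cring]] fil
  by (simp add: filtered_algebra_def)
 have mF: "module k (?Ak\<lparr>carrier := F n\<rparr>)" for n by (rule submodule.submodule_is_module[OF sub mAk])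
 define P where "P n \<longleftrightarrow> (\<exists>N. \<forall>p. primeideal p k --> (\<exists>f e \<mu>. f \<notin> p \<and> local_basis k (?Ak\<lparr>carrier := F n\<rparr>) f N e \<mu>))" for n
 obtain n1 where n1: "\<forall>n\<ge>n1. F n = {\<zero>\<^sub>A}"
  using art by (auto simp: artinian_with_hilbert_function_def in_AF_def)
 \<comment> \<open>The start \<open>max n1 0\<close> keeps index zero within reach even if
   \<open>n1\<close> is negative.\<close>
 have "P n" if "n \<le> max n1 0" for n
  using that
 proof (induction n rule: int_le_induct)
  case base
  have F0: "F (max n1 0) = {\<zero>\<^sub>A}" using n1 by simp
  interpret N: module k "?Ak\<lparr>carrier := F (max n1 0)\<rparr>" by (rule mF)
  have z: "finsum (?Ak\<lparr>carrier := F (max n1 0)\<rparr>) g {} = \<zero>\<^sub>A" for g :: "nat => _"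
   using N.M.finsum_empty[of g] by simp
  have "local_basis k (?Ak\<lparr>carrier := F (max n1 0)\<rparr>) \<one>\<^sub>k 0 e \<mu>" for e \<mu>
   using F0 z[unfolded F0] by (simp add: local_basis_def A.smult_one)
  moreover have "\<one>\<^sub>k \<notin> p" if "primeideal p k" for p
   using primeideal.I_notcarr[OF that] ideal.one_imp_carrier[OF primeideal.axioms(1)[OF that]] by blast
  ultimately show ?case unfolding P_def by blast
 next
  case (step n)
  then obtain N where N: "\<forall>p. primeideal p k --> (\<exists>f e \<mu>. f \<notin> p \<and> local_basis k (?Ak\<lparr>carrier := F n\<rparr>) f N e \<mu>)"
   unfolding P_def by blast
  have lf: "locally_free_rank k (quot_module (?Ak\<lparr>carrier := F (n - 1)\<rparr>) (F n)) (h (n - 1))"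
  proof -
   have "restrict_scalars A (graded_piece ?A F (n - 1)) = quot_module (?Ak\<lparr>carrier := F (n - 1)\<rparr>) (F n)"
    unfolding graded_piece_def restrict_scalars_quot_module by (simp add: restrict_scalars_def)
   then show ?thesis using art unfolding artinian_with_hilbert_function_def by metis
  qed
  have "F n \<subseteq> F (n - 1)" using fil unfolding filtered_algebra_def by (metis diff_add_cancel)
  have subF: "submodule (F n) k (?Ak\<lparr>carrier := F (n - 1)\<rparr>)"
  proof -
   interpret Ak: module k ?Ak by (rule mAk)
   interpret N: module k "?Ak\<lparr>carrier := F (n - 1)\<rparr>" by (rule mF)
   note Fn = Ak.submodule_closed[OF sub[of n]]
   have "\<ominus>\<^bsub>?Ak\<lparr>carrier := F (n - 1)\<rparr>\<^esub> x = \<ominus>\<^bsub>?Ak\<^esub> x" if x: "x \<in> F n" for x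
    using Ak.M.l_neg[OF Fn(1)[OF x]] subsetD[OF \<open>F n \<subseteq> F (n - 1)\<close>] Fn(4)[OF x] x by (intro N.M.minus_equality) auto
   then show ?thesis using \<open>F n \<subseteq> F (n - 1)\<close> Fn by (intro N.submoduleI) auto
  qed
  have "\<exists>f e \<mu>. f \<notin> p \<and> local_basis k (?Ak\<lparr>carrier := F (n - 1)\<rparr>) f (N + h (n - 1)) e \<mu>" if p: "primeideal p k" for p
  proof -
   interpret p: primeideal p k by (rule p)
   obtain f e \<mu> where f: "f \<notin> p" "local_basis k (?Ak\<lparr>carrier := F n\<rparr>) f N e \<mu>" using N p by blast
   obtain g c \<gamma> where g: "g \<notin> p" "local_basis k (quot_module (?Ak\<lparr>carrier := F (n - 1)\<rparr>) (F n)) g (h (n - 1)) c \<gamma>"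
    by (rule local_basis_if_locally_free[OF noeth lf p])
   have "f \<otimes>\<^sub>k g \<notin> p" using p.I_prime local_basisD(1)[OF f(2)] local_basisD(1)[OF g(2)] f(1) g(1) by blast
   then show ?thesis using local_basis_extension[OF mF subF _ g(2), of f N e \<mu>] f(2) by (simp, blast)
  qed
  then show ?case unfolding P_def by blast
 qed
 from this[of 0] have "P 0" by simp
 moreover have "F 0 = car A" using fil by (simp add: filtered_algebra_def)
 ultimately show ?thesis unfolding P_def by (simp add: restrict_scalars_def)
qed

text \<open>Lifting the dual basis of \<open>A/I\<close> to \<open>A\<close> gives a
  \<open>k\<close>-linear section of the quotient map; \<open>\<pi> a\<close> is \<open>a\<close>
  minus the section applied to its coset.\<close>

lemma retraction_exists:
 fixes k :: "('k, 'z) ring_scheme" and A :: "('k, 'a) module"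
 assumes alg: "algebra k A" and I: "ideal I A"
  and db: "dual_basis k (restrict_scalars A (quot_module (regular_module A) I)) N m \<mu>"
 shows "\<exists>\<pi>\<in>mod_hom k A A. (\<forall>a\<in>car A. \<pi> a \<in> I) \<and> (\<forall>a\<in>I. \<pi> a = a)"
proof -
 interpret A: algebra k A by (rule alg)
 define C where "C = quot_module (regular_module A) I"
 define Ck where "Ck = restrict_scalars A C"
 note sub = submodule_of_ideal[OF A.M_cring I] and mA = module_regular[OF A.M_cring]
 have mC: "module k Ck" unfolding Ck_def C_def
  by (rule module_restrict_scalars[OF alg module_quot_module[OF mA sub]])
 interpret C: module k Ck by (rule mC)
 define q where "q = (\<lambda>a. I +>\<^bsub>A\<^esub> a)"
 have q: "q \<in> mod_hom k A Ck"
  using mod_hom_restrict_scalars[OF alg quot_module_hom[OF mA sub]]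
  by (simp add: q_def C_def Ck_def mod_hom_restrict_regular[OF alg])
 have qim: "car Ck = q ` car A" by (simp add: Ck_def C_def carrier_quot_module q_def)
 have q0: "q a = \<zero>\<^sub>Ck \<longleftrightarrow> a \<in> I" if "a \<in> car A" for a
  using coset_zero_iff[OF mA sub, of a] that by (simp add: q_def Ck_def C_def)
 note db = db[folded C_def, folded Ck_def]
 have m: "m i \<in> car Ck" and \<mu>: "\<mu> i \<in> lin k Ck" if "i < N" for i
  using db that by (auto simp: dual_basis_def)
 have exp: "x = (\<Oplus>\<^sub>Ck i\<in>{..<N}. \<mu> i x \<odot>\<^sub>Ck m i)" if "x \<in> car Ck" for x
  using db that unfolding dual_basis_def by (elim conjE) (erule bspec)
 have "\<forall>i\<in>{..<N}. \<exists>a. a \<in> car A \<and> m i = q a" using m unfolding qim by blast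
 from bchoice[OF this] obtain b where b: "\<forall>i\<in>{..<N}. b i \<in> car A \<and> m i = q (b i)" by (elim exE)
 define \<sigma> where "\<sigma> = (\<lambda>a. \<Oplus>\<^sub>A i\<in>{..<N}. \<mu> i (q a) \<odot>\<^sub>A b i)"
 have \<sigma>: "\<sigma> \<in> mod_hom k A A" unfolding \<sigma>_def
  by (rule mod_hom_lincomb[OF A.module_axioms A.module_axioms]) (use b mod_hom_comp[OF q \<mu>] in auto)
 have \<sigma>c: "\<sigma> a \<in> car A" if "a \<in> car A" for a by (rule mod_hom_closed[OF \<sigma> that])
 have \<mu>c: "\<mu> i (q a) \<in> car k" if "i < N" "a \<in> car A" for i a
  using mod_hom_closed[OF \<mu>[OF that(1)] mod_hom_closed[OF q that(2)]] by simp
 have q\<sigma>: "q (\<sigma> a) = q a" if a: "a \<in> car A" for a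
 proof -
  have "q (\<sigma> a) = (\<Oplus>\<^sub>Ck i\<in>{..<N}. q (\<mu> i (q a) \<odot>\<^sub>A b i))"
   unfolding \<sigma>_def by (rule mod_hom_finsum[OF A.module_axioms mC q]) (use b \<mu>c a in auto)
  also have "... = (\<Oplus>\<^sub>Ck i\<in>{..<N}. \<mu> i (q a) \<odot>\<^sub>Ck m i)"
   using b \<mu>c[OF _ a] m by (intro C.M.finsum_cong') (auto simp: mod_hom_smult[OF q])
  finally show ?thesis using exp[OF mod_hom_closed[OF q a]] by simp
 qed
 define \<pi> where "\<pi> = (\<lambda>a. a \<ominus>\<^sub>A \<sigma> a)"
 have "\<pi> \<in> mod_hom k A A" unfolding \<pi>_def
  by (rule mod_hom_diff[OF A.module_axioms A.module_axioms _ \<sigma>]) (rule mod_homI; simp)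
 moreover have "\<pi> a \<in> I" if a: "a \<in> car A" for a
 proof -
  have "q (\<pi> a) = \<zero>\<^sub>Ck" unfolding \<pi>_def
   using mod_hom_minus[OF A.module_axioms mC q a \<sigma>c[OF a]] q\<sigma>[OF a] mod_hom_closed[OF q a]
   by (simp add: C.M.r_neg a_minus_def)
  then show ?thesis using q0[of "\<pi> a"] a \<sigma>c[OF a] by (simp add: \<pi>_def)
 qed
 moreover have "\<pi> a = a" if a: "a \<in> I" for a
 proof -
  have aA: "a \<in> car A" by (rule ideal.Icarr[OF I a])
  have "\<mu> i (q a) = \<zero>\<^sub>k" if "i < N" for i
   using mod_hom_zero[OF mC module_regular[OF A.R_cring] \<mu>[OF that]] q0[OF aA] a by simp
  then have "\<sigma> a = \<zero>\<^sub>A" unfolding \<sigma>_def using b by (intro A.M.finsum_all_zero) auto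
  then show ?thesis using aA by (simp add: \<pi>_def A.M.minus_zero_right)
 qed
 ultimately show ?thesis by blast
qed

text \<open>If \<open>G\<^sub>0(A/I) = k/\<epsilon>(I)\<close> is locally free of constant rank, it is \<open>0\<close> or \<open>k\<close>.\<close>

lemma (in augmented_algebra) ideal_total_or_below:
 assumes noeth: "noetherian_ring k" and I: "ideal I A" and F1: "F 1 = {a \<in> car A. \<epsilon> a = \<zero>\<^sub>k}"
  and F0: "F 0 = car A"
  and AF: "in_AF k A F (quot_module (regular_module A) I) (\<lambda>n. (\<lambda>a. I +> a) ` F n)"
 shows "I = car A \<or> (\<forall>y\<in>I. \<epsilon> y = \<zero>\<^sub>k)"
proof -
 define C where "C = quot_module (regular_module A) I"
 define Ck where "Ck = restrict_scalars A C"
 interpret I: ideal I A by (rule I)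
 note sub = submodule_of_ideal[OF M_cring I] and mA = module_regular[OF M_cring]
 have mC: "module A C" unfolding C_def by (rule module_quot_module[OF mA sub])
 have mCk: "module k Ck" unfolding Ck_def by (rule module_restrict_scalars[OF algebra_axioms mC])
 define q where "q = (\<lambda>a. I +> a)"
 have q: "q \<in> mod_hom k A Ck"
  using mod_hom_restrict_scalars[OF algebra_axioms quot_module_hom[OF mA sub]]
  by (simp add: q_def C_def Ck_def mod_hom_restrict_regular[OF algebra_axioms])
 have qeq: "q a = q b \<longleftrightarrow> a \<ominus> b \<in> I" if "a \<in> car A" "b \<in> car A" for a b
  using coset_eq_iff[OF mA sub, of a b] that by (simp add: q_def cring.minus_regular_module[OF M_cring])
 have car: "car Ck = q ` car A" by (simp add: Ck_def C_def carrier_quot_module q_def)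
 define J where "J = q ` F 1"
 have J: "submodule J k Ck"
  using AF submodule_restrict_scalars[OF algebra_axioms mC] by (simp add: in_AF_def filtered_module_def C_def Ck_def J_def q_def)
 define G where "G = quot_module Ck J"
 have mG: "module k G" unfolding G_def by (rule module_quot_module[OF mCk J])
 interpret G: module k G by (rule mG)
 have q2: "(\<lambda>X. J +>\<^bsub>Ck\<^esub> X) \<in> mod_hom k Ck G" unfolding G_def by (rule quot_module_hom[OF mCk J])
 define u where "u = (\<lambda>a. J +>\<^bsub>Ck\<^esub> q a)"
 have u: "u \<in> mod_hom k A G" unfolding u_def by (rule mod_hom_comp[OF q q2])
 have uim: "car G = u ` car A" unfolding u_def G_def carrier_quot_module car by blast
 have u0: "u a = \<zero>\<^sub>G \<longleftrightarrow> q a \<in> J" if "a \<in> car A" for a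
  unfolding u_def G_def by (rule coset_zero_iff[OF mCk J mod_hom_closed[OF q that]])
 have "car C = q ` F 0" using car by (simp add: F0 Ck_def)
 then have "restrict_scalars A (graded_piece C (\<lambda>n. q ` F n) 0) = G"
  unfolding graded_piece_def restrict_scalars_quot_module G_def J_def by (simp add: Ck_def restrict_scalars_def)
 then obtain r where lf: "locally_free_rank k G r"
  using AF unfolding in_AF_def C_def[symmetric] q_def[symmetric] by metis
 show ?thesis
 proof (cases r)
  case 0
  \<comment> \<open>Rank zero makes \<open>G\<close> vanish, so one is congruent modulo
    \<open>I\<close> to some \<open>a\<close> in the augmentation ideal, hence to every power of
    \<open>a\<close>; as \<open>a\<close> is nilpotent, one lies in \<open>I\<close>.\<close>
  have "u \<one> = \<zero>\<^sub>G"
  proof (rule G.zero_if_locally_zero)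
   show uc: "u \<one> \<in> car G" by (rule mod_hom_closed[OF u one_closed])
   fix p assume p: "primeideal p k"
   obtain f m \<mu> where f: "f \<notin> p" "local_basis k G f r m \<mu>" by (rule local_basis_if_locally_free[OF noeth lf p])
   show "\<exists>f\<in>car k - p. f \<odot>\<^sub>G u \<one> = \<zero>\<^sub>G"
    using f(1) local_basisD(1)[OF f(2)] local_basisD(4)[OF f(2) uc] by (intro bexI[of _ f]) (simp_all add: 0 G.M.finsum_empty)
  qed
  then obtain a where a: "a \<in> car A" "\<epsilon> a = \<zero>\<^sub>k" and "q \<one> = q a" using u0[OF one_closed] by (auto simp: J_def F1)
  then have d: "\<one> \<ominus> a \<in> I" using qeq by simp
  obtain m :: nat where m: "a [^] m = \<zero>" using eps_nilpotent a by blast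
  have "\<one> \<ominus> a [^] (l::nat) \<in> I" for l
  proof (induction l)
   case 0
   show ?case by (simp add: a_minus_def M.r_neg)
  next
   case (Suc l)
   have "\<one> \<ominus> a [^] Suc l = (\<one> \<ominus> a [^] l) \<oplus> a [^] l \<otimes> (\<one> \<ominus> a)"
    using a(1) by (simp add: a_minus_def r_distr r_minus M.a_assoc M.a_lcomm M.l_neg r_neg2 r_neg1)
   then show ?case using Suc I.I_l_closed[OF d] a(1) by (simp add: I.a_closed)
  qed
  from this[of m] have "\<one> \<in> I" by (simp add: m M.minus_zero_right)
  then show ?thesis using I.one_imp_carrier by blast
 next
  case (Suc r')
  \<comment> \<open>In positive rank, \<open>c = \<epsilon> y\<close> kills \<open>G\<close>: for
    each \<open>a\<close> the element \<open>c a - a y\<close> lies in \<open>F 1\<close> and has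
    the coset of \<open>c a\<close> modulo \<open>I\<close>. Reading the first local coordinate of
    the first basis vector gives \<open>c f = 0\<close>, so \<open>c\<close> is locally
    zero.\<close>
  have "\<epsilon> y = \<zero>\<^sub>k" if y: "y \<in> I" for y
  proof -
   define c where "c = \<epsilon> y"
   have yA: "y \<in> car A" by (rule I.Icarr[OF y])
   have c: "c \<in> car k" unfolding c_def by (rule Lin_closed[OF eps_Lin yA])
   have kill: "c \<odot>\<^sub>G X = \<zero>\<^sub>G" if X: "X \<in> car G" for X
   proof -
    obtain a where a: "a \<in> car A" "X = u a" using X unfolding uim by (rule imageE) (rule that)
    let ?b = "c \<odot> a \<ominus> a \<otimes> y"
    have b: "?b \<in> car A" using a c yA by simp
    have "\<epsilon> (c \<odot> a) = \<epsilon> (a \<otimes> y)"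
     using a c yA Lin_closed[OF eps_Lin a(1)] by (simp add: eps_mult Lin_smult[OF eps_Lin] R.m_comm flip: c_def)
    then have "\<epsilon> ?b = \<zero>\<^sub>k"
     using a c yA Lin_closed[OF eps_Lin, of "a \<otimes> y"] by (simp add: Lin_minus[OF eps_Lin] R.right_minus_eq)
    then have "q ?b \<in> J" unfolding J_def F1 using b by blast
    moreover have "c \<odot> a \<ominus> ?b = a \<otimes> y"
     using a c yA by (simp add: a_minus_def M.minus_add M.a_assoc[symmetric] M.r_neg)
    then have "q (c \<odot> a) = q ?b" using qeq[of "c \<odot> a" ?b] b a c I.I_l_closed[OF y a(1)] by simp
    ultimately have "u (c \<odot> a) = \<zero>\<^sub>G" using u0[of "c \<odot> a"] a c by simp
    then show ?thesis using mod_hom_smult[OF u c a(1)] a(2) by simp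
   qed
   have "c = \<zero>\<^bsub>regular_module k\<^esub>"
   proof (rule module.zero_if_locally_zero[OF module_regular[OF R_cring]])
    fix p assume p: "primeideal p k"
    obtain f m \<mu> where f: "f \<notin> p" "local_basis k G f r m \<mu>" by (rule local_basis_if_locally_free[OF noeth lf p])
    note D = local_basisD[OF f(2)]
    have r: "0 < r" by (simp add: Suc)
    have "c \<otimes>\<^sub>k f = \<zero>\<^sub>k"
     using mod_hom_smult[OF D(3)[OF r] c D(2)[OF r]] D(5)[OF r r] kill[OF D(2)[OF r]]
      mod_hom_zero[OF mG module_regular[OF R_cring] D(3)[OF r]] by simp
    then show "\<exists>f\<in>car k - p. f \<odot>\<^bsub>regular_module k\<^esub> c = \<zero>\<^bsub>regular_module k\<^esub>"
     using f(1) D(1) c by (intro bexI[of _ f]) (simp_all add: R.m_comm)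
   qed (use c in simp)
   then show ?thesis by (simp add: c_def)
  qed
  then show ?thesis by blast
 qed
qed

text \<open>The conclusions of \<open>cyclic_twist\<close> with the type of \<open>L\<close> left
  free, so that they apply both to the existentially quantified \<open>L\<close> on the small type
  and to an \<open>L\<close> on an arbitrary type.\<close>

lemma (in linkage) cyclic_twist_properties:
 fixes L :: "('k, 'm) module"
 assumes noeth: "noetherian_ring k" and inv: "invertible_module k L"
  and cyc: "cyclic_module A (tensor_alg k A L (AA\<lparr>carrier := Ann\<rparr>))"
 shows "gorenstein k B" and "socle \<subseteq> Ann ==> mod_isomorphic k L (tensor k SocC (dual k Soc))"
  and "mod_isomorphic A (tensor_alg k A L (AA\<lparr>carrier := Ann\<rparr>)) C"
proof -
 obtain g where g: "g \<in> car (tensor_alg k A L (AA\<lparr>carrier := Ann\<rparr>))"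
  "car (tensor_alg k A L (AA\<lparr>carrier := Ann\<rparr>)) =
   {a \<odot>\<^bsub>tensor_alg k A L (AA\<lparr>carrier := Ann\<rparr>)\<^esub> g |a. a \<in> car A}"
  using cyc unfolding cyclic_module_def by (elim conjE bexE)
 interpret L: cyclic_twist k A \<epsilon> n s \<phi> I \<pi> L g
  by (intro cyclic_twist.intro cyclic_twist_axioms.intro twist.intro linkage_axioms twist_axioms.intro
    noeth inv g) (use inv in \<open>simp add: invertible_module_def locally_free_rank_def\<close>)
 obtain G where "G \<in> mod_iso A C L.LI" using L.C_iso_LI by (elim bexE)
 then show "mod_isomorphic A L.LI C"
  using mod_iso_inverse[OF module_C L.module_LI] unfolding mod_isomorphic_def by blast
 show "gorenstein k B" by (rule L.gorenstein_B)
 show "mod_isomorphic k L (tensor k SocC (dual k Soc))" if "socle \<subseteq> Ann" by (rule L.twist_iso[OF that])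
qed

theorem mainTheorem13:
  fixes k :: "'k ring"
    and A :: "('k, 'a) module"
    and F :: "int \<Rightarrow> 'a set"
    and h :: "int \<Rightarrow> nat"
    and I :: "'a set"
  assumes "cring k" and "noetherian_ring k"
    and "filtered_algebra k A F"
    and "augmented k A F"
    and "artinian_with_hilbert_function k A F h"
    and "gorenstein k A"
    and "ideal I A"
    and "in_AM k A (quot_module (regular_module A) I)"
  defines "AA \<equiv> regular_module A"
    and "C \<equiv> quot_module (regular_module A) I"
    and "I' \<equiv> linked A I"
    and "II' \<equiv> (regular_module A)\<lparr>carrier := linked A I\<rparr>"
    and "C' \<equiv> quot_module (regular_module A) (linked A I)"
    and "S \<equiv> soc A F (regular_module A)"
  shows
    \<comment> \<open>linkage is symmetric\<close>
    "(ideal I' A \<and> I = linked A I') \<and>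
    \<comment> \<open>an isomorphism \<open>A \<cong> Soc(A) \<otimes> A\<^sup>*\<close> exists, and any one carries \<open>I'\<close> onto \<open>Soc(A) \<otimes> C\<^sup>*\<close>\<close>
     (mod_isomorphic A AA (tensor_alg k A S (dual_alg k A AA)) \<and>
      (\<forall>\<phi> \<in> mod_iso A AA (tensor_alg k A S (dual_alg k A AA)).
         tensor_map k S (restrict_scalars A (dual_alg k A C)) (restrict_scalars A (dual_alg k A AA))
             (quot_dual_incl A I)
           \<in> mod_iso A (tensor_alg k A S (dual_alg k A C))
               ((tensor_alg k A S (dual_alg k A AA))\<lparr>carrier := \<phi> ` I'\<rparr>)) \<and>
      (\<exists>\<psi> \<in> mod_iso A C' (hom_module A (AA\<lparr>carrier := I\<rparr>) AA).
         \<forall>a\<in>carrier A. \<psi> (I' +>\<^bsub>A\<^esub> a) = (\<lambda>x\<in>I. a \<otimes>\<^bsub>A\<^esub> x)) \<and>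
      in_AM k A C') \<and>
    \<comment> \<open>an invertible \<open>k\<close>-module is finitely generated, hence isomorphic to a quotient of some \<open>k\<^sup>n\<close>,
      so the type \<open>(nat \<Rightarrow> 'k) set\<close> is no restriction on the existentially quantified \<open>L\<close>\<close>
     (in_AF k A F C (\<lambda>n. (\<lambda>a. I +>\<^bsub>A\<^esub> a) ` F n) \<longrightarrow>
       (gorenstein k (quot_module A I) \<longleftrightarrow>
         (\<exists>L :: ('k, (nat \<Rightarrow> 'k) set) module.
            invertible_module k L \<and> cyclic_module A (tensor_alg k A L II'))) \<and>
    \<comment> \<open>for \<open>C = 0\<close> over a nonzero \<open>k\<close> every invertible \<open>L\<close> qualifies, and so \<open>L\<close> is not determined\<close>
       (\<forall>L :: ('k, 'l) module.
          invertible_module k L \<and> cyclic_module A (tensor_alg k A L II') \<longrightarrow>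
            gorenstein k (quot_module A I) \<and>
            (I \<noteq> carrier A \<or> carrier k = {\<zero>\<^bsub>k\<^esub>} \<longrightarrow>
               mod_isomorphic k L (tensor k (soc A F C) (dual k S))) \<and>
            mod_isomorphic A (tensor_alg k A L II') C))"
proof -
 have alg: "algebra k A" and Fid: "\<And>n. ideal (F n) A" and F0: "F 0 = car A"
  and Fmult: "\<And>m n a b. a \<in> F m ==> b \<in> F n ==> a \<otimes>\<^sub>A b \<in> F (m + n)"
  using assms(3) by (auto simp: filtered_algebra_def)
 interpret A: algebra k A by (rule alg)
 let ?Ak = "restrict_scalars A (regular_module A)"
 let ?C = "quot_module (regular_module A) I"
 obtain \<epsilon> where \<epsilon>: "\<epsilon> \<in> lin k A"
  "\<forall>a\<in>car A. \<forall>b\<in>car A. \<epsilon> (a \<otimes>\<^sub>A b) = \<epsilon> a \<otimes>\<^sub>k \<epsilon> b" "\<epsilon> \<one>\<^sub>A = \<one>\<^sub>k"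
  "\<forall>a\<in>car A. \<epsilon> a = \<zero>\<^sub>k \<longleftrightarrow> a \<in> F 1"
  using augmentation_exists[OF assms(3,4)] by (elim exE conjE)
 have F1: "F 1 = {a \<in> car A. \<epsilon> a = \<zero>\<^sub>k}" using \<epsilon>(4) ideal.Icarr[OF Fid] by blast
 obtain n1 where n1: "\<forall>n\<ge>n1. F n = {\<zero>\<^sub>A}"
  using assms(5) by (auto simp: artinian_with_hilbert_function_def in_AF_def)
 have nil: "\<exists>m::nat. a [^]\<^bsub>A\<^esub> m = \<zero>\<^sub>A" if a: "a \<in> car A" "\<epsilon> a = \<zero>\<^sub>k" for a
 proof -
  have a1: "a \<in> F 1" using a F1 by simp
  have "a [^]\<^bsub>A\<^esub> (m::nat) \<in> F (int m)" for m
  proof (induction m)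
   case (Suc m)
   then show ?case using Fmult[OF Suc a1] by (simp add: add.commute)
  qed (simp add: F0)
  from this[of "nat n1"] have "a [^]\<^bsub>A\<^esub> nat n1 = \<zero>\<^sub>A" using n1 by simp
  then show ?thesis by blast
 qed
 obtain N where N: "\<forall>p. primeideal p k --> (\<exists>f e \<mu>. f \<notin> p \<and> local_basis k ?Ak f N e \<mu>)"
  using filtration_local_basis[OF assms(2,3,5)] by (elim exE)
 have mAk: "module k ?Ak" by (rule module_restrict_scalars[OF alg module_regular[OF A.M_cring]])
 have "\<exists>n m \<mu>. dual_basis k ?Ak n m \<mu>"
  by (rule dual_basis_exists[OF mAk]) (use N in blast)
 then obtain n m \<mu> where db: "dual_basis k ?Ak n m \<mu>" by (elim exE)
 have "dual_basis k A n m \<mu>"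
 proof -
  have \<mu>: "\<mu> i \<in> lin k A" and m: "m i \<in> car A" if "i < n" for i
   using db that by (auto simp: dual_basis_def mod_hom_restrict_regular[OF alg])
  have "x = (\<Oplus>\<^sub>A i\<in>{..<n}. \<mu> i x \<odot>\<^sub>A m i)" if x: "x \<in> car A" for x
  proof -
   have \<mu>c: "\<mu> i x \<in> car k" if "i < n" for i using mod_hom_closed[OF \<mu>[OF that] x] by simp
   have "x = (\<Oplus>\<^sub>A i\<in>{..<n}. (\<mu> i x \<odot>\<^sub>A \<one>\<^sub>A) \<otimes>\<^sub>A m i)" using db x by (simp add: dual_basis_def)
   also have "... = (\<Oplus>\<^sub>A i\<in>{..<n}. \<mu> i x \<odot>\<^sub>A m i)"
    by (rule A.M.finsum_cong'[OF refl]) (use \<mu>c m in \<open>auto simp: A.smult_assoc2\<close>)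
   finally show ?thesis .
  qed
  then show ?thesis unfolding dual_basis_def using \<mu> m by simp
 qed
 then interpret aug: augmented_algebra k A \<epsilon>
  by (intro augmented_algebra.intro alg augmented_algebra_axioms.intro) (use \<epsilon> nil in auto)
 obtain n s \<phi> where fr: "aug.frame n s \<phi>" using aug.frame_exists[OF assms(6)] by (elim exE)
 obtain r where Cfree: "locally_free_rank k (restrict_scalars A ?C) r" using assms(8) by (auto simp: in_AM_def)
 then have mCk: "module k (restrict_scalars A ?C)" by (simp add: locally_free_rank_def)
 have "\<exists>N m \<mu>. dual_basis k (restrict_scalars A ?C) N m \<mu>"
  by (rule dual_basis_exists[OF mCk]) (use local_basis_if_locally_free[OF assms(2) Cfree] in metis)
 then obtain NC mC \<mu>C where dbC: "dual_basis k (restrict_scalars A ?C) NC mC \<mu>C" by (elim exE)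
 then obtain \<pi> where \<pi>: "\<pi> \<in> mod_hom k A A" "\<forall>a\<in>car A. \<pi> a \<in> I" "\<forall>a\<in>I. \<pi> a = a"
  using retraction_exists[OF alg assms(7)] by blast
 interpret linkage k A \<epsilon> n s \<phi> I \<pi>
  by (intro linkage.intro linkage_axioms.intro framed_algebra.intro framed_algebra_axioms.intro
    aug.augmented_algebra_axioms fr assms(7)) (use \<pi> in auto)
 have S: "S = Soc" unfolding S_def soc_def F1 aug.socle_def by (simp add: imp_conjL Ball_def)
 have socC: "soc A F C = SocC" unfolding C_def soc_def F1 socle_C_def by (simp add: imp_conjL Ball_def)
 have AF: "I = car A \<or> (\<forall>y\<in>I. \<epsilon> y = \<zero>\<^sub>k)" if "in_AF k A F C (\<lambda>n. (\<lambda>a. I +>\<^bsub>A\<^esub> a) ` F n)"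
  using aug.ideal_total_or_below[OF assms(2,7) F1 F0] that by (simp add: C_def)
 note twist = cyclic_twist_properties[OF assms(2), folded C_def]
 have below: "aug.socle \<subseteq> Ann" if "\<forall>y\<in>I. \<epsilon> y = \<zero>\<^sub>k"
  using that I_carrier by (auto simp: aug.socle_def Ann_def A.m_comm)
 have AM: "in_AM k A C'"
  using C'_locally_free[OF assms(2) _ Cfree] N module_quot_module[OF module_AA submodule_Ann]
  unfolding in_AM_def C'_def linked_I by blast
 show ?thesis
  unfolding S socC AA_def II'_def I'_def linked_I
 proof (intro conjI impI ballI allI)
  show "ideal Ann A" by (rule ideal_Ann)
  show "I = linked A Ann" using linked_linked by (simp only: linked_I)
  show "mod_isomorphic A (regular_module A) SD" using A_iso_SD by (auto simp only: mod_isomorphic_def)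
  fix f assume "f \<in> mod_iso A (regular_module A) SD"
  from J_iso[OF this] show "tensor_map k Soc (restrict_scalars A (dual_alg k A C)) Dk (quot_dual_incl A I)
   \<in> mod_iso A (tensor_alg k A Soc (dual_alg k A C)) (SD\<lparr>carrier := f ` Ann\<rparr>)" unfolding C_def .
 next
  show "\<exists>\<psi>\<in>mod_iso A C' (hom_module A ((regular_module A)\<lparr>carrier := I\<rparr>) (regular_module A)). \<forall>a\<in>car A. \<psi> (Ann +>\<^bsub>A\<^esub> a) = (\<lambda>x\<in>I. a \<otimes>\<^sub>A x)"
   using C'_iso_Hom unfolding C'_def linked_I AA_def by simp
 next
  show "in_AM k A C'" by (rule AM)
 next
  assume AF': "in_AF k A F C (\<lambda>n. (\<lambda>a. I +>\<^bsub>A\<^esub> a) ` F n)"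
  show "gorenstein k B \<longleftrightarrow> (\<exists>L :: ('k, (nat => 'k) set) module.
    invertible_module k L \<and> cyclic_module A (tensor_alg k A L ((regular_module A)\<lparr>carrier := Ann\<rparr>)))"
   using cyclic_twist_exists[OF dbC _ AF[OF AF']] twist(1) by blast
  fix L :: "('k, 'l) module"
  assume L: "invertible_module k L \<and> cyclic_module A (tensor_alg k A L ((regular_module A)\<lparr>carrier := Ann\<rparr>))"
  then show "gorenstein k B" "mod_isomorphic A (tensor_alg k A L ((regular_module A)\<lparr>carrier := Ann\<rparr>)) C" using twist(1,3) by blast+
  assume "I \<noteq> car A \<or> car k = {\<zero>\<^sub>k}"
  \<comment> \<open>If \<open>I = A\<close>, the assumption leaves only the zero ring as
    \<open>k\<close>, over which every value of \<open>\<epsilon>\<close> is zero.\<close>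
  then have "\<forall>y\<in>I. \<epsilon> y = \<zero>\<^sub>k" using AF[OF AF'] aug.Lin_closed[OF aug.eps_Lin I_carrier] by blast
  from cyclic_twist_properties(2)[OF assms(2) conjunct1[OF L] conjunct2[OF L] below[OF this]]
  show "mod_isomorphic k L (tensor k SocC (dual k Soc))" .
 qed
qed

end
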